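(* Let $n\geq 2$ be an integer and $C_n$ a primitive multiple curve of multiplicity $n$ whose associated reduced curve $C$ is projective (smooth, irreducible, over $\mathbb{C}$). Let $\alpha:\mathrm{Aut}_C(C_n)\to\mathbb{C}^*$ be the morphism associating to an automorphism of $C_n$ the induced automorphism (a scalar) of the associated line bundle $L$. If the image of $\alpha$ contains a $\lambda$ such that $\lambda^i\neq 1$ for $1\leq i\leq n-1$, then $C_n$ is trivial.
   Context: A primitive multiple curve $C_n$ of multiplicity $n$ with associated reduced curve $C$ is a scheme obtained by gluing schemes $U_i\times\mathrm{spec}(\mathbb{C}[t]/(t^n))$, $(U_i)$ an open cover of $C$, by means of automorphisms $g_{ij}$ over $U_{ij}$ inducing the identity on $U_{ij}$ and satisfying the cocycle relations. The associated line bundle is $L=\mathcal{I}_C/\mathcal{I}_C^2$ on $C$, where $\mathcal{I}_C$ is the ideal sheaf of $C$ in $C_n$. $\mathrm{Aut}_C(C_n)$ is the group of automorphisms of $C_n$ inducing the identity on $C$. The morphism $\alpha$ (denoted $H^0(\xi_n^\gamma)$ in the paper) is described locally as follows: an automorphism is given on $U_i$ by an automorphism $\phi_i$ of $\mathcal{O}_C(U_i)[t]/(t^n)$ commuting with the projection $t\mapsto0$, with $\phi_i(t)=\nu_it$, and $\alpha$ is the constant $\nu_i|_{t=0}$. $C_n$ is trivial if it is isomorphic (by an isomorphism inducing the identity on $C$) to the subscheme defined by the $n$-th power of the ideal of $C$ in the total space of the line bundle $L^*$, in which $C$ is embedded by the zero section. *)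

theory Defs
  imports Complex_Main
    "HOL-Analysis.Abstract_Topology"
    "HOL-Analysis.Function_Topology"
    "HOL-Library.Poly_Mapping"
    "HOL-Algebra.UnivPoly"
    "HOL-Algebra.QuotRing"
    "HOL-Algebra.Ideal_Product"
    "HOL-Algebra.Ring_Divisibility"
begin

section \<open>Ringed spaces over the complex numbers\<close>

text \<open>
  A space over the complex numbers: a topology, a ring of sections \<open>Sec U\<close> for every open \<open>U\<close>,
  restriction maps \<open>Res U V\<close> (from \<open>U\<close> to \<open>V\<close>, for \<open>V\<close> contained in \<open>U\<close>) and the structure maps
  \<open>Cst U\<close> that turn every \<open>Sec U\<close> into an algebra over the complex numbers.  All four fields are
  only meaningful on open sets and on carriers.
\<close>

record ('p, 'a) rspace =
  tsp :: "'p topology"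
  Sec :: "'p set \<Rightarrow> 'a ring"
  Res :: "'p set \<Rightarrow> 'p set \<Rightarrow> 'a \<Rightarrow> 'a"
  Cst :: "'p set \<Rightarrow> complex \<Rightarrow> 'a"

definition class_ring :: "'a::comm_ring_1 set \<Rightarrow> 'a ring" where
  "class_ring A = \<lparr>carrier = A, monoid.mult = (*), one = 1, zero = 0, add = (+)\<rparr>"

definition ringed_space :: "('p, 'a) rspace \<Rightarrow> bool" where
  "ringed_space X \<longleftrightarrow>
     (\<forall>U. openin (tsp X) U \<longrightarrow>
        cring (Sec X U) \<and>
        Cst X U \<in> ring_hom (class_ring UNIV) (Sec X U) \<and>
        (\<forall>s\<in>carrier (Sec X U). Res X U U s = s)) \<and>
     (\<forall>U V. openin (tsp X) U \<and> openin (tsp X) V \<and> V \<subseteq> U \<longrightarrow>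
        Res X U V \<in> ring_hom (Sec X U) (Sec X V) \<and>
        (\<forall>c. Res X U V (Cst X U c) = Cst X V c)) \<and>
     (\<forall>U V W. openin (tsp X) U \<and> openin (tsp X) V \<and> openin (tsp X) W \<and> W \<subseteq> V \<and> V \<subseteq> U \<longrightarrow>
        (\<forall>s\<in>carrier (Sec X U). Res X V W (Res X U V s) = Res X U W s)) \<and>
     (\<forall>\<U>. (\<forall>V\<in>\<U>. openin (tsp X) V) \<longrightarrow>
        (\<forall>s\<in>carrier (Sec X (\<Union>\<U>)). \<forall>r\<in>carrier (Sec X (\<Union>\<U>)).
           (\<forall>V\<in>\<U>. Res X (\<Union>\<U>) V s = Res X (\<Union>\<U>) V r) \<longrightarrow> s = r) \<and>
        (\<forall>f. (\<forall>V\<in>\<U>. f V \<in> carrier (Sec X V)) \<and>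
             (\<forall>V\<in>\<U>. \<forall>W\<in>\<U>. Res X V (V \<inter> W) (f V) = Res X W (V \<inter> W) (f W)) \<longrightarrow>
           (\<exists>s\<in>carrier (Sec X (\<Union>\<U>)). \<forall>V\<in>\<U>. Res X (\<Union>\<U>) V s = f V)))"

definition open_sub :: "('p, 'a) rspace \<Rightarrow> 'p set \<Rightarrow> ('p, 'a) rspace" where
  "open_sub X U = X\<lparr>tsp := subtopology (tsp X) U\<rparr>"

definition germ :: "('p, 'a) rspace \<Rightarrow> 'p \<Rightarrow> 'p set \<Rightarrow> 'a \<Rightarrow> ('p set \<times> 'a) set" where
  "germ X x U s = {(V, r). openin (tsp X) V \<and> x \<in> V \<and> r \<in> carrier (Sec X V) \<and>
     (\<exists>W. openin (tsp X) W \<and> x \<in> W \<and> W \<subseteq> U \<inter> V \<and> Res X U W s = Res X V W r)}"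

definition stalk :: "('p, 'a) rspace \<Rightarrow> 'p \<Rightarrow> ('p set \<times> 'a) set ring" where
  "stalk X x = \<lparr>
     carrier = {germ X x U s | U s. openin (tsp X) U \<and> x \<in> U \<and> s \<in> carrier (Sec X U)},
     monoid.mult = (\<lambda>\<xi> \<eta>. \<Union>(U, s)\<in>\<xi>. \<Union>(V, r)\<in>\<eta>.
               germ X x (U \<inter> V) (Res X U (U \<inter> V) s \<otimes>\<^bsub>Sec X (U \<inter> V)\<^esub> Res X V (U \<inter> V) r)),
     one = germ X x (topspace (tsp X)) \<one>\<^bsub>Sec X (topspace (tsp X))\<^esub>,
     zero = germ X x (topspace (tsp X)) \<zero>\<^bsub>Sec X (topspace (tsp X))\<^esub>,
     add = (\<lambda>\<xi> \<eta>. \<Union>(U, s)\<in>\<xi>. \<Union>(V, r)\<in>\<eta>.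
               germ X x (U \<inter> V) (Res X U (U \<inter> V) s \<oplus>\<^bsub>Sec X (U \<inter> V)\<^esub> Res X V (U \<inter> V) r))\<rparr>"

text \<open>\<open>s\<close> is a unit in the stalk at \<open>x\<close>.\<close>

definition unit_at :: "('p, 'a) rspace \<Rightarrow> 'p \<Rightarrow> 'p set \<Rightarrow> 'a \<Rightarrow> bool" where
  "unit_at X x U s \<longleftrightarrow>
     (\<exists>W. openin (tsp X) W \<and> x \<in> W \<and> W \<subseteq> U \<and> Res X U W s \<in> Units (Sec X W))"

section \<open>Morphisms\<close>

text \<open>A map of points together with the comorphisms \<open>cm V\<close> from the sections over \<open>V\<close> of the target
  to the sections over the preimage of \<open>V\<close>.\<close>

record ('p, 'a, 'q, 'b) mor =
  pt :: "'p \<Rightarrow> 'q"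
  cm :: "'q set \<Rightarrow> 'b \<Rightarrow> 'a"

definition preim :: "('p, 'a) rspace \<Rightarrow> ('p \<Rightarrow> 'q) \<Rightarrow> 'q set \<Rightarrow> 'p set" where
  "preim X h V = {x \<in> topspace (tsp X). h x \<in> V}"

text \<open>The last conjunct says that the maps on stalks are local.\<close>

definition morphism :: "('p, 'a) rspace \<Rightarrow> ('q, 'b) rspace \<Rightarrow> ('p, 'a, 'q, 'b) mor \<Rightarrow> bool" where
  "morphism X Y f \<longleftrightarrow>
     continuous_map (tsp X) (tsp Y) (pt f) \<and>
     (\<forall>V. openin (tsp Y) V \<longrightarrow>
        cm f V \<in> ring_hom (Sec Y V) (Sec X (preim X (pt f) V)) \<and>
        (\<forall>c. cm f V (Cst Y V c) = Cst X (preim X (pt f) V) c)) \<and>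
     (\<forall>V W. openin (tsp Y) V \<and> openin (tsp Y) W \<and> W \<subseteq> V \<longrightarrow>
        (\<forall>s\<in>carrier (Sec Y V).
           cm f W (Res Y V W s) = Res X (preim X (pt f) V) (preim X (pt f) W) (cm f V s))) \<and>
     (\<forall>V x. openin (tsp Y) V \<and> x \<in> preim X (pt f) V \<longrightarrow>
        (\<forall>s\<in>carrier (Sec Y V).
           unit_at X x (preim X (pt f) V) (cm f V s) \<longrightarrow> unit_at Y (pt f x) V s))"

definition mor_eq ::
  "('p, 'a) rspace \<Rightarrow> ('q, 'b) rspace \<Rightarrow> ('p, 'a, 'q, 'b) mor \<Rightarrow> ('p, 'a, 'q, 'b) mor \<Rightarrow> bool" where
  "mor_eq X Y f g \<longleftrightarrow> (\<forall>x\<in>topspace (tsp X). pt f x = pt g x) \<and>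
     (\<forall>V. openin (tsp Y) V \<longrightarrow> (\<forall>s\<in>carrier (Sec Y V). cm f V s = cm g V s))"

definition mor_id :: "('p, 'a, 'p, 'a) mor" where
  "mor_id = \<lparr>pt = (\<lambda>x. x), cm = (\<lambda>V s. s)\<rparr>"

text \<open>\<open>mor_comp Y g f\<close> is the composition of \<open>f\<close>, with target \<open>Y\<close>, and \<open>g\<close>, with source \<open>Y\<close>.\<close>

definition mor_comp ::
  "('q, 'b) rspace \<Rightarrow> ('q, 'b, 'r, 'c) mor \<Rightarrow> ('p, 'a, 'q, 'b) mor \<Rightarrow> ('p, 'a, 'r, 'c) mor" where
  "mor_comp Y g f = \<lparr>pt = (\<lambda>x. pt g (pt f x)), cm = (\<lambda>V s. cm f (preim Y (pt g) V) (cm g V s))\<rparr>"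

definition is_iso :: "('p, 'a) rspace \<Rightarrow> ('q, 'b) rspace \<Rightarrow> ('p, 'a, 'q, 'b) mor \<Rightarrow> bool" where
  "is_iso X Y f \<longleftrightarrow> morphism X Y f \<and>
     (\<exists>g. morphism Y X g \<and> mor_eq X X (mor_comp Y g f) mor_id \<and> mor_eq Y Y (mor_comp X f g) mor_id)"

definition closed_immersion ::
  "('p, 'a) rspace \<Rightarrow> ('q, 'b) rspace \<Rightarrow> ('p, 'a, 'q, 'b) mor \<Rightarrow> bool" where
  "closed_immersion X Y f \<longleftrightarrow> morphism X Y f \<and>
     embedding_map (tsp X) (tsp Y) (pt f) \<and>
     closedin (tsp Y) (pt f ` topspace (tsp X)) \<and>
     (\<forall>V s y. openin (tsp Y) V \<and> s \<in> carrier (Sec X (preim X (pt f) V)) \<and> y \<in> V \<longrightarrow>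
        (\<exists>W r. openin (tsp Y) W \<and> y \<in> W \<and> W \<subseteq> V \<and> r \<in> carrier (Sec Y W) \<and>
           cm f W r = Res X (preim X (pt f) V) (preim X (pt f) W) s))"

section \<open>Spec, Proj and schemes\<close>

text \<open>The fraction \<open>a / f\<close> in the localization of \<open>R\<close> at the prime \<open>P\<close>.\<close>

definition loc_frac :: "('a, 'm) ring_scheme \<Rightarrow> 'a set \<Rightarrow> 'a \<Rightarrow> 'a \<Rightarrow> ('a \<times> 'a) set" where
  "loc_frac R P a f = {(b, g). b \<in> carrier R \<and> g \<in> carrier R - P \<and>
     (\<exists>u\<in>carrier R - P. u \<otimes>\<^bsub>R\<^esub> (a \<otimes>\<^bsub>R\<^esub> g) = u \<otimes>\<^bsub>R\<^esub> (b \<otimes>\<^bsub>R\<^esub> f))}"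

definition loc_frac_add ::
  "('a, 'm) ring_scheme \<Rightarrow> 'a set \<Rightarrow> ('a \<times> 'a) set \<Rightarrow> ('a \<times> 'a) set \<Rightarrow> ('a \<times> 'a) set" where
  "loc_frac_add R P \<xi> \<eta> = (\<Union>(a, f)\<in>\<xi>. \<Union>(b, g)\<in>\<eta>.
     loc_frac R P (a \<otimes>\<^bsub>R\<^esub> g \<oplus>\<^bsub>R\<^esub> b \<otimes>\<^bsub>R\<^esub> f) (f \<otimes>\<^bsub>R\<^esub> g))"

definition loc_frac_mult ::
  "('a, 'm) ring_scheme \<Rightarrow> 'a set \<Rightarrow> ('a \<times> 'a) set \<Rightarrow> ('a \<times> 'a) set \<Rightarrow> ('a \<times> 'a) set" where
  "loc_frac_mult R P \<xi> \<eta> = (\<Union>(a, f)\<in>\<xi>. \<Union>(b, g)\<in>\<eta>. loc_frac R P (a \<otimes>\<^bsub>R\<^esub> b) (f \<otimes>\<^bsub>R\<^esub> g))"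

text \<open>
  The space whose sections over \<open>U\<close> are the functions that assign to a prime in \<open>U\<close> an element of
  the localization at that prime and are locally given by fractions \<open>a / f\<close> with \<open>ok a f\<close>; this
  covers both Spec and Proj.  The map \<open>\<kappa>\<close> is the structure map from the complex numbers to \<open>R\<close>.
\<close>

definition frac_space ::
  "('a, 'm) ring_scheme \<Rightarrow> (complex \<Rightarrow> 'a) \<Rightarrow> 'a set topology \<Rightarrow> ('a \<Rightarrow> 'a \<Rightarrow> bool) \<Rightarrow>
   ('a set, 'a set \<Rightarrow> ('a \<times> 'a) set) rspace" where
  "frac_space R \<kappa> \<T> ok = \<lparr>
     tsp = \<T>,
     Sec = (\<lambda>U. \<lparr>
       carrier = {s \<in> extensional U. \<forall>P\<in>U. \<exists>V a f. openin \<T> V \<and> P \<in> V \<and> V \<subseteq> U \<and>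
                    a \<in> carrier R \<and> f \<in> carrier R \<and> ok a f \<and>
                    (\<forall>Q\<in>V. f \<notin> Q \<and> s Q = loc_frac R Q a f)},
       monoid.mult = (\<lambda>s r. \<lambda>P\<in>U. loc_frac_mult R P (s P) (r P)),
       one = (\<lambda>P\<in>U. loc_frac R P \<one>\<^bsub>R\<^esub> \<one>\<^bsub>R\<^esub>),
       zero = (\<lambda>P\<in>U. loc_frac R P \<zero>\<^bsub>R\<^esub> \<one>\<^bsub>R\<^esub>),
       add = (\<lambda>s r. \<lambda>P\<in>U. loc_frac_add R P (s P) (r P))\<rparr>),
     Res = (\<lambda>U V s. restrict s V),
     Cst = (\<lambda>U c. \<lambda>P\<in>U. loc_frac R P (\<kappa> c) \<one>\<^bsub>R\<^esub>)\<rparr>"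

definition prime_spectrum :: "('a, 'm) ring_scheme \<Rightarrow> 'a set set" where
  "prime_spectrum R = {P. primeideal P R}"

definition Spec ::
  "('a, 'm) ring_scheme \<Rightarrow> (complex \<Rightarrow> 'a) \<Rightarrow> ('a set, 'a set \<Rightarrow> ('a \<times> 'a) set) rspace" where
  "Spec R \<kappa> = frac_space R \<kappa>
     (topology_generated_by ((\<lambda>f. {P \<in> prime_spectrum R. f \<notin> P}) ` carrier R)) (\<lambda>a f. True)"

text \<open>The canonical map from \<open>R\<close> to the global sections of its spectrum.\<close>

definition Spec_global :: "('a, 'm) ring_scheme \<Rightarrow> 'a \<Rightarrow> ('a set \<Rightarrow> ('a \<times> 'a) set)" where
  "Spec_global R a = (\<lambda>P\<in>prime_spectrum R. loc_frac R P a \<one>\<^bsub>R\<^esub>)"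

text \<open>An open set isomorphic to some spectrum is isomorphic to the spectrum of its own ring of
  sections, so that no quantification over rings of other types is needed.\<close>

definition affine_open :: "('p, 'a) rspace \<Rightarrow> 'p set \<Rightarrow> bool" where
  "affine_open X U \<longleftrightarrow> openin (tsp X) U \<and>
     (\<exists>f. is_iso (open_sub X U) (Spec (Sec X U) (Cst X U)) f)"

definition scheme :: "('p, 'a) rspace \<Rightarrow> bool" where
  "scheme X \<longleftrightarrow> ringed_space X \<and> (\<forall>x\<in>topspace (tsp X). \<exists>U. affine_open X U \<and> x \<in> U)"

text \<open>Polynomials in the variables \<open>0, \<dots>, N\<close>, where monomials are finitely supported exponents.\<close>

type_synonym cpoly = "(nat \<Rightarrow>\<^sub>0 nat) \<Rightarrow>\<^sub>0 complex"

definition cpoly_ring :: "nat \<Rightarrow> cpoly ring" where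
  "cpoly_ring N = class_ring {f. \<forall>m\<in>Poly_Mapping.keys f. Poly_Mapping.keys m \<subseteq> {..N}}"

definition homogeneous :: "nat \<Rightarrow> cpoly \<Rightarrow> bool" where
  "homogeneous d f \<longleftrightarrow>
     (\<forall>m\<in>Poly_Mapping.keys f. (\<Sum>i\<in>Poly_Mapping.keys m. Poly_Mapping.lookup m i) = d)"

definition proj_points :: "nat \<Rightarrow> cpoly set set" where
  "proj_points N = {P. primeideal P (cpoly_ring N) \<and>
     P = genideal (cpoly_ring N) {f \<in> P. \<exists>d. homogeneous d f} \<and>
     \<not> {f \<in> carrier (cpoly_ring N). Poly_Mapping.lookup f 0 = 0} \<subseteq> P}"

definition projective_space :: "nat \<Rightarrow> (cpoly set, cpoly set \<Rightarrow> (cpoly \<times> cpoly) set) rspace" where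
  "projective_space N = frac_space (cpoly_ring N) (Poly_Mapping.single 0)
     (topology_generated_by
        ((\<lambda>f. {P \<in> proj_points N. f \<notin> P}) `
           {f \<in> carrier (cpoly_ring N). \<exists>d. homogeneous d f}))
     (\<lambda>a f. \<exists>d. homogeneous d a \<and> homogeneous d f)"

section \<open>Smooth irreducible projective curves\<close>

definition projective :: "('p, 'a) rspace \<Rightarrow> bool" where
  "projective X \<longleftrightarrow> (\<exists>N f. closed_immersion X (projective_space N) f)"

definition irreducible_closed :: "'p topology \<Rightarrow> 'p set \<Rightarrow> bool" where
  "irreducible_closed \<T> Z \<longleftrightarrow> closedin \<T> Z \<and> Z \<noteq> {} \<and>
     (\<forall>A B. closedin \<T> A \<and> closedin \<T> B \<and> Z = A \<union> B \<longrightarrow> Z = A \<or> Z = B)"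

definition has_top_chain :: "'p topology \<Rightarrow> nat \<Rightarrow> bool" where
  "has_top_chain \<T> d \<longleftrightarrow> (\<exists>Z. (\<forall>i\<le>d. irreducible_closed \<T> (Z i)) \<and> (\<forall>i<d. Z i \<subset> Z (Suc i)))"

definition top_dim :: "'p topology \<Rightarrow> nat \<Rightarrow> bool" where
  "top_dim \<T> d \<longleftrightarrow> has_top_chain \<T> d \<and> \<not> has_top_chain \<T> (Suc d)"

definition has_prime_chain :: "('a, 'm) ring_scheme \<Rightarrow> nat \<Rightarrow> bool" where
  "has_prime_chain R d \<longleftrightarrow> (\<exists>P. (\<forall>i\<le>d. primeideal (P i) R) \<and> (\<forall>i<d. P i \<subset> P (Suc i)))"

definition krull_dim :: "('a, 'm) ring_scheme \<Rightarrow> nat \<Rightarrow> bool" where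
  "krull_dim R d \<longleftrightarrow> has_prime_chain R d \<and> \<not> has_prime_chain R (Suc d)"

definition regular_local_ring :: "('a, 'm) ring_scheme \<Rightarrow> bool" where
  "regular_local_ring R \<longleftrightarrow> cring R \<and> noetherian_ring R \<and> (\<exists>!M. maximalideal M R) \<and>
     (\<exists>S d. krull_dim R d \<and> finite S \<and> card S = d \<and> S \<subseteq> carrier R \<and>
        maximalideal (genideal R S) R)"

text \<open>Over the complex numbers a scheme of finite type is smooth iff its local rings are regular.\<close>

definition smooth_projective_curve :: "('p, 'a) rspace \<Rightarrow> bool" where
  "smooth_projective_curve C \<longleftrightarrow> scheme C \<and> projective C \<and>
     irreducible_closed (tsp C) (topspace (tsp C)) \<and> top_dim (tsp C) 1 \<and>
     (\<forall>x\<in>topspace (tsp C). regular_local_ring (stalk C x))"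

section \<open>Primitive multiple curves\<close>

text \<open>The ideal generated by \<open>t ^ n\<close> in the polynomials over \<open>R\<close>, and the quotient by it.\<close>

definition trunc_ideal :: "nat \<Rightarrow> ('a, 'm) ring_scheme \<Rightarrow> (nat \<Rightarrow> 'a) set" where
  "trunc_ideal n R = cgenideal (UP R) (monom (UP R) \<one>\<^bsub>R\<^esub> n)"

definition trunc_poly :: "nat \<Rightarrow> ('a, 'm) ring_scheme \<Rightarrow> (nat \<Rightarrow> 'a) set ring" where
  "trunc_poly n R = UP R Quot trunc_ideal n R"

text \<open>
  The product of the open subset \<open>U\<close> of \<open>C\<close> with the spectrum of \<open>\<complex>[t]/(t^n)\<close>: its underlying space
  is \<open>U\<close> and its sections over \<open>V\<close> are \<open>O(V)[t]/(t^n)\<close>.  Restriction acts on coefficients.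
\<close>

definition thickening ::
  "nat \<Rightarrow> ('p, 'a) rspace \<Rightarrow> 'p set \<Rightarrow> ('p, (nat \<Rightarrow> 'a) set) rspace" where
  "thickening n C U = \<lparr>
     tsp = subtopology (tsp C) U,
     Sec = (\<lambda>V. trunc_poly n (Sec C V)),
     Res = (\<lambda>V W \<xi>. \<Union>p\<in>\<xi>. trunc_ideal n (Sec C W) +>\<^bsub>UP (Sec C W)\<^esub> (\<lambda>k. Res C V W (p k))),
     Cst = (\<lambda>V c. trunc_ideal n (Sec C V) +>\<^bsub>UP (Sec C V)\<^esub> monom (UP (Sec C V)) (Cst C V c) 0)\<rparr>"

text \<open>The embedding of \<open>U\<close> in its thickening given by \<open>t = 0\<close>: all representatives of a class modulo
  \<open>t ^ n\<close> with \<open>n > 0\<close> have the same constant coefficient.\<close>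

definition thickening_base :: "('p, 'a, 'p, (nat \<Rightarrow> 'a) set) mor" where
  "thickening_base = \<lparr>pt = (\<lambda>x. x), cm = (\<lambda>V \<xi>. THE a. \<exists>p\<in>\<xi>. a = p 0)\<rparr>"

text \<open>
  \<open>X\<close> is obtained from the thickenings of the members of an open cover \<open>\<U>\<close> of \<open>C\<close> by gluing along
  automorphisms \<open>g U V\<close> of the thickening of \<open>U \<inter> V\<close> that induce the identity on \<open>U \<inter> V\<close>; the
  \<open>\<psi> U\<close> are the resulting charts.  Since the glued pieces have the underlying spaces \<open>U\<close> and the
  \<open>g U V\<close> fix all points, \<open>X\<close> has the same underlying space as \<open>C\<close>, and the embedding \<open>\<iota>\<close> of \<open>C\<close> is
  the identity on points.
\<close>

definition primitive_multiple_curve ::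
  "nat \<Rightarrow> ('p, 'a) rspace \<Rightarrow> ('p, 'b) rspace \<Rightarrow> ('p, 'a, 'p, 'b) mor \<Rightarrow> bool" where
  "primitive_multiple_curve n C X \<iota> \<longleftrightarrow> scheme X \<and> tsp X = tsp C \<and>
     closed_immersion C X \<iota> \<and> (\<forall>x\<in>topspace (tsp C). pt \<iota> x = x) \<and>
     (\<exists>\<U> g \<psi>. (\<forall>U\<in>\<U>. openin (tsp C) U) \<and> \<Union>\<U> = topspace (tsp C) \<and>
        (\<forall>U\<in>\<U>. \<forall>V\<in>\<U>.
           is_iso (thickening n C (U \<inter> V)) (thickening n C (U \<inter> V)) (g U V) \<and>
           mor_eq (open_sub C (U \<inter> V)) (thickening n C (U \<inter> V))
             (mor_comp (thickening n C (U \<inter> V)) (g U V) thickening_base) thickening_base) \<and>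
        (\<forall>U\<in>\<U>. \<forall>V\<in>\<U>. \<forall>W\<in>\<U>.
           mor_eq (thickening n C (U \<inter> V \<inter> W)) (thickening n C (U \<inter> V \<inter> W))
             (mor_comp (thickening n C (U \<inter> V \<inter> W)) (g U V) (g V W)) (g U W)) \<and>
        (\<forall>U\<in>\<U>.
           is_iso (thickening n C U) (open_sub X U) (\<psi> U) \<and>
           mor_eq (open_sub C U) (open_sub X U)
             (mor_comp (thickening n C U) (\<psi> U) thickening_base) \<iota>) \<and>
        (\<forall>U\<in>\<U>. \<forall>V\<in>\<U>.
           mor_eq (thickening n C (U \<inter> V)) (open_sub X (U \<inter> V))
             (mor_comp (thickening n C (U \<inter> V)) (\<psi> U) (g U V)) (\<psi> V)))"

section \<open>Ideal sheaves and the associated line bundle\<close>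

text \<open>The kernel of the comorphism of \<open>f\<close>, an ideal sheaf on the target \<open>Y\<close>.\<close>

definition ker_sheaf ::
  "('p, 'a) rspace \<Rightarrow> ('q, 'b) rspace \<Rightarrow> ('p, 'a, 'q, 'b) mor \<Rightarrow> 'q set \<Rightarrow> 'b set" where
  "ker_sheaf X Y f V = {s \<in> carrier (Sec Y V). cm f V s = \<zero>\<^bsub>Sec X (preim X (pt f) V)\<^esub>}"

primrec ideal_pow :: "('a, 'm) ring_scheme \<Rightarrow> 'a set \<Rightarrow> nat \<Rightarrow> 'a set" where
  "ideal_pow R I 0 = carrier R"
| "ideal_pow R I (Suc k) = ideal_prod R I (ideal_pow R I k)"

definition ideal_sheaf_pow ::
  "('p, 'a) rspace \<Rightarrow> ('p set \<Rightarrow> 'a set) \<Rightarrow> nat \<Rightarrow> 'p set \<Rightarrow> 'a set" where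
  "ideal_sheaf_pow X \<I> k U = {s \<in> carrier (Sec X U). \<forall>x\<in>U. \<exists>W. openin (tsp X) W \<and> x \<in> W \<and> W \<subseteq> U \<and>
     Res X U W s \<in> ideal_pow (Sec X W) (\<I> W) k}"

text \<open>
  \<open>conormal_germ C X \<iota> x V s\<close> is the class in the stalk at \<open>x\<close> of \<open>L = \<I>/\<I>^2\<close> of a section \<open>s\<close> of
  the ideal sheaf \<open>\<I>\<close> of \<open>C\<close> in \<open>X\<close>, and \<open>conormal C X \<iota> V\<close> is the set of sections of the sheaf \<open>L\<close>
  over \<open>V\<close>: families of such classes that are locally induced by sections of \<open>\<I>\<close>.
  As \<open>X\<close> and \<open>C\<close> have the same underlying space, \<open>L\<close> is viewed as a sheaf on \<open>C\<close>.
\<close>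

definition conormal_germ ::
  "('p, 'a) rspace \<Rightarrow> ('p, 'b) rspace \<Rightarrow> ('p, 'a, 'p, 'b) mor \<Rightarrow> 'p \<Rightarrow> 'p set \<Rightarrow> 'b \<Rightarrow> ('p set \<times> 'b) set"
where
  "conormal_germ C X \<iota> x V s = {(W, r). openin (tsp X) W \<and> x \<in> W \<and> r \<in> ker_sheaf C X \<iota> W \<and>
     (\<exists>W'. openin (tsp X) W' \<and> x \<in> W' \<and> W' \<subseteq> V \<inter> W \<and>
        Res X V W' s \<ominus>\<^bsub>Sec X W'\<^esub> Res X W W' r \<in> ideal_sheaf_pow X (ker_sheaf C X \<iota>) 2 W')}"

definition conormal ::
  "('p, 'a) rspace \<Rightarrow> ('p, 'b) rspace \<Rightarrow> ('p, 'a, 'p, 'b) mor \<Rightarrow> 'p set \<Rightarrow> ('p \<Rightarrow> ('p set \<times> 'b) set) set"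
where
  "conormal C X \<iota> V = {l \<in> extensional V. \<forall>x\<in>V. \<exists>W s. openin (tsp X) W \<and> x \<in> W \<and> W \<subseteq> V \<and>
     s \<in> ker_sheaf C X \<iota> W \<and> (\<forall>y\<in>W. l y = conormal_germ C X \<iota> y W s)}"

text \<open>Multiplication of a section of \<open>L\<close> by a function \<open>a\<close> on \<open>C\<close>: locally lift \<open>a\<close> to \<open>X\<close>.\<close>

definition conormal_smult ::
  "('p, 'a) rspace \<Rightarrow> ('p, 'b) rspace \<Rightarrow> ('p, 'a, 'p, 'b) mor \<Rightarrow> 'p set \<Rightarrow> 'a \<Rightarrow>
   ('p \<Rightarrow> ('p set \<times> 'b) set) \<Rightarrow> ('p \<Rightarrow> ('p set \<times> 'b) set)" where
  "conormal_smult C X \<iota> V a l = (\<lambda>x\<in>V. \<Union>{conormal_germ C X \<iota> x W' (b \<otimes>\<^bsub>Sec X W'\<^esub> Res X W W' s) |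
     W s W' b. (W, s) \<in> l x \<and> openin (tsp X) W' \<and> x \<in> W' \<and> W' \<subseteq> W \<inter> V \<and>
       b \<in> carrier (Sec X W') \<and> cm \<iota> W' b = Res C V W' a})"

text \<open>\<open>e\<close> trivializes \<open>L\<close> over \<open>U\<close>: multiplication by \<open>e\<close> is an isomorphism from the structure sheaf.\<close>

definition conormal_basis ::
  "('p, 'a) rspace \<Rightarrow> ('p, 'b) rspace \<Rightarrow> ('p, 'a, 'p, 'b) mor \<Rightarrow> 'p set \<Rightarrow>
   ('p \<Rightarrow> ('p set \<times> 'b) set) \<Rightarrow> bool" where
  "conormal_basis C X \<iota> U e \<longleftrightarrow> e \<in> conormal C X \<iota> U \<and>
     (\<forall>W. openin (tsp C) W \<and> W \<subseteq> U \<longrightarrow>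
        bij_betw (\<lambda>a. conormal_smult C X \<iota> W a (restrict e W)) (carrier (Sec C W)) (conormal C X \<iota> W))"

section \<open>Automorphisms\<close>

definition Aut_over ::
  "('p, 'a) rspace \<Rightarrow> ('p, 'b) rspace \<Rightarrow> ('p, 'a, 'p, 'b) mor \<Rightarrow> ('p, 'b, 'p, 'b) mor set" where
  "Aut_over C X \<iota> = {\<sigma>. is_iso X X \<sigma> \<and> mor_eq C X (mor_comp X \<sigma> \<iota>) \<iota>}"

text \<open>The automorphism of \<open>L\<close> induced by \<open>\<sigma>\<close>, which is the identity on points.\<close>

definition conormal_aut ::
  "('p, 'a) rspace \<Rightarrow> ('p, 'b) rspace \<Rightarrow> ('p, 'a, 'p, 'b) mor \<Rightarrow> ('p, 'b, 'p, 'b) mor \<Rightarrow> 'p set \<Rightarrow>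
   ('p \<Rightarrow> ('p set \<times> 'b) set) \<Rightarrow> ('p \<Rightarrow> ('p set \<times> 'b) set)" where
  "conormal_aut C X \<iota> \<sigma> V l = (\<lambda>x\<in>V. \<Union>{conormal_germ C X \<iota> x W (cm \<sigma> W s) | W s. (W, s) \<in> l x})"

text \<open>The automorphisms of a line bundle on a projective curve are the multiplications by nonzero
  scalars; \<open>alpha_image\<close> is the set of the scalars that come from automorphisms of \<open>X\<close> over \<open>C\<close>.\<close>

definition alpha_image ::
  "('p, 'a) rspace \<Rightarrow> ('p, 'b) rspace \<Rightarrow> ('p, 'a, 'p, 'b) mor \<Rightarrow> complex set" where
  "alpha_image C X \<iota> = {c. c \<noteq> 0 \<and> (\<exists>\<sigma>\<in>Aut_over C X \<iota>. \<forall>V. openin (tsp C) V \<longrightarrow>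
     (\<forall>l\<in>conormal C X \<iota> V. conormal_aut C X \<iota> \<sigma> V l = conormal_smult C X \<iota> V (Cst C V c) l))}"

section \<open>The total space of the dual bundle and trivial multiple curves\<close>

text \<open>
  \<open>T\<close> is the total space of the line bundle \<open>L^*\<close> on \<open>C\<close>, with projection \<open>p\<close> and zero section \<open>z\<close>.
  Over the members \<open>U\<close> of an affine cover, with \<open>L\<close> trivialized by \<open>e U\<close>, \<open>T\<close> is the product of \<open>U\<close>
  with the affine line, i.e. the spectrum of the polynomials over \<open>O(U)\<close>; the chart \<open>\<psi> U\<close> is a map
  over \<open>U\<close> (by the condition on constant polynomials, \<open>U\<close> being affine).  The coordinate \<open>t U\<close> is the
  linear function on the fibres of \<open>L^*\<close> that corresponds to the section \<open>e U\<close> of \<open>L = (L^*)^*\<close>, so that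
  the coordinates of two charts are related in the same way as the local bases of \<open>L\<close>.
  These conditions determine \<open>(T, p, z)\<close> up to isomorphism.
\<close>

definition total_space_dual_conormal ::
  "('p, 'a) rspace \<Rightarrow> ('p, 'b) rspace \<Rightarrow> ('p, 'a, 'p, 'b) mor \<Rightarrow>
   ('q, 'c) rspace \<Rightarrow> ('q, 'c, 'p, 'a) mor \<Rightarrow> ('p, 'a, 'q, 'c) mor \<Rightarrow> bool" where
  "total_space_dual_conormal C X \<iota> T p z \<longleftrightarrow>
     scheme T \<and> morphism T C p \<and> morphism C T z \<and> mor_eq C C (mor_comp T p z) mor_id \<and>
     (\<exists>\<U> e t \<psi>. \<Union>\<U> = topspace (tsp C) \<and>
        (\<forall>U\<in>\<U>. affine_open C U \<and> conormal_basis C X \<iota> U (e U) \<and>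
           is_iso (open_sub T (preim T (pt p) U))
             (Spec (UP (Sec C U)) (\<lambda>c. monom (UP (Sec C U)) (Cst C U c) 0)) (\<psi> U) \<and>
           (\<forall>a\<in>carrier (Sec C U).
              cm (\<psi> U) (prime_spectrum (UP (Sec C U)))
                (Spec_global (UP (Sec C U)) (monom (UP (Sec C U)) a 0)) = cm p U a) \<and>
           t U = cm (\<psi> U) (prime_spectrum (UP (Sec C U)))
                (Spec_global (UP (Sec C U)) (monom (UP (Sec C U)) \<one>\<^bsub>Sec C U\<^esub> 1)) \<and>
           cm z (preim T (pt p) U) (t U) = \<zero>\<^bsub>Sec C U\<^esub>) \<and>
        (\<forall>U\<in>\<U>. \<forall>V\<in>\<U>. \<forall>W a. openin (tsp C) W \<and> W \<subseteq> U \<inter> V \<and> a \<in> carrier (Sec C W) \<and>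
           restrict (e V) W = conormal_smult C X \<iota> W a (restrict (e U) W) \<longrightarrow>
           Res T (preim T (pt p) V) (preim T (pt p) W) (t V) =
             cm p W a \<otimes>\<^bsub>Sec T (preim T (pt p) W)\<^esub>
               Res T (preim T (pt p) U) (preim T (pt p) W) (t U)))"

text \<open>
  \<open>X\<close> is isomorphic, by an isomorphism inducing the identity on \<open>C\<close>, to the closed subscheme of \<open>T\<close>
  defined by the \<open>n\<close>-th power of the ideal sheaf of the zero section \<open>z\<close>: there is a closed immersion
  of \<open>X\<close> in \<open>T\<close> with this ideal sheaf that extends \<open>z\<close>.
\<close>

definition trivial_multiple_curve ::
  "nat \<Rightarrow> ('p, 'a) rspace \<Rightarrow> ('p, 'b) rspace \<Rightarrow> ('p, 'a, 'p, 'b) mor \<Rightarrow>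
   ('q, 'c) rspace \<Rightarrow> ('p, 'a, 'q, 'c) mor \<Rightarrow> bool" where
  "trivial_multiple_curve n C X \<iota> T z \<longleftrightarrow>
     (\<exists>f. closed_immersion X T f \<and> mor_eq C T (mor_comp X f \<iota>) z \<and>
        (\<forall>V. openin (tsp T) V \<longrightarrow> ker_sheaf X T f V = ideal_sheaf_pow T (ker_sheaf C T z) n V))"

end

theory Submission
  imports Defs "HOL-Algebra.Subrings"
begin

text \<open>
  Let \<open>\<sigma>\<close> be an automorphism of the multiple curve \<open>X\<close> over \<open>C\<close> that acts on the conormal bundle \<open>L\<close>
  by a scalar \<open>lam\<close>.  Its comorphism acts on the structure sheaf of \<open>X\<close>, it is the identity modulo
  the ideal \<open>\<I>\<close> of \<open>C\<close>, and hence it acts on \<open>\<I>^k/\<I>^(k+1) = L^k\<close> by \<open>lam^k\<close>.  The numbers \<open>lam^k\<close> with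
  \<open>k < n\<close> are distinct, so the structure sheaf of \<open>X\<close> is the direct sum of the eigensheaves for these
  numbers.  The fixed sections form a subring that is mapped isomorphically to the structure sheaf of
  \<open>C\<close>: this is a retraction of \<open>X\<close> to \<open>C\<close>.  The eigensheaf for \<open>lam\<close> is mapped isomorphically to \<open>L\<close>
  and generates \<open>\<I>\<close>.  Thus \<open>X\<close> is the spectrum of the sum of the \<open>L^k\<close> with \<open>k < n\<close>, which is
  the \<open>n\<close>-th infinitesimal neighbourhood of the zero section in the total space \<open>T\<close> of \<open>L^*\<close>.

  The argument is carried out on stalks.  Let \<open>x\<close> be a point of \<open>C\<close>, let \<open>D\<close> be the stalk of \<open>X\<close> at
  \<open>x\<close> and \<open>B\<close> the stalk of \<open>T\<close> at \<open>z x\<close>, and let \<open>E\<close> be the ring of fixed elements of \<open>D\<close>; as it is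
  a copy of the stalk of \<open>C\<close>, it is also mapped to \<open>B\<close>.  A local basis of \<open>L\<close> gives an eigenvector \<open>\<epsilon>\<close>
  in \<open>D\<close> and a fibre coordinate \<open>t\<close> in \<open>B\<close>.  Every element of \<open>B\<close> has an expansion in powers of \<open>t\<close>
  with coefficients in \<open>E\<close>, unique modulo \<open>t^n\<close>, and every element of \<open>D\<close> one in powers of \<open>\<epsilon>\<close>.
  Replacing \<open>t\<close> by \<open>\<epsilon>\<close> is a surjective ring homomorphism from \<open>B\<close> to \<open>D\<close> with kernel \<open>(t^n)\<close>.
  It does not depend on the basis, because \<open>t\<close> and \<open>\<epsilon>\<close> change by the same factor.  These homomorphisms
  are the stalk maps of the required closed immersion, which on points is the zero section.

  The eigenvectors come from \<open>eigen_lift\<close> and \<open>eigen_unique\<close>, the homomorphism from the locale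
  \<open>expansion\<close>, and the expansions in \<open>B\<close> from \<open>t_regular\<close> and \<open>z_kernel\<close>.  That the stalk maps fit
  together to a morphism is \<open>morphism_from_stalk_maps\<close> together with \<open>J_open\<close>.
\<close>

section \<open>Preliminaries\<close>

lemma (in cring) unitI:
  "r \<in> carrier R \<Longrightarrow> s \<in> carrier R \<Longrightarrow> r \<otimes> s = \<one> \<Longrightarrow> s \<in> Units R"
  unfolding Units_def using m_comm[of r s] by auto

lemma (in cring) cancel_unit:
  assumes "u \<in> Units R" "a \<in> carrier R" "b \<in> carrier R" "a \<otimes> u = b"
  obtains v where "v \<in> carrier R" "a = b \<otimes> v"
  using assms that[of "inv u"] by (metis Units_closed Units_inv_closed Units_r_inv m_assoc r_one)

lemma (in ring_hom_cring) hom_minus: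
  "x \<in> carrier R \<Longrightarrow> y \<in> carrier R \<Longrightarrow> h (x \<ominus> y) = h x \<ominus>\<^bsub>S\<^esub> h y"
  by (simp add: a_minus_def)

lemma (in cring) add_diff: "c \<in> carrier R \<Longrightarrow> r \<in> carrier R \<Longrightarrow> r = c \<oplus> (r \<ominus> c)"
  by (simp add: a_minus_def a_lcomm[of c r] r_neg)

lemma (in cring) diff_cancel:
  assumes c: "s \<in> carrier R" "r \<in> carrier R" "g \<in> carrier R"
  shows "(s \<ominus> g) \<ominus> (s \<ominus> r) = r \<ominus> g" and "(r \<ominus> g) \<oplus> (s \<ominus> r) = s \<ominus> g"
proof -
  have "(s \<ominus> g) \<ominus> (s \<ominus> r) = (s \<oplus> \<ominus> g) \<oplus> (\<ominus> s \<oplus> r)" using c by (simp add: a_minus_def minus_add)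
  also have "\<dots> = (s \<oplus> \<ominus> s) \<oplus> (r \<oplus> \<ominus> g)" using c by (simp only: a_ac a_closed a_inv_closed)
  finally show "(s \<ominus> g) \<ominus> (s \<ominus> r) = r \<ominus> g" using c by (simp add: r_neg a_minus_def)
  have "(r \<ominus> g) \<oplus> (s \<ominus> r) = (r \<oplus> \<ominus> r) \<oplus> (s \<oplus> \<ominus> g)"
    unfolding a_minus_def using c by (simp only: a_ac a_closed a_inv_closed)
  then show "(r \<ominus> g) \<oplus> (s \<ominus> r) = s \<ominus> g" using c by (simp add: r_neg a_minus_def)
qed

lemma (in cring) diff_cancel_right:
  assumes c: "s \<in> carrier R" "r \<in> carrier R" "g \<in> carrier R"
  shows "(s \<ominus> g) \<ominus> (r \<ominus> g) = s \<ominus> r"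
proof -
  have "(s \<ominus> g) \<ominus> (r \<ominus> g) = (s \<oplus> \<ominus> g) \<oplus> (\<ominus> r \<oplus> g)" using c by (simp add: a_minus_def minus_add)
  also have "\<dots> = (g \<oplus> \<ominus> g) \<oplus> (s \<oplus> \<ominus> r)" using c by (simp only: a_ac a_closed a_inv_closed)
  finally show ?thesis using c by (simp add: r_neg a_minus_def)
qed

text \<open>
  Sums and products of germs, and of elements of a localization, are unions over all pairs of
  representatives.  By this lemma it is enough to see that they do not depend on the representatives.
\<close>

lemma UN_pairs_const:
  assumes "(V\<^sub>0, a\<^sub>0) \<in> A" "(W\<^sub>0, b\<^sub>0) \<in> B"
    and const: "\<And>V a W b. (V, a) \<in> A \<Longrightarrow> (W, b) \<in> B \<Longrightarrow> F V a W b = c"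
  shows "(\<Union>(V, a)\<in>A. \<Union>(W, b)\<in>B. F V a W b) = c"
proof (intro equalityI subsetI)
  fix z assume "z \<in> (\<Union>(V, a)\<in>A. \<Union>(W, b)\<in>B. F V a W b)"
  then obtain V a W b where "(V, a) \<in> A" "(W, b) \<in> B" "z \<in> F V a W b" by auto
  then show "z \<in> c" using const[of V a W b] by simp
next
  fix z assume "z \<in> c"
  then have "z \<in> F V\<^sub>0 a\<^sub>0 W\<^sub>0 b\<^sub>0" using const[OF assms(1,2)] by simp
  then show "z \<in> (\<Union>(V, a)\<in>A. \<Union>(W, b)\<in>B. F V a W b)"
    using assms(1,2) by (intro UN_I[of "(V\<^sub>0, a\<^sub>0)"]) (auto intro!: bexI[of _ "(W\<^sub>0, b\<^sub>0)"])
qed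

section \<open>Stalks\<close>

locale ringed =
  fixes X :: "('p, 'a) rspace"
  assumes ringed_space: "ringed_space X"
begin

abbreviation opn :: "'p set \<Rightarrow> bool" where "opn \<equiv> openin (tsp X)"

lemmas ringed_space_parts =
  ringed_space[unfolded ringed_space_def, THEN conjunct1]
  ringed_space[unfolded ringed_space_def, THEN conjunct2, THEN conjunct1]
  ringed_space[unfolded ringed_space_def, THEN conjunct2, THEN conjunct2, THEN conjunct1]
  ringed_space[unfolded ringed_space_def, THEN conjunct2, THEN conjunct2, THEN conjunct2]

lemma sec_cring: "opn U \<Longrightarrow> cring (Sec X U)"
  using ringed_space_parts(1) by blast

lemma sec_ring: "opn U \<Longrightarrow> ring (Sec X U)"
  using sec_cring cring.axioms(1) by blast

lemma sec_closed:
  assumes "opn U"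
  shows "\<one>\<^bsub>Sec X U\<^esub> \<in> carrier (Sec X U)" "\<zero>\<^bsub>Sec X U\<^esub> \<in> carrier (Sec X U)"
    "s \<in> carrier (Sec X U) \<Longrightarrow> r \<in> carrier (Sec X U) \<Longrightarrow> s \<otimes>\<^bsub>Sec X U\<^esub> r \<in> carrier (Sec X U)"
    "s \<in> carrier (Sec X U) \<Longrightarrow> r \<in> carrier (Sec X U) \<Longrightarrow> s \<oplus>\<^bsub>Sec X U\<^esub> r \<in> carrier (Sec X U)"
proof -
  interpret cring "Sec X U" by (rule sec_cring) fact
  show "\<one>\<^bsub>Sec X U\<^esub> \<in> carrier (Sec X U)" "\<zero>\<^bsub>Sec X U\<^esub> \<in> carrier (Sec X U)"
    "s \<in> carrier (Sec X U) \<Longrightarrow> r \<in> carrier (Sec X U) \<Longrightarrow> s \<otimes>\<^bsub>Sec X U\<^esub> r \<in> carrier (Sec X U)"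
    "s \<in> carrier (Sec X U) \<Longrightarrow> r \<in> carrier (Sec X U) \<Longrightarrow> s \<oplus>\<^bsub>Sec X U\<^esub> r \<in> carrier (Sec X U)"
    by auto
qed

lemma cst_hom: "opn U \<Longrightarrow> Cst X U \<in> ring_hom (class_ring UNIV) (Sec X U)"
  using ringed_space_parts(1) by blast

lemma cst_closed: "opn U \<Longrightarrow> Cst X U c \<in> carrier (Sec X U)"
  using ring_hom_closed[OF cst_hom, of U c] by (simp add: class_ring_def)

lemma res_id: "opn U \<Longrightarrow> s \<in> carrier (Sec X U) \<Longrightarrow> Res X U U s = s"
  using ringed_space_parts(1) by blast

lemma res_hom: "opn U \<Longrightarrow> opn V \<Longrightarrow> V \<subseteq> U \<Longrightarrow> Res X U V \<in> ring_hom (Sec X U) (Sec X V)"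
  using ringed_space_parts(2) by blast

lemma res_cst: "opn U \<Longrightarrow> opn V \<Longrightarrow> V \<subseteq> U \<Longrightarrow> Res X U V (Cst X U c) = Cst X V c"
  using ringed_space_parts(2) by blast

lemma res_closed:
  "opn U \<Longrightarrow> opn V \<Longrightarrow> V \<subseteq> U \<Longrightarrow> s \<in> carrier (Sec X U) \<Longrightarrow> Res X U V s \<in> carrier (Sec X V)"
  by (rule ring_hom_closed[OF res_hom])

lemma res_res:
  "opn U \<Longrightarrow> opn V \<Longrightarrow> opn W \<Longrightarrow> W \<subseteq> V \<Longrightarrow> V \<subseteq> U \<Longrightarrow> s \<in> carrier (Sec X U) \<Longrightarrow>
   Res X V W (Res X U V s) = Res X U W s"
  using ringed_space_parts(3) by blast

lemma separated:
  "(\<And>V. V \<in> \<U> \<Longrightarrow> opn V) \<Longrightarrow> s \<in> carrier (Sec X (\<Union>\<U>)) \<Longrightarrow> r \<in> carrier (Sec X (\<Union>\<U>)) \<Longrightarrow>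
   (\<And>V. V \<in> \<U> \<Longrightarrow> Res X (\<Union>\<U>) V s = Res X (\<Union>\<U>) V r) \<Longrightarrow> s = r"
  using ringed_space_parts(4) by metis

lemma gluing:
  "(\<And>V. V \<in> \<U> \<Longrightarrow> opn V) \<Longrightarrow> (\<And>V. V \<in> \<U> \<Longrightarrow> f V \<in> carrier (Sec X V)) \<Longrightarrow>
   (\<And>V W. V \<in> \<U> \<Longrightarrow> W \<in> \<U> \<Longrightarrow> Res X V (V \<inter> W) (f V) = Res X W (V \<inter> W) (f W)) \<Longrightarrow>
   \<exists>s\<in>carrier (Sec X (\<Union>\<U>)). \<forall>V\<in>\<U>. Res X (\<Union>\<U>) V s = f V"
  using ringed_space_parts(4) by metis

lemma germ_self: "opn U \<Longrightarrow> x \<in> U \<Longrightarrow> s \<in> carrier (Sec X U) \<Longrightarrow> (U, s) \<in> germ X x U s"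
  unfolding germ_def by blast

lemma germ_subset:
  assumes "opn U" "s \<in> carrier (Sec X U)" "opn V" "r \<in> carrier (Sec X V)"
    and W: "opn W" "x \<in> W" "W \<subseteq> U \<inter> V" "Res X U W s = Res X V W r"
  shows "germ X x V r \<subseteq> germ X x U s"
proof
  fix g assume "g \<in> germ X x V r"
  then obtain V' r' W' where g: "g = (V', r')" "opn V'" "x \<in> V'" "r' \<in> carrier (Sec X V')"
    "opn W'" "x \<in> W'" "W' \<subseteq> V \<inter> V'" "Res X V W' r = Res X V' W' r'"
    unfolding germ_def by blast
  have o: "opn (W \<inter> W')" using W(1) g(5) by blast
  have "Res X U (W \<inter> W') s = Res X W (W \<inter> W') (Res X U W s)"
    using res_res[OF assms(1) W(1) o] assms(2) W(3) by simp
  also have "\<dots> = Res X V (W \<inter> W') r"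
    using res_res[OF assms(3) W(1) o] assms(4) W(3,4) by simp
  also have "\<dots> = Res X W' (W \<inter> W') (Res X V W' r)"
    using res_res[OF assms(3) g(5) o] assms(4) g(7) by simp
  also have "\<dots> = Res X V' (W \<inter> W') r'"
    using res_res[OF g(2) g(5) o] g(4,7,8) by simp
  finally show "g \<in> germ X x U s"
    unfolding germ_def using g W o by blast
qed

lemma germ_eqI:
  assumes "opn U" "s \<in> carrier (Sec X U)" "opn V" "r \<in> carrier (Sec X V)"
    and W: "opn W" "x \<in> W" "W \<subseteq> U" "W \<subseteq> V" "Res X U W s = Res X V W r"
  shows "germ X x U s = germ X x V r"
  using germ_subset[OF assms(1-4), of W x] germ_subset[OF assms(3,4,1,2), of W x] W by auto

lemma germ_eqD:
  assumes "germ X x U s = germ X x V r" "opn V" "x \<in> V" "r \<in> carrier (Sec X V)"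
  obtains W where "opn W" "x \<in> W" "W \<subseteq> U" "W \<subseteq> V" "Res X U W s = Res X V W r"
proof -
  have "(V, r) \<in> germ X x U s" using germ_self[OF assms(2-4)] assms(1) by simp
  then show ?thesis using that unfolding germ_def by blast
qed

lemma germ_mem:
  assumes "opn U" "s \<in> carrier (Sec X U)" "(V, r) \<in> germ X x U s"
  shows "opn V" "x \<in> V" "r \<in> carrier (Sec X V)" "germ X x V r = germ X x U s"
proof -
  obtain W where W: "opn V" "x \<in> V" "r \<in> carrier (Sec X V)"
    "opn W" "x \<in> W" "W \<subseteq> U \<inter> V" "Res X U W s = Res X V W r"
    using assms(3) unfolding germ_def by blast
  then show "opn V" "x \<in> V" "r \<in> carrier (Sec X V)" by auto
  show "germ X x V r = germ X x U s" by (rule sym, rule germ_eqI) (use W assms in auto)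
qed

lemma germ_res:
  assumes "opn U" "opn W" "x \<in> W" "W \<subseteq> U" "s \<in> carrier (Sec X U)"
  shows "germ X x W (Res X U W s) = germ X x U s"
  by (rule germ_eqI[where W = W]) (use assms res_closed res_id in auto)

lemma germ_closed:
  "opn U \<Longrightarrow> x \<in> U \<Longrightarrow> s \<in> carrier (Sec X U) \<Longrightarrow> germ X x U s \<in> carrier (stalk X x)"
  unfolding stalk_def by auto

lemma stalk_elem:
  assumes "\<xi> \<in> carrier (stalk X x)"
  obtains U s where "opn U" "x \<in> U" "s \<in> carrier (Sec X U)" "\<xi> = germ X x U s"
  using assms unfolding stalk_def by auto

lemma stalk_elem_inside:
  assumes "\<xi> \<in> carrier (stalk X x)" "opn V" "x \<in> V"
  obtains U s where "opn U" "x \<in> U" "U \<subseteq> V" "s \<in> carrier (Sec X U)" "\<xi> = germ X x U s"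
proof -
  obtain U s where U: "opn U" "x \<in> U" "s \<in> carrier (Sec X U)" "\<xi> = germ X x U s"
    by (rule stalk_elem[OF assms(1)])
  have o: "opn (U \<inter> V)" using U assms by blast
  show ?thesis
    by (rule that[of "U \<inter> V" "Res X U (U \<inter> V) s"])
      (use U assms o germ_res[OF U(1) o] res_closed[OF U(1) o] in auto)
qed

lemma germ_op:
  fixes opr :: "'p set \<Rightarrow> 'a \<Rightarrow> 'a \<Rightarrow> 'a"
  assumes closed: "\<And>W a b. opn W \<Longrightarrow> a \<in> carrier (Sec X W) \<Longrightarrow> b \<in> carrier (Sec X W) \<Longrightarrow>
      opr W a b \<in> carrier (Sec X W)"
    and res: "\<And>W W' a b. opn W \<Longrightarrow> opn W' \<Longrightarrow> W' \<subseteq> W \<Longrightarrow> a \<in> carrier (Sec X W) \<Longrightarrow>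
      b \<in> carrier (Sec X W) \<Longrightarrow> Res X W W' (opr W a b) = opr W' (Res X W W' a) (Res X W W' b)"
    and U: "opn U" "x \<in> U" "s \<in> carrier (Sec X U)" "r \<in> carrier (Sec X U)"
  shows "(\<Union>(V, a)\<in>germ X x U s. \<Union>(W, b)\<in>germ X x U r.
      germ X x (V \<inter> W) (opr (V \<inter> W) (Res X V (V \<inter> W) a) (Res X W (V \<inter> W) b))) =
    germ X x U (opr U s r)"
proof -
  have one: "germ X x (V \<inter> W) (opr (V \<inter> W) (Res X V (V \<inter> W) a) (Res X W (V \<inter> W) b)) =
      germ X x U (opr U s r)" (is "?l = _")
    if a: "(V, a) \<in> germ X x U s" and b: "(W, b) \<in> germ X x U r" for V a W b
  proof -
    note a = germ_mem[OF U(1,3) a] and b = germ_mem[OF U(1,4) b]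
    obtain V' where V': "opn V'" "x \<in> V'" "V' \<subseteq> V" "V' \<subseteq> U" "Res X V V' a = Res X U V' s"
      using germ_eqD[OF a(4) U(1,2,3)] by metis
    obtain W' where W': "opn W'" "x \<in> W'" "W' \<subseteq> W" "W' \<subseteq> U" "Res X W W' b = Res X U W' r"
      using germ_eqD[OF b(4) U(1,2,4)] by metis
    define N where "N = V' \<inter> W'"
    have N: "opn N" "x \<in> N" "N \<subseteq> V" "N \<subseteq> W" "N \<subseteq> U" "N \<subseteq> V'" "N \<subseteq> W'" "opn (V \<inter> W)" "N \<subseteq> V \<inter> W"
      using V' W' a b unfolding N_def by auto
    have 1: "Res X V N a = Res X U N s"
      using res_res[OF a(1) V'(1) N(1) N(6) V'(3) a(3)] res_res[OF U(1) V'(1) N(1) N(6) V'(4) U(3)] V'(5)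
      by simp
    have 2: "Res X W N b = Res X U N r"
      using res_res[OF b(1) W'(1) N(1) N(7) W'(3) b(3)] res_res[OF U(1) W'(1) N(1) N(7) W'(4) U(4)] W'(5)
      by simp
    have c: "Res X V (V \<inter> W) a \<in> carrier (Sec X (V \<inter> W))" "Res X W (V \<inter> W) b \<in> carrier (Sec X (V \<inter> W))"
      using res_closed a b N by auto
    show ?thesis
    proof (rule germ_eqI[where W = N])
      show "Res X (V \<inter> W) N (opr (V \<inter> W) (Res X V (V \<inter> W) a) (Res X W (V \<inter> W) b)) =
          Res X U N (opr U s r)"
        using res[OF N(8,1,9) c] res[OF U(1) N(1,5) U(3,4)] 1 2
          res_res[OF a(1) N(8) N(1) N(9) _ a(3)] res_res[OF b(1) N(8) N(1) N(9) _ b(3)] by simp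
    qed (use N c closed U in auto)
  qed
  show ?thesis
    by (rule UN_pairs_const[OF germ_self[OF U(1,2,3)] germ_self[OF U(1,2,4)] one])
qed

lemma germ_mult:
  assumes "opn U" "x \<in> U" "s \<in> carrier (Sec X U)" "r \<in> carrier (Sec X U)"
  shows "germ X x U s \<otimes>\<^bsub>stalk X x\<^esub> germ X x U r = germ X x U (s \<otimes>\<^bsub>Sec X U\<^esub> r)"
  unfolding stalk_def monoid.simps
  by (rule germ_op[OF _ _ assms])
    (simp_all add: ring_hom_mult[OF res_hom] sec_closed)

lemma germ_add:
  assumes "opn U" "x \<in> U" "s \<in> carrier (Sec X U)" "r \<in> carrier (Sec X U)"
  shows "germ X x U s \<oplus>\<^bsub>stalk X x\<^esub> germ X x U r = germ X x U (s \<oplus>\<^bsub>Sec X U\<^esub> r)"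
  unfolding stalk_def ring.simps
  by (rule germ_op[OF _ _ assms])
    (simp_all add: ring_hom_add[OF res_hom] sec_closed)

lemma germ_one: "opn U \<Longrightarrow> x \<in> U \<Longrightarrow> germ X x U \<one>\<^bsub>Sec X U\<^esub> = \<one>\<^bsub>stalk X x\<^esub>"
  unfolding stalk_def monoid.simps
  by (rule germ_eqI[where W = U])
    (simp_all add: ring_hom_one[OF res_hom] sec_closed openin_subset)

lemma germ_zero: "opn U \<Longrightarrow> x \<in> U \<Longrightarrow> germ X x U \<zero>\<^bsub>Sec X U\<^esub> = \<zero>\<^bsub>stalk X x\<^esub>"
  unfolding stalk_def ring.simps
  by (rule germ_eqI[where W = U])
    (simp_all add: ring_hom_zero[OF res_hom] sec_ring sec_closed openin_subset)

lemma stalk_elem2: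
  assumes "\<xi> \<in> carrier (stalk X x)" "\<eta> \<in> carrier (stalk X x)" "opn V" "x \<in> V"
  obtains U s r where "opn U" "x \<in> U" "U \<subseteq> V" "s \<in> carrier (Sec X U)" "r \<in> carrier (Sec X U)"
    "\<xi> = germ X x U s" "\<eta> = germ X x U r"
proof -
  obtain U s where U: "opn U" "x \<in> U" "U \<subseteq> V" "s \<in> carrier (Sec X U)" "\<xi> = germ X x U s"
    by (rule stalk_elem_inside[OF assms(1,3,4)])
  obtain W r where W: "opn W" "x \<in> W" "W \<subseteq> U" "r \<in> carrier (Sec X W)" "\<eta> = germ X x W r"
    by (rule stalk_elem_inside[OF assms(2) U(1,2)])
  show ?thesis
    by (rule that[of W "Res X U W s" r]) (use U W germ_res[OF U(1) W(1,2,3)] res_closed[OF U(1) W(1,3)] in auto)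
qed

lemma stalk_elem3:
  assumes "\<xi> \<in> carrier (stalk X x)" "\<eta> \<in> carrier (stalk X x)" "\<zeta> \<in> carrier (stalk X x)"
  obtains U s r q where "opn U" "x \<in> U" "s \<in> carrier (Sec X U)" "r \<in> carrier (Sec X U)"
    "q \<in> carrier (Sec X U)" "\<xi> = germ X x U s" "\<eta> = germ X x U r" "\<zeta> = germ X x U q"
proof -
  obtain V q where V: "opn V" "x \<in> V" "q \<in> carrier (Sec X V)" "\<zeta> = germ X x V q"
    by (rule stalk_elem[OF assms(3)])
  obtain U s r where U: "opn U" "x \<in> U" "U \<subseteq> V" "s \<in> carrier (Sec X U)" "r \<in> carrier (Sec X U)"
    "\<xi> = germ X x U s" "\<eta> = germ X x U r"
    by (rule stalk_elem2[OF assms(1,2) V(1,2)])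
  show ?thesis
    by (rule that[of U s r "Res X V U q"]) (use U V germ_res[OF V(1) U(1,2,3)] res_closed[OF V(1) U(1,3)] in auto)
qed

lemma stalk_cring:
  assumes x: "x \<in> topspace (tsp X)"
  shows "cring (stalk X x)"
proof -
  have T: "opn (topspace (tsp X))" by simp
  have ag: "abelian_group (stalk X x)"
  proof (rule abelian_groupI)
    fix \<xi> \<eta> assume a: "\<xi> \<in> carrier (stalk X x)" "\<eta> \<in> carrier (stalk X x)"
    obtain U s r where U: "opn U" "x \<in> U" "s \<in> carrier (Sec X U)" "r \<in> carrier (Sec X U)"
      "\<xi> = germ X x U s" "\<eta> = germ X x U r" by (rule stalk_elem2[OF a T x])
    interpret cring "Sec X U" by (rule sec_cring[OF U(1)])
    show "\<xi> \<oplus>\<^bsub>stalk X x\<^esub> \<eta> \<in> carrier (stalk X x)" using U by (simp add: germ_add germ_closed)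
    show "\<xi> \<oplus>\<^bsub>stalk X x\<^esub> \<eta> = \<eta> \<oplus>\<^bsub>stalk X x\<^esub> \<xi>" using U by (simp add: germ_add a_comm)
  next
    show "\<zero>\<^bsub>stalk X x\<^esub> \<in> carrier (stalk X x)"
      using germ_closed[OF T x sec_closed(2)[OF T]] germ_zero[OF T x] by simp
  next
    fix \<xi> \<eta> \<zeta> assume a: "\<xi> \<in> carrier (stalk X x)" "\<eta> \<in> carrier (stalk X x)" "\<zeta> \<in> carrier (stalk X x)"
    obtain U s r q where U: "opn U" "x \<in> U" "s \<in> carrier (Sec X U)" "r \<in> carrier (Sec X U)" "q \<in> carrier (Sec X U)"
      "\<xi> = germ X x U s" "\<eta> = germ X x U r" "\<zeta> = germ X x U q" by (rule stalk_elem3[OF a])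
    interpret cring "Sec X U" by (rule sec_cring[OF U(1)])
    show "\<xi> \<oplus>\<^bsub>stalk X x\<^esub> \<eta> \<oplus>\<^bsub>stalk X x\<^esub> \<zeta> = \<xi> \<oplus>\<^bsub>stalk X x\<^esub> (\<eta> \<oplus>\<^bsub>stalk X x\<^esub> \<zeta>)"
      using U by (simp add: germ_add a_assoc)
  next
    fix \<xi> assume a: "\<xi> \<in> carrier (stalk X x)"
    obtain U s where U: "opn U" "x \<in> U" "s \<in> carrier (Sec X U)" "\<xi> = germ X x U s" by (rule stalk_elem[OF a])
    interpret cring "Sec X U" by (rule sec_cring[OF U(1)])
    show "\<zero>\<^bsub>stalk X x\<^esub> \<oplus>\<^bsub>stalk X x\<^esub> \<xi> = \<xi>"
      using U by (simp add: germ_zero[OF U(1,2), symmetric] germ_add)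
    have "germ X x U (\<ominus>\<^bsub>Sec X U\<^esub> s) \<oplus>\<^bsub>stalk X x\<^esub> \<xi> = \<zero>\<^bsub>stalk X x\<^esub>"
      using U by (simp add: germ_zero[OF U(1,2), symmetric] germ_add l_neg)
    then show "\<exists>y\<in>carrier (stalk X x). y \<oplus>\<^bsub>stalk X x\<^esub> \<xi> = \<zero>\<^bsub>stalk X x\<^esub>"
      using U germ_closed[OF U(1,2), of "\<ominus>\<^bsub>Sec X U\<^esub> s"] by auto
  qed
  have cm: "comm_monoid (stalk X x)"
  proof (rule comm_monoidI)
    fix \<xi> \<eta> assume a: "\<xi> \<in> carrier (stalk X x)" "\<eta> \<in> carrier (stalk X x)"
    obtain U s r where U: "opn U" "x \<in> U" "s \<in> carrier (Sec X U)" "r \<in> carrier (Sec X U)"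
      "\<xi> = germ X x U s" "\<eta> = germ X x U r" by (rule stalk_elem2[OF a T x])
    interpret cring "Sec X U" by (rule sec_cring[OF U(1)])
    show "\<xi> \<otimes>\<^bsub>stalk X x\<^esub> \<eta> \<in> carrier (stalk X x)" using U by (simp add: germ_mult germ_closed)
    show "\<xi> \<otimes>\<^bsub>stalk X x\<^esub> \<eta> = \<eta> \<otimes>\<^bsub>stalk X x\<^esub> \<xi>" using U by (simp add: germ_mult m_comm)
  next
    show "\<one>\<^bsub>stalk X x\<^esub> \<in> carrier (stalk X x)"
      using germ_closed[OF T x sec_closed(1)[OF T]] germ_one[OF T x] by simp
  next
    fix \<xi> \<eta> \<zeta> assume a: "\<xi> \<in> carrier (stalk X x)" "\<eta> \<in> carrier (stalk X x)" "\<zeta> \<in> carrier (stalk X x)"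
    obtain U s r q where U: "opn U" "x \<in> U" "s \<in> carrier (Sec X U)" "r \<in> carrier (Sec X U)" "q \<in> carrier (Sec X U)"
      "\<xi> = germ X x U s" "\<eta> = germ X x U r" "\<zeta> = germ X x U q" by (rule stalk_elem3[OF a])
    interpret cring "Sec X U" by (rule sec_cring[OF U(1)])
    show "\<xi> \<otimes>\<^bsub>stalk X x\<^esub> \<eta> \<otimes>\<^bsub>stalk X x\<^esub> \<zeta> = \<xi> \<otimes>\<^bsub>stalk X x\<^esub> (\<eta> \<otimes>\<^bsub>stalk X x\<^esub> \<zeta>)"
      using U by (simp add: germ_mult m_assoc)
  next
    fix \<xi> assume a: "\<xi> \<in> carrier (stalk X x)"
    obtain U s where U: "opn U" "x \<in> U" "s \<in> carrier (Sec X U)" "\<xi> = germ X x U s" by (rule stalk_elem[OF a])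
    interpret cring "Sec X U" by (rule sec_cring[OF U(1)])
    show "\<one>\<^bsub>stalk X x\<^esub> \<otimes>\<^bsub>stalk X x\<^esub> \<xi> = \<xi>"
      using U by (simp add: germ_one[OF U(1,2), symmetric] germ_mult)
  qed
  show ?thesis
  proof (rule cringI[OF ag cm])
    fix \<xi> \<eta> \<zeta> assume a: "\<xi> \<in> carrier (stalk X x)" "\<eta> \<in> carrier (stalk X x)" "\<zeta> \<in> carrier (stalk X x)"
    obtain U s r q where U: "opn U" "x \<in> U" "s \<in> carrier (Sec X U)" "r \<in> carrier (Sec X U)" "q \<in> carrier (Sec X U)"
      "\<xi> = germ X x U s" "\<eta> = germ X x U r" "\<zeta> = germ X x U q" by (rule stalk_elem3[OF a])
    interpret cring "Sec X U" by (rule sec_cring[OF U(1)])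
    show "(\<xi> \<oplus>\<^bsub>stalk X x\<^esub> \<eta>) \<otimes>\<^bsub>stalk X x\<^esub> \<zeta> = \<xi> \<otimes>\<^bsub>stalk X x\<^esub> \<zeta> \<oplus>\<^bsub>stalk X x\<^esub> \<eta> \<otimes>\<^bsub>stalk X x\<^esub> \<zeta>"
      using U by (simp add: germ_mult germ_add l_distr)
  qed
qed

lemma germ_hom: "opn U \<Longrightarrow> x \<in> U \<Longrightarrow> germ X x U \<in> ring_hom (Sec X U) (stalk X x)"
  by (rule ring_hom_memI) (auto simp: germ_closed germ_mult germ_add germ_one)

lemma germ_hom_cring: "opn U \<Longrightarrow> x \<in> U \<Longrightarrow> ring_hom_cring (Sec X U) (stalk X x) (germ X x U)"
  by (meson ring_hom_cring.intro ring_hom_cring_axioms.intro germ_hom sec_cring stalk_cring openin_subset subsetD)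

lemma unit_at_iff:
  assumes U: "opn U" "x \<in> U" "s \<in> carrier (Sec X U)"
  shows "unit_at X x U s \<longleftrightarrow> germ X x U s \<in> Units (stalk X x)"
proof
  assume "unit_at X x U s"
  then obtain W where W: "opn W" "x \<in> W" "W \<subseteq> U" "Res X U W s \<in> Units (Sec X W)"
    unfolding unit_at_def by blast
  interpret h: ring_hom_cring "Sec X W" "stalk X x" "germ X x W" by (rule germ_hom_cring[OF W(1,2)])
  obtain r where r: "r \<in> carrier (Sec X W)" "r \<otimes>\<^bsub>Sec X W\<^esub> Res X U W s = \<one>\<^bsub>Sec X W\<^esub>"
    "Res X U W s \<in> carrier (Sec X W)" using W(4) unfolding Units_def by blast
  have "germ X x W r \<otimes>\<^bsub>stalk X x\<^esub> germ X x W (Res X U W s) = \<one>\<^bsub>stalk X x\<^esub>"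
    using h.hom_mult[OF r(1,3)] r(2) by simp
  then have "germ X x W r \<otimes>\<^bsub>stalk X x\<^esub> germ X x U s = \<one>\<^bsub>stalk X x\<^esub>"
    using germ_res[OF U(1) W(1-3) U(3)] by simp
  then show "germ X x U s \<in> Units (stalk X x)"
    by (rule h.S.unitI[OF germ_closed[OF W(1,2) r(1)] germ_closed[OF U]])
next
  assume "germ X x U s \<in> Units (stalk X x)"
  then obtain \<eta> where \<eta>: "\<eta> \<in> carrier (stalk X x)" "\<eta> \<otimes>\<^bsub>stalk X x\<^esub> germ X x U s = \<one>\<^bsub>stalk X x\<^esub>"
    unfolding Units_def by blast
  obtain V r where V: "opn V" "x \<in> V" "V \<subseteq> U" "r \<in> carrier (Sec X V)" "\<eta> = germ X x V r"
    by (rule stalk_elem_inside[OF \<eta>(1) U(1,2)])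
  interpret V: cring "Sec X V" by (rule sec_cring[OF V(1)])
  have sV: "Res X U V s \<in> carrier (Sec X V)" using res_closed U V by blast
  have "germ X x V (r \<otimes>\<^bsub>Sec X V\<^esub> Res X U V s) = germ X x V \<one>\<^bsub>Sec X V\<^esub>"
    using germ_mult[OF V(1,2,4) sV] \<eta>(2) V(5) germ_res[OF U(1) V(1-3) U(3)] germ_one[OF V(1,2)] by simp
  then obtain W where W: "opn W" "x \<in> W" "W \<subseteq> V"
    "Res X V W (r \<otimes>\<^bsub>Sec X V\<^esub> Res X U V s) = Res X V W \<one>\<^bsub>Sec X V\<^esub>"
    by (rule germ_eqD[OF _ V(1,2) V.one_closed])
  interpret W: cring "Sec X W" by (rule sec_cring[OF W(1)])
  have h: "Res X V W \<in> ring_hom (Sec X V) (Sec X W)" using res_hom V W by blast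
  have "Res X V W r \<otimes>\<^bsub>Sec X W\<^esub> Res X U W s = \<one>\<^bsub>Sec X W\<^esub>"
    using W(4) ring_hom_mult[OF h V(4) sV] ring_hom_one[OF h] res_res[OF U(1) V(1) W(1) W(3) V(3) U(3)] by simp
  moreover have "Res X V W r \<in> carrier (Sec X W)" using ring_hom_closed[OF h V(4)] .
  moreover have "Res X U W s \<in> carrier (Sec X W)" using res_closed U V W by blast
  ultimately have "Res X U W s \<in> Units (Sec X W)" using W.unitI by blast
  then show "unit_at X x U s" unfolding unit_at_def using V W by blast
qed

lemma germs_determine:
  assumes U: "opn U" "s \<in> carrier (Sec X U)" "r \<in> carrier (Sec X U)"
    and eq: "\<And>x. x \<in> U \<Longrightarrow> germ X x U s = germ X x U r"
  shows "s = r"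
proof -
  define \<U> where "\<U> = {W. opn W \<and> W \<subseteq> U \<and> Res X U W s = Res X U W r}"
  have "x \<in> \<Union>\<U>" if x: "x \<in> U" for x
  proof -
    obtain W where "opn W" "x \<in> W" "W \<subseteq> U" "Res X U W s = Res X U W r"
      by (rule germ_eqD[OF eq[OF x] U(1) x U(3)])
    then show ?thesis unfolding \<U>_def by blast
  qed
  then have "\<Union>\<U> = U" unfolding \<U>_def by blast
  then show ?thesis using separated[of \<U> s r] U unfolding \<U>_def by auto
qed

text \<open>
  Local sections with prescribed germs agree on overlaps, since sections are determined by their
  germs.  So a section can be defined by giving its germs.
\<close>

lemma sections_from_germs:
  assumes U: "opn U"
    and loc: "\<And>x. x \<in> U \<Longrightarrow> \<exists>W s. opn W \<and> x \<in> W \<and> W \<subseteq> U \<and> s \<in> carrier (Sec X W) \<and>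
      (\<forall>y\<in>W. germ X y W s = \<gamma> y)"
  obtains s where "s \<in> carrier (Sec X U)" "\<And>y. y \<in> U \<Longrightarrow> germ X y U s = \<gamma> y"
proof -
  define P where "P W s \<longleftrightarrow> s \<in> carrier (Sec X W) \<and> (\<forall>y\<in>W. germ X y W s = \<gamma> y)" for W s
  define \<U> where "\<U> = {W. opn W \<and> W \<subseteq> U \<and> (\<exists>s. P W s)}"
  define f where "f W = (SOME s. P W s)" for W
  have "x \<in> \<Union>\<U>" if x: "x \<in> U" for x
  proof -
    obtain W s where "opn W" "x \<in> W" "W \<subseteq> U" "P W s" using loc[OF x] unfolding P_def by auto
    then show ?thesis unfolding \<U>_def by blast
  qed
  then have UU: "\<Union>\<U> = U" unfolding \<U>_def by blast
  have f: "P W (f W)" if "W \<in> \<U>" for W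
    unfolding f_def using that unfolding \<U>_def by (auto intro: someI_ex)
  have o: "opn W" if "W \<in> \<U>" for W using that unfolding \<U>_def by auto
  have "Res X V (V \<inter> W) (f V) = Res X W (V \<inter> W) (f W)" if VW: "V \<in> \<U>" "W \<in> \<U>" for V W
  proof -
    have oi: "opn (V \<inter> W)" using o VW by blast
    show ?thesis
      by (rule germs_determine[OF oi])
        (use f[OF VW(1)] f[OF VW(2)] o[OF VW(1)] o[OF VW(2)] oi in \<open>auto simp: P_def res_closed germ_res\<close>)
  qed
  then obtain s where s: "s \<in> carrier (Sec X U)" "\<And>V. V \<in> \<U> \<Longrightarrow> Res X U V s = f V"
    using gluing[of \<U> f] o f UU unfolding P_def by metis
  show ?thesis
  proof (rule that[OF s(1)])
    fix y assume "y \<in> U"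
    then obtain W where W: "W \<in> \<U>" "y \<in> W" using UU by blast
    have "germ X y U s = germ X y W (f W)"
      using germ_res[OF U o[OF W(1)] W(2) _ s(1)] s(2)[OF W(1)] W UU by auto
    then show "germ X y U s = \<gamma> y" using f[OF W(1)] W(2) unfolding P_def by auto
  qed
qed

lemma sec_empty: "s \<in> carrier (Sec X {}) \<Longrightarrow> r \<in> carrier (Sec X {}) \<Longrightarrow> s = r"
  by (rule germs_determine) auto

lemma germ_eq_nearby:
  assumes "germ X x U s = germ X x V r" "opn U" "opn V" "x \<in> V" "s \<in> carrier (Sec X U)" "r \<in> carrier (Sec X V)"
  obtains W where "opn W" "x \<in> W" "W \<subseteq> U" "W \<subseteq> V" "\<And>y. y \<in> W \<Longrightarrow> germ X y U s = germ X y V r"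
proof -
  obtain W where W: "opn W" "x \<in> W" "W \<subseteq> U" "W \<subseteq> V" "Res X U W s = Res X V W r"
    by (rule germ_eqD[OF assms(1,3,4,6)])
  show ?thesis
    by (rule that[OF W(1-4)]) (rule germ_eqI[OF assms(2,5,3,6) W(1) _ W(3-5)])
qed

text \<open>
  An equation between germs holds at all points nearby.  The equation considered here is one step
  of the expansion of \<open>s\<close> in powers of \<open>b\<close>.
\<close>

lemma nearby_affine:
  assumes V: "opn V" "x \<in> V" "s \<in> carrier (Sec X V)" and A: "opn A" "x \<in> A" "a \<in> carrier (Sec X A)"
    and B: "opn B" "x \<in> B" "b \<in> carrier (Sec X B)" and D: "opn D" "x \<in> D" "d \<in> carrier (Sec X D)"
    and eq: "germ X x V s = germ X x A a \<oplus>\<^bsub>stalk X x\<^esub> germ X x B b \<otimes>\<^bsub>stalk X x\<^esub> germ X x D d"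
  obtains W where "opn W" "x \<in> W" "W \<subseteq> V \<inter> A \<inter> B \<inter> D"
    "\<forall>y\<in>W. germ X y V s = germ X y A a \<oplus>\<^bsub>stalk X y\<^esub> germ X y B b \<otimes>\<^bsub>stalk X y\<^esub> germ X y D d"
proof -
  define N where "N = A \<inter> B \<inter> D"
  have N: "opn N" "x \<in> N" "N \<subseteq> A" "N \<subseteq> B" "N \<subseteq> D" unfolding N_def using A B D by auto
  have c: "Res X A N a \<in> carrier (Sec X N)" "Res X B N b \<in> carrier (Sec X N)" "Res X D N d \<in> carrier (Sec X N)"
    using res_closed A B D N by auto
  define r where "r = Res X A N a \<oplus>\<^bsub>Sec X N\<^esub> Res X B N b \<otimes>\<^bsub>Sec X N\<^esub> Res X D N d"
  have bd: "Res X B N b \<otimes>\<^bsub>Sec X N\<^esub> Res X D N d \<in> carrier (Sec X N)" by (rule sec_closed(3)[OF N(1) c(2,3)])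
  have r: "r \<in> carrier (Sec X N)" unfolding r_def by (rule sec_closed(4)[OF N(1) c(1) bd])
  have g: "germ X y N r = germ X y A a \<oplus>\<^bsub>stalk X y\<^esub> germ X y B b \<otimes>\<^bsub>stalk X y\<^esub> germ X y D d" if y: "y \<in> N" for y
    unfolding r_def germ_add[OF N(1) y c(1) bd, symmetric] germ_mult[OF N(1) y c(2,3), symmetric]
      germ_res[OF A(1) N(1) y N(3) A(3)] germ_res[OF B(1) N(1) y N(4) B(3)] germ_res[OF D(1) N(1) y N(5) D(3)] ..
  have "germ X x V s = germ X x N r" using eq g[OF N(2)] by simp
  then obtain W where W: "opn W" "x \<in> W" "W \<subseteq> V" "W \<subseteq> N" "\<And>y. y \<in> W \<Longrightarrow> germ X y V s = germ X y N r"
    using germ_eq_nearby[OF _ V(1) N(1,2) V(3) r] by metis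
  show ?thesis
  proof (rule that[OF W(1,2)])
    show "W \<subseteq> V \<inter> A \<inter> B \<inter> D" using W N by blast
    show "\<forall>y\<in>W. germ X y V s = germ X y A a \<oplus>\<^bsub>stalk X y\<^esub> germ X y B b \<otimes>\<^bsub>stalk X y\<^esub> germ X y D d"
    proof
      fix y assume y: "y \<in> W"
      then have "y \<in> N" using W(4) by blast
      then show "germ X y V s = germ X y A a \<oplus>\<^bsub>stalk X y\<^esub> germ X y B b \<otimes>\<^bsub>stalk X y\<^esub> germ X y D d"
        using W(5)[OF y] g by simp
    qed
  qed
qed

end

section \<open>Stalk maps\<close>

definition stalk_map :: "('p, 'a) rspace \<Rightarrow> ('p, 'a, 'q, 'b) mor \<Rightarrow> 'p \<Rightarrow> ('q set \<times> 'b) set \<Rightarrow> ('p set \<times> 'a) set"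
  where "stalk_map X f x \<xi> = (\<Union>(V, s)\<in>\<xi>. germ X x (preim X (pt f) V) (cm f V s))"

lemma openin_preim:
  "continuous_map (tsp X) (tsp Y) h \<Longrightarrow> openin (tsp Y) V \<Longrightarrow> openin (tsp X) (preim X h V)"
  unfolding preim_def by (rule openin_continuous_map_preimage)

lemma preim_mono: "V \<subseteq> W \<Longrightarrow> preim X h V \<subseteq> preim X h W"
  unfolding preim_def by auto

locale ringed_mor = X: ringed X + Y: ringed Y
  for X :: "('p, 'a) rspace" and Y :: "('q, 'b) rspace" +
  fixes f :: "('p, 'a, 'q, 'b) mor"
  assumes mor: "morphism X Y f"
begin

lemmas mor_parts =
  mor[unfolded morphism_def, THEN conjunct1]
  mor[unfolded morphism_def, THEN conjunct2, THEN conjunct1]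
  mor[unfolded morphism_def, THEN conjunct2, THEN conjunct2, THEN conjunct1]
  mor[unfolded morphism_def, THEN conjunct2, THEN conjunct2, THEN conjunct2]

lemma cont: "continuous_map (tsp X) (tsp Y) (pt f)"
  by (rule mor_parts(1))

lemma pre_open: "Y.opn V \<Longrightarrow> X.opn (preim X (pt f) V)"
  by (rule openin_preim[OF cont])

lemma cm_hom: "Y.opn V \<Longrightarrow> cm f V \<in> ring_hom (Sec Y V) (Sec X (preim X (pt f) V))"
  using mor_parts(2) by blast

lemma cm_closed: "Y.opn V \<Longrightarrow> s \<in> carrier (Sec Y V) \<Longrightarrow> cm f V s \<in> carrier (Sec X (preim X (pt f) V))"
  by (rule ring_hom_closed[OF cm_hom])

lemma cm_cst: "Y.opn V \<Longrightarrow> cm f V (Cst Y V c) = Cst X (preim X (pt f) V) c"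
  using mor_parts(2) by blast

lemma cm_res: "Y.opn V \<Longrightarrow> Y.opn W \<Longrightarrow> W \<subseteq> V \<Longrightarrow> s \<in> carrier (Sec Y V) \<Longrightarrow>
   cm f W (Res Y V W s) = Res X (preim X (pt f) V) (preim X (pt f) W) (cm f V s)"
  using mor_parts(3) by blast

lemma pt_in: "x \<in> topspace (tsp X) \<Longrightarrow> pt f x \<in> topspace (tsp Y)"
  using cont by (auto simp: continuous_map_def)

lemma stalk_map_germ:
  assumes x: "x \<in> topspace (tsp X)" and V: "Y.opn V" "pt f x \<in> V" "s \<in> carrier (Sec Y V)"
  shows "stalk_map X f x (germ Y (pt f x) V s) = germ X x (preim X (pt f) V) (cm f V s)"
proof -
  have "germ X x (preim X (pt f) W) (cm f W r) = germ X x (preim X (pt f) V) (cm f V s)"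
    if W: "(W, r) \<in> germ Y (pt f x) V s" for W r
  proof -
    note W = Y.germ_mem[OF V(1,3) W]
    obtain N where N: "Y.opn N" "pt f x \<in> N" "N \<subseteq> W" "N \<subseteq> V" "Res Y W N r = Res Y V N s"
      by (rule Y.germ_eqD[OF W(4) V])
    show ?thesis
      by (rule X.germ_eqI[where W = "preim X (pt f) N"])
        (use N W V x in \<open>auto simp: pre_open cm_closed cm_res[symmetric] preim_mono, auto simp: preim_def\<close>)
  qed
  then show ?thesis unfolding stalk_map_def using Y.germ_self[OF V] by blast
qed

lemma stalk_map_hom:
  assumes x: "x \<in> topspace (tsp X)"
  shows "stalk_map X f x \<in> ring_hom (stalk Y (pt f x)) (stalk X x)"
proof -
  have T: "Y.opn (topspace (tsp Y))" and fx: "pt f x \<in> topspace (tsp Y)" using pt_in[OF x] by auto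
  have xp: "x \<in> preim X (pt f) V" if "pt f x \<in> V" for V using that x by (simp add: preim_def)
  show ?thesis
  proof (rule ring_hom_memI)
    fix \<xi> assume a: "\<xi> \<in> carrier (stalk Y (pt f x))"
    obtain U s where U: "Y.opn U" "pt f x \<in> U" "s \<in> carrier (Sec Y U)" "\<xi> = germ Y (pt f x) U s"
      by (rule Y.stalk_elem[OF a])
    show "stalk_map X f x \<xi> \<in> carrier (stalk X x)"
      using U stalk_map_germ[OF x U(1-3)] by (simp add: X.germ_closed pre_open xp cm_closed)
  next
    fix \<xi> \<eta> assume a: "\<xi> \<in> carrier (stalk Y (pt f x))" "\<eta> \<in> carrier (stalk Y (pt f x))"
    obtain U s r where U: "Y.opn U" "pt f x \<in> U" "s \<in> carrier (Sec Y U)" "r \<in> carrier (Sec Y U)"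
      "\<xi> = germ Y (pt f x) U s" "\<eta> = germ Y (pt f x) U r" by (rule Y.stalk_elem2[OF a T fx])
    interpret cring "Sec Y U" by (rule Y.sec_cring[OF U(1)])
    note sm = stalk_map_germ[OF x U(1,2)] and o = pre_open[OF U(1)] xp[OF U(2)]
    show "stalk_map X f x (\<xi> \<otimes>\<^bsub>stalk Y (pt f x)\<^esub> \<eta>) = stalk_map X f x \<xi> \<otimes>\<^bsub>stalk X x\<^esub> stalk_map X f x \<eta>"
      using U o by (simp add: Y.germ_mult sm X.germ_mult cm_closed ring_hom_mult[OF cm_hom])
    show "stalk_map X f x (\<xi> \<oplus>\<^bsub>stalk Y (pt f x)\<^esub> \<eta>) = stalk_map X f x \<xi> \<oplus>\<^bsub>stalk X x\<^esub> stalk_map X f x \<eta>"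
      using U o by (simp add: Y.germ_add sm X.germ_add cm_closed ring_hom_add[OF cm_hom])
  next
    show "stalk_map X f x \<one>\<^bsub>stalk Y (pt f x)\<^esub> = \<one>\<^bsub>stalk X x\<^esub>"
      using stalk_map_germ[OF x T fx Y.sec_closed(1)[OF T]] Y.germ_one[OF T fx]
        X.germ_one[OF pre_open[OF T] xp[OF fx]] ring_hom_one[OF cm_hom[OF T]] by simp
  qed
qed

lemma stalk_map_hom_cring:
  "x \<in> topspace (tsp X) \<Longrightarrow> ring_hom_cring (stalk Y (pt f x)) (stalk X x) (stalk_map X f x)"
  by (intro ring_hom_cring.intro ring_hom_cring_axioms.intro stalk_map_hom Y.stalk_cring X.stalk_cring pt_in)

lemma stalk_map_local:
  assumes x: "x \<in> topspace (tsp X)" and \<xi>: "\<xi> \<in> carrier (stalk Y (pt f x))"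
    and u: "stalk_map X f x \<xi> \<in> Units (stalk X x)"
  shows "\<xi> \<in> Units (stalk Y (pt f x))"
proof -
  obtain V s where V: "Y.opn V" "pt f x \<in> V" "s \<in> carrier (Sec Y V)" "\<xi> = germ Y (pt f x) V s"
    by (rule Y.stalk_elem[OF \<xi>])
  have xp: "x \<in> preim X (pt f) V" using V x by (simp add: preim_def)
  have "unit_at X x (preim X (pt f) V) (cm f V s)"
    using X.unit_at_iff[OF pre_open[OF V(1)] xp cm_closed[OF V(1,3)]] u V(4) stalk_map_germ[OF x V(1-3)] by simp
  then have "unit_at Y (pt f x) V s" using mor_parts(4) V xp by blast
  then show ?thesis using Y.unit_at_iff[OF V(1-3)] V(4) by simp
qed

end

text \<open>
  The comorphism is glued from germs by \<open>sections_from_germs\<close>, for which the stalk maps have to vary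
  with the point like those of a comorphism (\<open>nearby\<close>).  The identities that it has to satisfy
  hold because they hold on germs.
\<close>

lemma morphism_from_stalk_maps:
  fixes X :: "('p, 'a) rspace" and Y :: "('q, 'b) rspace"
  assumes "ringed_space X" "ringed_space Y"
    and cont: "continuous_map (tsp X) (tsp Y) h"
    and hom: "\<And>x. x \<in> topspace (tsp X) \<Longrightarrow> F x \<in> ring_hom (stalk Y (h x)) (stalk X x)"
    and cst: "\<And>x c V. x \<in> topspace (tsp X) \<Longrightarrow> openin (tsp Y) V \<Longrightarrow> h x \<in> V \<Longrightarrow>
      F x (germ Y (h x) V (Cst Y V c)) = germ X x (preim X h V) (Cst X (preim X h V) c)"
    and loc: "\<And>x \<xi>. x \<in> topspace (tsp X) \<Longrightarrow> \<xi> \<in> carrier (stalk Y (h x)) \<Longrightarrow> F x \<xi> \<in> Units (stalk X x) \<Longrightarrow>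
      \<xi> \<in> Units (stalk Y (h x))"
    and nearby: "\<And>x V s. x \<in> topspace (tsp X) \<Longrightarrow> openin (tsp Y) V \<Longrightarrow> h x \<in> V \<Longrightarrow> s \<in> carrier (Sec Y V) \<Longrightarrow>
      \<exists>W r. openin (tsp X) W \<and> x \<in> W \<and> W \<subseteq> preim X h V \<and> r \<in> carrier (Sec X W) \<and>
        (\<forall>y\<in>W. germ X y W r = F y (germ Y (h y) V s))"
  obtains f where "morphism X Y f" "pt f = h"
    "\<And>x V s. x \<in> topspace (tsp X) \<Longrightarrow> openin (tsp Y) V \<Longrightarrow> h x \<in> V \<Longrightarrow> s \<in> carrier (Sec Y V) \<Longrightarrow>
      germ X x (preim X h V) (cm f V s) = F x (germ Y (h x) V s)"
proof -
  interpret X: ringed X by standard fact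
  interpret Y: ringed Y by standard fact
  define P where "P V s r \<longleftrightarrow> r \<in> carrier (Sec X (preim X h V)) \<and>
    (\<forall>y\<in>preim X h V. germ X y (preim X h V) r = F y (germ Y (h y) V s))" for V s r
  define f :: "('p, 'a, 'q, 'b) mor" where "f = \<lparr>pt = h, cm = (\<lambda>V s. SOME r. P V s r)\<rparr>"
  have pth: "pt f = h" by (simp add: f_def)
  have po: "X.opn (preim X h V)" if "Y.opn V" for V using openin_preim[OF cont that] .
  have P: "P V s (cm f V s)" if V: "Y.opn V" "s \<in> carrier (Sec Y V)" for V s
  proof -
    obtain r where r: "r \<in> carrier (Sec X (preim X h V))"
        "\<And>y. y \<in> preim X h V \<Longrightarrow> germ X y (preim X h V) r = F y (germ Y (h y) V s)"
    proof (rule X.sections_from_germs[OF po[OF V(1)], where \<gamma> = "\<lambda>y. F y (germ Y (h y) V s)"])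
      fix x assume "x \<in> preim X h V"
      then show "\<exists>W r. X.opn W \<and> x \<in> W \<and> W \<subseteq> preim X h V \<and> r \<in> carrier (Sec X W) \<and>
          (\<forall>y\<in>W. germ X y W r = F y (germ Y (h y) V s))"
        by (intro nearby V) (auto simp: preim_def)
    qed (rule that)
    then have "P V s r" unfolding P_def by blast
    then show ?thesis unfolding f_def by (auto intro: someI)
  qed
  have cl: "cm f V s \<in> carrier (Sec X (preim X h V))" if "Y.opn V" "s \<in> carrier (Sec Y V)" for V s
    using P[OF that] unfolding P_def by blast
  have G: "germ X x (preim X h V) (cm f V s) = F x (germ Y (h x) V s)"
    if "Y.opn V" "s \<in> carrier (Sec Y V)" "x \<in> preim X h V" for x V s
    using P[OF that(1,2)] that(3) unfolding P_def by blast
  have pin: "x \<in> topspace (tsp X) \<and> h x \<in> V" if "x \<in> preim X h V" for x V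
    using that unfolding preim_def by auto
  have "morphism X Y f"
    unfolding morphism_def pth
  proof (intro conjI allI impI ballI cont)
    fix V assume V: "Y.opn V"
    interpret V: cring "Sec Y V" by (rule Y.sec_cring[OF V])
    interpret PV: cring "Sec X (preim X h V)" by (rule X.sec_cring[OF po[OF V]])
    show "cm f V \<in> ring_hom (Sec Y V) (Sec X (preim X h V))"
    proof (rule ring_hom_memI)
      fix s r assume s: "s \<in> carrier (Sec Y V)" "r \<in> carrier (Sec Y V)"
      show "cm f V (s \<otimes>\<^bsub>Sec Y V\<^esub> r) = cm f V s \<otimes>\<^bsub>Sec X (preim X h V)\<^esub> cm f V r"
      proof (rule X.germs_determine[OF po[OF V]])
        fix x assume x: "x \<in> preim X h V"
        note p = pin[OF x]
        show "germ X x (preim X h V) (cm f V (s \<otimes>\<^bsub>Sec Y V\<^esub> r)) =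
          germ X x (preim X h V) (cm f V s \<otimes>\<^bsub>Sec X (preim X h V)\<^esub> cm f V r)"
          using V s x p by (simp add: G cl X.germ_mult[symmetric] po Y.germ_mult[symmetric]
              ring_hom_mult[OF hom] Y.germ_closed)
      qed (simp_all add: cl V s)
      show "cm f V (s \<oplus>\<^bsub>Sec Y V\<^esub> r) = cm f V s \<oplus>\<^bsub>Sec X (preim X h V)\<^esub> cm f V r"
      proof (rule X.germs_determine[OF po[OF V]])
        fix x assume x: "x \<in> preim X h V"
        note p = pin[OF x]
        show "germ X x (preim X h V) (cm f V (s \<oplus>\<^bsub>Sec Y V\<^esub> r)) =
          germ X x (preim X h V) (cm f V s \<oplus>\<^bsub>Sec X (preim X h V)\<^esub> cm f V r)"
          using V s x p by (simp add: G cl X.germ_add[symmetric] po Y.germ_add[symmetric]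
              ring_hom_add[OF hom] Y.germ_closed)
      qed (simp_all add: cl V s)
    next
      show "cm f V \<one>\<^bsub>Sec Y V\<^esub> = \<one>\<^bsub>Sec X (preim X h V)\<^esub>"
      proof (rule X.germs_determine[OF po[OF V]])
        fix x assume x: "x \<in> preim X h V"
        note p = pin[OF x]
        show "germ X x (preim X h V) (cm f V \<one>\<^bsub>Sec Y V\<^esub>) = germ X x (preim X h V) \<one>\<^bsub>Sec X (preim X h V)\<^esub>"
          using V x p by (simp add: G Y.germ_one X.germ_one po ring_hom_one[OF hom])
      qed (simp_all add: cl V)
    qed (simp_all add: cl V)
  next
    fix V c assume V: "Y.opn V"
    show "cm f V (Cst Y V c) = Cst X (preim X h V) c"
    proof (rule X.germs_determine[OF po[OF V]])
      fix x assume x: "x \<in> preim X h V"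
      show "germ X x (preim X h V) (cm f V (Cst Y V c)) = germ X x (preim X h V) (Cst X (preim X h V) c)"
        using G[OF V Y.cst_closed[OF V] x] cst[OF _ V] pin[OF x] by simp
    qed (simp_all add: cl V Y.cst_closed X.cst_closed po)
  next
    fix V W s assume a: "Y.opn V \<and> Y.opn W \<and> W \<subseteq> V" and s: "s \<in> carrier (Sec Y V)"
    have o: "Y.opn V" "Y.opn W" "W \<subseteq> V" "preim X h W \<subseteq> preim X h V" using a preim_mono[of W V X h] by auto
    have sW: "Res Y V W s \<in> carrier (Sec Y W)" using Y.res_closed o s by blast
    show "cm f W (Res Y V W s) = Res X (preim X h V) (preim X h W) (cm f V s)"
    proof (rule X.germs_determine[OF po[OF o(2)]])
      fix x assume x: "x \<in> preim X h W"
      have xV: "x \<in> preim X h V" using x o(4) by blast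
      show "germ X x (preim X h W) (cm f W (Res Y V W s)) =
          germ X x (preim X h W) (Res X (preim X h V) (preim X h W) (cm f V s))"
        using G[OF o(2) sW x] X.germ_res[OF po[OF o(1)] po[OF o(2)] x o(4) cl[OF o(1) s]] G[OF o(1) s xV]
          Y.germ_res[OF o(1,2) _ o(3) s, of "h x"] pin[OF x] by simp
    qed (simp_all add: cl sW o s po X.res_closed)
  next
    fix V x s assume a: "Y.opn V \<and> x \<in> preim X h V" and s: "s \<in> carrier (Sec Y V)"
      and u: "unit_at X x (preim X h V) (cm f V s)"
    have p: "x \<in> topspace (tsp X)" "h x \<in> V" using pin a by auto
    have "F x (germ Y (h x) V s) \<in> Units (stalk X x)"
      using u X.unit_at_iff[OF po _ cl[OF _ s]] a G[OF _ s] by simp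
    then show "unit_at Y (h x) V s"
      using loc[OF p(1) Y.germ_closed[OF _ p(2) s]] Y.unit_at_iff[OF _ p(2) s] a by simp
  qed
  then show ?thesis
    by (rule that[OF _ pth]) (rule G, auto simp: preim_def)
qed

section \<open>Eigenvectors of an automorphism of a nilpotent thickening\<close>

text \<open>
  The local situation at a point: \<open>D\<close> is the stalk of the multiple curve, \<open>A\<close> that of the reduced
  curve, \<open>i\<close> the restriction and \<open>\<tau>\<close> a local equation of the reduced curve.  The assumption \<open>free\<close> says
  that the powers \<open>\<tau>^k\<close> with \<open>k < n\<close> are bases of the graded pieces over \<open>A\<close>.
\<close>

locale nilpotent_thickening = i: ring_hom_cring D A i for D (structure) and A and i +
  fixes \<tau> and n :: nat
  assumes tau: "\<tau> \<in> carrier D" "i \<tau> = \<zero>\<^bsub>A\<^esub>"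
    and i_surj: "a \<in> carrier A \<Longrightarrow> \<exists>r\<in>carrier D. i r = a"
    and i_ker: "r \<in> carrier D \<Longrightarrow> i r = \<zero>\<^bsub>A\<^esub> \<Longrightarrow> \<exists>y\<in>carrier D. r = \<tau> \<otimes> y"
    and nilp: "\<tau> [^] n = \<zero>"
    and free: "k < n \<Longrightarrow> r \<in> carrier D \<Longrightarrow> \<tau> [^] k \<otimes> r = \<zero> \<Longrightarrow> i r = \<zero>\<^bsub>A\<^esub>"
    and n_pos: "0 < n"
begin

lemma i_minus: "r \<in> carrier D \<Longrightarrow> s \<in> carrier D \<Longrightarrow> i (r \<ominus> s) = i r \<ominus>\<^bsub>A\<^esub> i s"
  by (simp add: a_minus_def)

text \<open>The filtration by the powers of the ideal generated by \<open>\<tau>\<close>.\<close>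

definition pw :: "nat \<Rightarrow> 'a set" where "pw k = {\<tau> [^] k \<otimes> y | y. y \<in> carrier D}"

lemma pwI: "y \<in> carrier D \<Longrightarrow> \<tau> [^] k \<otimes> y \<in> pw k" unfolding pw_def by blast

lemma pwE: assumes "r \<in> pw k" obtains y where "y \<in> carrier D" "r = \<tau> [^] k \<otimes> y"
  using assms unfolding pw_def by blast

lemma pw_closed: "r \<in> pw k \<Longrightarrow> r \<in> carrier D"
  using tau(1) by (auto elim!: pwE)

lemma pw_add: assumes "r \<in> pw k" "s \<in> pw k" shows "r \<oplus> s \<in> pw k"
proof -
  obtain y z where y: "y \<in> carrier D" "r = \<tau> [^] k \<otimes> y" and z: "z \<in> carrier D" "s = \<tau> [^] k \<otimes> z"
    using assms by (auto elim!: pwE)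
  have "r \<oplus> s = \<tau> [^] k \<otimes> (y \<oplus> z)" using y z tau(1) by (simp add: i.R.r_distr)
  then show ?thesis using pwI[of "y \<oplus> z" k] y z by simp
qed

lemma pw_mult: assumes "r \<in> pw j" "s \<in> pw k" shows "r \<otimes> s \<in> pw (j + k)"
proof -
  obtain y z where y: "y \<in> carrier D" "r = \<tau> [^] j \<otimes> y" and z: "z \<in> carrier D" "s = \<tau> [^] k \<otimes> z"
    using assms by (auto elim!: pwE)
  have c: "\<tau> [^] j \<in> carrier D" "\<tau> [^] k \<in> carrier D" using tau(1) by auto
  have "r \<otimes> s = (\<tau> [^] j \<otimes> \<tau> [^] k) \<otimes> (y \<otimes> z)" using y z c by algebra
  also have "\<dots> = \<tau> [^] (j + k) \<otimes> (y \<otimes> z)" using tau(1) by (simp add: i.R.nat_pow_mult)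
  finally show ?thesis using pwI[of "y \<otimes> z" "j + k"] y z by simp
qed

lemma pw_zero: "carrier D = pw 0"
proof
  show "carrier D \<subseteq> pw 0" using pwI[of _ 0] by auto
qed (auto dest: pw_closed)

lemma pw_lmult: "r \<in> carrier D \<Longrightarrow> s \<in> pw k \<Longrightarrow> r \<otimes> s \<in> pw k"
  using pw_mult[of r 0 s k] pw_zero by simp

lemma pw_minus: assumes "r \<in> pw k" "s \<in> pw k" shows "r \<ominus> s \<in> pw k"
proof -
  have c: "r \<in> carrier D" "s \<in> carrier D" using assms pw_closed by auto
  have "r \<ominus> s = r \<oplus> (\<ominus> \<one>) \<otimes> s" using c by algebra
  then show ?thesis using pw_add[OF assms(1) pw_lmult[of "\<ominus> \<one>" s k]] assms(2) by simp
qed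

lemma pw_sym:
  assumes c: "r \<in> carrier D" "s \<in> carrier D" and d: "r \<ominus> s \<in> pw k"
  shows "s \<ominus> r \<in> pw k"
proof -
  have "s \<ominus> r = (\<ominus> \<one>) \<otimes> (r \<ominus> s)" using c by algebra
  then show ?thesis using pw_lmult[OF _ d, of "\<ominus> \<one>"] by simp
qed

lemma pw_mono: "j \<le> k \<Longrightarrow> pw k \<subseteq> pw j"
proof
  fix r assume "j \<le> k" "r \<in> pw k"
  then obtain y where y: "y \<in> carrier D" "r = \<tau> [^] k \<otimes> y" by (auto elim!: pwE)
  have "r = \<tau> [^] j \<otimes> (\<tau> [^] (k - j) \<otimes> y)"
    using y tau(1) \<open>j \<le> k\<close> by (simp add: i.R.m_assoc[symmetric] i.R.nat_pow_mult)
  then show "r \<in> pw j" using pwI[of "\<tau> [^] (k - j) \<otimes> y" j] y tau(1) by simp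
qed

lemma pw_n: assumes "n \<le> k" "r \<in> pw k" shows "r = \<zero>"
proof -
  have "r \<in> pw n" using pw_mono assms by blast
  then show ?thesis using nilp by (auto elim!: pwE)
qed

lemma tau_pw: "\<tau> \<in> pw 1" using pwI[of \<one> 1] tau(1) by simp

lemma pw_1_iff: "r \<in> carrier D \<Longrightarrow> r \<in> pw 1 \<longleftrightarrow> i r = \<zero>\<^bsub>A\<^esub>"
  using i_ker[of r] pwI[of _ 1] tau by (auto elim!: pwE)

lemma lin_nilpotent:
  assumes "e \<in> carrier D" "i e = \<zero>\<^bsub>A\<^esub>" shows "e [^] n = \<zero>"
proof -
  obtain y where "y \<in> carrier D" "e = \<tau> \<otimes> y" using i_ker assms by blast
  then show ?thesis using tau(1) nilp by (simp add: i.R.nat_pow_distrib)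
qed

text \<open>
  If \<open>r\<close> is in the \<open>k\<close>-th step of the filtration with \<open>k < n - 1\<close>, then its leading coefficient is killed
  because \<open>\<tau> r = 0\<close> and the next graded piece is free.  So \<open>r\<close> moves down to the last step, where
  \<open>\<tau>\<close> and \<open>e\<close> differ by a factor.
\<close>

lemma annihilator:
  assumes e: "e \<in> carrier D" "b \<in> carrier D" "\<tau> = b \<otimes> e" and r: "r \<in> carrier D" "e \<otimes> r = \<zero>"
  shows "\<exists>y\<in>carrier D. r = e [^] (n - 1) \<otimes> y"
proof -
  have tr: "\<tau> \<otimes> r = \<zero>" using e r by (simp add: i.R.m_assoc)
  have "r \<in> pw k" if "k \<le> n - 1" for k
    using that
  proof (induction k)
    case 0 show ?case using r pw_zero by simp
  next
    case (Suc k)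
    obtain y where y: "y \<in> carrier D" "r = \<tau> [^] k \<otimes> y" using Suc by (auto elim: pwE)
    have "\<tau> [^] Suc k \<otimes> y = \<tau> \<otimes> r" using y tau(1) by (simp add: i.R.m_ac)
    then have "i y = \<zero>\<^bsub>A\<^esub>" using free[of "Suc k" y] y tr Suc.prems n_pos by simp
    then have "y \<in> pw 1" using pw_1_iff y by simp
    moreover have "\<tau> [^] k \<in> pw k" using pwI[of \<one> k] tau(1) by simp
    ultimately show ?case using pw_mult[of "\<tau> [^] k" k y 1] y by simp
  qed
  then obtain y where y: "y \<in> carrier D" "r = \<tau> [^] (n - 1) \<otimes> y" by (auto elim: pwE)
  have "\<tau> [^] (n - 1) = b [^] (n - 1) \<otimes> e [^] (n - 1)" using e by (simp add: i.R.nat_pow_distrib)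
  then have "r = e [^] (n - 1) \<otimes> (b [^] (n - 1) \<otimes> y)" using y e by (simp add: i.R.m_ac)
  then show ?thesis using y e by blast
qed

end

text \<open>
  \<open>\<phi>\<close> is the action of an automorphism over the reduced curve and \<open>\<kappa>\<close> the structure map from the
  complex numbers.  The assumption \<open>phi_tau\<close> says that \<open>\<phi>\<close> acts on the conormal module by \<open>lam\<close>.
\<close>

locale eigen_thickening = nilpotent_thickening D A i \<tau> n
  for D (structure) and A and i and \<tau> and n :: nat +
  fixes \<phi> \<kappa> and lam :: complex
  assumes phi: "\<phi> \<in> ring_hom D D"
    and i_phi: "r \<in> carrier D \<Longrightarrow> i (\<phi> r) = i r"
    and kap: "\<kappa> \<in> ring_hom (class_ring UNIV) D"
    and phi_kap: "\<phi> (\<kappa> c) = \<kappa> c"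
    and phi_tau: "\<exists>y\<in>carrier D. \<phi> \<tau> = \<kappa> lam \<otimes> \<tau> \<oplus> \<tau> \<otimes> \<tau> \<otimes> y"
    and roots: "\<forall>k\<in>{1..n - 1}. lam ^ k \<noteq> 1"
    and lam_nz: "lam \<noteq> 0"
begin

lemma phi_closed [simp]: "r \<in> carrier D \<Longrightarrow> \<phi> r \<in> carrier D"
  by (rule ring_hom_closed[OF phi])

lemma phi_mult: "r \<in> carrier D \<Longrightarrow> s \<in> carrier D \<Longrightarrow> \<phi> (r \<otimes> s) = \<phi> r \<otimes> \<phi> s"
  by (rule ring_hom_mult[OF phi])

lemma phi_add: "r \<in> carrier D \<Longrightarrow> s \<in> carrier D \<Longrightarrow> \<phi> (r \<oplus> s) = \<phi> r \<oplus> \<phi> s"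
  by (rule ring_hom_add[OF phi])

lemma phi_one: "\<phi> \<one> = \<one>" by (rule ring_hom_one[OF phi])

lemma phi_ring_hom_cring: "ring_hom_cring D D \<phi>"
  by (intro ring_hom_cring.intro ring_hom_cring_axioms.intro phi i.R.is_cring)

lemma phi_a_inv: "r \<in> carrier D \<Longrightarrow> \<phi> (\<ominus> r) = \<ominus> \<phi> r"
  by (rule ring_hom_cring.hom_a_inv[OF phi_ring_hom_cring])

lemma phi_minus: "r \<in> carrier D \<Longrightarrow> s \<in> carrier D \<Longrightarrow> \<phi> (r \<ominus> s) = \<phi> r \<ominus> \<phi> s"
  by (simp add: a_minus_def phi_add phi_a_inv)

lemma kap_closed [simp]: "\<kappa> c \<in> carrier D"
  using ring_hom_closed[OF kap, of c] by (simp add: class_ring_def)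

lemma kap_mult: "\<kappa> (c * d) = \<kappa> c \<otimes> \<kappa> d"
  using ring_hom_mult[OF kap, of c d] by (simp add: class_ring_def)

lemma kap_add: "\<kappa> (c + d) = \<kappa> c \<oplus> \<kappa> d"
  using ring_hom_add[OF kap, of c d] by (simp add: class_ring_def)

lemma kap_one: "\<kappa> 1 = \<one>"
  using ring_hom_one[OF kap] by (simp add: class_ring_def)

lemma kap_zero: "\<kappa> 0 = \<zero>"
  using kap_add[of 0 0] i.R.add.l_cancel_one by simp

lemma kap_diff: "\<kappa> (c - d) = \<kappa> c \<ominus> \<kappa> d"
proof -
  have "\<kappa> (c - d) \<oplus> \<kappa> d = \<kappa> c" using kap_add[of "c - d" d] by simp
  moreover have "\<kappa> (c - d) = (\<kappa> (c - d) \<oplus> \<kappa> d) \<ominus> \<kappa> d"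
    using kap_closed[of "c - d"] kap_closed[of d] by algebra
  ultimately show ?thesis by simp
qed

text \<open>On the \<open>k\<close>-th graded piece \<open>\<phi>\<close> is multiplication by \<open>lam ^ k\<close>, because this holds for \<open>k = 0\<close>
  and for the generator \<open>\<tau>\<close>.\<close>

lemma phi_graded: "r \<in> pw k \<Longrightarrow> \<phi> r \<ominus> \<kappa> (lam ^ k) \<otimes> r \<in> pw (Suc k)"
proof (induction k arbitrary: r)
  case 0
  have r: "r \<in> carrier D" using 0 by (rule pw_closed)
  have "i (\<phi> r \<ominus> \<kappa> (lam ^ 0) \<otimes> r) = \<zero>\<^bsub>A\<^esub>"
    using r i.S.r_neg by (simp add: kap_one i_minus i_phi a_minus_def)
  then show ?case using r pw_1_iff[of "\<phi> r \<ominus> \<kappa> (lam ^ 0) \<otimes> r"] by simp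
next
  case (Suc k)
  obtain y where y: "y \<in> carrier D" "r = \<tau> [^] Suc k \<otimes> y" using Suc.prems by (rule pwE)
  define s where "s = \<tau> [^] k \<otimes> y"
  have s: "s \<in> pw k" "s \<in> carrier D" unfolding s_def using pwI y tau(1) by auto
  have tk: "\<tau> [^] k \<in> carrier D" using tau(1) by simp
  have rs: "r = \<tau> \<otimes> s" unfolding y(2) s_def using y(1) tau(1) tk by (simp add: i.R.m_ac)
  obtain z where z: "z \<in> carrier D" "\<phi> \<tau> = \<kappa> lam \<otimes> \<tau> \<oplus> \<tau> \<otimes> \<tau> \<otimes> z" using phi_tau by blast
  define d where "d = \<phi> s \<ominus> \<kappa> (lam ^ k) \<otimes> s"
  have d: "d \<in> pw (Suc k)" "d \<in> carrier D" unfolding d_def using Suc.IH[OF s(1)] pw_closed by auto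
  have ps: "\<phi> s \<in> pw k"
  proof -
    have "\<phi> s = d \<oplus> \<kappa> (lam ^ k) \<otimes> s"
      unfolding d_def using s(2) phi_closed[OF s(2)] kap_closed[of "lam ^ k"] by algebra
    then show ?thesis using pw_add[OF _ pw_lmult[OF kap_closed s(1)]] d(1) pw_mono[of k "Suc k"] by auto
  qed
  have e: "\<phi> r \<ominus> \<kappa> (lam ^ Suc k) \<otimes> r = \<kappa> lam \<otimes> (\<tau> \<otimes> d) \<oplus> z \<otimes> (\<tau> \<otimes> (\<tau> \<otimes> \<phi> s))"
    unfolding rs phi_mult[OF tau(1) s(2)] z(2) d_def power_Suc kap_mult
    using tau(1) s(2) phi_closed[OF s(2)] z(1) kap_closed[of lam] kap_closed[of "lam ^ k"] by algebra
  have "\<tau> \<otimes> d \<in> pw (Suc (Suc k))" using pw_mult[OF tau_pw d(1)] by simp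
  moreover have "\<tau> \<otimes> (\<tau> \<otimes> \<phi> s) \<in> pw (Suc (Suc k))"
    using pw_mult[OF tau_pw pw_mult[OF tau_pw ps]] by simp
  ultimately show ?case
    unfolding e by (intro pw_add[OF pw_lmult[OF kap_closed] pw_lmult[OF z(1)]])
qed

lemma powers_distinct: assumes "j < k" "k < n" shows "lam ^ j \<noteq> lam ^ k"
proof
  assume e: "lam ^ j = lam ^ k"
  have "lam ^ k = lam ^ j * lam ^ (k - j)" using assms by (simp add: power_add[symmetric])
  then have "lam ^ (k - j) = 1" using e lam_nz by simp
  moreover have "k - j \<in> {1..n - 1}" using assms by auto
  ultimately show False using roots by blast
qed

text \<open>An eigenvector modulo the filtration step \<open>Suc j\<close> can be corrected, one step at a time, because
  the further eigenvalues \<open>lam ^ k\<close> are different from \<open>lam ^ j\<close>.\<close>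

lemma eigen_lift:
  assumes r: "r \<in> carrier D" "\<phi> r \<ominus> \<kappa> (lam ^ j) \<otimes> r \<in> pw (Suc j)"
  shows "\<exists>s\<in>carrier D. s \<ominus> r \<in> pw (Suc j) \<and> \<phi> s = \<kappa> (lam ^ j) \<otimes> s"
proof -
  have "\<exists>s\<in>carrier D. s \<ominus> r \<in> pw (Suc j) \<and> \<phi> s \<ominus> \<kappa> (lam ^ j) \<otimes> s \<in> pw k" if "Suc j \<le> k" for k
    using that
  proof (induction k rule: dec_induct)
    case base
    have "r \<ominus> r = \<tau> [^] Suc j \<otimes> \<zero>" using r(1) tau(1) i.R.r_neg[of r] by (simp add: a_minus_def)
    then have "r \<ominus> r \<in> pw (Suc j)" using pwI[of \<zero> "Suc j"] by simp
    then show ?case using r by blast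
  next
    case (step k)
    obtain s where s: "s \<in> carrier D" "s \<ominus> r \<in> pw (Suc j)" "\<phi> s \<ominus> \<kappa> (lam ^ j) \<otimes> s \<in> pw k"
      using step.IH by blast
    define d where "d = \<phi> s \<ominus> \<kappa> (lam ^ j) \<otimes> s"
    have d: "d \<in> pw k" "d \<in> carrier D" using s(3) pw_closed unfolding d_def by auto
    show ?case
    proof (cases "k < n")
      case False
      then have "d = \<zero>" using pw_n[OF _ d(1)] by simp
      then have "d = \<tau> [^] Suc k \<otimes> \<zero>" using tau(1) by simp
      then have "d \<in> pw (Suc k)" using pwI[of \<zero> "Suc k"] by simp
      then show ?thesis using s unfolding d_def by blast
    next
      case True
      \<comment> \<open>Adding \<open>c d\<close> changes the error \<open>d\<close> to \<open>(1 + c (lam ^ k - lam ^ j)) d\<close> modulo the next step.\<close>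
      define c where "c = - 1 / (lam ^ k - lam ^ j)"
      have c: "c * (lam ^ k - lam ^ j) = - 1"
        unfolding c_def using powers_distinct[of j k] step.hyps True by (auto simp: field_simps)
      then have c0: "1 + c * (lam ^ k - lam ^ j) = 0" by simp
      define u where "u = \<phi> d \<ominus> \<kappa> (lam ^ k) \<otimes> d"
      have u: "u \<in> pw (Suc k)" "u \<in> carrier D" unfolding u_def using phi_graded[OF d(1)] pw_closed by auto
      define s' where "s' = s \<oplus> \<kappa> c \<otimes> d"
      have s': "s' \<in> carrier D" unfolding s'_def using s d by simp
      have ps: "\<phi> s' = \<phi> s \<oplus> \<kappa> c \<otimes> \<phi> d"
        unfolding s'_def using s d by (simp add: phi_add phi_mult phi_kap)
      have fs: "\<phi> s = d \<oplus> \<kappa> (lam ^ j) \<otimes> s"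
        unfolding d_def using s(1) phi_closed[OF s(1)] kap_closed[of "lam ^ j"] by algebra
      have "\<phi> s' \<ominus> \<kappa> (lam ^ j) \<otimes> s' =
          \<kappa> c \<otimes> u \<oplus> (\<one> \<oplus> \<kappa> c \<otimes> (\<kappa> (lam ^ k) \<ominus> \<kappa> (lam ^ j))) \<otimes> d"
        unfolding ps unfolding s'_def u_def fs
        using s(1) d(2) phi_closed[OF d(2)] kap_closed[of c]
          kap_closed[of "lam ^ k"] kap_closed[of "lam ^ j"] by algebra
      also have "\<one> \<oplus> \<kappa> c \<otimes> (\<kappa> (lam ^ k) \<ominus> \<kappa> (lam ^ j)) = \<zero>"
        by (simp only: kap_one[symmetric] kap_diff[symmetric] kap_mult[symmetric] kap_add[symmetric] c0 kap_zero)
      finally have "\<phi> s' \<ominus> \<kappa> (lam ^ j) \<otimes> s' \<in> pw (Suc k)"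
        using pw_lmult[OF kap_closed u(1)] u(2) d(2) by simp
      moreover have "s' \<ominus> r = (s \<ominus> r) \<oplus> \<kappa> c \<otimes> d"
        unfolding s'_def using s(1) r(1) d(2) kap_closed[of c] by algebra
      then have "s' \<ominus> r \<in> pw (Suc j)"
        using pw_add[OF s(2)] pw_lmult[OF kap_closed] d(1) pw_mono[OF step.hyps(1)] by auto
      ultimately show ?thesis using s' by blast
    qed
  qed
  from this[of "Suc (j + n)"] obtain s where s: "s \<in> carrier D" "s \<ominus> r \<in> pw (Suc j)"
    "\<phi> s \<ominus> \<kappa> (lam ^ j) \<otimes> s \<in> pw (Suc (j + n))" by auto
  have "\<phi> s \<ominus> \<kappa> (lam ^ j) \<otimes> s = \<zero>" using pw_n[OF _ s(3)] by simp
  then have "\<phi> s = \<kappa> (lam ^ j) \<otimes> s" using s(1) by simp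
  then show ?thesis using s by blast
qed

text \<open>
  On the \<open>k\<close>-th graded piece \<open>\<phi>\<close> acts by \<open>lam ^ k\<close>, so that an eigenvector for \<open>lam ^ j\<close> in a step \<open>k > j\<close>
  vanishes there and is in the next step.
\<close>

lemma eigen_unique:
  assumes r: "r \<in> pw (Suc j)" "\<phi> r = \<kappa> (lam ^ j) \<otimes> r"
  shows "r = \<zero>"
proof -
  have c: "r \<in> carrier D" using r pw_closed by auto
  have "r \<in> pw k" if "Suc j \<le> k" for k
    using that
  proof (induction k rule: dec_induct)
    case (step k)
    show ?case
    proof (cases "k < n")
      case False
      then have "r = \<tau> [^] Suc k \<otimes> \<zero>" using pw_n[OF _ step.IH] tau(1) by simp
      then show ?thesis using pwI[of \<zero> "Suc k"] by simp
    next
      case True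
      define c where "c = 1 / (lam ^ j - lam ^ k)"
      have c: "c * (lam ^ j - lam ^ k) = 1"
        unfolding c_def using powers_distinct[of j k] step.hyps True by (auto simp: field_simps)
      have rc: "r \<in> carrier D" by fact
      have "\<kappa> c \<otimes> (\<phi> r \<ominus> \<kappa> (lam ^ k) \<otimes> r) = (\<kappa> c \<otimes> (\<kappa> (lam ^ j) \<ominus> \<kappa> (lam ^ k))) \<otimes> r"
        unfolding r(2) using rc kap_closed[of c] kap_closed[of "lam ^ j"] kap_closed[of "lam ^ k"] by algebra
      also have "\<dots> = r" using rc by (simp add: kap_diff[symmetric] kap_mult[symmetric] c kap_one)
      finally show ?thesis using pw_lmult[OF kap_closed phi_graded[OF step.IH], of c] by simp
    qed
  qed (use r in simp)
  from this[of "Suc (j + n)"] show ?thesis using pw_n[of "Suc (j + n)" r] by simp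
qed

text \<open>
  The fixed elements are a copy of \<open>A\<close> in \<open>D\<close>, by the case \<open>j = 0\<close> of the preceding lemmas.
  This is where the retraction to the reduced curve comes from.
\<close>

definition fixed_ring :: "'a set" where "fixed_ring = {b \<in> carrier D. \<phi> b = b}"

lemma fixed_subring: "subring fixed_ring D"
  by (rule i.R.subringI) (auto simp: fixed_ring_def phi_one phi_a_inv phi_mult phi_add)

lemma fixed_lift: assumes "a \<in> carrier A" obtains b where "b \<in> fixed_ring" "i b = a"
proof -
  obtain r where r: "r \<in> carrier D" "i r = a" using i_surj assms by blast
  have "\<phi> r \<ominus> \<kappa> (lam ^ 0) \<otimes> r \<in> pw (Suc 0)" using phi_graded[of r 0] r(1) pw_zero by simp
  from eigen_lift[OF r(1) this] obtain b where b: "b \<in> carrier D" "b \<ominus> r \<in> pw 1" "\<phi> b = b"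
    by (auto simp: kap_one)
  have "i b \<ominus>\<^bsub>A\<^esub> i r = \<zero>\<^bsub>A\<^esub>" using b pw_1_iff[of "b \<ominus> r"] i_minus r by simp
  then have "i b = i r" using b(1) r(1) by simp
  then show ?thesis using that[of b] b r by (simp add: fixed_ring_def)
qed

lemma fixed_inj: assumes "b \<in> fixed_ring" "i b = \<zero>\<^bsub>A\<^esub>" shows "b = \<zero>"
  using eigen_unique[of b 0] assms pw_1_iff[of b] by (simp add: fixed_ring_def kap_one)

text \<open>
  By the case \<open>j = 1\<close>, every class in the conormal module contains exactly one of the following elements.
\<close>

definition lin :: "'a set" where "lin = {e \<in> carrier D. \<phi> e = \<kappa> lam \<otimes> e \<and> i e = \<zero>\<^bsub>A\<^esub>}"

lemma lin_lift: assumes "w \<in> carrier D" "i w = \<zero>\<^bsub>A\<^esub>" obtains e where "e \<in> lin" "e \<ominus> w \<in> pw 2"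
proof -
  have "\<phi> w \<ominus> \<kappa> (lam ^ 1) \<otimes> w \<in> pw (Suc 1)" using phi_graded[of w 1] pw_1_iff assms by simp
  from eigen_lift[OF assms(1) this] obtain e where e: "e \<in> carrier D" "e \<ominus> w \<in> pw 2" "\<phi> e = \<kappa> lam \<otimes> e"
    by (auto simp: numeral_2_eq_2)
  have "e \<ominus> w \<in> pw 1" using pw_mono[of 1 2] e by auto
  then have "i e \<ominus>\<^bsub>A\<^esub> i w = \<zero>\<^bsub>A\<^esub>" using e pw_1_iff[of "e \<ominus> w"] i_minus assms by simp
  then have "i e = \<zero>\<^bsub>A\<^esub>" using assms e(1) by simp
  then show ?thesis using that[of e] e by (simp add: lin_def)
qed

lemma lin_inj: assumes "e \<in> lin" "e' \<in> lin" "e \<ominus> e' \<in> pw 2" shows "e = e'"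
proof -
  have c: "e \<in> carrier D" "e' \<in> carrier D" using assms by (auto simp: lin_def)
  have "\<phi> (e \<ominus> e') = \<phi> e \<ominus> \<phi> e'" using c by (simp add: phi_minus)
  also have "\<dots> = \<kappa> lam \<otimes> (e \<ominus> e')"
  proof -
    have "\<phi> e = \<kappa> lam \<otimes> e" "\<phi> e' = \<kappa> lam \<otimes> e'" using assms by (auto simp: lin_def)
    then show ?thesis using c kap_closed[of lam] by (simp only:) algebra
  qed
  finally have "e \<ominus> e' = \<zero>" using eigen_unique[of "e \<ominus> e'" 1] assms(3) by (simp add: numeral_2_eq_2)
  then show ?thesis using c by simp
qed

lemma lin_mult: assumes "b \<in> fixed_ring" "e \<in> lin" shows "b \<otimes> e \<in> lin"
proof -
  have c: "b \<in> carrier D" "\<phi> b = b" "e \<in> carrier D" "\<phi> e = \<kappa> lam \<otimes> e" "i e = \<zero>\<^bsub>A\<^esub>"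
    using assms by (auto simp: lin_def fixed_ring_def)
  have "\<phi> (b \<otimes> e) = \<kappa> lam \<otimes> (b \<otimes> e)" unfolding phi_mult[OF c(1,3)] c(2,4)
    using c kap_closed[of lam] by (simp add: i.R.m_ac)
  then show ?thesis using c by (simp add: lin_def)
qed

text \<open>
  Both sides are eigenvectors for \<open>lam\<close>.  They are in the same class: \<open>u\<close> and \<open>b\<close> differ by an element of
  the ideal, which kills the conormal module.
\<close>

lemma fixed_times_lin_unique:
  assumes e: "e \<in> lin" "e' \<in> lin" and w: "w \<in> carrier D" "w' \<in> carrier D" "i w = \<zero>\<^bsub>A\<^esub>"
    "e \<ominus> w \<in> pw 2" "e' \<ominus> w' \<in> pw 2" and b: "b \<in> carrier D" "w' \<ominus> b \<otimes> w \<in> pw 2"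
    and u: "u \<in> fixed_ring" "i u = i b"
  shows "e' = u \<otimes> e"
proof (rule lin_inj[OF e(2) lin_mult[OF u(1) e(1)]])
  have c: "e \<in> carrier D" "e' \<in> carrier D" "u \<in> carrier D"
    using e u by (auto simp: lin_def fixed_ring_def)
  have "u \<ominus> b \<in> pw 1" using pw_1_iff[of "u \<ominus> b"] c b(1) u(2) i.S.r_neg by (simp add: i_minus a_minus_def)
  moreover have "w \<in> pw 1" using pw_1_iff w by simp
  ultimately have ubw: "(u \<ominus> b) \<otimes> w \<in> pw 2" using pw_mult[of "u \<ominus> b" 1 w 1] by (simp add: numeral_2_eq_2)
  have "e' \<ominus> u \<otimes> e = ((e' \<ominus> w') \<oplus> (w' \<ominus> b \<otimes> w)) \<ominus> (u \<otimes> (e \<ominus> w) \<oplus> (u \<ominus> b) \<otimes> w)"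
    using c w(1,2) b(1) by algebra
  then show "e' \<ominus> u \<otimes> e \<in> pw 2"
    using pw_minus[OF pw_add[OF w(5) b(2)] pw_add[OF pw_lmult[OF c(3) w(4)] ubw]] by simp
qed

text \<open>
  Nakayama's lemma for a nilpotent ideal: inserting \<open>\<tau> = c e + \<tau>^2 z\<close> repeatedly into itself
  moves the remainder to higher powers of \<open>\<tau>\<close>.
\<close>

lemma lin_generates:
  assumes e: "e \<in> carrier D" and c: "c \<in> carrier D" and d: "\<tau> \<ominus> c \<otimes> e \<in> pw 2"
  obtains b where "b \<in> carrier D" "\<tau> = b \<otimes> e"
proof -
  obtain z where z: "z \<in> carrier D" "\<tau> \<ominus> c \<otimes> e = \<tau> [^] (2::nat) \<otimes> z" by (rule pwE[OF d])
  have t2: "\<tau> [^] (2::nat) = \<tau> \<otimes> \<tau>" using tau(1) by (simp add: numeral_2_eq_2)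
  have tz: "\<tau> = c \<otimes> e \<oplus> \<tau> \<otimes> (\<tau> \<otimes> z)"
  proof -
    have "\<tau> = c \<otimes> e \<oplus> (\<tau> \<ominus> c \<otimes> e)" using tau(1) c e by algebra
    then show ?thesis unfolding z(2) t2 using tau(1) z(1) by (simp add: i.R.m_assoc)
  qed
  have "\<exists>b\<in>carrier D. \<exists>y\<in>carrier D. \<tau> = b \<otimes> e \<oplus> \<tau> \<otimes> (\<tau> [^] k \<otimes> y)" for k :: nat
  proof (induction k)
    case 0
    show ?case using tau(1) e by (intro bexI[of _ \<zero>] bexI[of _ \<one>]) auto
  next
    case (Suc k)
    then obtain b y where b: "b \<in> carrier D" "y \<in> carrier D" "\<tau> = b \<otimes> e \<oplus> \<tau> \<otimes> (\<tau> [^] k \<otimes> y)" by blast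
    have tk: "\<tau> [^] k \<in> carrier D" using tau(1) by simp
    have "\<tau> = b \<otimes> e \<oplus> (c \<otimes> e \<oplus> \<tau> \<otimes> (\<tau> \<otimes> z)) \<otimes> (\<tau> [^] k \<otimes> y)" using b(3) tz by simp
    also have "\<dots> = (b \<oplus> c \<otimes> (\<tau> [^] k \<otimes> y)) \<otimes> e \<oplus> \<tau> \<otimes> ((\<tau> [^] k \<otimes> \<tau>) \<otimes> (z \<otimes> y))"
      using b(1,2) e c tk tau(1) z(1) by algebra
    finally show ?case using b e c tk tau(1) z(1)
      by (intro bexI[of _ "b \<oplus> c \<otimes> (\<tau> [^] k \<otimes> y)"] bexI[of _ "z \<otimes> y"]) simp_all
  qed
  from this[of n] obtain b y where b: "b \<in> carrier D" "y \<in> carrier D" "\<tau> = b \<otimes> e \<oplus> \<tau> \<otimes> (\<tau> [^] n \<otimes> y)" by blast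
  then have "\<tau> = b \<otimes> e" using nilp tau(1) e by simp
  then show ?thesis using that b by blast
qed

end

section \<open>Truncated expansions\<close>

text \<open>
  \<open>\<sigma>\<close> and \<open>r\<close> have expansions of length \<open>m\<close> in powers of \<open>t\<close> and of \<open>\<epsilon>\<close> with the same coefficients, which
  are in \<open>E\<close> and are mapped to \<open>B\<close> by \<open>q\<close>.  The remainders are arbitrary.  As a relation between \<open>B\<close> and
  \<open>D\<close> this is visibly compatible with sums and products, and it makes sense before the
  coefficients are known to be unique.
\<close>

primrec expn where
  "expn D B q E t \<epsilon> 0 \<sigma> r \<longleftrightarrow> \<sigma> \<in> carrier B \<and> r \<in> carrier D"
| "expn D B q E t \<epsilon> (Suc m) \<sigma> r \<longleftrightarrow>
     (\<exists>b\<in>E. \<exists>\<sigma>' r'. expn D B q E t \<epsilon> m \<sigma>' r' \<and>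
        \<sigma> = q b \<oplus>\<^bsub>B\<^esub> t \<otimes>\<^bsub>B\<^esub> \<sigma>' \<and> r = b \<oplus>\<^bsub>D\<^esub> \<epsilon> \<otimes>\<^bsub>D\<^esub> r')"

locale expansion_pair = q: ring_hom_cring D B q for D (structure) and B (structure) and q +
  fixes E t \<epsilon>
  assumes E: "subring E D"
    and t: "t \<in> carrier B" and eps: "\<epsilon> \<in> carrier D"
begin

abbreviation "J \<equiv> expn D B q E t \<epsilon>"

lemma E_closed: "b \<in> E \<Longrightarrow> b \<in> carrier D" using subringE(1)[OF E] by blast
lemma E_zero: "\<zero> \<in> E" by (rule subringE(2)[OF E])
lemma E_one: "\<one> \<in> E" by (rule subringE(3)[OF E])
lemma E_mult: "b \<in> E \<Longrightarrow> c \<in> E \<Longrightarrow> b \<otimes> c \<in> E" by (rule subringE(6)[OF E])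
lemma E_add: "b \<in> E \<Longrightarrow> c \<in> E \<Longrightarrow> b \<oplus> c \<in> E" by (rule subringE(7)[OF E])
lemma E_minus: "b \<in> E \<Longrightarrow> c \<in> E \<Longrightarrow> b \<ominus> c \<in> E"
  using E_add[OF _ subringE(5)[OF E]] by (simp add: a_minus_def)

lemma J_closed: "J m \<sigma> r \<Longrightarrow> \<sigma> \<in> carrier B \<and> r \<in> carrier D"
  by (induction m arbitrary: \<sigma> r) (auto simp: E_closed t eps)

lemma J_SucI:
  "b \<in> E \<Longrightarrow> J m \<sigma>' r' \<Longrightarrow> \<sigma> = q b \<oplus>\<^bsub>B\<^esub> t \<otimes>\<^bsub>B\<^esub> \<sigma>' \<Longrightarrow> r = b \<oplus> \<epsilon> \<otimes> r' \<Longrightarrow> J (Suc m) \<sigma> r"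
  by auto

lemma J_SucE:
  assumes "J (Suc m) \<sigma> r"
  obtains b \<sigma>' r' where "b \<in> E" "J m \<sigma>' r'" "\<sigma> = q b \<oplus>\<^bsub>B\<^esub> t \<otimes>\<^bsub>B\<^esub> \<sigma>'" "r = b \<oplus> \<epsilon> \<otimes> r'"
    "b \<in> carrier D" "q b \<in> carrier B" "\<sigma>' \<in> carrier B" "r' \<in> carrier D"
  using assms by (auto dest: J_closed E_closed)

lemma J_E: "b \<in> E \<Longrightarrow> J m (q b) b"
proof (induction m arbitrary: b)
  case 0
  then show ?case by (simp add: E_closed)
next
  case (Suc m)
  show ?case
    by (rule J_SucI[OF Suc.prems Suc.IH[OF E_zero]]) (use Suc.prems E_closed t eps in auto)
qed

lemma J_add: "J m \<sigma> r \<Longrightarrow> J m \<sigma>' r' \<Longrightarrow> J m (\<sigma> \<oplus>\<^bsub>B\<^esub> \<sigma>') (r \<oplus> r')"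
proof (induction m arbitrary: \<sigma> r \<sigma>' r')
  case (Suc m)
  obtain b s p where 1: "b \<in> E" "J m s p" "\<sigma> = q b \<oplus>\<^bsub>B\<^esub> t \<otimes>\<^bsub>B\<^esub> s" "r = b \<oplus> \<epsilon> \<otimes> p"
    "b \<in> carrier D" "q b \<in> carrier B" "s \<in> carrier B" "p \<in> carrier D" by (rule J_SucE[OF Suc.prems(1)])
  obtain b' s' p' where 2: "b' \<in> E" "J m s' p'" "\<sigma>' = q b' \<oplus>\<^bsub>B\<^esub> t \<otimes>\<^bsub>B\<^esub> s'" "r' = b' \<oplus> \<epsilon> \<otimes> p'"
    "b' \<in> carrier D" "q b' \<in> carrier B" "s' \<in> carrier B" "p' \<in> carrier D" by (rule J_SucE[OF Suc.prems(2)])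
  show ?case
  proof (rule J_SucI[OF E_add[OF 1(1) 2(1)] Suc.IH[OF 1(2) 2(2)]])
    show "\<sigma> \<oplus>\<^bsub>B\<^esub> \<sigma>' = q (b \<oplus> b') \<oplus>\<^bsub>B\<^esub> t \<otimes>\<^bsub>B\<^esub> (s \<oplus>\<^bsub>B\<^esub> s')"
      unfolding 1(3) 2(3) q.hom_add[OF 1(5) 2(5)] using 1(6,7) 2(6,7) t by algebra
    show "r \<oplus> r' = b \<oplus> b' \<oplus> \<epsilon> \<otimes> (p \<oplus> p')"
      unfolding 1(4) 2(4) using 1(5,8) 2(5,8) eps by algebra
  qed
qed auto

lemma J_t: "J m t \<epsilon>"
proof (cases m)
  case (Suc k)
  show ?thesis unfolding Suc
    by (rule J_SucI[OF E_zero J_E[OF E_one]]) (use t eps in auto)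
qed (use t eps in auto)

lemma J_mult: "J m \<sigma> r \<Longrightarrow> J m \<sigma>' r' \<Longrightarrow> J m (\<sigma> \<otimes>\<^bsub>B\<^esub> \<sigma>') (r \<otimes> r')"
proof (induction m arbitrary: \<sigma> r \<sigma>' r')
  case (Suc m)
  obtain b s p where 1: "b \<in> E" "J m s p" "\<sigma> = q b \<oplus>\<^bsub>B\<^esub> t \<otimes>\<^bsub>B\<^esub> s" "r = b \<oplus> \<epsilon> \<otimes> p"
    "b \<in> carrier D" "q b \<in> carrier B" "s \<in> carrier B" "p \<in> carrier D" by (rule J_SucE[OF Suc.prems(1)])
  obtain b' s' p' where 2: "b' \<in> E" "J m s' p'" "\<sigma>' = q b' \<oplus>\<^bsub>B\<^esub> t \<otimes>\<^bsub>B\<^esub> s'" "r' = b' \<oplus> \<epsilon> \<otimes> p'"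
    "b' \<in> carrier D" "q b' \<in> carrier B" "s' \<in> carrier B" "p' \<in> carrier D" by (rule J_SucE[OF Suc.prems(2)])
  have J: "J m (q b \<otimes>\<^bsub>B\<^esub> s' \<oplus>\<^bsub>B\<^esub> (q b' \<otimes>\<^bsub>B\<^esub> s \<oplus>\<^bsub>B\<^esub> t \<otimes>\<^bsub>B\<^esub> (s \<otimes>\<^bsub>B\<^esub> s')))
      (b \<otimes> p' \<oplus> (b' \<otimes> p \<oplus> \<epsilon> \<otimes> (p \<otimes> p')))"
    by (intro J_add Suc.IH J_E J_t 1 2)
  show ?case
  proof (rule J_SucI[OF E_mult[OF 1(1) 2(1)] J])
    show "\<sigma> \<otimes>\<^bsub>B\<^esub> \<sigma>' = q (b \<otimes> b') \<oplus>\<^bsub>B\<^esub>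
        t \<otimes>\<^bsub>B\<^esub> (q b \<otimes>\<^bsub>B\<^esub> s' \<oplus>\<^bsub>B\<^esub> (q b' \<otimes>\<^bsub>B\<^esub> s \<oplus>\<^bsub>B\<^esub> t \<otimes>\<^bsub>B\<^esub> (s \<otimes>\<^bsub>B\<^esub> s')))"
      unfolding 1(3) 2(3) q.hom_mult[OF 1(5) 2(5)] using 1(6,7) 2(6,7) t by algebra
    show "r \<otimes> r' = b \<otimes> b' \<oplus> \<epsilon> \<otimes> (b \<otimes> p' \<oplus> (b' \<otimes> p \<oplus> \<epsilon> \<otimes> (p \<otimes> p')))"
      unfolding 1(4) 2(4) using 1(5,8) 2(5,8) eps by algebra
  qed
qed auto

text \<open>
  A common factor of \<open>t\<close> and \<open>\<epsilon>\<close> can be moved into the coefficients, so the relation between \<open>B\<close> and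
  \<open>D\<close> does not depend on the choice of the coordinate.
\<close>

lemma J_change:
  assumes u: "u \<in> E"
  shows "expn D B q E (q u \<otimes>\<^bsub>B\<^esub> t) (u \<otimes> \<epsilon>) m \<sigma> r \<Longrightarrow> J m \<sigma> r"
proof (induction m arbitrary: \<sigma> r)
  case (Suc m)
  obtain b s p where b: "b \<in> E" "expn D B q E (q u \<otimes>\<^bsub>B\<^esub> t) (u \<otimes> \<epsilon>) m s p"
    "\<sigma> = q b \<oplus>\<^bsub>B\<^esub> (q u \<otimes>\<^bsub>B\<^esub> t) \<otimes>\<^bsub>B\<^esub> s" "r = b \<oplus> (u \<otimes> \<epsilon>) \<otimes> p"
    using Suc.prems by auto
  have J: "J m s p" by (rule Suc.IH[OF b(2)])
  have c: "s \<in> carrier B" "p \<in> carrier D" "u \<in> carrier D" "q u \<in> carrier B"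
    using J_closed[OF J] E_closed[OF u] by auto
  show ?case
    by (rule J_SucI[OF b(1) J_mult[OF J_E[OF u] J]])
      (use b(3,4) c t eps in \<open>auto simp: q.R.m_ac q.S.m_ac\<close>)
qed simp

end

text \<open>
  The assumptions on \<open>D\<close> say that it is the direct sum of the \<open>E \<epsilon>^k\<close> with \<open>k < n\<close>, and those on \<open>B\<close>
  that every element has an expansion in powers of \<open>t\<close> with unique coefficients.
\<close>

locale expansion = expansion_pair +
  fixes n :: nat
  assumes n_pos: "0 < n"
    and D_gen: "r \<in> carrier D \<Longrightarrow> \<exists>b\<in>E. \<exists>r'\<in>carrier D. r = b \<oplus> \<epsilon> \<otimes> r'"
    and D_nil: "\<epsilon> [^] n = \<zero>"
    and D_sep: "b \<in> E \<Longrightarrow> r \<in> carrier D \<Longrightarrow> b = \<epsilon> \<otimes> r \<Longrightarrow> b = \<zero>"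
    and D_ann: "r \<in> carrier D \<Longrightarrow> \<epsilon> \<otimes> r = \<zero> \<Longrightarrow> \<exists>y\<in>carrier D. r = \<epsilon> [^] (n - 1) \<otimes> y"
    and B_gen: "\<sigma> \<in> carrier B \<Longrightarrow> \<exists>b\<in>E. \<exists>\<sigma>'\<in>carrier B. \<sigma> = q b \<oplus>\<^bsub>B\<^esub> t \<otimes>\<^bsub>B\<^esub> \<sigma>'"
    and B_sep: "b \<in> E \<Longrightarrow> \<sigma> \<in> carrier B \<Longrightarrow> q b = t \<otimes>\<^bsub>B\<^esub> \<sigma> \<Longrightarrow> b = \<zero>"
    and B_reg: "\<sigma> \<in> carrier B \<Longrightarrow> t \<otimes>\<^bsub>B\<^esub> \<sigma> = \<zero>\<^bsub>B\<^esub> \<Longrightarrow> \<sigma> = \<zero>\<^bsub>B\<^esub>"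
begin

lemma J_total: "\<sigma> \<in> carrier B \<Longrightarrow> \<exists>r. J m \<sigma> r"
proof (induction m arbitrary: \<sigma>)
  case (Suc m)
  obtain b \<sigma>' where b: "b \<in> E" "\<sigma>' \<in> carrier B" "\<sigma> = q b \<oplus>\<^bsub>B\<^esub> t \<otimes>\<^bsub>B\<^esub> \<sigma>'" using B_gen[OF Suc.prems] by blast
  obtain r' where "J m \<sigma>' r'" using Suc.IH[OF b(2)] by blast
  then show ?case using J_SucI[OF b(1) _ b(3) refl] by blast
qed (use eps in auto)

lemma J_surj: "r \<in> carrier D \<Longrightarrow> \<exists>\<sigma>. J m \<sigma> r"
proof (induction m arbitrary: r)
  case (Suc m)
  obtain b r' where b: "b \<in> E" "r' \<in> carrier D" "r = b \<oplus> \<epsilon> \<otimes> r'" using D_gen[OF Suc.prems] by blast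
  obtain \<sigma>' where "J m \<sigma>' r'" using Suc.IH[OF b(2)] by blast
  then show ?case using J_SucI[OF b(1) _ refl b(3)] by blast
qed auto

text \<open>
  Comparing two expansions of \<open>\<sigma>\<close>, the constant coefficients agree by \<open>B_sep\<close>; then \<open>t\<close> can be
  cancelled by \<open>B_reg\<close>.
\<close>

lemma J_functional: "J m \<sigma> r \<Longrightarrow> J m \<sigma> r' \<Longrightarrow> \<exists>y\<in>carrier D. r = r' \<oplus> \<epsilon> [^] m \<otimes> y"
proof (induction m arbitrary: \<sigma> r r')
  case 0
  then have c: "r \<in> carrier D" "r' \<in> carrier D" by auto
  have "r = r' \<oplus> \<epsilon> [^] (0::nat) \<otimes> (r \<ominus> r')" using c by simp algebra
  then show ?case using c by blast
next
  case (Suc m)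
  obtain b s p where 1: "b \<in> E" "J m s p" "\<sigma> = q b \<oplus>\<^bsub>B\<^esub> t \<otimes>\<^bsub>B\<^esub> s" "r = b \<oplus> \<epsilon> \<otimes> p"
    "b \<in> carrier D" "q b \<in> carrier B" "s \<in> carrier B" "p \<in> carrier D" by (rule J_SucE[OF Suc.prems(1)])
  obtain b' s' p' where 2: "b' \<in> E" "J m s' p'" "\<sigma> = q b' \<oplus>\<^bsub>B\<^esub> t \<otimes>\<^bsub>B\<^esub> s'" "r' = b' \<oplus> \<epsilon> \<otimes> p'"
    "b' \<in> carrier D" "q b' \<in> carrier B" "s' \<in> carrier B" "p' \<in> carrier D" by (rule J_SucE[OF Suc.prems(2)])
  have ts: "t \<otimes>\<^bsub>B\<^esub> s \<in> carrier B" "t \<otimes>\<^bsub>B\<^esub> s' \<in> carrier B" using t 1 2 by auto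
  have "q (b \<ominus> b') = q b \<ominus>\<^bsub>B\<^esub> q b'" using 1 2 by (simp add: a_minus_def)
  also have "\<dots> = ((q b \<oplus>\<^bsub>B\<^esub> t \<otimes>\<^bsub>B\<^esub> s) \<ominus>\<^bsub>B\<^esub> (q b' \<oplus>\<^bsub>B\<^esub> t \<otimes>\<^bsub>B\<^esub> s')) \<oplus>\<^bsub>B\<^esub> t \<otimes>\<^bsub>B\<^esub> (s' \<ominus>\<^bsub>B\<^esub> s)"
    using 1(6,7) 2(6,7) t by algebra
  also have "\<dots> = t \<otimes>\<^bsub>B\<^esub> (s' \<ominus>\<^bsub>B\<^esub> s)"
    using 1(3,6,7) 2(3,6,7) t by simp
  finally have qb: "q (b \<ominus> b') = t \<otimes>\<^bsub>B\<^esub> (s' \<ominus>\<^bsub>B\<^esub> s)" .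
  have "b \<ominus> b' = \<zero>" by (rule B_sep[OF E_minus[OF 1(1) 2(1)] _ qb]) (use 1 2 in auto)
  then have bb: "b = b'" using 1 2 by simp
  have "t \<otimes>\<^bsub>B\<^esub> (s' \<ominus>\<^bsub>B\<^esub> s) = \<zero>\<^bsub>B\<^esub>" using qb \<open>b \<ominus> b' = \<zero>\<close> by simp
  then have "s' \<ominus>\<^bsub>B\<^esub> s = \<zero>\<^bsub>B\<^esub>" using B_reg[of "s' \<ominus>\<^bsub>B\<^esub> s"] 1(7) 2(7) by simp
  then have "s' = s" using 1 2 by simp
  then obtain y where y: "y \<in> carrier D" "p = p' \<oplus> \<epsilon> [^] m \<otimes> y" using Suc.IH 1(2) 2(2) by blast
  have em: "\<epsilon> [^] m \<in> carrier D" using eps by simp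
  have "r = r' \<oplus> (\<epsilon> [^] m \<otimes> \<epsilon>) \<otimes> y" unfolding 1(4) 2(4) bb y(2)
    using 2(5,8) y(1) em eps by algebra
  then show ?case using y(1) by auto
qed

text \<open>
  If \<open>\<epsilon>^m\<close> divides \<open>r\<close>, then the constant coefficient \<open>b\<close> is \<open>0\<close> and \<open>\<epsilon>\<close> can be cancelled up to an
  element of its annihilator, which consists of multiples of \<open>\<epsilon>^(n - 1)\<close> and so does no harm as long as
  \<open>m \<le> n\<close>.
\<close>

lemma J_kernel:
  "J m \<sigma> r \<Longrightarrow> y \<in> carrier D \<Longrightarrow> r = \<epsilon> [^] m \<otimes> y \<Longrightarrow> m \<le> n \<Longrightarrow>
   \<exists>s\<in>carrier B. \<sigma> = t [^]\<^bsub>B\<^esub> m \<otimes>\<^bsub>B\<^esub> s"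
proof (induction m arbitrary: \<sigma> r y)
  case (Suc m)
  obtain b s p where 1: "b \<in> E" "J m s p" "\<sigma> = q b \<oplus>\<^bsub>B\<^esub> t \<otimes>\<^bsub>B\<^esub> s" "r = b \<oplus> \<epsilon> \<otimes> p"
    "b \<in> carrier D" "q b \<in> carrier B" "s \<in> carrier B" "p \<in> carrier D" by (rule J_SucE[OF Suc.prems(1)])
  have em: "\<epsilon> [^] m \<in> carrier D" using eps by simp
  have "b = (b \<oplus> \<epsilon> \<otimes> p) \<ominus> \<epsilon> \<otimes> p" using 1(5,8) eps by algebra
  also have "\<dots> = \<epsilon> [^] Suc m \<otimes> y \<ominus> \<epsilon> \<otimes> p" using Suc.prems(3) 1(4) by simp
  also have "\<dots> = \<epsilon> \<otimes> (\<epsilon> [^] m \<otimes> y \<ominus> p)"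
    unfolding q.R.nat_pow_Suc using em eps 1(8) Suc.prems(2) by algebra
  finally have be: "b = \<epsilon> \<otimes> (\<epsilon> [^] m \<otimes> y \<ominus> p)" .
  have b0: "b = \<zero>" by (rule D_sep[OF 1(1) _ be]) (use em 1 Suc.prems in auto)
  obtain w where w: "w \<in> carrier D" "\<epsilon> [^] m \<otimes> y \<ominus> p = \<epsilon> [^] (n - 1) \<otimes> w"
    using D_ann[of "\<epsilon> [^] m \<otimes> y \<ominus> p"] be b0 em 1 Suc.prems by auto
  have "\<epsilon> [^] (n - 1) = \<epsilon> [^] m \<otimes> \<epsilon> [^] (n - 1 - m)"
    using eps Suc.prems(4) by (simp add: q.R.nat_pow_mult)
  then have w2: "\<epsilon> [^] m \<otimes> y \<ominus> p = \<epsilon> [^] m \<otimes> (\<epsilon> [^] (n - 1 - m) \<otimes> w)"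
    using w eps by (simp add: q.R.m_assoc)
  define v where "v = \<epsilon> [^] (n - 1 - m) \<otimes> w"
  have v: "v \<in> carrier D" unfolding v_def using w eps by simp
  have "p = \<epsilon> [^] m \<otimes> y \<ominus> (\<epsilon> [^] m \<otimes> y \<ominus> p)" using em 1(8) Suc.prems(2) by algebra
  also have "\<dots> = \<epsilon> [^] m \<otimes> (y \<ominus> v)" unfolding w2 v_def[symmetric] using em v Suc.prems(2) by algebra
  finally have "p = \<epsilon> [^] m \<otimes> (y \<ominus> v)" .
  from Suc.IH[OF 1(2) _ this] obtain z where z: "z \<in> carrier B" "s = t [^]\<^bsub>B\<^esub> m \<otimes>\<^bsub>B\<^esub> z"
    using v Suc.prems by auto
  have tm: "t [^]\<^bsub>B\<^esub> m \<in> carrier B" using t by simp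
  have "\<sigma> = t [^]\<^bsub>B\<^esub> Suc m \<otimes>\<^bsub>B\<^esub> z"
    unfolding 1(3) b0 z(2) using z(1) t tm by (simp add: q.S.m_ac)
  then show ?case using z(1) by blast
qed auto

lemma J_pow: "\<sigma> \<in> carrier B \<Longrightarrow> J m (t [^]\<^bsub>B\<^esub> m \<otimes>\<^bsub>B\<^esub> \<sigma>) \<zero>"
proof (induction m)
  case (Suc m)
  have tm: "t [^]\<^bsub>B\<^esub> m \<in> carrier B" using t by simp
  show ?case
    by (rule J_SucI[OF E_zero Suc.IH[OF Suc.prems]]) (use tm t eps Suc.prems in \<open>auto simp: q.S.m_ac\<close>)
qed simp

text \<open>
  Substitution of \<open>\<epsilon>\<close> for \<open>t\<close>.
\<close>

definition reduce where "reduce \<sigma> = (THE r. J n \<sigma> r)"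

lemma reduce_eq: assumes "J n \<sigma> r" shows "reduce \<sigma> = r"
  unfolding reduce_def
proof (rule the_equality, rule assms)
  fix r' assume r': "J n \<sigma> r'"
  obtain y where "y \<in> carrier D" "r' = r \<oplus> \<epsilon> [^] n \<otimes> y" using J_functional[OF r' assms] by blast
  then show "r' = r" using J_closed[OF assms] by (simp add: D_nil)
qed

lemma reduce_J: "\<sigma> \<in> carrier B \<Longrightarrow> J n \<sigma> (reduce \<sigma>)"
  using J_total[of \<sigma> n] reduce_eq by auto

lemma reduce_hom: "reduce \<in> ring_hom B D"
proof (rule ring_hom_memI)
  fix \<sigma> assume "\<sigma> \<in> carrier B" then show "reduce \<sigma> \<in> carrier D" using reduce_J J_closed by blast
next
  fix \<sigma> \<sigma>' assume "\<sigma> \<in> carrier B" "\<sigma>' \<in> carrier B"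
  then show "reduce (\<sigma> \<otimes>\<^bsub>B\<^esub> \<sigma>') = reduce \<sigma> \<otimes> reduce \<sigma>'" "reduce (\<sigma> \<oplus>\<^bsub>B\<^esub> \<sigma>') = reduce \<sigma> \<oplus> reduce \<sigma>'"
    using reduce_J J_mult J_add by (auto intro!: reduce_eq)
next
  show "reduce \<one>\<^bsub>B\<^esub> = \<one>" using J_E[OF E_one] by (intro reduce_eq) simp
qed

lemma reduce_E: "b \<in> E \<Longrightarrow> reduce (q b) = b"
  using J_E reduce_eq by blast

lemma reduce_surj: "r \<in> carrier D \<Longrightarrow> \<exists>\<sigma>\<in>carrier B. reduce \<sigma> = r"
  using J_surj[of r n] reduce_eq J_closed by blast

lemma reduce_kernel:
  assumes "\<sigma> \<in> carrier B"
  shows "reduce \<sigma> = \<zero> \<longleftrightarrow> (\<exists>s\<in>carrier B. \<sigma> = t [^]\<^bsub>B\<^esub> n \<otimes>\<^bsub>B\<^esub> s)"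
proof
  assume "reduce \<sigma> = \<zero>"
  then have "J n \<sigma> \<zero>" using reduce_J[OF assms] by simp
  from J_kernel[OF this q.R.zero_closed] show "\<exists>s\<in>carrier B. \<sigma> = t [^]\<^bsub>B\<^esub> n \<otimes>\<^bsub>B\<^esub> s" using eps by simp
qed (auto intro: reduce_eq J_pow)

end

section \<open>Truncated polynomials\<close>

context UP_cring
begin

lemma coeff_shift:
  assumes p: "p \<in> carrier P"
  shows "coeff P (monom P \<one> n \<otimes>\<^bsub>P\<^esub> p) k = (if k < n then \<zero> else coeff P p (k - n))"
proof (cases "k < n")
  case True
  have "coeff P (monom P \<one> n \<otimes>\<^bsub>P\<^esub> p) k = (\<Oplus>i\<in>{..k}. \<zero>)"
    unfolding coeff_mult[OF monom_closed[OF R.one_closed] p]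
    by (rule R.finsum_cong') (use True p in auto)
  then show ?thesis using True by simp
next
  case False
  then show ?thesis using coeff_monom_mult[OF R.one_closed p, of n "k - n"] p by simp
qed

lemma coeff_eval: "p \<in> carrier P \<Longrightarrow> coeff P p k = p k"
  by (simp add: P_def UP_def)

lemma poly_shift:
  assumes p: "p \<in> carrier P" and z: "\<And>k. k < n \<Longrightarrow> coeff P p k = \<zero>"
  obtains r where "r \<in> carrier P" "p = monom P \<one> n \<otimes>\<^bsub>P\<^esub> r"
proof -
  have pu: "p \<in> up R" using p by (simp add: P_def UP_def)
  obtain N where N: "bound \<zero> N p" using pu by (auto simp: up_def)
  have "(\<lambda>k. p (k + n)) \<in> up R"
  proof (rule mem_upI)
    show "p (k + n) \<in> carrier R" for k using mem_upD[OF pu] .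
    show "\<exists>N. bound \<zero> N (\<lambda>k. p (k + n))" using N by (auto intro!: exI[of _ N] simp: bound_def)
  qed
  then have r: "(\<lambda>k. p (k + n)) \<in> carrier P" by (simp add: P_def UP_def)
  show ?thesis
  proof (rule that[OF r], rule up_eqI)
    show "coeff P p k = coeff P (monom P \<one> n \<otimes>\<^bsub>P\<^esub> (\<lambda>k. p (k + n))) k" for k
      unfolding coeff_shift[OF r] using z[of k] coeff_eval[OF p] coeff_eval[OF r] by auto
  qed (use p r in auto)
qed

lemma poly_split:
  assumes p: "p \<in> carrier P"
  obtains r where "r \<in> carrier P" "p = monom P (p 0) 0 \<oplus>\<^bsub>P\<^esub> monom P \<one> 1 \<otimes>\<^bsub>P\<^esub> r" "p 0 \<in> carrier R"
proof -
  have p0: "p 0 \<in> carrier R" "coeff P p 0 = p 0" using p coeff_closed[OF p, of 0] coeff_eval[OF p, of 0] by auto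
  have m: "monom P (p 0) 0 \<in> carrier P" using p0 by simp
  have "coeff P (p \<ominus>\<^bsub>P\<^esub> monom P (p 0) 0) k = \<zero>" if "k < 1" for k
    using that p m p0 by (simp add: R.r_neg a_minus_def)
  then obtain r where r: "r \<in> carrier P" "p \<ominus>\<^bsub>P\<^esub> monom P (p 0) 0 = monom P \<one> 1 \<otimes>\<^bsub>P\<^esub> r"
    using poly_shift[of "p \<ominus>\<^bsub>P\<^esub> monom P (p 0) 0" 1] p m by auto
  have "p = monom P (p 0) 0 \<oplus>\<^bsub>P\<^esub> (p \<ominus>\<^bsub>P\<^esub> monom P (p 0) 0)" using p m by algebra
  then show ?thesis using that[OF r(1) _ p0(1)] unfolding r(2) by simp
qed

lemma X_regular:
  assumes p: "p \<in> carrier P" and z: "monom P \<one> 1 \<otimes>\<^bsub>P\<^esub> p = \<zero>\<^bsub>P\<^esub>" shows "p = \<zero>\<^bsub>P\<^esub>"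
proof (rule up_eqI)
  fix k
  have "coeff P (monom P \<one> 1 \<otimes>\<^bsub>P\<^esub> p) (Suc k) = \<zero>" using z by simp
  then show "coeff P p k = coeff P \<zero>\<^bsub>P\<^esub> k" using coeff_shift[OF p, of 1 "Suc k"] by simp
qed (use p in auto)

lemma trunc_ideal_is_ideal: "ideal (trunc_ideal n R) P"
  unfolding trunc_ideal_def P_def[symmetric] by (rule P.cgenideal_ideal) simp

lemma trunc_ideal_iff:
  assumes p: "p \<in> carrier P"
  shows "p \<in> trunc_ideal n R \<longleftrightarrow> (\<forall>k<n. coeff P p k = \<zero>)"
proof
  assume "p \<in> trunc_ideal n R"
  then obtain r where r: "r \<in> carrier P" "p = r \<otimes>\<^bsub>P\<^esub> monom P \<one> n"
    unfolding trunc_ideal_def P_def[symmetric] cgenideal_def by blast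
  then show "\<forall>k<n. coeff P p k = \<zero>" using coeff_shift[OF r(1)] P.m_comm[OF r(1), of "monom P \<one> n"] by simp
next
  assume "\<forall>k<n. coeff P p k = \<zero>"
  then obtain r where r: "r \<in> carrier P" "p = monom P \<one> n \<otimes>\<^bsub>P\<^esub> r" using poly_shift[OF p] by blast
  then show "p \<in> trunc_ideal n R"
    unfolding trunc_ideal_def P_def[symmetric] cgenideal_def using P.m_comm[OF r(1), of "monom P \<one> n"] by (auto intro!: exI[of _ r])
qed

definition cls :: "nat \<Rightarrow> (nat \<Rightarrow> 'a) \<Rightarrow> (nat \<Rightarrow> 'a) set" where "cls n p = trunc_ideal n R +>\<^bsub>P\<^esub> p"

lemma trunc_cring: "cring (trunc_poly n R)"
  unfolding trunc_poly_def P_def[symmetric] by (rule ideal.quotient_is_cring[OF trunc_ideal_is_ideal P.is_cring])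

lemma cls_hom: "cls n \<in> ring_hom P (trunc_poly n R)"
  unfolding trunc_poly_def P_def[symmetric] cls_def[abs_def] by (rule ideal.rcos_ring_hom[OF trunc_ideal_is_ideal])

lemma trunc_elem: assumes "\<xi> \<in> carrier (trunc_poly n R)" obtains p where "p \<in> carrier P" "\<xi> = cls n p"
  using assms unfolding trunc_poly_def P_def[symmetric] FactRing_def A_RCOSETS_def' cls_def by auto

lemma cls_eq_iff:
  assumes "p \<in> carrier P" "r \<in> carrier P"
  shows "cls n p = cls n r \<longleftrightarrow> (\<forall>k<n. coeff P p k = coeff P r k)"
proof -
  have "cls n p = cls n r \<longleftrightarrow> p \<ominus>\<^bsub>P\<^esub> r \<in> trunc_ideal n R"
    unfolding cls_def using P.quotient_eq_iff_same_a_r_cos[OF trunc_ideal_is_ideal assms] by simp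
  also have "\<dots> \<longleftrightarrow> (\<forall>k<n. coeff P p k = coeff P r k)"
    using assms by (subst trunc_ideal_iff) auto
  finally show ?thesis .
qed

lemma cls_mem_iff:
  assumes p: "p \<in> carrier P"
  shows "r \<in> cls n p \<longleftrightarrow> r \<in> carrier P \<and> (\<forall>k<n. coeff P r k = coeff P p k)"
proof -
  interpret I: ideal "trunc_ideal n R" P by (rule trunc_ideal_is_ideal)
  have "r \<in> cls n p \<longleftrightarrow> r \<in> carrier P \<and> r \<ominus>\<^bsub>P\<^esub> p \<in> trunc_ideal n R"
    unfolding cls_def using I.a_rcos_module_minus[OF P.ring_axioms p] I.a_elemrcos_carrier[OF p] by auto
  then show ?thesis using trunc_ideal_iff[of "r \<ominus>\<^bsub>P\<^esub> p"] p by auto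
qed

lemma cls_const:
  assumes "0 < n" "p \<in> carrier P" shows "(THE a. \<exists>r\<in>cls n p. a = r 0) = p 0"
proof (rule the_equality)
  show "\<exists>r\<in>cls n p. p 0 = r 0" using assms cls_mem_iff[of p p n] by auto
  fix a assume "\<exists>r\<in>cls n p. a = r 0"
  then show "a = p 0" using assms cls_mem_iff[of p _ n] coeff_eval by auto
qed

lemma monom_const_coeff: "a \<in> carrier R \<Longrightarrow> monom P a 0 0 = a"
  using coeff_eval[of "monom P a 0" 0] by simp

lemma divisible_by_X:
  assumes p: "p \<in> carrier P" "p 0 = \<zero>"
  obtains r where "r \<in> carrier P" "p = monom P \<one> 1 \<otimes>\<^bsub>P\<^esub> r"
  using poly_shift[OF p(1), of 1] coeff_eval[OF p(1)] p(2) by auto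

lemma cls_zero_iff: "p \<in> carrier P \<Longrightarrow> cls n p = \<zero>\<^bsub>trunc_poly n R\<^esub> \<longleftrightarrow> (\<forall>k<n. coeff P p k = \<zero>)"
  using cls_eq_iff[of p "\<zero>\<^bsub>P\<^esub>" n] ring_hom_zero[OF cls_hom P.ring_axioms cring.axioms(1)[OF trunc_cring], of n] by simp

lemma cls_hom_cring: "ring_hom_cring P (trunc_poly n R) (cls n)"
  by (intro ring_hom_cring.intro ring_hom_cring_axioms.intro cls_hom trunc_cring P.is_cring)

lemma monom_pow_one: "monom P \<one> 1 [^]\<^bsub>P\<^esub> (k::nat) = monom P \<one> k"
  using monom_pow[OF R.one_closed, of 1 k] by simp

end

text \<open>
  What is used of the truncated polynomial ring \<open>Q = R[t]/(t^n)\<close>, where \<open>T\<close> is the class of \<open>t\<close> and \<open>c\<close>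
  the constant coefficient.  In this form it can be carried over to multiple curves and to their stalks.
\<close>

definition thick_at :: "('a, 'm) ring_scheme \<Rightarrow> ('b, 'k) ring_scheme \<Rightarrow> ('b \<Rightarrow> 'a) \<Rightarrow> 'b \<Rightarrow> nat \<Rightarrow> bool" where
  "thick_at R Q c T n \<longleftrightarrow> T \<in> carrier Q \<and> c T = \<zero>\<^bsub>R\<^esub> \<and> T [^]\<^bsub>Q\<^esub> n = \<zero>\<^bsub>Q\<^esub> \<and>
     (\<forall>a\<in>carrier R. \<exists>\<xi>\<in>carrier Q. c \<xi> = a) \<and>
     (\<forall>\<xi>\<in>carrier Q. c \<xi> = \<zero>\<^bsub>R\<^esub> \<longrightarrow> (\<exists>\<eta>\<in>carrier Q. \<xi> = T \<otimes>\<^bsub>Q\<^esub> \<eta>)) \<and>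
     (\<forall>\<xi>\<in>carrier Q. \<forall>k<n. T [^]\<^bsub>Q\<^esub> k \<otimes>\<^bsub>Q\<^esub> \<xi> = \<zero>\<^bsub>Q\<^esub> \<longrightarrow> c \<xi> = \<zero>\<^bsub>R\<^esub>)"

lemma (in UP_cring) trunc_thick_at:
  assumes n: "0 < n"
  shows "thick_at R (trunc_poly n R) (\<lambda>\<xi>. THE a. \<exists>r\<in>\<xi>. a = r 0) (cls n (monom P \<one> 1)) n"
proof -
  interpret h: ring_hom_cring P "trunc_poly n R" "cls n" by (rule cls_hom_cring)
  have X: "monom P \<one> 1 \<in> carrier P" by simp
  have pow: "cls n (monom P \<one> 1) [^]\<^bsub>trunc_poly n R\<^esub> k = cls n (monom P \<one> k)" for k :: nat
    by (rule h.hom_pow[OF X, of k, unfolded monom_pow_one, symmetric])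
  show ?thesis
    unfolding thick_at_def
  proof (intro conjI ballI allI impI)
    show "cls n (monom P \<one> 1) \<in> carrier (trunc_poly n R)" by simp
    show "(THE a. \<exists>r\<in>cls n (monom P \<one> 1). a = r 0) = \<zero>"
      using cls_const[OF n X] coeff_eval[OF X, of 0] by simp
    show "cls n (monom P \<one> 1) [^]\<^bsub>trunc_poly n R\<^esub> n = \<zero>\<^bsub>trunc_poly n R\<^esub>"
      unfolding pow by (subst cls_zero_iff) auto
  next
    fix a assume a: "a \<in> carrier R"
    then show "\<exists>\<xi>\<in>carrier (trunc_poly n R). (THE a. \<exists>r\<in>\<xi>. a = r 0) = a"
      using cls_const[OF n monom_closed[OF a, of 0]] monom_const_coeff[OF a] by (intro bexI[of _ "cls n (monom P a 0)"]) auto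
  next
    fix \<xi> assume xi: "\<xi> \<in> carrier (trunc_poly n R)" "(THE a. \<exists>r\<in>\<xi>. a = r 0) = \<zero>"
    obtain p where p: "p \<in> carrier P" "\<xi> = cls n p" by (rule trunc_elem[OF xi(1)])
    have "p 0 = \<zero>" using xi(2) p cls_const[OF n p(1)] by simp
    then obtain r where r: "r \<in> carrier P" "p = monom P \<one> 1 \<otimes>\<^bsub>P\<^esub> r" using divisible_by_X[OF p(1)] by blast
    then show "\<exists>\<eta>\<in>carrier (trunc_poly n R). \<xi> = cls n (monom P \<one> 1) \<otimes>\<^bsub>trunc_poly n R\<^esub> \<eta>"
      using p(2) h.hom_mult[OF X r(1)] by (intro bexI[of _ "cls n r"]) auto
  next
    fix \<xi> k assume xi: "\<xi> \<in> carrier (trunc_poly n R)" and k: "k < n"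
      and z: "cls n (monom P \<one> 1) [^]\<^bsub>trunc_poly n R\<^esub> k \<otimes>\<^bsub>trunc_poly n R\<^esub> \<xi> = \<zero>\<^bsub>trunc_poly n R\<^esub>"
    obtain p where p: "p \<in> carrier P" "\<xi> = cls n p" by (rule trunc_elem[OF xi(1)])
    have Xk: "monom P \<one> k \<in> carrier P" by simp
    have "cls n (monom P \<one> k \<otimes>\<^bsub>P\<^esub> p) = \<zero>\<^bsub>trunc_poly n R\<^esub>"
      using z h.hom_mult[OF Xk p(1)] p(2) unfolding pow by simp
    then have "coeff P (monom P \<one> k \<otimes>\<^bsub>P\<^esub> p) k = \<zero>" using cls_zero_iff[of "monom P \<one> k \<otimes>\<^bsub>P\<^esub> p" n] k p(1) by auto
    then have "p 0 = \<zero>" using coeff_shift[OF p(1), of k k] coeff_eval[OF p(1)] by simp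
    then show "(THE a. \<exists>r\<in>\<xi>. a = r 0) = \<zero>" using cls_const[OF n p(1)] p(2) by simp
  qed
qed

text \<open>
  The restriction maps of a thickening are unions over all representatives of a class.  All of
  them give the same class, because \<open>h\<close> acts on each coefficient separately.
\<close>

lemma trunc_restrict:
  assumes R: "cring R" and S: "cring S" and h: "h \<in> ring_hom R S" and p: "p \<in> carrier (UP R)"
  shows "(\<Union>q\<in>UP_cring.cls R n p. trunc_ideal n S +>\<^bsub>UP S\<^esub> (\<lambda>k. h (q k))) = UP_cring.cls S n (\<lambda>k. h (p k))"
    and "(\<lambda>k. h (p k)) \<in> carrier (UP S)"
proof -
  interpret R: UP_cring R "UP R" by (intro UP_cring.intro R reflexive)
  interpret S: UP_cring S "UP S" by (intro UP_cring.intro S reflexive)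
  interpret h: ring_hom_cring R S h by (intro ring_hom_cring.intro ring_hom_cring_axioms.intro R S h)
  have cl: "(\<lambda>k. h (q k)) \<in> carrier (UP S)" if q: "q \<in> carrier (UP R)" for q
  proof -
    have qu: "q \<in> up R" using q by (simp add: UP_def)
    obtain N where N: "bound \<zero>\<^bsub>R\<^esub> N q" using qu by (auto simp: up_def)
    have "(\<lambda>k. h (q k)) \<in> up S"
    proof (rule mem_upI)
      show "h (q k) \<in> carrier S" for k using mem_upD[OF qu] by simp
      show "\<exists>N. bound \<zero>\<^bsub>S\<^esub> N (\<lambda>k. h (q k))" using N by (auto intro!: exI[of _ N] simp: bound_def)
    qed
    then show ?thesis by (simp add: UP_def)
  qed
  show "(\<lambda>k. h (p k)) \<in> carrier (UP S)" by (rule cl[OF p])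
  have "trunc_ideal n S +>\<^bsub>UP S\<^esub> (\<lambda>k. h (q k)) = S.cls n (\<lambda>k. h (p k))" if q: "q \<in> R.cls n p" for q
  proof -
    have q: "q \<in> carrier (UP R)" "\<forall>k<n. coeff (UP R) q k = coeff (UP R) p k" using R.cls_mem_iff[OF p] q by auto
    have "S.cls n (\<lambda>k. h (q k)) = S.cls n (\<lambda>k. h (p k))"
      unfolding S.cls_eq_iff[OF cl[OF q(1)] cl[OF p]]
      using q R.coeff_eval[OF q(1)] R.coeff_eval[OF p] S.coeff_eval[OF cl[OF q(1)]] S.coeff_eval[OF cl[OF p]] by simp
    then show ?thesis unfolding S.cls_def .
  qed
  moreover have "p \<in> R.cls n p" using R.cls_mem_iff[OF p] p by simp
  ultimately show "(\<Union>q\<in>UP_cring.cls R n p. trunc_ideal n S +>\<^bsub>UP S\<^esub> (\<lambda>k. h (q k))) = UP_cring.cls S n (\<lambda>k. h (p k))"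
    by blast
qed

lemma thick_at_iso:
  assumes Q: "cring Q" and Q': "cring Q'" and f: "f \<in> ring_hom Q' Q" and g: "g \<in> ring_hom Q Q'"
    and gf: "\<And>s. s \<in> carrier Q' \<Longrightarrow> g (f s) = s" and fg: "\<And>s. s \<in> carrier Q \<Longrightarrow> f (g s) = s"
    and c: "\<And>s. s \<in> carrier Q' \<Longrightarrow> c' s = c (f s)"
    and T: "thick_at R Q c (f T) n" "T \<in> carrier Q'"
  shows "thick_at R Q' c' T n"
proof -
  interpret f: ring_hom_cring Q' Q f by (intro ring_hom_cring.intro ring_hom_cring_axioms.intro Q Q' f)
  interpret g: ring_hom_cring Q Q' g by (intro ring_hom_cring.intro ring_hom_cring_axioms.intro Q Q' g)
  have inj: "s = s'" if "f s = f s'" "s \<in> carrier Q'" "s' \<in> carrier Q'" for s s' using gf that by metis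
  have cg: "c' (g s) = c s" if "s \<in> carrier Q" for s using c[of "g s"] fg[OF that] that by simp
  note T' = T(1)[unfolded thick_at_def]
  show ?thesis
    unfolding thick_at_def
  proof (intro conjI ballI allI impI)
    show "T \<in> carrier Q'" by fact
    show "c' T = \<zero>\<^bsub>R\<^esub>" using T' c T(2) by simp
    show "T [^]\<^bsub>Q'\<^esub> n = \<zero>\<^bsub>Q'\<^esub>" by (rule inj) (use T' T(2) in simp_all)
  next
    fix a assume "a \<in> carrier R"
    then obtain \<xi> where "\<xi> \<in> carrier Q" "c \<xi> = a" using T' by blast
    then show "\<exists>\<xi>\<in>carrier Q'. c' \<xi> = a" using cg by (intro bexI[of _ "g \<xi>"]) auto
  next
    fix \<xi> assume xi: "\<xi> \<in> carrier Q'" "c' \<xi> = \<zero>\<^bsub>R\<^esub>"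
    then have "c (f \<xi>) = \<zero>\<^bsub>R\<^esub>" "f \<xi> \<in> carrier Q" using c by auto
    then obtain \<eta> where e: "\<eta> \<in> carrier Q" "f \<xi> = f T \<otimes>\<^bsub>Q\<^esub> \<eta>" using T' by blast
    have "\<xi> = T \<otimes>\<^bsub>Q'\<^esub> g \<eta>" by (rule inj) (use e xi T(2) fg in simp_all)
    then show "\<exists>\<eta>\<in>carrier Q'. \<xi> = T \<otimes>\<^bsub>Q'\<^esub> \<eta>" using e by blast
  next
    fix \<xi> k assume xi: "\<xi> \<in> carrier Q'" and k: "k < n" and z: "T [^]\<^bsub>Q'\<^esub> k \<otimes>\<^bsub>Q'\<^esub> \<xi> = \<zero>\<^bsub>Q'\<^esub>"
    have "f T [^]\<^bsub>Q\<^esub> k \<otimes>\<^bsub>Q\<^esub> f \<xi> = f (T [^]\<^bsub>Q'\<^esub> k \<otimes>\<^bsub>Q'\<^esub> \<xi>)" using xi T(2) by simp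
    then have "f T [^]\<^bsub>Q\<^esub> k \<otimes>\<^bsub>Q\<^esub> f \<xi> = \<zero>\<^bsub>Q\<^esub>" using z by simp
    then show "c' \<xi> = \<zero>\<^bsub>R\<^esub>" using T' k xi c by simp
  qed
qed

section \<open>Ideal powers and germs\<close>

context ringed
begin

lemma ideal_pow_germ:
  assumes W: "opn W" "y \<in> W" and t: "t \<in> carrier (stalk X y)"
    and K: "\<And>k. k \<in> K \<Longrightarrow> k \<in> carrier (Sec X W) \<and>
      (\<exists>\<eta>\<in>carrier (stalk X y). germ X y W k = t \<otimes>\<^bsub>stalk X y\<^esub> \<eta>)"
  shows "s \<in> ideal_pow (Sec X W) K m \<Longrightarrow> s \<in> carrier (Sec X W) \<and>
    (\<exists>\<eta>\<in>carrier (stalk X y). germ X y W s = t [^]\<^bsub>stalk X y\<^esub> m \<otimes>\<^bsub>stalk X y\<^esub> \<eta>)"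
proof (induction m arbitrary: s)
  interpret h: ring_hom_cring "Sec X W" "stalk X y" "germ X y W" by (rule germ_hom_cring[OF W])
  {
    case 0
    then have s: "s \<in> carrier (Sec X W)" by simp
    then show ?case by (auto intro!: bexI[of _ "germ X y W s"])
  next
    case (Suc m)
    have "s \<in> ideal_prod (Sec X W) K (ideal_pow (Sec X W) K m)" using Suc.prems by simp
    then show ?case
    proof (induction s rule: ideal_prod.induct)
      case (prod k s)
      obtain \<eta> where e: "\<eta> \<in> carrier (stalk X y)" "germ X y W k = t \<otimes>\<^bsub>stalk X y\<^esub> \<eta>" using K prod(1) by blast
      obtain \<zeta> where z: "\<zeta> \<in> carrier (stalk X y)" "germ X y W s = t [^]\<^bsub>stalk X y\<^esub> m \<otimes>\<^bsub>stalk X y\<^esub> \<zeta>"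
        using Suc.IH[OF prod(2)] by blast
      have c: "k \<in> carrier (Sec X W)" "s \<in> carrier (Sec X W)" using K prod(1) Suc.IH[OF prod(2)] by auto
      have tm: "t [^]\<^bsub>stalk X y\<^esub> m \<in> carrier (stalk X y)" using t by simp
      have "germ X y W (k \<otimes>\<^bsub>Sec X W\<^esub> s) = t [^]\<^bsub>stalk X y\<^esub> Suc m \<otimes>\<^bsub>stalk X y\<^esub> (\<eta> \<otimes>\<^bsub>stalk X y\<^esub> \<zeta>)"
        unfolding h.hom_mult[OF c] e(2) z(2) h.S.nat_pow_Suc using t tm e(1) z(1) by algebra
      then show ?case using c e z by auto
    next
      case (sum s r)
      then obtain \<eta> \<zeta> where e: "\<eta> \<in> carrier (stalk X y)" "\<zeta> \<in> carrier (stalk X y)"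
        "germ X y W s = t [^]\<^bsub>stalk X y\<^esub> Suc m \<otimes>\<^bsub>stalk X y\<^esub> \<eta>"
        "germ X y W r = t [^]\<^bsub>stalk X y\<^esub> Suc m \<otimes>\<^bsub>stalk X y\<^esub> \<zeta>" by blast
      have c: "s \<in> carrier (Sec X W)" "r \<in> carrier (Sec X W)" using sum by auto
      have tm: "t [^]\<^bsub>stalk X y\<^esub> Suc m \<in> carrier (stalk X y)" using t by simp
      have "germ X y W (s \<oplus>\<^bsub>Sec X W\<^esub> r) = t [^]\<^bsub>stalk X y\<^esub> Suc m \<otimes>\<^bsub>stalk X y\<^esub> (\<eta> \<oplus>\<^bsub>stalk X y\<^esub> \<zeta>)"
        unfolding h.hom_add[OF c] e(3,4) using tm e(1,2) by (simp only: h.S.r_distr)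
      then show ?case using c e by auto
    qed
  }
qed

text \<open>
  The powers of an ideal sheaf are defined through sections, with a choice of neighbourhood.  For an
  ideal sheaf with a local generator \<open>t\<close> this lemma and \<open>germ_power_ideal_pow\<close> reduce membership to
  divisibility by \<open>t^m\<close> in the stalks.
\<close>

lemma ideal_sheaf_pow_germ:
  assumes V: "opn V" "x \<in> V" and s: "s \<in> ideal_sheaf_pow X K m V" and t: "t \<in> carrier (stalk X x)"
    and K: "\<And>W k. opn W \<Longrightarrow> x \<in> W \<Longrightarrow> k \<in> K W \<Longrightarrow> k \<in> carrier (Sec X W) \<and>
      (\<exists>\<eta>\<in>carrier (stalk X x). germ X x W k = t \<otimes>\<^bsub>stalk X x\<^esub> \<eta>)"
  shows "\<exists>\<eta>\<in>carrier (stalk X x). germ X x V s = t [^]\<^bsub>stalk X x\<^esub> m \<otimes>\<^bsub>stalk X x\<^esub> \<eta>"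
proof -
  obtain W where W: "opn W" "x \<in> W" "W \<subseteq> V" "Res X V W s \<in> ideal_pow (Sec X W) (K W) m"
    and sc: "s \<in> carrier (Sec X V)"
    using s V(2) unfolding ideal_sheaf_pow_def by blast
  show ?thesis
    using ideal_pow_germ[OF W(1,2) t K W(4)] W germ_res[OF V(1) W(1-3) sc] by simp
qed

lemma power_in_ideal_pow:
  assumes "opn W" "t \<in> K" "s \<in> carrier (Sec X W)" "t \<in> carrier (Sec X W)"
  shows "t [^]\<^bsub>Sec X W\<^esub> m \<otimes>\<^bsub>Sec X W\<^esub> s \<in> ideal_pow (Sec X W) K m"
proof -
  interpret cring "Sec X W" by (rule sec_cring) fact
  show ?thesis
  proof (induction m)
    case (Suc m)
    have "t [^]\<^bsub>Sec X W\<^esub> Suc m \<otimes>\<^bsub>Sec X W\<^esub> s = t \<otimes>\<^bsub>Sec X W\<^esub> (t [^]\<^bsub>Sec X W\<^esub> m \<otimes>\<^bsub>Sec X W\<^esub> s)"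
      using assms by (simp add: m_ac)
    then show ?case using ideal_prod.prod[OF assms(2) Suc] by simp
  qed (use assms in simp)
qed

lemma germ_power_ideal_pow:
  assumes V: "opn V" "x \<in> V" "s \<in> carrier (Sec X V)"
    and U: "opn U" "x \<in> U" "t\<^sub>0 \<in> carrier (Sec X U)"
    and K: "\<And>W. opn W \<Longrightarrow> W \<subseteq> U \<Longrightarrow> Res X U W t\<^sub>0 \<in> K W"
    and \<eta>: "\<eta> \<in> carrier (stalk X x)"
      "germ X x V s = germ X x U t\<^sub>0 [^]\<^bsub>stalk X x\<^esub> m \<otimes>\<^bsub>stalk X x\<^esub> \<eta>"
  shows "\<exists>W. opn W \<and> x \<in> W \<and> W \<subseteq> V \<and> Res X V W s \<in> ideal_pow (Sec X W) (K W) m"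
proof -
  have UV: "opn (U \<inter> V)" "x \<in> U \<inter> V" using U V by auto
  obtain N h where N: "opn N" "x \<in> N" "N \<subseteq> U \<inter> V" "h \<in> carrier (Sec X N)" "\<eta> = germ X x N h"
    by (rule stalk_elem_inside[OF \<eta>(1) UV])
  have NU: "N \<subseteq> U" "N \<subseteq> V" using N by auto
  interpret h: ring_hom_cring "Sec X N" "stalk X x" "germ X x N" by (rule germ_hom_cring[OF N(1,2)])
  define tN where "tN = Res X U N t\<^sub>0"
  have tN: "tN \<in> carrier (Sec X N)" unfolding tN_def using res_closed U N NU by blast
  have p: "tN [^]\<^bsub>Sec X N\<^esub> m \<otimes>\<^bsub>Sec X N\<^esub> h \<in> carrier (Sec X N)" using tN N by simp
  have "germ X x V s = germ X x N (tN [^]\<^bsub>Sec X N\<^esub> m \<otimes>\<^bsub>Sec X N\<^esub> h)"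
    using \<eta>(2) tN N germ_res[OF U(1) N(1,2) NU(1) U(3)] unfolding tN_def[symmetric] by simp
  then obtain W where W: "opn W" "x \<in> W" "W \<subseteq> V" "W \<subseteq> N"
    "Res X V W s = Res X N W (tN [^]\<^bsub>Sec X N\<^esub> m \<otimes>\<^bsub>Sec X N\<^esub> h)"
    by (rule germ_eqD[OF _ N(1,2) p])
  interpret r: ring_hom_cring "Sec X N" "Sec X W" "Res X N W"
    by (intro ring_hom_cring.intro ring_hom_cring_axioms.intro sec_cring res_hom N W)
  have tW: "Res X N W tN = Res X U W t\<^sub>0" unfolding tN_def by (rule res_res[OF U(1) N(1) W(1,4) NU(1) U(3)])
  have "Res X V W s = Res X U W t\<^sub>0 [^]\<^bsub>Sec X W\<^esub> m \<otimes>\<^bsub>Sec X W\<^esub> Res X N W h"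
    unfolding W(5) tW[symmetric] using tN N by simp
  moreover have "Res X U W t\<^sub>0 \<in> K W" by (rule K[OF W(1)]) (use W NU in auto)
  moreover have "Res X U W t\<^sub>0 \<in> carrier (Sec X W)" unfolding tW[symmetric] using tN by simp
  ultimately have "Res X V W s \<in> ideal_pow (Sec X W) (K W) m"
    using power_in_ideal_pow[OF W(1)] N(4) by simp
  then show ?thesis using W by blast
qed

end

section \<open>Multiple curves and their conormal sheaf\<close>

text \<open>
  Each of the properties is about finitely many germs and an equation between them, so it may be
  checked on sections over a small neighbourhood.
\<close>

lemma thick_at_stalk:
  assumes "ringed_mor C X \<iota>" and pt: "pt \<iota> x = x" and x: "x \<in> topspace (tsp C)" and top: "tsp X = tsp C"
    and pre: "\<And>V. openin (tsp C) V \<Longrightarrow> preim C (pt \<iota>) V = V"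
    and U: "openin (tsp C) U" "x \<in> U" "T \<in> carrier (Sec X U)"
    and thick: "\<And>V. openin (tsp C) V \<Longrightarrow> V \<subseteq> U \<Longrightarrow> thick_at (Sec C V) (Sec X V) (cm \<iota> V) (Res X U V T) n"
  shows "thick_at (stalk C x) (stalk X x) (stalk_map C \<iota> x) (germ X x U T) n"
proof -
  interpret C: ringed C using assms(1) by (simp add: ringed_mor_def)
  interpret X: ringed X using assms(1) by (simp add: ringed_mor_def)
  interpret io: ringed_mor C X \<iota> by fact
  have U': "X.opn U" using U(1) top by simp
  have ig: "stalk_map C \<iota> x (germ X x V s) = germ C x V (cm \<iota> V s)"
    if "C.opn V" "x \<in> V" "s \<in> carrier (Sec X V)" for V s
    using io.stalk_map_germ[OF x, of V s] that pt pre top by simp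
  have cc: "cm \<iota> V s \<in> carrier (Sec C V)" if "C.opn V" "s \<in> carrier (Sec X V)" for V s
    using io.cm_closed[of V s] that pre top by simp
  have rt: "Res X U V T \<in> carrier (Sec X V)" "germ X x V (Res X U V T) = germ X x U T"
    if "C.opn V" "x \<in> V" "V \<subseteq> U" for V
    using X.res_closed[OF U' _ that(3) U(3)] X.germ_res[OF U' _ that(2,3) U(3)] that(1) top by auto
  show ?thesis
    unfolding thick_at_def
  proof (intro conjI ballI allI impI)
    have TU: "Res X U U T = T" by (rule X.res_id[OF U' U(3)])
    note th = thick[OF U(1) subset_refl, unfolded thick_at_def TU]
    interpret g: ring_hom_cring "Sec X U" "stalk X x" "germ X x U" by (rule X.germ_hom_cring[OF U' U(2)])
    show "germ X x U T \<in> carrier (stalk X x)" using U(3) by simp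
    show "stalk_map C \<iota> x (germ X x U T) = \<zero>\<^bsub>stalk C x\<^esub>" using ig[OF U] th C.germ_zero[OF U(1,2)] by simp
    show "germ X x U T [^]\<^bsub>stalk X x\<^esub> n = \<zero>\<^bsub>stalk X x\<^esub>" using th g.hom_pow[OF U(3), of n] by simp
  next
    fix a assume "a \<in> carrier (stalk C x)"
    then obtain V b where V: "C.opn V" "x \<in> V" "V \<subseteq> U" "b \<in> carrier (Sec C V)" "a = germ C x V b"
      by (rule C.stalk_elem_inside[OF _ U(1,2)])
    obtain s where s: "s \<in> carrier (Sec X V)" "cm \<iota> V s = b"
      using thick[OF V(1,3)] V(4) unfolding thick_at_def by blast
    have "germ X x V s \<in> carrier (stalk X x)" using X.germ_closed[of V x s] V s top by simp
    then show "\<exists>\<xi>\<in>carrier (stalk X x). stalk_map C \<iota> x \<xi> = a" using ig[OF V(1,2) s(1)] s V by auto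
  next
    fix \<xi> assume xi: "\<xi> \<in> carrier (stalk X x)" "stalk_map C \<iota> x \<xi> = \<zero>\<^bsub>stalk C x\<^esub>"
    obtain V s where V: "X.opn V" "x \<in> V" "V \<subseteq> U" "s \<in> carrier (Sec X V)" "\<xi> = germ X x V s"
      by (rule X.stalk_elem_inside[OF xi(1) U' U(2)])
    have V': "C.opn V" using V(1) top by simp
    have "germ C x V (cm \<iota> V s) = germ C x V \<zero>\<^bsub>Sec C V\<^esub>"
      using ig[OF V' V(2,4)] xi(2) V(5) C.germ_zero[OF V' V(2)] by simp
    then obtain W where W: "C.opn W" "x \<in> W" "W \<subseteq> V" "Res C V W (cm \<iota> V s) = Res C V W \<zero>\<^bsub>Sec C V\<^esub>"
      by (rule C.germ_eqD[OF _ V' V(2) C.sec_closed(2)[OF V']])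
    have W': "X.opn W" using W(1) top by simp
    have WU: "W \<subseteq> U" using W V by blast
    have "cm \<iota> W (Res X V W s) = \<zero>\<^bsub>Sec C W\<^esub>"
      using io.cm_res[OF V(1) W' W(3) V(4)] W(4) pre[OF V'] pre[OF W(1)]
        ring_hom_zero[OF C.res_hom[OF V' W(1,3)] C.sec_ring[OF V'] C.sec_ring[OF W(1)]] by simp
    moreover have sW: "Res X V W s \<in> carrier (Sec X W)" by (rule X.res_closed[OF V(1) W' W(3) V(4)])
    ultimately obtain h where h: "h \<in> carrier (Sec X W)" "Res X V W s = Res X U W T \<otimes>\<^bsub>Sec X W\<^esub> h"
      using thick[OF W(1) WU] unfolding thick_at_def by blast
    have "\<xi> = germ X x U T \<otimes>\<^bsub>stalk X x\<^esub> germ X x W h"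
      using X.germ_mult[OF W' W(2) rt(1)[OF W(1,2) WU] h(1)] h(2) X.germ_res[OF V(1) W' W(2,3) V(4)] V(5)
        rt(2)[OF W(1,2) WU] by simp
    then show "\<exists>\<eta>\<in>carrier (stalk X x). \<xi> = germ X x U T \<otimes>\<^bsub>stalk X x\<^esub> \<eta>"
      using X.germ_closed[OF W' W(2) h(1)] by blast
  next
    fix \<xi> k assume xi: "\<xi> \<in> carrier (stalk X x)" and k: "k < n"
      and z: "germ X x U T [^]\<^bsub>stalk X x\<^esub> k \<otimes>\<^bsub>stalk X x\<^esub> \<xi> = \<zero>\<^bsub>stalk X x\<^esub>"
    obtain V s where V: "X.opn V" "x \<in> V" "V \<subseteq> U" "s \<in> carrier (Sec X V)" "\<xi> = germ X x V s"
      by (rule X.stalk_elem_inside[OF xi U' U(2)])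
    have V': "C.opn V" using V(1) top by simp
    interpret g: ring_hom_cring "Sec X V" "stalk X x" "germ X x V" by (rule X.germ_hom_cring[OF V(1,2)])
    note rV = rt[OF V' V(2,3)]
    define m where "m = Res X U V T [^]\<^bsub>Sec X V\<^esub> k \<otimes>\<^bsub>Sec X V\<^esub> s"
    have m: "m \<in> carrier (Sec X V)" unfolding m_def using rV V by simp
    have "germ X x V m = germ X x V \<zero>\<^bsub>Sec X V\<^esub>"
      unfolding m_def using rV V z by simp
    then obtain W where W: "X.opn W" "x \<in> W" "W \<subseteq> V" "Res X V W m = Res X V W \<zero>\<^bsub>Sec X V\<^esub>"
      by (rule X.germ_eqD[OF _ V(1,2) X.sec_closed(2)[OF V(1)]])
    have W': "C.opn W" using W(1) top by simp
    have WU: "W \<subseteq> U" using W V by blast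
    interpret r: ring_hom_cring "Sec X V" "Sec X W" "Res X V W"
      by (intro ring_hom_cring.intro ring_hom_cring_axioms.intro X.sec_cring X.res_hom V W)
    have "Res X U W T [^]\<^bsub>Sec X W\<^esub> k \<otimes>\<^bsub>Sec X W\<^esub> Res X V W s = \<zero>\<^bsub>Sec X W\<^esub>"
      using W(4) rV(1) V(4) unfolding m_def by (simp add: X.res_res[OF U' V(1) W(1,3) V(3) U(3)])
    moreover have sW: "Res X V W s \<in> carrier (Sec X W)" using V by simp
    ultimately have "cm \<iota> W (Res X V W s) = \<zero>\<^bsub>Sec C W\<^esub>"
      using thick[OF W' WU] k unfolding thick_at_def by blast
    then show "stalk_map C \<iota> x \<xi> = \<zero>\<^bsub>stalk C x\<^esub>"
      using ig[OF W' W(2) sW] X.germ_res[OF V(1) W(1-3) V(4)] V(5) C.germ_zero[OF W' W(2)] by simp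
  qed
qed

text \<open>The properties of a multiple curve that enter the argument: locally the ideal of \<open>C\<close> has a
  generator with the properties of \<open>t\<close> in a truncated polynomial ring.\<close>

locale multiple_curve = C: ringed C + X: ringed X + io: ringed_mor C X \<iota>
  for C :: "('p, 'a) rspace" and X :: "('p, 'b) rspace" and \<iota> :: "('p, 'a, 'p, 'b) mor" +
  fixes n :: nat
  assumes top [simp]: "tsp X = tsp C"
    and pt_io: "x \<in> topspace (tsp C) \<Longrightarrow> pt \<iota> x = x"
    and n: "0 < n"
    and local_generator: "x \<in> topspace (tsp C) \<Longrightarrow> \<exists>U T. openin (tsp C) U \<and> x \<in> U \<and> T \<in> carrier (Sec X U) \<and>
      (\<forall>V. openin (tsp C) V \<and> V \<subseteq> U \<longrightarrow> thick_at (Sec C V) (Sec X V) (cm \<iota> V) (Res X U V T) n)"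

lemma preim_id: "openin (tsp Y) V \<Longrightarrow> (\<And>x. x \<in> topspace (tsp Y) \<Longrightarrow> h x = x) \<Longrightarrow> preim Y h V = V"
  unfolding preim_def using openin_subset[of "tsp Y" V] by force

text \<open>
  In a chart the generator is the image of the class of \<open>t\<close>.
\<close>

lemma chart_thick_at:
  assumes C: "ringed C" and X: "ringed X" and top: "tsp X = tsp C" and n: "0 < n"
    and U: "openin (tsp C) U"
    and iso: "is_iso (thickening n C U) (open_sub X U) \<psi>"
    and base: "mor_eq (open_sub C U) (open_sub X U) (mor_comp (thickening n C U) \<psi> thickening_base) \<iota>"
    and pt_io: "\<And>x. x \<in> topspace (tsp C) \<Longrightarrow> pt \<iota> x = x"
  obtains T where "T \<in> carrier (Sec X U)"
    "\<And>V. openin (tsp C) V \<Longrightarrow> V \<subseteq> U \<Longrightarrow> thick_at (Sec C V) (Sec X V) (cm \<iota> V) (Res X U V T) n"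
proof -
  interpret C: ringed C by fact
  interpret X: ringed X by fact
  let ?Th = "thickening n C U" and ?XU = "open_sub X U"
  obtain g where mor: "morphism ?Th ?XU \<psi>" "morphism ?XU ?Th g"
    and gf: "mor_eq ?Th ?Th (mor_comp ?XU g \<psi>) mor_id" and fg: "mor_eq ?XU ?XU (mor_comp ?Th \<psi> g) mor_id"
    using iso unfolding is_iso_def by blast
  have Usub: "U \<subseteq> topspace (tsp C)" by (rule openin_subset[OF U])
  have tops: "topspace (tsp ?Th) = U" "topspace (tsp ?XU) = U" "topspace (tsp (open_sub C U)) = U"
    using Usub top by (auto simp: thickening_def open_sub_def)
  have opens: "openin (tsp ?Th) V" "openin (tsp ?XU) V" if "C.opn V" "V \<subseteq> U" for V
    using that U top by (auto simp: thickening_def open_sub_def openin_open_subtopology)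
  have ptp: "pt \<psi> x = x" if "x \<in> U" for x
    using base that tops Usub pt_io unfolding mor_eq_def by (auto simp: mor_comp_def thickening_base_def)
  have ptg: "pt g x = x" if "x \<in> U" for x
    using gf that tops ptp unfolding mor_eq_def by (auto simp: mor_comp_def mor_id_def)
  have preT: "preim ?Th (pt \<psi>) V = V" "preim ?XU (pt g) V = V" if "V \<subseteq> U" for V
    unfolding preim_def tops using that ptp ptg by force+
  have SecX: "Sec ?XU V = Sec X V" and ResX: "Res ?XU V W = Res X V W" for V W by (auto simp: open_sub_def)
  have SecT: "Sec ?Th V = trunc_poly n (Sec C V)" for V by (simp add: thickening_def)
  have psi_hom: "cm \<psi> V \<in> ring_hom (Sec X V) (trunc_poly n (Sec C V))" if "C.opn V" "V \<subseteq> U" for V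
    using mor(1) opens(2)[OF that] preT(1)[OF that(2)] unfolding morphism_def SecX SecT by metis
  have g_hom: "cm g V \<in> ring_hom (trunc_poly n (Sec C V)) (Sec X V)" if "C.opn V" "V \<subseteq> U" for V
    using mor(2) opens(1)[OF that] preT(2)[OF that(2)] unfolding morphism_def SecX SecT by metis
  have psi_res: "cm \<psi> W (Res X V W s) = Res ?Th V W (cm \<psi> V s)"
    if "C.opn V" "C.opn W" "W \<subseteq> V" "V \<subseteq> U" "s \<in> carrier (Sec X V)" for V W s
  proof -
    have "W \<subseteq> U" using that by blast
    moreover have "\<forall>V W. openin (tsp ?XU) V \<and> openin (tsp ?XU) W \<and> W \<subseteq> V \<longrightarrow>
        (\<forall>s\<in>carrier (Sec X V). cm \<psi> W (Res X V W s) =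
           Res ?Th (preim ?Th (pt \<psi>) V) (preim ?Th (pt \<psi>) W) (cm \<psi> V s))"
      using mor(1)[unfolded morphism_def SecX ResX, THEN conjunct2, THEN conjunct2, THEN conjunct1] .
    ultimately show ?thesis using that opens(2) preT(1) by simp
  qed
  have g_psi: "cm g V (cm \<psi> V s) = s" if "C.opn V" "V \<subseteq> U" "s \<in> carrier (Sec X V)" for V s
    using fg opens(2)[OF that(1,2)] that preT(1)[OF that(2)]
    unfolding mor_eq_def SecX by (auto simp: mor_comp_def mor_id_def)
  have psi_g: "cm \<psi> V (cm g V s) = s" if "C.opn V" "V \<subseteq> U" "s \<in> carrier (trunc_poly n (Sec C V))" for V s
    using gf opens(1)[OF that(1,2)] that preT(2)[OF that(2)]
    unfolding mor_eq_def SecT by (auto simp: mor_comp_def mor_id_def)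
  have io: "cm \<iota> V s = (THE a. \<exists>p\<in>cm \<psi> V s. a = p 0)" if "C.opn V" "V \<subseteq> U" "s \<in> carrier (Sec X V)" for V s
    using base opens(2)[OF that(1,2)] that preT(1)[OF that(2)]
    unfolding mor_eq_def SecX by (auto simp: mor_comp_def thickening_base_def)
  have UP_cring_at: "UP_cring (Sec C V)" if "C.opn V" for V by (intro UP_cring.intro C.sec_cring that)
  define X1 where "X1 V = UP_cring.cls (Sec C V) n (monom (UP (Sec C V)) \<one>\<^bsub>Sec C V\<^esub> 1)" for V
  have thT: "thick_at (Sec C V) (trunc_poly n (Sec C V)) (\<lambda>\<xi>. THE a. \<exists>r\<in>\<xi>. a = r 0) (X1 V) n" if "C.opn V" for V
    unfolding X1_def by (rule UP_cring.trunc_thick_at[OF UP_cring_at[OF that] n])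
  define T where "T = cm g U (X1 U)"
  have X1: "X1 U \<in> carrier (trunc_poly n (Sec C U))" using thT[OF U] unfolding thick_at_def by blast
  have T: "T \<in> carrier (Sec X U)" unfolding T_def by (rule ring_hom_closed[OF g_hom[OF U subset_refl] X1])
  have psiT: "cm \<psi> V (Res X U V T) = X1 V" if V: "C.opn V" "V \<subseteq> U" for V
  proof -
    interpret PU: UP_cring "Sec C U" "UP (Sec C U)" by (intro UP_cring.intro C.sec_cring U reflexive)
    interpret PV: UP_cring "Sec C V" "UP (Sec C V)" by (intro UP_cring.intro C.sec_cring V reflexive)
    let ?m = "monom (UP (Sec C U)) \<one>\<^bsub>Sec C U\<^esub> 1"
    have m: "?m \<in> carrier (UP (Sec C U))" by simp
    have h: "Res C U V \<in> ring_hom (Sec C U) (Sec C V)" by (rule C.res_hom[OF U V])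
    note tr = trunc_restrict[OF C.sec_cring[OF U] C.sec_cring[OF V(1)] h m]
    have "cm \<psi> V (Res X U V T) = Res ?Th U V (X1 U)"
      using psi_res[OF U V(1) V(2) subset_refl T] psi_g[OF U subset_refl X1] unfolding T_def by simp
    also have "\<dots> = PV.cls n (\<lambda>k. Res C U V (?m k))"
      unfolding X1_def using tr(1)[of n] by (simp add: thickening_def)
    also have "\<dots> = X1 V"
      unfolding X1_def
    proof (subst PV.cls_eq_iff[OF tr(2)])
      have "Res C U V (?m k) = monom (UP (Sec C V)) \<one>\<^bsub>Sec C V\<^esub> 1 k" for k
      proof -
        have 1: "?m k = (if 1 = k then \<one>\<^bsub>Sec C U\<^esub> else \<zero>\<^bsub>Sec C U\<^esub>)"
          using PU.coeff_eval[OF m, of k] by simp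
        have 2: "monom (UP (Sec C V)) \<one>\<^bsub>Sec C V\<^esub> 1 k = (if 1 = k then \<one>\<^bsub>Sec C V\<^esub> else \<zero>\<^bsub>Sec C V\<^esub>)"
          using PV.coeff_eval[of "monom (UP (Sec C V)) \<one>\<^bsub>Sec C V\<^esub> 1" k] by simp
        show ?thesis unfolding 1 2
          using ring_hom_one[OF h] ring_hom_zero[OF h C.sec_ring[OF U] C.sec_ring[OF V(1)]] by simp
      qed
      then show "\<forall>k<n. coeff (UP (Sec C V)) (\<lambda>k. Res C U V (?m k)) k =
          coeff (UP (Sec C V)) (monom (UP (Sec C V)) \<one>\<^bsub>Sec C V\<^esub> 1) k" by presburger
    qed simp
    finally show ?thesis .
  qed
  show ?thesis
  proof (rule that[OF T])
    fix V assume V: "C.opn V" "V \<subseteq> U"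
    have XV: "X.opn V" "X.opn U" using V U top by auto
    have rT: "Res X U V T \<in> carrier (Sec X V)" by (rule X.res_closed[OF XV(2,1) V(2) T])
    show "thick_at (Sec C V) (Sec X V) (cm \<iota> V) (Res X U V T) n"
      by (rule thick_at_iso[where c = "\<lambda>\<xi>. THE a. \<exists>r\<in>\<xi>. a = r 0" and T = "Res X U V T", OF UP_cring.trunc_cring[OF UP_cring_at[OF V(1)]] X.sec_cring[OF XV(1)] psi_hom[OF V] g_hom[OF V]
            g_psi[OF V] psi_g[OF V] io[OF V] _ rT]) (simp_all add: psiT[OF V] thT[OF V(1)])
  qed
qed

lemma multiple_curveI:
  assumes C: "scheme C" and n: "0 < n" and pmc: "primitive_multiple_curve n C X \<iota>"
  shows "multiple_curve C X \<iota> n"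
proof -
  have top: "tsp X = tsp C" and pt: "\<And>x. x \<in> topspace (tsp C) \<Longrightarrow> pt \<iota> x = x"
    and X: "ringed X" and mor: "morphism C X \<iota>"
    using pmc unfolding primitive_multiple_curve_def scheme_def closed_immersion_def by (auto intro: ringed.intro)
  have C: "ringed C" using C unfolding scheme_def by (auto intro: ringed.intro)
  obtain \<U> \<psi> where cover: "\<And>U. U \<in> \<U> \<Longrightarrow> openin (tsp C) U" "\<Union>\<U> = topspace (tsp C)"
    and chart: "\<And>U. U \<in> \<U> \<Longrightarrow> is_iso (thickening n C U) (open_sub X U) (\<psi> U) \<and>
      mor_eq (open_sub C U) (open_sub X U) (mor_comp (thickening n C U) (\<psi> U) thickening_base) \<iota>"
    using pmc unfolding primitive_multiple_curve_def by (elim conjE exE) metis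
  interpret C: ringed C by fact
  interpret X: ringed X by fact
  interpret io: ringed_mor C X \<iota> by (intro ringed_mor.intro ringed_mor_axioms.intro C X mor)
  show ?thesis
  proof (unfold_locales)
    fix x assume "x \<in> topspace (tsp C)"
    then obtain U where U: "U \<in> \<U>" "x \<in> U" using cover by blast
    obtain T where "T \<in> carrier (Sec X U)"
      "\<And>V. C.opn V \<Longrightarrow> V \<subseteq> U \<Longrightarrow> thick_at (Sec C V) (Sec X V) (cm \<iota> V) (Res X U V T) n"
      using chart_thick_at[OF C X top n cover(1)[OF U(1)] _ _ pt] chart[OF U(1)] by metis
    then show "\<exists>U T. C.opn U \<and> x \<in> U \<and> T \<in> carrier (Sec X U) \<and>
        (\<forall>V. C.opn V \<and> V \<subseteq> U \<longrightarrow> thick_at (Sec C V) (Sec X V) (cm \<iota> V) (Res X U V T) n)"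
      using U cover(1) by blast
  qed (use top pt n in auto)
qed

context multiple_curve
begin

abbreviation opn :: "'p set \<Rightarrow> bool" where "opn \<equiv> openin (tsp C)"
abbreviation i :: "'p \<Rightarrow> ('p set \<times> 'b) set \<Rightarrow> ('p set \<times> 'a) set" where "i \<equiv> stalk_map C \<iota>"
abbreviation K :: "'p set \<Rightarrow> 'b set" where "K \<equiv> ker_sheaf C X \<iota>"

lemma oX: "opn V \<Longrightarrow> X.opn V" by simp

lemma in_top: "opn V \<Longrightarrow> x \<in> V \<Longrightarrow> x \<in> topspace (tsp C)"
  using openin_subset[of "tsp C" V] by blast

lemma preim_iota: "opn V \<Longrightarrow> preim C (pt \<iota>) V = V"
  by (rule preim_id[OF _ pt_io])

lemma io_hom: "opn V \<Longrightarrow> cm \<iota> V \<in> ring_hom (Sec X V) (Sec C V)"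
  using io.cm_hom[of V] preim_iota by simp

lemma io_hom_cring: "opn V \<Longrightarrow> ring_hom_cring (Sec X V) (Sec C V) (cm \<iota> V)"
  by (intro ring_hom_cring.intro ring_hom_cring_axioms.intro io_hom C.sec_cring X.sec_cring oX)

lemma io_res: "opn V \<Longrightarrow> opn W \<Longrightarrow> W \<subseteq> V \<Longrightarrow> s \<in> carrier (Sec X V) \<Longrightarrow>
    cm \<iota> W (Res X V W s) = Res C V W (cm \<iota> V s)"
  using io.cm_res[of V W s] preim_iota by simp

lemma i_germ: "opn V \<Longrightarrow> x \<in> V \<Longrightarrow> s \<in> carrier (Sec X V) \<Longrightarrow> i x (germ X x V s) = germ C x V (cm \<iota> V s)"
  using io.stalk_map_germ[of x V s] in_top[of V x] pt_io[of x] preim_iota[of V] by simp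

lemma i_hom_cring: "x \<in> topspace (tsp C) \<Longrightarrow> ring_hom_cring (stalk X x) (stalk C x) (i x)"
  using io.stalk_map_hom_cring[of x] pt_io by simp

lemma K_iff: "opn V \<Longrightarrow> s \<in> K V \<longleftrightarrow> s \<in> carrier (Sec X V) \<and> cm \<iota> V s = \<zero>\<^bsub>Sec C V\<^esub>"
  unfolding ker_sheaf_def by (simp add: preim_iota)

lemma K_closed: "s \<in> K V \<Longrightarrow> s \<in> carrier (Sec X V)"
  unfolding ker_sheaf_def by simp

lemma K_res: assumes "opn V" "opn W" "W \<subseteq> V" "s \<in> K V" shows "Res X V W s \<in> K W"
proof -
  interpret r: ring_hom_cring "Sec C V" "Sec C W" "Res C V W"
    by (intro ring_hom_cring.intro ring_hom_cring_axioms.intro C.sec_cring C.res_hom assms)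
  show ?thesis using assms K_iff[OF assms(1)] K_iff[OF assms(2)] X.res_closed io_res by simp
qed

lemma K_mult: assumes "opn V" "s \<in> K V" "b \<in> carrier (Sec X V)" shows "b \<otimes>\<^bsub>Sec X V\<^esub> s \<in> K V"
proof -
  interpret h: ring_hom_cring "Sec X V" "Sec C V" "cm \<iota> V" by (rule io_hom_cring[OF assms(1)])
  show ?thesis using assms K_iff[OF assms(1)] by simp
qed

text \<open>
  A local equation of \<open>C\<close> at \<open>x\<close>.  There is no canonical one, and those chosen at different points are
  unrelated; only the ideal generated by \<open>gen x\<close> matters.
\<close>

definition gen :: "'p \<Rightarrow> ('p set \<times> 'b) set" where
  "gen x = (SOME \<xi>. \<exists>U T. opn U \<and> x \<in> U \<and> T \<in> carrier (Sec X U) \<and>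
     (\<forall>V. opn V \<and> V \<subseteq> U \<longrightarrow> thick_at (Sec C V) (Sec X V) (cm \<iota> V) (Res X U V T) n) \<and> \<xi> = germ X x U T)"

lemma gen_rep':
  assumes "x \<in> topspace (tsp C)"
  shows "\<exists>U T. opn U \<and> x \<in> U \<and> T \<in> carrier (Sec X U) \<and>
     (\<forall>V. opn V \<and> V \<subseteq> U \<longrightarrow> thick_at (Sec C V) (Sec X V) (cm \<iota> V) (Res X U V T) n) \<and> gen x = germ X x U T"
  unfolding gen_def by (rule someI_ex) (use local_generator[OF assms] in blast)

lemma gen_rep:
  assumes "x \<in> topspace (tsp C)"
  obtains U T where "opn U" "x \<in> U" "T \<in> K U" "gen x = germ X x U T"
proof -
  obtain U T where U: "opn U" "x \<in> U" "T \<in> carrier (Sec X U)" "gen x = germ X x U T"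
    "\<forall>V. opn V \<and> V \<subseteq> U \<longrightarrow> thick_at (Sec C V) (Sec X V) (cm \<iota> V) (Res X U V T) n"
    using gen_rep'[OF assms] by blast
  have "thick_at (Sec C U) (Sec X U) (cm \<iota> U) T n" using U(5)[rule_format, of U] U(1,3) X.res_id[of U T] by simp
  then have "cm \<iota> U T = \<zero>\<^bsub>Sec C U\<^esub>" by (simp add: thick_at_def)
  then have "T \<in> K U" using K_iff[OF U(1)] U(3) by simp
  then show ?thesis by (rule that[OF U(1,2) _ U(4)])
qed

lemma nilp_at:
  assumes x: "x \<in> topspace (tsp C)"
  shows "nilpotent_thickening (stalk X x) (stalk C x) (i x) (gen x) n"
proof -
  obtain U T where U: "opn U" "x \<in> U" "T \<in> carrier (Sec X U)" "gen x = germ X x U T"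
    "\<forall>V. opn V \<and> V \<subseteq> U \<longrightarrow> thick_at (Sec C V) (Sec X V) (cm \<iota> V) (Res X U V T) n"
    using gen_rep'[OF x] by blast
  have "thick_at (stalk C x) (stalk X x) (i x) (gen x) n"
    unfolding U(4) by (rule thick_at_stalk[OF io.ringed_mor_axioms pt_io[OF x] x top preim_iota U(1-3)]) (use U(5) in auto)
  then show ?thesis
    by (intro nilpotent_thickening.intro nilpotent_thickening_axioms.intro i_hom_cring[OF x] n)
      (auto simp: thick_at_def)
qed

abbreviation P :: "'p \<Rightarrow> nat \<Rightarrow> ('p set \<times> 'b) set set" where
  "P x \<equiv> nilpotent_thickening.pw (stalk X x) (gen x)"

lemma K_germ: assumes "opn V" "x \<in> V" "s \<in> K V" shows "i x (germ X x V s) = \<zero>\<^bsub>stalk C x\<^esub>"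
  using assms K_iff[of V s] i_germ[of V x s] C.germ_zero[of V x] by simp

lemma K_germ_closed: assumes "opn V" "x \<in> V" "s \<in> K V" shows "germ X x V s \<in> carrier (stalk X x)"
  using assms X.germ_closed[of V x s] K_closed by simp

text \<open>
  The stalk of \<open>L\<close> at \<open>x\<close> is \<open>\<I>\<^sub>x/\<I>\<^sub>x^2\<close>, and \<open>\<I>\<^sub>x^2\<close> is generated by the square of \<open>gen x\<close>.
\<close>

lemma conormal_germ_iff:
  assumes V: "opn V" "x \<in> V" "s \<in> K V"
  shows "(W, r) \<in> conormal_germ C X \<iota> x V s \<longleftrightarrow> opn W \<and> x \<in> W \<and> r \<in> K W \<and>
    germ X x V s \<ominus>\<^bsub>stalk X x\<^esub> germ X x W r \<in> P x 2"
proof -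
  have xt: "x \<in> topspace (tsp C)" using V in_top by blast
  interpret nt: nilpotent_thickening "stalk X x" "stalk C x" "i x" "gen x" n by (rule nilp_at[OF xt])
  have main: "(\<exists>W'. opn W' \<and> x \<in> W' \<and> W' \<subseteq> V \<inter> W \<and>
        Res X V W' s \<ominus>\<^bsub>Sec X W'\<^esub> Res X W W' r \<in> ideal_sheaf_pow X K 2 W') \<longleftrightarrow>
      germ X x V s \<ominus>\<^bsub>stalk X x\<^esub> germ X x W r \<in> P x 2" (is "?l \<longleftrightarrow> ?r") if W: "opn W" "x \<in> W" "r \<in> K W"
  proof -
    have diff: "Res X V N s \<ominus>\<^bsub>Sec X N\<^esub> Res X W N r \<in> carrier (Sec X N) \<and>
        germ X x N (Res X V N s \<ominus>\<^bsub>Sec X N\<^esub> Res X W N r) = germ X x V s \<ominus>\<^bsub>stalk X x\<^esub> germ X x W r"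
      if N: "opn N" "x \<in> N" "N \<subseteq> V" "N \<subseteq> W" for N
    proof -
      interpret g: ring_hom_cring "Sec X N" "stalk X x" "germ X x N" by (rule X.germ_hom_cring[OF oX]) fact+
      have c: "Res X V N s \<in> carrier (Sec X N)" "Res X W N r \<in> carrier (Sec X N)"
        using X.res_closed[OF oX[OF V(1)] oX[OF N(1)] N(3)] X.res_closed[OF oX[OF W(1)] oX[OF N(1)] N(4)] K_closed V W by auto
      then show ?thesis
        using g.hom_minus[OF c] X.germ_res[OF oX[OF V(1)] oX[OF N(1)] N(2,3)] X.germ_res[OF oX[OF W(1)] oX[OF N(1)] N(2,4)]
          K_closed V W by auto
    qed
    show ?thesis
    proof
      assume ?l
      then obtain N where N: "opn N" "x \<in> N" "N \<subseteq> V" "N \<subseteq> W"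
        "Res X V N s \<ominus>\<^bsub>Sec X N\<^esub> Res X W N r \<in> ideal_sheaf_pow X K 2 N" by blast
      have "\<exists>\<eta>\<in>carrier (stalk X x). germ X x N (Res X V N s \<ominus>\<^bsub>Sec X N\<^esub> Res X W N r) =
          gen x [^]\<^bsub>stalk X x\<^esub> (2::nat) \<otimes>\<^bsub>stalk X x\<^esub> \<eta>"
      proof (rule X.ideal_sheaf_pow_germ[OF oX[OF N(1)] N(2,5) nt.tau(1)])
        fix W k assume "X.opn W" "x \<in> W" "k \<in> K W"
        then show "k \<in> carrier (Sec X W) \<and> (\<exists>\<eta>\<in>carrier (stalk X x). germ X x W k = gen x \<otimes>\<^bsub>stalk X x\<^esub> \<eta>)"
          using nt.i_ker[OF K_germ_closed K_germ] K_closed by auto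
      qed
      then show ?r using diff[OF N(1-4)] by (auto simp: nt.pw_def)
    next
      assume ?r
      define N where "N = V \<inter> W"
      have N: "opn N" "x \<in> N" "N \<subseteq> V" "N \<subseteq> W" using V W by (auto simp: N_def)
      define d where "d = Res X V N s \<ominus>\<^bsub>Sec X N\<^esub> Res X W N r"
      have d: "d \<in> carrier (Sec X N)" "germ X x N d = germ X x V s \<ominus>\<^bsub>stalk X x\<^esub> germ X x W r"
        using diff[OF N] unfolding d_def by auto
      obtain U T where U: "opn U" "x \<in> U" "T \<in> K U" "gen x = germ X x U T" by (rule gen_rep[OF xt])
      obtain \<eta> where e: "\<eta> \<in> carrier (stalk X x)"
        "germ X x N d = germ X x U T [^]\<^bsub>stalk X x\<^esub> (2::nat) \<otimes>\<^bsub>stalk X x\<^esub> \<eta>"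
        using \<open>?r\<close> unfolding d(2)[symmetric] U(4)[symmetric] nt.pw_def by blast
      obtain N' where N': "opn N'" "x \<in> N'" "N' \<subseteq> N" "Res X N N' d \<in> ideal_pow (Sec X N') (K N') 2"
        using X.germ_power_ideal_pow[OF oX[OF N(1)] N(2) d(1) oX[OF U(1)] U(2) K_closed[OF U(3)], of K, OF _ e]
          K_res[OF U(1) _ _ U(3)] by auto
      interpret h: ring_hom_cring "Sec X N" "Sec X N'" "Res X N N'"
        by (intro ring_hom_cring.intro ring_hom_cring_axioms.intro X.sec_cring X.res_hom oX N N')
      have c: "Res X V N s \<in> carrier (Sec X N)" "Res X W N r \<in> carrier (Sec X N)"
        using X.res_closed[OF oX[OF V(1)] oX[OF N(1)] N(3)] X.res_closed[OF oX[OF W(1)] oX[OF N(1)] N(4)] K_closed V W by auto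
      have "Res X N N' d = Res X V N' s \<ominus>\<^bsub>Sec X N'\<^esub> Res X W N' r"
        unfolding d_def h.hom_minus[OF c]
        using X.res_res[OF oX[OF V(1)] oX[OF N(1)] oX[OF N'(1)] N'(3) N(3)]
          X.res_res[OF oX[OF W(1)] oX[OF N(1)] oX[OF N'(1)] N'(3) N(4)] K_closed V W by simp
      moreover have "Res X N N' d \<in> carrier (Sec X N')" using d by simp
      ultimately have "Res X V N' s \<ominus>\<^bsub>Sec X N'\<^esub> Res X W N' r \<in> ideal_sheaf_pow X K 2 N'"
        unfolding ideal_sheaf_pow_def using N'(1,4) X.res_id[OF oX[OF N'(1)]] by (auto intro!: exI[of _ N'])
      then show ?l using N' N by blast
    qed
  qed
  show ?thesis unfolding conormal_germ_def using main by auto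
qed

lemma conormal_germ_self:
  assumes V: "opn V" "x \<in> V" "s \<in> K V" shows "(V, s) \<in> conormal_germ C X \<iota> x V s"
proof -
  have xt: "x \<in> topspace (tsp C)" using V in_top by blast
  interpret nt: nilpotent_thickening "stalk X x" "stalk C x" "i x" "gen x" n by (rule nilp_at[OF xt])
  have "germ X x V s \<ominus>\<^bsub>stalk X x\<^esub> germ X x V s = gen x [^]\<^bsub>stalk X x\<^esub> (2::nat) \<otimes>\<^bsub>stalk X x\<^esub> \<zero>\<^bsub>stalk X x\<^esub>"
    using K_germ_closed[OF V] nt.tau(1) by simp
  then have "germ X x V s \<ominus>\<^bsub>stalk X x\<^esub> germ X x V s \<in> P x 2" using nt.pwI by simp
  then show ?thesis using conormal_germ_iff[OF V] V by simp
qed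

lemma conormal_germ_eqI:
  assumes V: "opn V" "x \<in> V" "s \<in> K V" and W: "opn W" "x \<in> W" "r \<in> K W"
    and d: "germ X x V s \<ominus>\<^bsub>stalk X x\<^esub> germ X x W r \<in> P x 2"
  shows "conormal_germ C X \<iota> x V s = conormal_germ C X \<iota> x W r"
proof -
  have xt: "x \<in> topspace (tsp C)" using V in_top by blast
  interpret nt: nilpotent_thickening "stalk X x" "stalk C x" "i x" "gen x" n by (rule nilp_at[OF xt])
  let ?s = "germ X x V s" and ?r = "germ X x W r"
  have c: "?s \<in> carrier (stalk X x)" "?r \<in> carrier (stalk X x)" using K_germ_closed V W by auto
  have same: "?s \<ominus>\<^bsub>stalk X x\<^esub> g \<in> P x 2 \<longleftrightarrow> ?r \<ominus>\<^bsub>stalk X x\<^esub> g \<in> P x 2" if g: "g \<in> carrier (stalk X x)" for g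
  proof
    assume a: "?s \<ominus>\<^bsub>stalk X x\<^esub> g \<in> P x 2"
    have "?r \<ominus>\<^bsub>stalk X x\<^esub> g = (?s \<ominus>\<^bsub>stalk X x\<^esub> g) \<ominus>\<^bsub>stalk X x\<^esub> (?s \<ominus>\<^bsub>stalk X x\<^esub> ?r)"
      using nt.i.R.diff_cancel(1)[OF c g] by simp
    then show "?r \<ominus>\<^bsub>stalk X x\<^esub> g \<in> P x 2" using nt.pw_minus[OF a d] by simp
  next
    assume a: "?r \<ominus>\<^bsub>stalk X x\<^esub> g \<in> P x 2"
    have "?s \<ominus>\<^bsub>stalk X x\<^esub> g = (?r \<ominus>\<^bsub>stalk X x\<^esub> g) \<oplus>\<^bsub>stalk X x\<^esub> (?s \<ominus>\<^bsub>stalk X x\<^esub> ?r)"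
      using nt.i.R.diff_cancel(2)[OF c g] by simp
    then show "?s \<ominus>\<^bsub>stalk X x\<^esub> g \<in> P x 2" using nt.pw_add[OF a d] by simp
  qed
  have mem: "(W', q) \<in> conormal_germ C X \<iota> x V s \<longleftrightarrow> (W', q) \<in> conormal_germ C X \<iota> x W r" for W' q
    unfolding conormal_germ_iff[OF V] conormal_germ_iff[OF W]
    using same[of "germ X x W' q"] K_germ_closed[of W' x q] by metis
  show ?thesis by (rule Set.set_eqI) (simp only: mem split_paired_all)
qed

lemma conormal_germ_res:
  assumes V: "opn V" "s \<in> K V" and W: "opn W" "x \<in> W" "W \<subseteq> V"
  shows "conormal_germ C X \<iota> x W (Res X V W s) = conormal_germ C X \<iota> x V s"
proof (rule conormal_germ_eqI[OF W(1,2) K_res[OF V(1) W(1,3) V(2)] V(1) _ V(2)])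
  show xV: "x \<in> V" using W by blast
  have "germ X x W (Res X V W s) = germ X x V s"
    by (rule X.germ_res[OF oX[OF V(1)] oX[OF W(1)] W(2,3) K_closed[OF V(2)]])
  then show "germ X x W (Res X V W s) \<ominus>\<^bsub>stalk X x\<^esub> germ X x V s \<in> P x 2"
    using conormal_germ_self[OF V(1) xV V(2)] conormal_germ_iff[OF V(1) xV V(2), of V s] by simp
qed

lemma conormal_germ_section: "opn V \<Longrightarrow> s \<in> K V \<Longrightarrow> (\<lambda>y\<in>V. conormal_germ C X \<iota> y V s) \<in> conormal C X \<iota> V"
  unfolding conormal_def by auto

text \<open>
  The product of a function with a section of \<open>L\<close> is a union over all lifts of the function.  Any
  element of this union comes from one lift \<open>\<beta>\<close>.
\<close>

lemma conormal_smult_mem: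
  assumes V: "opn V" "x \<in> V" "a \<in> carrier (Sec C V)"
    and U: "opn U" "x \<in> U" "w \<in> K U" "l x = conormal_germ C X \<iota> x U w"
    and r: "(W, r) \<in> conormal_smult C X \<iota> V a l x"
  obtains \<beta> where "\<beta> \<in> carrier (stalk X x)" "i x \<beta> = germ C x V a" "opn W" "x \<in> W" "r \<in> K W"
    "(\<beta> \<otimes>\<^bsub>stalk X x\<^esub> germ X x U w) \<ominus>\<^bsub>stalk X x\<^esub> germ X x W r \<in> P x 2"
proof -
  have xt: "x \<in> topspace (tsp C)" using V in_top by blast
  interpret nt: nilpotent_thickening "stalk X x" "stalk C x" "i x" "gen x" n by (rule nilp_at[OF xt])
  have "(W, r) \<in> \<Union>{conormal_germ C X \<iota> x W' (b \<otimes>\<^bsub>Sec X W'\<^esub> Res X W W' s) |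
     W s W' b. (W, s) \<in> l x \<and> openin (tsp X) W' \<and> x \<in> W' \<and> W' \<subseteq> W \<inter> V \<and>
       b \<in> carrier (Sec X W') \<and> cm \<iota> W' b = Res C V W' a}"
    using r V(2) unfolding conormal_smult_def by simp
  then obtain N s N' b where N: "(N, s) \<in> l x" "opn N'" "x \<in> N'" "N' \<subseteq> N" "N' \<subseteq> V"
    "b \<in> carrier (Sec X N')" "cm \<iota> N' b = Res C V N' a"
    "(W, r) \<in> conormal_germ C X \<iota> x N' (b \<otimes>\<^bsub>Sec X N'\<^esub> Res X N N' s)" by auto
  have s: "opn N" "x \<in> N" "s \<in> K N" "germ X x U w \<ominus>\<^bsub>stalk X x\<^esub> germ X x N s \<in> P x 2"
    using N(1) conormal_germ_iff[OF U(1-3)] U(4) by auto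
  have rs: "Res X N N' s \<in> K N'" by (rule K_res[OF s(1) N(2,4) s(3)])
  have bs: "b \<otimes>\<^bsub>Sec X N'\<^esub> Res X N N' s \<in> K N'" by (rule K_mult[OF N(2) rs N(6)])
  let ?\<beta> = "germ X x N' b"
  have b: "?\<beta> \<in> carrier (stalk X x)" by (rule X.germ_closed[OF oX[OF N(2)] N(3,6)])
  have r: "opn W" "x \<in> W" "r \<in> K W"
    "germ X x N' (b \<otimes>\<^bsub>Sec X N'\<^esub> Res X N N' s) \<ominus>\<^bsub>stalk X x\<^esub> germ X x W r \<in> P x 2"
    using N(8) conormal_germ_iff[OF N(2,3) bs] by auto
  have g: "germ X x N' (b \<otimes>\<^bsub>Sec X N'\<^esub> Res X N N' s) = ?\<beta> \<otimes>\<^bsub>stalk X x\<^esub> germ X x N s"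
    using X.germ_mult[OF oX[OF N(2)] N(3,6) K_closed[OF rs]] X.germ_res[OF oX[OF s(1)] oX[OF N(2)] N(3,4) K_closed[OF s(3)]]
    by simp
  have c: "germ X x U w \<in> carrier (stalk X x)" "germ X x N s \<in> carrier (stalk X x)" "germ X x W r \<in> carrier (stalk X x)"
    using K_germ_closed U s r by auto
  have "(?\<beta> \<otimes>\<^bsub>stalk X x\<^esub> germ X x U w) \<ominus>\<^bsub>stalk X x\<^esub> germ X x W r =
      ?\<beta> \<otimes>\<^bsub>stalk X x\<^esub> (germ X x U w \<ominus>\<^bsub>stalk X x\<^esub> germ X x N s) \<oplus>\<^bsub>stalk X x\<^esub>
      ((?\<beta> \<otimes>\<^bsub>stalk X x\<^esub> germ X x N s) \<ominus>\<^bsub>stalk X x\<^esub> germ X x W r)"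
  proof -
    let ?bs = "?\<beta> \<otimes>\<^bsub>stalk X x\<^esub> germ X x N s"
    have "?\<beta> \<otimes>\<^bsub>stalk X x\<^esub> (germ X x U w \<ominus>\<^bsub>stalk X x\<^esub> germ X x N s) =
        ?\<beta> \<otimes>\<^bsub>stalk X x\<^esub> germ X x U w \<ominus>\<^bsub>stalk X x\<^esub> ?bs" using b c by algebra
    then show ?thesis
      using nt.i.R.diff_cancel(2)[of "?\<beta> \<otimes>\<^bsub>stalk X x\<^esub> germ X x U w" ?bs "germ X x W r"] b c
      by (simp add: nt.i.R.a_comm)
  qed
  then have m: "(?\<beta> \<otimes>\<^bsub>stalk X x\<^esub> germ X x U w) \<ominus>\<^bsub>stalk X x\<^esub> germ X x W r \<in> P x 2"
    using nt.pw_add[OF nt.pw_lmult[OF b s(4)] r(4)[unfolded g]] by simp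
  have "i x ?\<beta> = germ C x V a"
    using i_germ[OF N(2,3,6)] N(7) C.germ_res[OF V(1) N(2,3,5) V(3)] by simp
  then show ?thesis using that[OF b _ r(1-3) m] by simp
qed

text \<open>
  The hypothesis on the action on \<open>L\<close> is applied to the class of a section that represents \<open>gen x\<close>.  It
  gives \<open>phi_tau\<close>, as a lift of the constant \<open>lam\<close> to \<open>X\<close> differs from \<open>lam\<close> by an element of the ideal.
\<close>

lemma automorphism_eigen:
  assumes \<sigma>: "\<sigma> \<in> Aut_over C X \<iota>" and lam: "lam \<noteq> 0" "\<forall>k\<in>{1..n - 1}. lam ^ k \<noteq> 1"
    and scalar: "\<And>V l. opn V \<Longrightarrow> l \<in> conormal C X \<iota> V \<Longrightarrow>
      conormal_aut C X \<iota> \<sigma> V l = conormal_smult C X \<iota> V (Cst C V lam) l"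
    and x: "x \<in> topspace (tsp C)"
  shows "eigen_thickening (stalk X x) (stalk C x) (i x) (gen x) n (stalk_map X \<sigma> x)
      (\<lambda>c. germ X x (topspace (tsp C)) (Cst X (topspace (tsp C)) c)) lam"
    and "\<And>V s. opn V \<Longrightarrow> x \<in> V \<Longrightarrow> s \<in> carrier (Sec X V) \<Longrightarrow> stalk_map X \<sigma> x (germ X x V s) = germ X x V (cm \<sigma> V s)"
    and "\<And>V s. opn V \<Longrightarrow> s \<in> carrier (Sec X V) \<Longrightarrow> cm \<sigma> V s \<in> carrier (Sec X V)"
proof -
  have mor: "morphism X X \<sigma>" and over: "mor_eq C X (mor_comp X \<sigma> \<iota>) \<iota>"
    using \<sigma> unfolding Aut_over_def is_iso_def by auto
  interpret s: ringed_mor X X \<sigma> by (intro ringed_mor.intro ringed_mor_axioms.intro X.ringed_axioms mor)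
  have pts: "pt \<sigma> y = y" if "y \<in> topspace (tsp C)" for y
    using over that pt_io unfolding mor_eq_def by (simp add: mor_comp_def)
  have pre_s: "preim X (pt \<sigma>) V = V" if "opn V" for V
    by (rule preim_id) (use that pts in auto)
  have cms: "cm \<sigma> V s \<in> carrier (Sec X V)" if "opn V" "s \<in> carrier (Sec X V)" for V s
    using s.cm_closed[of V s] that pre_s by simp
  then show "\<And>V s. opn V \<Longrightarrow> s \<in> carrier (Sec X V) \<Longrightarrow> cm \<sigma> V s \<in> carrier (Sec X V)" .
  have io_s: "cm \<iota> V (cm \<sigma> V s) = cm \<iota> V s" if "opn V" "s \<in> carrier (Sec X V)" for V s
  proof -
    have "cm \<iota> (preim X (pt \<sigma>) V) (cm \<sigma> V s) = cm \<iota> V s"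
      using over that unfolding mor_eq_def by (simp add: mor_comp_def)
    then show ?thesis by (simp add: pre_s[OF that(1)])
  qed
  have sg: "stalk_map X \<sigma> x (germ X x V s) = germ X x V (cm \<sigma> V s)" if "opn V" "x \<in> V" "s \<in> carrier (Sec X V)" for V s
    using s.stalk_map_germ[of x V s] that x pts[OF x] pre_s[OF that(1)] by simp
  then show "\<And>V s. opn V \<Longrightarrow> x \<in> V \<Longrightarrow> s \<in> carrier (Sec X V) \<Longrightarrow> stalk_map X \<sigma> x (germ X x V s) = germ X x V (cm \<sigma> V s)" .
  have s_hom: "stalk_map X \<sigma> x \<in> ring_hom (stalk X x) (stalk X x)"
    using s.stalk_map_hom[of x] x pts[OF x] by simp
  let ?T = "topspace (tsp C)"
  let ?\<kappa> = "\<lambda>c. germ X x ?T (Cst X ?T c)"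
  have oT: "opn ?T" by simp
  have kap: "?\<kappa> \<in> ring_hom (class_ring UNIV) (stalk X x)"
    using ring_hom_trans[OF X.cst_hom[OF oX[OF oT]] X.germ_hom[OF oX[OF oT] x]] by (simp add: comp_def)
  have kapc: "?\<kappa> c \<in> carrier (stalk X x)" for c
    by (rule X.germ_closed[OF oX[OF oT] x X.cst_closed[OF oX[OF oT]]])
  interpret nt: nilpotent_thickening "stalk X x" "stalk C x" "i x" "gen x" n by (rule nilp_at[OF x])
  obtain U T where U: "opn U" "x \<in> U" "T \<in> K U" "gen x = germ X x U T" by (rule gen_rep[OF x])
  have Tc: "T \<in> carrier (Sec X U)" by (rule K_closed[OF U(3)])
  have sT: "cm \<sigma> U T \<in> K U" using K_iff[OF U(1)] U(3) cms[OF U(1) Tc] io_s[OF U(1) Tc] by simp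
  define l where "l = (\<lambda>y\<in>U. conormal_germ C X \<iota> y U T)"
  have lx: "l x = conormal_germ C X \<iota> x U T" using U(2) by (simp add: l_def)
  have "(U, cm \<sigma> U T) \<in> conormal_aut C X \<iota> \<sigma> U l x"
    unfolding conormal_aut_def using U(2) lx conormal_germ_self[OF U(1-3)] conormal_germ_self[OF U(1,2) sT] by auto
  then have "(U, cm \<sigma> U T) \<in> conormal_smult C X \<iota> U (Cst C U lam) l x"
    using scalar[OF U(1), of l] conormal_germ_section[OF U(1,3)] unfolding l_def by simp
  then obtain \<beta> where b: "\<beta> \<in> carrier (stalk X x)" "i x \<beta> = germ C x U (Cst C U lam)"
    "(\<beta> \<otimes>\<^bsub>stalk X x\<^esub> germ X x U T) \<ominus>\<^bsub>stalk X x\<^esub> germ X x U (cm \<sigma> U T) \<in> P x 2"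
    by (rule conormal_smult_mem[OF U(1,2) C.cst_closed[OF U(1)] U(1-3), of l, OF lx])
  define f where "f = germ X x U (cm \<sigma> U T)"
  have f: "f \<in> carrier (stalk X x)" "stalk_map X \<sigma> x (gen x) = f"
    unfolding f_def using K_germ_closed[OF U(1,2) sT] sg[OF U(1,2) Tc] U(4) by auto
  have b3: "(\<beta> \<otimes>\<^bsub>stalk X x\<^esub> gen x) \<ominus>\<^bsub>stalk X x\<^esub> f \<in> P x 2" using b(3) unfolding f_def U(4) .
  have cst: "germ C x U (Cst C U lam) = germ C x ?T (Cst C ?T lam)"
    using C.germ_res[OF oT U(1,2) openin_subset[OF U(1)] C.cst_closed[OF oT]] C.res_cst[OF oT U(1) openin_subset[OF U(1)]] by simp
  have ik: "i x (?\<kappa> lam) = i x \<beta>"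
    using i_germ[OF oT x X.cst_closed[OF oX[OF oT]]] io.cm_cst[of ?T lam] preim_iota[OF oT] b(2) cst by simp
  have bk: "\<beta> \<ominus>\<^bsub>stalk X x\<^esub> ?\<kappa> lam \<in> P x 1"
    using nt.pw_1_iff[of "\<beta> \<ominus>\<^bsub>stalk X x\<^esub> ?\<kappa> lam"] nt.i_minus[OF b(1) kapc] b(1) kapc ik by simp
  have bkt: "(\<beta> \<ominus>\<^bsub>stalk X x\<^esub> ?\<kappa> lam) \<otimes>\<^bsub>stalk X x\<^esub> gen x \<in> P x 2"
    using nt.pw_mult[OF bk nt.tau_pw] by (simp add: numeral_2_eq_2)
  have kl: "?\<kappa> lam \<in> carrier (stalk X x)" by (rule kapc)
  have "f \<ominus>\<^bsub>stalk X x\<^esub> ?\<kappa> lam \<otimes>\<^bsub>stalk X x\<^esub> gen x =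
      (\<beta> \<ominus>\<^bsub>stalk X x\<^esub> ?\<kappa> lam) \<otimes>\<^bsub>stalk X x\<^esub> gen x \<ominus>\<^bsub>stalk X x\<^esub> ((\<beta> \<otimes>\<^bsub>stalk X x\<^esub> gen x) \<ominus>\<^bsub>stalk X x\<^esub> f)"
  proof -
    have "(\<beta> \<ominus>\<^bsub>stalk X x\<^esub> ?\<kappa> lam) \<otimes>\<^bsub>stalk X x\<^esub> gen x =
        \<beta> \<otimes>\<^bsub>stalk X x\<^esub> gen x \<ominus>\<^bsub>stalk X x\<^esub> ?\<kappa> lam \<otimes>\<^bsub>stalk X x\<^esub> gen x"
      using kl b(1) nt.tau(1) by algebra
    then show ?thesis
      using nt.i.R.diff_cancel(1)[of "\<beta> \<otimes>\<^bsub>stalk X x\<^esub> gen x" f "?\<kappa> lam \<otimes>\<^bsub>stalk X x\<^esub> gen x"] f(1) kl b(1) nt.tau(1)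
      by simp
  qed
  then have "f \<ominus>\<^bsub>stalk X x\<^esub> ?\<kappa> lam \<otimes>\<^bsub>stalk X x\<^esub> gen x \<in> P x 2" using nt.pw_minus[OF bkt b3] by simp
  then obtain y where y: "y \<in> carrier (stalk X x)"
    "f \<ominus>\<^bsub>stalk X x\<^esub> ?\<kappa> lam \<otimes>\<^bsub>stalk X x\<^esub> gen x = gen x [^]\<^bsub>stalk X x\<^esub> (2::nat) \<otimes>\<^bsub>stalk X x\<^esub> y" by (rule nt.pwE)
  have g2: "gen x [^]\<^bsub>stalk X x\<^esub> (2::nat) = gen x \<otimes>\<^bsub>stalk X x\<^esub> gen x" using nt.tau(1) by (simp add: numeral_2_eq_2)
  have "f = ?\<kappa> lam \<otimes>\<^bsub>stalk X x\<^esub> gen x \<oplus>\<^bsub>stalk X x\<^esub> (f \<ominus>\<^bsub>stalk X x\<^esub> ?\<kappa> lam \<otimes>\<^bsub>stalk X x\<^esub> gen x)"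
    using f(1) kl nt.tau(1) by algebra
  then have fe: "f = ?\<kappa> lam \<otimes>\<^bsub>stalk X x\<^esub> gen x \<oplus>\<^bsub>stalk X x\<^esub> gen x \<otimes>\<^bsub>stalk X x\<^esub> gen x \<otimes>\<^bsub>stalk X x\<^esub> y"
    unfolding y(2) g2 .
  show "eigen_thickening (stalk X x) (stalk C x) (i x) (gen x) n (stalk_map X \<sigma> x) ?\<kappa> lam"
  proof (intro eigen_thickening.intro eigen_thickening_axioms.intro nt.nilpotent_thickening_axioms s_hom kap lam)
    fix r assume "r \<in> carrier (stalk X x)"
    then obtain V s where V: "X.opn V" "x \<in> V" "s \<in> carrier (Sec X V)" "r = germ X x V s" by (rule X.stalk_elem)
    then show "i x (stalk_map X \<sigma> x r) = i x r"
      using sg[of V s] i_germ[of V x s] i_germ[of V x "cm \<sigma> V s"] cms io_s by simp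
  next
    fix c show "stalk_map X \<sigma> x (?\<kappa> c) = ?\<kappa> c"
      using sg[OF oT x X.cst_closed[OF oX[OF oT]]] s.cm_cst[of ?T c] pre_s[OF oT] by simp
  next
    show "\<exists>y\<in>carrier (stalk X x). stalk_map X \<sigma> x (gen x) =
        ?\<kappa> lam \<otimes>\<^bsub>stalk X x\<^esub> gen x \<oplus>\<^bsub>stalk X x\<^esub> gen x \<otimes>\<^bsub>stalk X x\<^esub> gen x \<otimes>\<^bsub>stalk X x\<^esub> y"
      using f(2) fe y(1) by blast
  qed
qed

lemma conormal_rep:
  assumes "l \<in> conormal C X \<iota> U" "x \<in> U"
  obtains W w where "opn W" "x \<in> W" "W \<subseteq> U" "w \<in> K W" "\<forall>y\<in>W. l y = conormal_germ C X \<iota> y W w"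
  using assms unfolding conormal_def by auto

lemma basis_expand:
  assumes e: "conormal_basis C X \<iota> U e" and N: "opn N" "N \<subseteq> U" and l: "l \<in> conormal C X \<iota> N"
  obtains a where "a \<in> carrier (Sec C N)" "l = conormal_smult C X \<iota> N a (restrict e N)"
  using e N l unfolding conormal_basis_def bij_betw_def by blast

text \<open>
  The class of \<open>gen x\<close> is a multiple of the basis \<open>e\<close>.
\<close>

lemma basis_generates:
  assumes e: "conormal_basis C X \<iota> U e" and U: "opn U" and W: "opn W" "x \<in> W" "x \<in> U" "w \<in> K W"
    "e x = conormal_germ C X \<iota> x W w"
  obtains \<beta> where "\<beta> \<in> carrier (stalk X x)"
    "(\<beta> \<otimes>\<^bsub>stalk X x\<^esub> germ X x W w) \<ominus>\<^bsub>stalk X x\<^esub> gen x \<in> P x 2"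
proof -
  have xt: "x \<in> topspace (tsp C)" using W in_top by blast
  obtain V T where V: "opn V" "x \<in> V" "T \<in> K V" "gen x = germ X x V T" by (rule gen_rep[OF xt])
  define N where "N = U \<inter> V"
  have N: "opn N" "x \<in> N" "N \<subseteq> U" "N \<subseteq> V" unfolding N_def using U V W by auto
  have TN: "Res X V N T \<in> K N" by (rule K_res[OF V(1) N(1,4) V(3)])
  obtain a where a: "a \<in> carrier (Sec C N)"
    "(\<lambda>y\<in>N. conormal_germ C X \<iota> y N (Res X V N T)) = conormal_smult C X \<iota> N a (restrict e N)"
    by (rule basis_expand[OF e N(1,3) conormal_germ_section[OF N(1) TN]])
  have m: "(N, Res X V N T) \<in> conormal_smult C X \<iota> N a (restrict e N) x"
    unfolding a(2)[symmetric] using N(2) conormal_germ_self[OF N(1,2) TN] by simp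
  have lx: "restrict e N x = conormal_germ C X \<iota> x W w" using N(2) W(5) by simp
  obtain \<beta> where b: "\<beta> \<in> carrier (stalk X x)"
    "(\<beta> \<otimes>\<^bsub>stalk X x\<^esub> germ X x W w) \<ominus>\<^bsub>stalk X x\<^esub> germ X x N (Res X V N T) \<in> P x 2"
    by (rule conormal_smult_mem[OF N(1,2) a(1) W(1,2,4), of "restrict e N", OF lx m])
  have "germ X x N (Res X V N T) = gen x"
    unfolding V(4) by (rule X.germ_res[OF oX[OF V(1)] oX[OF N(1)] N(2,4) K_closed[OF V(3)]])
  then show ?thesis using that[OF b(1)] b(2) by simp
qed

lemma conormal_restrict:
  assumes "l \<in> conormal C X \<iota> U" "opn N" "N \<subseteq> U" shows "restrict l N \<in> conormal C X \<iota> N"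
proof -
  have "\<exists>W w. openin (tsp X) W \<and> x \<in> W \<and> W \<subseteq> N \<and> w \<in> K W \<and> (\<forall>y\<in>W. restrict l N y = conormal_germ C X \<iota> y W w)"
    if x: "x \<in> N" for x
  proof -
    have "x \<in> U" using x assms by blast
    then obtain W w where W: "opn W" "x \<in> W" "W \<subseteq> U" "w \<in> K W"
      "\<forall>y\<in>W. l y = conormal_germ C X \<iota> y W w"
      by (rule conormal_rep[OF assms(1)])
    have o: "opn (W \<inter> N)" using W assms by blast
    show ?thesis
      by (rule exI[of _ "W \<inter> N"], rule exI[of _ "Res X W (W \<inter> N) w"])
        (use W x o K_res[OF W(1) o _ W(4)] conormal_germ_res[OF W(1,4) o] in auto)
  qed
  then show ?thesis unfolding conormal_def by auto
qed

lemma basis_change: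
  assumes e: "conormal_basis C X \<iota> U e" and e': "conormal_basis C X \<iota> U' e'" and U: "opn U" "opn U'" "x \<in> U" "x \<in> U'"
    and W: "opn W" "x \<in> W" "w \<in> K W" "e x = conormal_germ C X \<iota> x W w"
    and W': "opn W'" "x \<in> W'" "w' \<in> K W'" "e' x = conormal_germ C X \<iota> x W' w'"
  obtains a \<beta> where "a \<in> carrier (Sec C (U \<inter> U'))"
    "restrict e' (U \<inter> U') = conormal_smult C X \<iota> (U \<inter> U') a (restrict e (U \<inter> U'))"
    "\<beta> \<in> carrier (stalk X x)" "i x \<beta> = germ C x (U \<inter> U') a"
    "(\<beta> \<otimes>\<^bsub>stalk X x\<^esub> germ X x W w) \<ominus>\<^bsub>stalk X x\<^esub> germ X x W' w' \<in> P x 2"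
proof -
  define N where "N = U \<inter> U'"
  have N: "opn N" "x \<in> N" "N \<subseteq> U" "N \<subseteq> U'" unfolding N_def using U by auto
  have "restrict e' N \<in> conormal C X \<iota> N"
    using conormal_restrict[OF _ N(1,4)] e' unfolding conormal_basis_def by blast
  then obtain a where a: "a \<in> carrier (Sec C N)" "restrict e' N = conormal_smult C X \<iota> N a (restrict e N)"
    by (rule basis_expand[OF e N(1,3)])
  have m: "(W', w') \<in> conormal_smult C X \<iota> N a (restrict e N) x"
    unfolding a(2)[symmetric] using N(2) conormal_germ_self[OF W'(1-3)] W'(4) by simp
  have lx: "restrict e N x = conormal_germ C X \<iota> x W w" using N(2) W(4) by simp
  obtain \<beta> where b: "\<beta> \<in> carrier (stalk X x)" "i x \<beta> = germ C x N a"
    "(\<beta> \<otimes>\<^bsub>stalk X x\<^esub> germ X x W w) \<ominus>\<^bsub>stalk X x\<^esub> germ X x W' w' \<in> P x 2"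
    by (rule conormal_smult_mem[OF N(1,2) a(1) W(1-3), of "restrict e N", OF lx m])
  show ?thesis using that[of a \<beta>] a b unfolding N_def by blast
qed

end

section \<open>The eigensections\<close>

locale scalar_automorphism = multiple_curve C X \<iota> n
  for C :: "('p, 'a) rspace" and X :: "('p, 'b) rspace" and \<iota> :: "('p, 'a, 'p, 'b) mor" and n :: nat +
  fixes \<sigma> :: "('p, 'b, 'p, 'b) mor" and lam :: complex
  assumes aut: "\<sigma> \<in> Aut_over C X \<iota>"
    and lam_nz: "lam \<noteq> 0"
    and roots: "\<forall>k\<in>{1..n - 1}. lam ^ k \<noteq> 1"
    and scalar: "openin (tsp C) V \<Longrightarrow> l \<in> conormal C X \<iota> V \<Longrightarrow>
      conormal_aut C X \<iota> \<sigma> V l = conormal_smult C X \<iota> V (Cst C V lam) l"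
begin

abbreviation \<phi> :: "'p \<Rightarrow> ('p set \<times> 'b) set \<Rightarrow> ('p set \<times> 'b) set" where "\<phi> \<equiv> stalk_map X \<sigma>"
abbreviation \<kappa> :: "'p \<Rightarrow> complex \<Rightarrow> ('p set \<times> 'b) set" where
  "\<kappa> x c \<equiv> germ X x (topspace (tsp C)) (Cst X (topspace (tsp C)) c)"
abbreviation Lin :: "'p \<Rightarrow> ('p set \<times> 'b) set set" where
  "Lin x \<equiv> eigen_thickening.lin (stalk X x) (stalk C x) (i x) (\<phi> x) (\<kappa> x) lam"
abbreviation Fixed :: "'p \<Rightarrow> ('p set \<times> 'b) set set" where
  "Fixed x \<equiv> eigen_thickening.fixed_ring (stalk X x) (\<phi> x)"

lemma eigen_at: "x \<in> topspace (tsp C) \<Longrightarrow>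
    eigen_thickening (stalk X x) (stalk C x) (i x) (gen x) n (\<phi> x) (\<kappa> x) lam"
  by (rule automorphism_eigen(1)[OF aut lam_nz roots scalar])

lemma phi_germ: "opn V \<Longrightarrow> x \<in> V \<Longrightarrow> s \<in> carrier (Sec X V) \<Longrightarrow> \<phi> x (germ X x V s) = germ X x V (cm \<sigma> V s)"
  by (rule automorphism_eigen(2)[OF aut lam_nz roots scalar in_top])

lemma cm_aut_closed: "opn V \<Longrightarrow> s \<in> carrier (Sec X V) \<Longrightarrow> cm \<sigma> V s \<in> carrier (Sec X V)"
proof (cases "topspace (tsp C) = {}")
  case True
  assume "opn V" "s \<in> carrier (Sec X V)"
  then show ?thesis using openin_subset[of "tsp C" V] True aut ringed_mor.cm_closed[of X X \<sigma> V s]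
    unfolding Aut_over_def is_iso_def
    by (auto simp: ringed_mor_def ringed_mor_axioms_def X.ringed_axioms preim_def)
next
  case False
  then show "opn V \<Longrightarrow> s \<in> carrier (Sec X V) \<Longrightarrow> cm \<sigma> V s \<in> carrier (Sec X V)"
    using automorphism_eigen(3)[OF aut lam_nz roots scalar] by blast
qed

text \<open>
  An eigenvector is described by equations between germs, so it is the germ of a section whose germs at
  nearby points are eigenvectors too.
\<close>

lemma Fixed_iff: assumes "x \<in> topspace (tsp C)"
  shows "b \<in> Fixed x \<longleftrightarrow> b \<in> carrier (stalk X x) \<and> \<phi> x b = b"
  using eigen_thickening.fixed_ring_def[OF eigen_at[OF assms]] by auto

lemma Lin_iff: assumes "x \<in> topspace (tsp C)"
  shows "e \<in> Lin x \<longleftrightarrow> e \<in> carrier (stalk X x) \<and> \<phi> x e = \<kappa> x lam \<otimes>\<^bsub>stalk X x\<^esub> e \<and> i x e = \<zero>\<^bsub>stalk C x\<^esub>"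
  using eigen_thickening.lin_def[OF eigen_at[OF assms]] by auto

lemma Fixed_open:
  assumes N: "opn N" "x \<in> N" "s \<in> carrier (Sec X N)" and e: "germ X x N s \<in> Fixed x"
  obtains W where "opn W" "x \<in> W" "W \<subseteq> N" "\<And>y. y \<in> W \<Longrightarrow> germ X y N s \<in> Fixed y"
proof -
  have xt: "x \<in> topspace (tsp C)" by (rule in_top[OF N(1,2)])
  have "germ X x N (cm \<sigma> N s) = germ X x N s" using e phi_germ[OF N] xt by (simp add: Fixed_iff)
  then obtain W where W: "X.opn W" "x \<in> W" "W \<subseteq> N" "\<And>y. y \<in> W \<Longrightarrow> germ X y N (cm \<sigma> N s) = germ X y N s"
    using X.germ_eq_nearby[OF _ oX[OF N(1)] oX[OF N(1)] N(2) cm_aut_closed[OF N(1,3)] N(3)] by metis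
  show ?thesis
  proof (rule that[OF _ W(2,3)])
    show "opn W" using W(1) by simp
    fix y assume y: "y \<in> W"
    then have yN: "y \<in> N" using W by blast
    have yt: "y \<in> topspace (tsp C)" by (rule in_top[OF N(1) yN])
    show "germ X y N s \<in> Fixed y"
      using phi_germ[OF N(1) yN N(3)] W(4)[OF y] X.germ_closed[OF oX[OF N(1)] yN N(3)] yt by (simp add: Fixed_iff)
  qed
qed

lemma Lin_open:
  assumes N: "opn N" "x \<in> N" "s \<in> carrier (Sec X N)" and e: "germ X x N s \<in> Lin x"
  obtains W where "opn W" "x \<in> W" "W \<subseteq> N" "\<And>y. y \<in> W \<Longrightarrow> germ X y N s \<in> Lin y"
proof -
  have kap: "\<kappa> y lam \<otimes>\<^bsub>stalk X y\<^esub> germ X y N s = germ X y N (Cst X N lam \<otimes>\<^bsub>Sec X N\<^esub> s)" if y: "y \<in> N" for y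
  proof -
    have "\<kappa> y lam = germ X y N (Cst X N lam)"
      using X.germ_res[of "topspace (tsp C)" N y "Cst X (topspace (tsp C)) lam"] N(1) y openin_subset[OF N(1)]
        X.cst_closed[of "topspace (tsp C)" lam] X.res_cst[of "topspace (tsp C)" N lam] by simp
    then show ?thesis using X.germ_mult[OF oX[OF N(1)] y X.cst_closed[OF oX[OF N(1)]] N(3)] by simp
  qed
  have cs: "Cst X N lam \<otimes>\<^bsub>Sec X N\<^esub> s \<in> carrier (Sec X N)"
    by (rule X.sec_closed(3)[OF oX[OF N(1)] X.cst_closed[OF oX[OF N(1)]] N(3)])
  have isc: "cm \<iota> N s \<in> carrier (Sec C N)" by (rule ring_hom_closed[OF io_hom[OF N(1)] N(3)])
  have xt: "x \<in> topspace (tsp C)" by (rule in_top[OF N(1,2)])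
  have "germ X x N (cm \<sigma> N s) = germ X x N (Cst X N lam \<otimes>\<^bsub>Sec X N\<^esub> s)"
    using e phi_germ[OF N] kap[OF N(2)] xt by (simp add: Lin_iff)
  then obtain W where W: "X.opn W" "x \<in> W" "W \<subseteq> N"
    "\<And>y. y \<in> W \<Longrightarrow> germ X y N (cm \<sigma> N s) = germ X y N (Cst X N lam \<otimes>\<^bsub>Sec X N\<^esub> s)"
    using X.germ_eq_nearby[OF _ oX[OF N(1)] oX[OF N(1)] N(2) cm_aut_closed[OF N(1,3)] cs] by metis
  have "germ C x N (cm \<iota> N s) = germ C x N \<zero>\<^bsub>Sec C N\<^esub>"
    using e i_germ[OF N] C.germ_zero[OF N(1,2)] xt by (simp add: Lin_iff)
  then obtain W' where W': "opn W'" "x \<in> W'" "W' \<subseteq> N"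
    "\<And>y. y \<in> W' \<Longrightarrow> germ C y N (cm \<iota> N s) = germ C y N \<zero>\<^bsub>Sec C N\<^esub>"
    using C.germ_eq_nearby[OF _ N(1) N(1) N(2) isc C.sec_closed(2)[OF N(1)]] by metis
  show ?thesis
  proof (rule that[of "W \<inter> W'"])
    show "opn (W \<inter> W')" "x \<in> W \<inter> W'" "W \<inter> W' \<subseteq> N" using W W' by auto
    fix y assume y: "y \<in> W \<inter> W'"
    then have yN: "y \<in> N" using W by blast
    have yt: "y \<in> topspace (tsp C)" by (rule in_top[OF N(1) yN])
    show "germ X y N s \<in> Lin y"
      using phi_germ[OF N(1) yN N(3)] W(4)[of y] X.germ_closed[OF oX[OF N(1)] yN N(3)] kap[OF yN]
        i_germ[OF N(1) yN N(3)] W'(4)[of y] C.germ_zero[OF N(1) yN] y yt by (simp add: Lin_iff)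
  qed
qed

text \<open>The eigenvector in the class \<open>l\<close> of a conormal germ.\<close>

definition eps :: "'p \<Rightarrow> ('p set \<times> 'b) set \<Rightarrow> ('p set \<times> 'b) set" where
  "eps x l = (SOME \<epsilon>. \<epsilon> \<in> Lin x \<and> (\<exists>W w. (W, w) \<in> l \<and> \<epsilon> \<ominus>\<^bsub>stalk X x\<^esub> germ X x W w \<in> P x 2))"

lemma eps_class:
  assumes W: "opn W" "x \<in> W" "w \<in> K W" "l = conormal_germ C X \<iota> x W w"
  shows "eps x l \<in> Lin x" "eps x l \<ominus>\<^bsub>stalk X x\<^esub> germ X x W w \<in> P x 2"
proof -
  interpret ev: eigen_thickening "stalk X x" "stalk C x" "i x" "gen x" n "\<phi> x" "\<kappa> x" lam
    by (rule eigen_at[OF in_top[OF W(1,2)]])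
  obtain e where "e \<in> Lin x" "e \<ominus>\<^bsub>stalk X x\<^esub> germ X x W w \<in> P x 2"
    by (rule ev.lin_lift[OF K_germ_closed[OF W(1-3)] K_germ[OF W(1-3)]])
  then have "\<exists>\<epsilon>. \<epsilon> \<in> Lin x \<and> (\<exists>W w. (W, w) \<in> l \<and> \<epsilon> \<ominus>\<^bsub>stalk X x\<^esub> germ X x W w \<in> P x 2)"
    using conormal_germ_self[OF W(1-3)] W(4) by blast
  from someI_ex[OF this] have s: "eps x l \<in> Lin x"
    "\<exists>W w. (W, w) \<in> l \<and> eps x l \<ominus>\<^bsub>stalk X x\<^esub> germ X x W w \<in> P x 2" unfolding eps_def by auto
  show "eps x l \<in> Lin x" by (rule s(1))
  obtain V v where v: "(V, v) \<in> l" "eps x l \<ominus>\<^bsub>stalk X x\<^esub> germ X x V v \<in> P x 2" using s(2) by blast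
  have V: "opn V" "x \<in> V" "v \<in> K V" "germ X x W w \<ominus>\<^bsub>stalk X x\<^esub> germ X x V v \<in> P x 2"
    using v(1) conormal_germ_iff[OF W(1-3)] W(4) by auto
  have c: "eps x l \<in> carrier (stalk X x)" "germ X x W w \<in> carrier (stalk X x)" "germ X x V v \<in> carrier (stalk X x)"
    using s(1) K_germ_closed W(1-3) V(1-3) by (auto simp: ev.lin_def)
  show "eps x l \<ominus>\<^bsub>stalk X x\<^esub> germ X x W w \<in> P x 2"
    using ev.pw_minus[OF v(2) V(4)] ev.i.R.diff_cancel_right[OF c] by simp
qed

lemma eps_eqI:
  assumes W: "opn W" "x \<in> W" "w \<in> K W" "l = conormal_germ C X \<iota> x W w"
    and e: "e \<in> Lin x" "e \<ominus>\<^bsub>stalk X x\<^esub> germ X x W w \<in> P x 2"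
  shows "eps x l = e"
proof -
  interpret ev: eigen_thickening "stalk X x" "stalk C x" "i x" "gen x" n "\<phi> x" "\<kappa> x" lam
    by (rule eigen_at[OF in_top[OF W(1,2)]])
  note s = eps_class[OF W]
  have c: "eps x l \<in> carrier (stalk X x)" "e \<in> carrier (stalk X x)" "germ X x W w \<in> carrier (stalk X x)"
    using s(1) e(1) K_germ_closed W(1-3) by (auto simp: ev.lin_def)
  show ?thesis
    by (rule ev.lin_inj[OF s(1) e(1)])
      (use ev.pw_minus[OF s(2) e(2)] ev.i.R.diff_cancel_right[OF c] in simp)
qed

text \<open>
  The eigenvectors in the classes \<open>l y\<close> are the germs of one section: a section representing the eigenvector
  at \<open>x\<close> is an eigenvector nearby and stays in the given classes, so uniqueness applies.
\<close>

lemma eps_open: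
  assumes W: "opn W" "x \<in> W" "w \<in> K W" and l: "\<forall>y\<in>W. l y = conormal_germ C X \<iota> y W w"
  obtains N s where "opn N" "x \<in> N" "N \<subseteq> W" "s \<in> carrier (Sec X N)" "\<forall>y\<in>N. germ X y N s = eps y (l y)"
proof -
  have e: "eps x (l x) \<in> Lin x" "eps x (l x) \<ominus>\<^bsub>stalk X x\<^esub> germ X x W w \<in> P x 2"
    using eps_class[OF W l[rule_format, OF W(2)]] by auto
  interpret ev: eigen_thickening "stalk X x" "stalk C x" "i x" "gen x" n "\<phi> x" "\<kappa> x" lam
    by (rule eigen_at[OF in_top[OF W(1,2)]])
  have "eps x (l x) \<in> carrier (stalk X x)" using e(1) by (simp add: ev.lin_def)
  then obtain V r where V: "X.opn V" "x \<in> V" "V \<subseteq> W" "r \<in> carrier (Sec X V)" "eps x (l x) = germ X x V r"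
    by (rule X.stalk_elem_inside[OF _ oX[OF W(1)] W(2)])
  have V': "opn V" using V(1) by simp
  obtain N where N: "opn N" "x \<in> N" "N \<subseteq> V" "\<And>y. y \<in> N \<Longrightarrow> germ X y V r \<in> Lin y"
    using Lin_open[OF V' V(2,4)] e(1) unfolding V(5) by blast
  define s where "s = Res X V N r"
  have s: "s \<in> carrier (Sec X N)" unfolding s_def by (rule X.res_closed[OF V(1) oX[OF N(1)] N(3) V(4)])
  have sg: "germ X y N s = germ X y V r" if "y \<in> N" for y
    unfolding s_def by (rule X.germ_res[OF V(1) oX[OF N(1)] that N(3) V(4)])
  have "cm \<iota> N s = \<zero>\<^bsub>Sec C N\<^esub>"
  proof (rule C.germs_determine[OF N(1)])
    show "cm \<iota> N s \<in> carrier (Sec C N)" by (rule ring_hom_closed[OF io_hom[OF N(1)] s])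
    show "\<zero>\<^bsub>Sec C N\<^esub> \<in> carrier (Sec C N)" by (rule C.sec_closed(2)[OF N(1)])
    fix y assume y: "y \<in> N"
    have yt: "y \<in> topspace (tsp C)" by (rule in_top[OF N(1) y])
    show "germ C y N (cm \<iota> N s) = germ C y N \<zero>\<^bsub>Sec C N\<^esub>"
      using N(4)[OF y] i_germ[OF N(1) y s] sg[OF y] C.germ_zero[OF N(1) y] yt by (simp add: Lin_iff)
  qed
  then have sK: "s \<in> K N" using s K_iff[OF N(1)] by simp
  have "(W, w) \<in> conormal_germ C X \<iota> x N s"
    using conormal_germ_iff[OF N(1,2) sK] W e(2) V(5) sg[OF N(2)] by simp
  then obtain M where M: "X.opn M" "x \<in> M" "M \<subseteq> N \<inter> W"
      "Res X N M s \<ominus>\<^bsub>Sec X M\<^esub> Res X W M w \<in> ideal_sheaf_pow X K 2 M"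
    unfolding conormal_germ_def by blast
  have M': "opn M" "M \<subseteq> N" using M by auto
  show ?thesis
  proof (rule that[OF M'(1) M(2)])
    show "M \<subseteq> W" using M by blast
    show "Res X N M s \<in> carrier (Sec X M)" by (rule X.res_closed[OF oX[OF N(1)] M(1) M'(2) s])
    show "\<forall>y\<in>M. germ X y M (Res X N M s) = eps y (l y)"
    proof
    fix y assume y: "y \<in> M"
    have yN: "y \<in> N" and yW: "y \<in> W" using y M by auto
    have "(W, w) \<in> conormal_germ C X \<iota> y N s"
      unfolding conormal_germ_def using W(1,3) yW y M by auto
    then have d: "germ X y N s \<ominus>\<^bsub>stalk X y\<^esub> germ X y W w \<in> P y 2" using conormal_germ_iff[OF N(1) yN sK] by simp
    have "eps y (l y) = germ X y N s"
      by (rule eps_eqI[OF W(1) yW W(3) l[rule_format, OF yW] _ d]) (use N(4)[OF yN] sg[OF yN] in simp)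
    then show "germ X y M (Res X N M s) = eps y (l y)"
      using X.germ_res[OF oX[OF N(1)] M(1) y M'(2) s] by simp
    qed
  qed
qed

lemma eps_generates:
  assumes e: "conormal_basis C X \<iota> U e" and U: "opn U" "x \<in> U"
  shows "eps x (e x) \<in> Lin x" and "\<exists>b\<in>carrier (stalk X x). gen x = b \<otimes>\<^bsub>stalk X x\<^esub> eps x (e x)"
proof -
  obtain W w where W: "opn W" "x \<in> W" "W \<subseteq> U" "w \<in> K W" "\<forall>y\<in>W. e y = conormal_germ C X \<iota> y W w"
    using conormal_rep[of e U x] e U(2) unfolding conormal_basis_def by blast
  have ex: "e x = conormal_germ C X \<iota> x W w" using W by blast
  interpret ev: eigen_thickening "stalk X x" "stalk C x" "i x" "gen x" n "\<phi> x" "\<kappa> x" lam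
    by (rule eigen_at[OF in_top[OF U]])
  note s = eps_class[OF W(1,2,4) ex]
  show "eps x (e x) \<in> Lin x" by (rule s(1))
  obtain \<beta> where b: "\<beta> \<in> carrier (stalk X x)"
    "(\<beta> \<otimes>\<^bsub>stalk X x\<^esub> germ X x W w) \<ominus>\<^bsub>stalk X x\<^esub> gen x \<in> P x 2"
    by (rule basis_generates[OF e U(1) W(1,2) U(2) W(4) ex])
  have c: "eps x (e x) \<in> carrier (stalk X x)" "germ X x W w \<in> carrier (stalk X x)" "gen x \<in> carrier (stalk X x)"
    using s(1) K_germ_closed W ev.tau(1) by (auto simp: ev.lin_def)
  let ?be = "\<beta> \<otimes>\<^bsub>stalk X x\<^esub> eps x (e x)" and ?bw = "\<beta> \<otimes>\<^bsub>stalk X x\<^esub> germ X x W w"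
  have bc: "?be \<in> carrier (stalk X x)" "?bw \<in> carrier (stalk X x)" using b c by auto
  have "\<beta> \<otimes>\<^bsub>stalk X x\<^esub> (eps x (e x) \<ominus>\<^bsub>stalk X x\<^esub> germ X x W w) = ?be \<ominus>\<^bsub>stalk X x\<^esub> ?bw"
    using b(1) c by algebra
  then have "?be \<ominus>\<^bsub>stalk X x\<^esub> ?bw \<in> P x 2" using ev.pw_lmult[OF b(1) s(2)] by simp
  then have "?be \<ominus>\<^bsub>stalk X x\<^esub> gen x \<in> P x 2"
    using ev.pw_add[OF b(2), of "?be \<ominus>\<^bsub>stalk X x\<^esub> ?bw"] ev.i.R.diff_cancel(2)[OF bc c(3)] by simp
  then have "gen x \<ominus>\<^bsub>stalk X x\<^esub> ?be \<in> P x 2" by (rule ev.pw_sym[OF bc(1) c(3)])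
  then show "\<exists>b\<in>carrier (stalk X x). gen x = b \<otimes>\<^bsub>stalk X x\<^esub> eps x (e x)"
    using ev.lin_generates[OF c(1) b(1)] by metis
qed

text \<open>
  The eigenvectors are related by the same function \<open>a\<close> as the two bases of \<open>L\<close>, lifted to a fixed
  element.
\<close>

lemma eps_change:
  assumes e: "conormal_basis C X \<iota> U e" and e': "conormal_basis C X \<iota> U' e'" and U: "opn U" "opn U'" "x \<in> U" "x \<in> U'"
  obtains a u where "a \<in> carrier (Sec C (U \<inter> U'))"
    "restrict e' (U \<inter> U') = conormal_smult C X \<iota> (U \<inter> U') a (restrict e (U \<inter> U'))"
    "u \<in> Fixed x" "i x u = germ C x (U \<inter> U') a" "eps x (e' x) = u \<otimes>\<^bsub>stalk X x\<^esub> eps x (e x)"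
proof -
  obtain W w where W: "opn W" "x \<in> W" "W \<subseteq> U" "w \<in> K W" "\<forall>y\<in>W. e y = conormal_germ C X \<iota> y W w"
    using conormal_rep[of e U x] e U unfolding conormal_basis_def by blast
  have ex: "e x = conormal_germ C X \<iota> x W w" using W by blast
  obtain W' w' where W': "opn W'" "x \<in> W'" "W' \<subseteq> U'" "w' \<in> K W'" "\<forall>y\<in>W'. e' y = conormal_germ C X \<iota> y W' w'"
    using conormal_rep[of e' U' x] e' U unfolding conormal_basis_def by blast
  have ex': "e' x = conormal_germ C X \<iota> x W' w'" using W' by blast
  obtain a \<beta> where a: "a \<in> carrier (Sec C (U \<inter> U'))"
    "restrict e' (U \<inter> U') = conormal_smult C X \<iota> (U \<inter> U') a (restrict e (U \<inter> U'))"
    and b: "\<beta> \<in> carrier (stalk X x)" "i x \<beta> = germ C x (U \<inter> U') a"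
    "(\<beta> \<otimes>\<^bsub>stalk X x\<^esub> germ X x W w) \<ominus>\<^bsub>stalk X x\<^esub> germ X x W' w' \<in> P x 2"
    by (rule basis_change[OF e e' U W(1,2,4) ex W'(1,2,4) ex'])
  interpret ev: eigen_thickening "stalk X x" "stalk C x" "i x" "gen x" n "\<phi> x" "\<kappa> x" lam
    by (rule eigen_at[OF in_top[OF U(1,3)]])
  note s = eps_class[OF W(1,2,4) ex] and s' = eps_class[OF W'(1,2,4) ex']
  have ia: "i x \<beta> \<in> carrier (stalk C x)" using b(1) by simp
  obtain u where u: "u \<in> Fixed x" "i x u = i x \<beta>" by (rule ev.fixed_lift[OF ia])
  have c: "germ X x W w \<in> carrier (stalk X x)" "germ X x W' w' \<in> carrier (stalk X x)" using K_germ_closed W W' by auto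
  have bw: "germ X x W' w' \<ominus>\<^bsub>stalk X x\<^esub> \<beta> \<otimes>\<^bsub>stalk X x\<^esub> germ X x W w \<in> P x 2"
    by (rule ev.pw_sym[OF _ c(2) b(3)]) (use b(1) c in simp)
  have "eps x (e' x) = u \<otimes>\<^bsub>stalk X x\<^esub> eps x (e x)"
    by (rule ev.fixed_times_lin_unique[OF s(1) s'(1) c K_germ[OF W(1,2,4)] s(2) s'(2) b(1) bw u])
  then show ?thesis using that[OF a u(1)] u(2) b(2) by simp
qed

end

section \<open>Functions on a spectrum\<close>

context primeideal
begin

lemma compl_closed: "f \<in> carrier R - I \<Longrightarrow> g \<in> carrier R - I \<Longrightarrow> f \<otimes> g \<in> carrier R - I"
  using I_prime by blast

lemma one_compl: "\<one> \<in> carrier R - I"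
  using I_notcarr one_imp_carrier by blast

lemma loc_frac_self: "a \<in> carrier R \<Longrightarrow> f \<in> carrier R - I \<Longrightarrow> (a, f) \<in> loc_frac R I a f"
  unfolding loc_frac_def using one_compl by auto

lemma loc_frac_eqI:
  assumes a: "a \<in> carrier R" "f \<in> carrier R - I" "b \<in> carrier R" "g \<in> carrier R - I"
    and u: "u \<in> carrier R - I" "u \<otimes> (a \<otimes> g) = u \<otimes> (b \<otimes> f)"
  shows "loc_frac R I a f = loc_frac R I b g"
proof -
  have sub: "loc_frac R I a f \<subseteq> loc_frac R I b g"
    if a: "a \<in> carrier R" "f \<in> carrier R - I" "b \<in> carrier R" "g \<in> carrier R - I"
      and u: "u \<in> carrier R - I" "u \<otimes> (a \<otimes> g) = u \<otimes> (b \<otimes> f)" for a f b g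
  proof
    fix p assume "p \<in> loc_frac R I a f"
    then obtain c h v where p: "p = (c, h)" "c \<in> carrier R" "h \<in> carrier R - I" "v \<in> carrier R - I"
      "v \<otimes> (a \<otimes> h) = v \<otimes> (c \<otimes> f)" unfolding loc_frac_def by blast
    have uvf: "u \<otimes> v \<otimes> f \<in> carrier R - I" using compl_closed u(1) p(4) a(2) by blast
    have "u \<otimes> v \<otimes> f \<otimes> (b \<otimes> h) = v \<otimes> h \<otimes> (u \<otimes> (b \<otimes> f))"
      using a u(1) p(2-4) by (auto simp: m_ac)
    also have "\<dots> = u \<otimes> g \<otimes> (v \<otimes> (a \<otimes> h))"
      unfolding u(2)[symmetric] using a u(1) p(2-4) by (auto simp: m_ac)
    also have "\<dots> = u \<otimes> v \<otimes> f \<otimes> (c \<otimes> g)"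
      unfolding p(5) using a u(1) p(2-4) by (auto simp: m_ac)
    finally show "p \<in> loc_frac R I b g" unfolding loc_frac_def p(1) using p(2,3) uvf by blast
  qed
  show ?thesis using sub[OF a u] sub[OF a(3,4,1,2) u(1) u(2)[symmetric]] by blast
qed

lemma loc_frac_eqD:
  assumes "loc_frac R I a f = loc_frac R I b g" "b \<in> carrier R" "g \<in> carrier R - I"
  obtains u where "u \<in> carrier R - I" "u \<otimes> (a \<otimes> g) = u \<otimes> (b \<otimes> f)"
proof -
  have "(b, g) \<in> loc_frac R I a f" using loc_frac_self[OF assms(2,3)] assms(1) by simp
  then obtain u where "u \<in> carrier R - I" "u \<otimes> (a \<otimes> g) = u \<otimes> (b \<otimes> f)" unfolding loc_frac_def by auto
  then show ?thesis by (rule that)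
qed

lemma loc_frac_memD:
  assumes "(b, g) \<in> loc_frac R I a f"
  obtains u where "b \<in> carrier R" "g \<in> carrier R - I" "u \<in> carrier R - I" "u \<otimes> (a \<otimes> g) = u \<otimes> (b \<otimes> f)"
  using assms unfolding loc_frac_def by blast

lemma loc_frac_mult:
  assumes a: "a \<in> carrier R" "f \<in> carrier R - I" and b: "b \<in> carrier R" "g \<in> carrier R - I"
  shows "loc_frac_mult R I (loc_frac R I a f) (loc_frac R I b g) = loc_frac R I (a \<otimes> b) (f \<otimes> g)"
  unfolding loc_frac_mult_def
proof (rule UN_pairs_const[OF loc_frac_self[OF a] loc_frac_self[OF b]])
  fix a' f' b' g' assume "(a', f') \<in> loc_frac R I a f" "(b', g') \<in> loc_frac R I b g"
  then obtain u v where u: "a' \<in> carrier R" "f' \<in> carrier R - I" "u \<in> carrier R - I" "u \<otimes> (a \<otimes> f') = u \<otimes> (a' \<otimes> f)"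
    and v: "b' \<in> carrier R" "g' \<in> carrier R - I" "v \<in> carrier R - I" "v \<otimes> (b \<otimes> g') = v \<otimes> (b' \<otimes> g)"
    by (meson loc_frac_memD)
  have c: "f \<in> carrier R" "g \<in> carrier R" "f' \<in> carrier R" "g' \<in> carrier R" "u \<in> carrier R" "v \<in> carrier R"
    using a b u v by auto
  show "loc_frac R I (a' \<otimes> b') (f' \<otimes> g') = loc_frac R I (a \<otimes> b) (f \<otimes> g)"
  proof (rule loc_frac_eqI[where u = "u \<otimes> v"])
    have "u \<otimes> v \<otimes> (a' \<otimes> b' \<otimes> (f \<otimes> g)) = (u \<otimes> (a' \<otimes> f)) \<otimes> (v \<otimes> (b' \<otimes> g))"
      using a(1) b(1) u(1) v(1) c by algebra
    also have "\<dots> = u \<otimes> v \<otimes> (a \<otimes> b \<otimes> (f' \<otimes> g'))"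
      unfolding u(4)[symmetric] v(4)[symmetric] using a(1) b(1) u(1) v(1) c by algebra
    finally show "u \<otimes> v \<otimes> (a' \<otimes> b' \<otimes> (f \<otimes> g)) = u \<otimes> v \<otimes> (a \<otimes> b \<otimes> (f' \<otimes> g'))" .
  qed (use a b u v compl_closed in auto)
qed

lemma loc_frac_add:
  assumes a: "a \<in> carrier R" "f \<in> carrier R - I" and b: "b \<in> carrier R" "g \<in> carrier R - I"
  shows "loc_frac_add R I (loc_frac R I a f) (loc_frac R I b g) = loc_frac R I (a \<otimes> g \<oplus> b \<otimes> f) (f \<otimes> g)"
  unfolding loc_frac_add_def
proof (rule UN_pairs_const[OF loc_frac_self[OF a] loc_frac_self[OF b]])
  fix a' f' b' g' assume "(a', f') \<in> loc_frac R I a f" "(b', g') \<in> loc_frac R I b g"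
  then obtain u v where u: "a' \<in> carrier R" "f' \<in> carrier R - I" "u \<in> carrier R - I" "u \<otimes> (a \<otimes> f') = u \<otimes> (a' \<otimes> f)"
    and v: "b' \<in> carrier R" "g' \<in> carrier R - I" "v \<in> carrier R - I" "v \<otimes> (b \<otimes> g') = v \<otimes> (b' \<otimes> g)"
    by (meson loc_frac_memD)
  have c: "f \<in> carrier R" "g \<in> carrier R" "f' \<in> carrier R" "g' \<in> carrier R" "u \<in> carrier R" "v \<in> carrier R"
    using a b u v by auto
  show "loc_frac R I (a' \<otimes> g' \<oplus> b' \<otimes> f') (f' \<otimes> g') = loc_frac R I (a \<otimes> g \<oplus> b \<otimes> f) (f \<otimes> g)"
  proof (rule loc_frac_eqI[where u = "u \<otimes> v"])
    have "u \<otimes> v \<otimes> ((a' \<otimes> g' \<oplus> b' \<otimes> f') \<otimes> (f \<otimes> g)) =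
        (u \<otimes> (a' \<otimes> f)) \<otimes> (v \<otimes> g \<otimes> g') \<oplus> (v \<otimes> (b' \<otimes> g)) \<otimes> (u \<otimes> f \<otimes> f')"
      using a(1) b(1) u(1) v(1) c by algebra
    also have "\<dots> = u \<otimes> v \<otimes> ((a \<otimes> g \<oplus> b \<otimes> f) \<otimes> (f' \<otimes> g'))"
      unfolding u(4)[symmetric] v(4)[symmetric] using a(1) b(1) u(1) v(1) c by algebra
    finally show "u \<otimes> v \<otimes> ((a' \<otimes> g' \<oplus> b' \<otimes> f') \<otimes> (f \<otimes> g)) =
      u \<otimes> v \<otimes> ((a \<otimes> g \<oplus> b \<otimes> f) \<otimes> (f' \<otimes> g'))" .
  qed (use a b u v compl_closed in auto)
qed

end

context cring
begin

lemma Spec_topspace: "topspace (tsp (Spec R \<kappa>)) = prime_spectrum R"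
proof -
  have "topspace (tsp (Spec R \<kappa>)) = (\<Union>f\<in>carrier R. {P \<in> prime_spectrum R. f \<notin> P})"
    by (simp add: Spec_def frac_space_def topology_generated_by_topspace)
  also have "\<dots> = prime_spectrum R"
    using primeideal.one_compl by (fastforce simp: prime_spectrum_def)
  finally show ?thesis .
qed

lemma Spec_basic_open: "f \<in> carrier R \<Longrightarrow> openin (tsp (Spec R \<kappa>)) {P \<in> prime_spectrum R. f \<notin> P}"
  by (auto simp: Spec_def frac_space_def intro!: topology_generated_by_Basis)

lemma Spec_top_open: "openin (tsp (Spec R \<kappa>)) (prime_spectrum R)"
  using openin_topspace[of "tsp (Spec R \<kappa>)"] by (simp add: Spec_topspace)

lemma Spec_open_sub: "openin (tsp (Spec R \<kappa>)) W \<Longrightarrow> W \<subseteq> prime_spectrum R"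
  using openin_subset[of "tsp (Spec R \<kappa>)" W] by (simp add: Spec_topspace)

lemma Spec_res: "Res (Spec R \<kappa>) V W s = restrict s W"
  by (simp add: Spec_def frac_space_def)

lemma Spec_mult: "s \<otimes>\<^bsub>Sec (Spec R \<kappa>) W\<^esub> r = (\<lambda>P\<in>W. loc_frac_mult R P (s P) (r P))"
  by (simp add: Spec_def frac_space_def)

lemma Spec_add: "s \<oplus>\<^bsub>Sec (Spec R \<kappa>) W\<^esub> r = (\<lambda>P\<in>W. loc_frac_add R P (s P) (r P))"
  by (simp add: Spec_def frac_space_def)

lemma Spec_one: "\<one>\<^bsub>Sec (Spec R \<kappa>) W\<^esub> = (\<lambda>P\<in>W. loc_frac R P \<one> \<one>)"
  by (simp add: Spec_def frac_space_def)

lemma Spec_zero: "\<zero>\<^bsub>Sec (Spec R \<kappa>) W\<^esub> = (\<lambda>P\<in>W. loc_frac R P \<zero> \<one>)"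
  by (simp add: Spec_def frac_space_def)

lemma Spec_sectionI:
  assumes "openin (tsp (Spec R \<kappa>)) W" "a \<in> carrier R" "f \<in> carrier R" "\<And>P. P \<in> W \<Longrightarrow> f \<notin> P"
  shows "(\<lambda>P\<in>W. loc_frac R P a f) \<in> carrier (Sec (Spec R \<kappa>) W)"
proof -
  have "\<exists>V b g. openin (tsp (Spec R \<kappa>)) V \<and> P \<in> V \<and> V \<subseteq> W \<and> b \<in> carrier R \<and> g \<in> carrier R \<and>
      (\<forall>Q\<in>V. g \<notin> Q \<and> (\<lambda>P\<in>W. loc_frac R P a f) Q = loc_frac R Q b g)" if "P \<in> W" for P
    by (rule exI[of _ W], rule exI[of _ a], rule exI[of _ f]) (use assms that in auto)
  then show ?thesis by (auto simp: Spec_def frac_space_def)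
qed

lemma Spec_sectionE:
  assumes "s \<in> carrier (Sec (Spec R \<kappa>) V)" "P \<in> V"
  obtains W a f where "openin (tsp (Spec R \<kappa>)) W" "P \<in> W" "W \<subseteq> V" "a \<in> carrier R" "f \<in> carrier R"
    "\<forall>Q\<in>W. f \<notin> Q \<and> s Q = loc_frac R Q a f"
  using assms unfolding Spec_def frac_space_def by auto

lemma primeD: "P \<in> prime_spectrum R \<Longrightarrow> primeideal P R"
  by (simp add: prime_spectrum_def)

lemma Spec_global_hom: "Spec_global R \<in> ring_hom R (Sec (Spec R \<kappa>) (prime_spectrum R))"
proof (rule ring_hom_memI)
  fix a assume "a \<in> carrier R"
  then show "Spec_global R a \<in> carrier (Sec (Spec R \<kappa>) (prime_spectrum R))"
    unfolding Spec_global_def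
    by (rule Spec_sectionI[OF Spec_top_open]) (use primeideal.one_compl primeD in auto)
next
  fix a b assume ab: "a \<in> carrier R" "b \<in> carrier R"
  show "Spec_global R (a \<otimes> b) = Spec_global R a \<otimes>\<^bsub>Sec (Spec R \<kappa>) (prime_spectrum R)\<^esub> Spec_global R b"
    unfolding Spec_mult Spec_global_def
    by (rule restrict_ext) (use ab primeideal.loc_frac_mult[OF primeD] primeideal.one_compl[OF primeD] in simp)
  show "Spec_global R (a \<oplus> b) = Spec_global R a \<oplus>\<^bsub>Sec (Spec R \<kappa>) (prime_spectrum R)\<^esub> Spec_global R b"
    unfolding Spec_add Spec_global_def
    by (rule restrict_ext) (use ab primeideal.loc_frac_add[OF primeD] primeideal.one_compl[OF primeD] in simp)
next
  show "Spec_global R \<one> = \<one>\<^bsub>Sec (Spec R \<kappa>) (prime_spectrum R)\<^esub>"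
    unfolding Spec_one Spec_global_def ..
qed

text \<open>
  The defining property of the sections over a spectrum, with the denominator multiplied out.
\<close>

lemma Spec_fraction:
  assumes V: "openin (tsp (Spec R \<kappa>)) V" "P \<in> V" and s: "s \<in> carrier (Sec (Spec R \<kappa>) V)"
  obtains W a f where "openin (tsp (Spec R \<kappa>)) W" "P \<in> W" "W \<subseteq> V" "a \<in> carrier R" "f \<in> carrier R"
    "\<forall>Q\<in>W. f \<notin> Q"
    "Res (Spec R \<kappa>) V W s \<otimes>\<^bsub>Sec (Spec R \<kappa>) W\<^esub> Res (Spec R \<kappa>) (prime_spectrum R) W (Spec_global R f) =
     Res (Spec R \<kappa>) (prime_spectrum R) W (Spec_global R a)"
proof -
  obtain W a f where W: "openin (tsp (Spec R \<kappa>)) W" "P \<in> W" "W \<subseteq> V" "a \<in> carrier R" "f \<in> carrier R"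
    "\<forall>Q\<in>W. f \<notin> Q \<and> s Q = loc_frac R Q a f" by (rule Spec_sectionE[OF s V(2)])
  have "loc_frac_mult R Q (s Q) (loc_frac R Q f \<one>) = loc_frac R Q a \<one>" if Q: "Q \<in> W" for Q
  proof -
    have pr: "primeideal Q R" using Spec_open_sub[OF W(1)] Q primeD by blast
    have f: "f \<in> carrier R - Q" using W Q by blast
    note one = primeideal.one_compl[OF pr]
    have "loc_frac_mult R Q (loc_frac R Q a f) (loc_frac R Q f \<one>) = loc_frac R Q (a \<otimes> f) (f \<otimes> \<one>)"
      by (rule primeideal.loc_frac_mult[OF pr W(4) f W(5) one])
    also have "\<dots> = loc_frac R Q a \<one>"
      by (rule primeideal.loc_frac_eqI[OF pr, where u = \<one>]) (use W f one in auto)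
    finally show ?thesis using W Q by simp
  qed
  moreover have "W \<subseteq> prime_spectrum R" by (rule Spec_open_sub[OF W(1)])
  ultimately have "Res (Spec R \<kappa>) V W s \<otimes>\<^bsub>Sec (Spec R \<kappa>) W\<^esub> Res (Spec R \<kappa>) (prime_spectrum R) W (Spec_global R f) =
     Res (Spec R \<kappa>) (prime_spectrum R) W (Spec_global R a)"
    unfolding Spec_mult Spec_res Spec_global_def by (intro ext) (auto simp: restrict_def)
  then show ?thesis using that[OF W(1-5)] W(6) by blast
qed

lemma Spec_global_unit:
  assumes W: "openin (tsp (Spec R \<kappa>)) W" and f: "f \<in> carrier R" "\<forall>Q\<in>W. f \<notin> Q"
  obtains r where "r \<in> carrier (Sec (Spec R \<kappa>) W)"
    "r \<otimes>\<^bsub>Sec (Spec R \<kappa>) W\<^esub> Res (Spec R \<kappa>) (prime_spectrum R) W (Spec_global R f) = \<one>\<^bsub>Sec (Spec R \<kappa>) W\<^esub>"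
proof -
  define r where "r = (\<lambda>P\<in>W. loc_frac R P \<one> f)"
  have "r \<in> carrier (Sec (Spec R \<kappa>) W)" unfolding r_def by (rule Spec_sectionI[OF W]) (use f in auto)
  moreover have "loc_frac_mult R Q (loc_frac R Q \<one> f) (loc_frac R Q f \<one>) = loc_frac R Q \<one> \<one>" if Q: "Q \<in> W" for Q
  proof -
    have pr: "primeideal Q R" using Spec_open_sub[OF W] Q primeD by blast
    have f: "f \<in> carrier R - Q" using f Q by blast
    note one = primeideal.one_compl[OF pr]
    have "loc_frac_mult R Q (loc_frac R Q \<one> f) (loc_frac R Q f \<one>) = loc_frac R Q (\<one> \<otimes> f) (f \<otimes> \<one>)"
      by (rule primeideal.loc_frac_mult[OF pr _ f _ one]) (use f in auto)
    also have "\<dots> = loc_frac R Q \<one> \<one>"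
      by (rule primeideal.loc_frac_eqI[OF pr, where u = \<one>]) (use f one in auto)
    finally show ?thesis .
  qed
  then have "r \<otimes>\<^bsub>Sec (Spec R \<kappa>) W\<^esub> Res (Spec R \<kappa>) (prime_spectrum R) W (Spec_global R f) = \<one>\<^bsub>Sec (Spec R \<kappa>) W\<^esub>"
    unfolding Spec_mult Spec_res Spec_global_def Spec_one r_def using Spec_open_sub[OF W]
    by (intro ext) (auto simp: restrict_def)
  ultimately show ?thesis by (rule that)
qed

lemma Spec_global_zero:
  assumes W: "openin (tsp (Spec R \<kappa>)) W" "P \<in> W" and a: "a \<in> carrier R"
    and z: "Res (Spec R \<kappa>) (prime_spectrum R) W (Spec_global R a) = \<zero>\<^bsub>Sec (Spec R \<kappa>) W\<^esub>"
  obtains u where "u \<in> carrier R" "u \<notin> P" "u \<otimes> a = \<zero>"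
proof -
  have zc: "\<zero> \<in> carrier R" "\<one> \<in> carrier R" by simp_all
  have pP: "P \<in> prime_spectrum R" using Spec_open_sub[OF W(1)] W(2) by blast
  interpret primeideal P R by (rule primeD[OF pP])
  have "loc_frac R P a \<one> = loc_frac R P \<zero> \<one>"
    using fun_cong[OF z, of P] W(2) pP by (simp add: Spec_res Spec_global_def Spec_zero)
  then obtain u where "u \<in> carrier R - P" "u \<otimes> (a \<otimes> \<one>) = u \<otimes> (\<zero> \<otimes> \<one>)"
    by (rule loc_frac_eqD[OF _ zc(1) one_compl])
  then show ?thesis using that[of u] a by simp
qed

lemma Spec_unit_at:
  assumes g: "g \<in> carrier R" and u: "unit_at (Spec R \<kappa>) P (prime_spectrum R) (Spec_global R g)"
  shows "g \<notin> P"
proof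
  assume gP: "g \<in> P"
  obtain W r where W: "openin (tsp (Spec R \<kappa>)) W" "P \<in> W" "r \<in> carrier (Sec (Spec R \<kappa>) W)"
    "r \<otimes>\<^bsub>Sec (Spec R \<kappa>) W\<^esub> Res (Spec R \<kappa>) (prime_spectrum R) W (Spec_global R g) = \<one>\<^bsub>Sec (Spec R \<kappa>) W\<^esub>"
    using u unfolding unit_at_def Units_def by blast
  have zc: "\<zero> \<in> carrier R" "\<one> \<in> carrier R" by simp_all
  have pP: "P \<in> prime_spectrum R" using Spec_open_sub[OF W(1)] W(2) by blast
  interpret primeideal P R by (rule primeD[OF pP])
  obtain a f where a: "a \<in> carrier R" "f \<in> carrier R - P" "r P = loc_frac R P a f"
    using Spec_sectionE[OF W(3,2)] by (metis DiffI)
  have "loc_frac_mult R P (r P) (loc_frac R P g \<one>) = loc_frac R P \<one> \<one>"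
    using fun_cong[OF W(4), of P] W(2) pP by (simp add: Spec_mult Spec_res Spec_global_def Spec_one)
  then have "loc_frac R P (a \<otimes> g) (f \<otimes> \<one>) = loc_frac R P \<one> \<one>"
    using loc_frac_mult[OF a(1,2) g one_compl] a(3) by simp
  then obtain v where v: "v \<in> carrier R - P" "v \<otimes> (a \<otimes> g \<otimes> \<one>) = v \<otimes> (\<one> \<otimes> (f \<otimes> \<one>))"
    by (rule loc_frac_eqD[OF _ zc(2) one_compl])
  have "v \<otimes> (a \<otimes> g \<otimes> \<one>) \<in> P" using v(1) a(1) g gP by (auto intro: I_l_closed)
  then have "v \<otimes> f \<in> P" using v a by simp
  then show False using compl_closed[OF v(1) a(2)] by blast
qed

end

section \<open>Affine charts\<close>

text \<open>
  An open subset \<open>V\<^sub>0\<close> of \<open>T\<close> with an isomorphism \<open>\<psi>\<close> to a spectrum.  The stalks of \<open>T\<close> at the points of \<open>V\<^sub>0\<close>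
  are the localizations of \<open>R\<close>, which is expressed by \<open>germ_glob_unit\<close>, \<open>germ_fraction\<close> and
  \<open>germ_glob_zero\<close> without comparing the two rings.
\<close>

locale affine_chart = T: ringed T + R: cring R
  for T :: "('q, 'c) rspace" and R (structure) +
  fixes \<kappa> :: "complex \<Rightarrow> 'a" and V\<^sub>0 :: "'q set" and \<psi>
  assumes V0: "openin (tsp T) V\<^sub>0"
    and iso: "is_iso (open_sub T V\<^sub>0) (Spec R \<kappa>) \<psi>"
begin

abbreviation "Y \<equiv> Spec R \<kappa>"
abbreviation "TV \<equiv> open_sub T V\<^sub>0"

definition glob where "glob a = cm \<psi> (prime_spectrum R) (Spec_global R a)"

lemma TV_open: "openin (tsp TV) W \<longleftrightarrow> T.opn W \<and> W \<subseteq> V\<^sub>0"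
  using V0 by (simp add: open_sub_def openin_open_subtopology)

lemma TV_top: "topspace (tsp TV) = V\<^sub>0"
  using openin_subset[OF V0] by (auto simp: open_sub_def)

lemma TV_simps: "Sec TV = Sec T" "Res TV = Res T" by (auto simp: open_sub_def)

definition inv_mor where
  "inv_mor = (SOME g. morphism Y TV g \<and> mor_eq TV TV (mor_comp Y g \<psi>) mor_id \<and> mor_eq Y Y (mor_comp TV \<psi> g) mor_id)"

lemma inv_mor: "morphism Y TV inv_mor" "mor_eq TV TV (mor_comp Y inv_mor \<psi>) mor_id"
  "mor_eq Y Y (mor_comp TV \<psi> inv_mor) mor_id"
proof -
  have "\<exists>g. morphism Y TV g \<and> mor_eq TV TV (mor_comp Y g \<psi>) mor_id \<and> mor_eq Y Y (mor_comp TV \<psi> g) mor_id"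
    using iso unfolding is_iso_def by blast
  from someI_ex[OF this] show "morphism Y TV inv_mor" "mor_eq TV TV (mor_comp Y inv_mor \<psi>) mor_id"
    "mor_eq Y Y (mor_comp TV \<psi> inv_mor) mor_id" unfolding inv_mor_def by auto
qed

lemma inv_pt: "y \<in> V\<^sub>0 \<Longrightarrow> pt inv_mor (pt \<psi> y) = y"
  using inv_mor(2) by (simp add: mor_eq_def mor_comp_def mor_id_def TV_top)

lemma psi_inv: "T.opn V \<Longrightarrow> V \<subseteq> V\<^sub>0 \<Longrightarrow> s \<in> carrier (Sec T V) \<Longrightarrow>
    cm \<psi> (preim Y (pt inv_mor) V) (cm inv_mor V s) = s"
  using inv_mor(2) by (simp add: mor_eq_def mor_comp_def mor_id_def TV_open TV_simps)

lemma inv_psi: "openin (tsp Y) V \<Longrightarrow> s \<in> carrier (Sec Y V) \<Longrightarrow> cm inv_mor (preim TV (pt \<psi>) V) (cm \<psi> V s) = s"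
  using inv_mor(3) by (simp add: mor_eq_def mor_comp_def mor_id_def)

lemma psi_mor: "morphism TV Y \<psi>" using iso unfolding is_iso_def by blast

lemma psi_cont: "continuous_map (tsp TV) (tsp Y) (pt \<psi>)" using psi_mor unfolding morphism_def by blast

lemma psi_pre_open: "openin (tsp Y) W \<Longrightarrow> T.opn (preim TV (pt \<psi>) W) \<and> preim TV (pt \<psi>) W \<subseteq> V\<^sub>0"
  using openin_preim[OF psi_cont] TV_open by blast

lemma psi_prime: "y \<in> V\<^sub>0 \<Longrightarrow> pt \<psi> y \<in> prime_spectrum R"
  using psi_cont by (auto simp: continuous_map_def TV_top R.Spec_topspace)

lemma pre_mem: "y \<in> preim TV (pt \<psi>) W \<longleftrightarrow> y \<in> V\<^sub>0 \<and> pt \<psi> y \<in> W"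
  by (simp add: preim_def TV_top)

lemma preY_mem: "Q \<in> preim Y h W \<longleftrightarrow> Q \<in> prime_spectrum R \<and> h Q \<in> W"
  by (simp add: preim_def R.Spec_topspace)

lemma psi_pre_top: "preim TV (pt \<psi>) (prime_spectrum R) = V\<^sub>0"
  using psi_prime by (auto simp: pre_mem)

lemma psi_hom: "openin (tsp Y) W \<Longrightarrow> cm \<psi> W \<in> ring_hom (Sec Y W) (Sec T (preim TV (pt \<psi>) W))"
  using psi_mor[unfolded morphism_def, THEN conjunct2, THEN conjunct1] by (simp add: TV_simps)

lemma psi_res: "openin (tsp Y) V \<Longrightarrow> openin (tsp Y) W \<Longrightarrow> W \<subseteq> V \<Longrightarrow> s \<in> carrier (Sec Y V) \<Longrightarrow>
    cm \<psi> W (Res Y V W s) = Res T (preim TV (pt \<psi>) V) (preim TV (pt \<psi>) W) (cm \<psi> V s)"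
  using psi_mor[unfolded morphism_def, THEN conjunct2, THEN conjunct2, THEN conjunct1] by (simp add: TV_simps)

lemma glob_hom: "glob \<in> ring_hom R (Sec T V\<^sub>0)"
proof -
  have "cm \<psi> (prime_spectrum R) \<circ> Spec_global R \<in> ring_hom R (Sec T V\<^sub>0)"
    using ring_hom_trans[OF R.Spec_global_hom psi_hom[OF R.Spec_top_open]] by (simp add: psi_pre_top)
  moreover have "glob = cm \<psi> (prime_spectrum R) \<circ> Spec_global R" by (rule ext) (simp add: glob_def)
  ultimately show ?thesis by simp
qed

lemma glob_closed: "a \<in> carrier R \<Longrightarrow> glob a \<in> carrier (Sec T V\<^sub>0)"
  by (rule ring_hom_closed[OF glob_hom])

lemma global_closed: "a \<in> carrier R \<Longrightarrow> Spec_global R a \<in> carrier (Sec Y (prime_spectrum R))"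
  by (rule ring_hom_closed[OF R.Spec_global_hom])

lemma global_res_closed:
  assumes W: "openin (tsp Y) W" and f: "f \<in> carrier R"
  shows "Res Y (prime_spectrum R) W (Spec_global R f) \<in> carrier (Sec Y W)"
proof -
  have Wsub: "W \<subseteq> prime_spectrum R" by (rule R.Spec_open_sub[OF W])
  have "(\<lambda>P\<in>W. loc_frac R P f \<one>) \<in> carrier (Sec Y W)"
    by (rule R.Spec_sectionI[OF W f]) (use primeideal.one_compl R.primeD Wsub in auto)
  moreover have "Res Y (prime_spectrum R) W (Spec_global R f) = (\<lambda>P\<in>W. loc_frac R P f \<one>)"
    unfolding R.Spec_res Spec_global_def using Wsub by (intro ext) (auto simp: restrict_def)
  ultimately show ?thesis by simp
qed

lemma glob_res: "openin (tsp Y) W \<Longrightarrow> a \<in> carrier R \<Longrightarrow>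
    cm \<psi> W (Res Y (prime_spectrum R) W (Spec_global R a)) = Res T V\<^sub>0 (preim TV (pt \<psi>) W) (glob a)"
  using psi_res[OF R.Spec_top_open _ R.Spec_open_sub global_closed] by (simp add: glob_def psi_pre_top)

lemma germ_glob_hom_cring: "y \<in> V\<^sub>0 \<Longrightarrow> ring_hom_cring R (stalk T y) (\<lambda>a. germ T y V\<^sub>0 (glob a))"
  using ring_hom_trans[OF glob_hom T.germ_hom[OF V0]] openin_subset[OF V0]
  by (intro ring_hom_cring.intro ring_hom_cring_axioms.intro R.is_cring T.stalk_cring) (auto simp: comp_def)

lemma germ_glob_unit:
  assumes y: "y \<in> V\<^sub>0" and f: "f \<in> carrier R"
  shows "germ T y V\<^sub>0 (glob f) \<in> Units (stalk T y) \<longleftrightarrow> f \<notin> pt \<psi> y"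
proof
  assume "germ T y V\<^sub>0 (glob f) \<in> Units (stalk T y)"
  then have "unit_at T y V\<^sub>0 (glob f)" using T.unit_at_iff[OF V0 y glob_closed[OF f]] by simp
  then have "unit_at TV y V\<^sub>0 (glob f)" unfolding unit_at_def TV_open TV_simps by blast
  then have "unit_at Y (pt \<psi> y) (prime_spectrum R) (Spec_global R f)"
    using psi_mor[unfolded morphism_def, THEN conjunct2, THEN conjunct2, THEN conjunct2]
      R.Spec_top_open[of \<kappa>] global_closed[OF f] y unfolding glob_def
    by (auto simp: psi_pre_top)
  then show "f \<notin> pt \<psi> y" by (rule R.Spec_unit_at[OF f])
next
  assume fy: "f \<notin> pt \<psi> y"
  define W where "W = {P \<in> prime_spectrum R. f \<notin> P}"
  have W: "openin (tsp Y) W" "\<forall>Q\<in>W. f \<notin> Q" unfolding W_def using R.Spec_basic_open[OF f] by auto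
  have yW: "y \<in> preim TV (pt \<psi>) W" using y fy psi_prime by (simp add: pre_mem W_def)
  obtain r where r: "r \<in> carrier (Sec Y W)"
    "r \<otimes>\<^bsub>Sec Y W\<^esub> Res Y (prime_spectrum R) W (Spec_global R f) = \<one>\<^bsub>Sec Y W\<^esub>"
    by (rule R.Spec_global_unit[OF W(1) f W(2)])
  have rc: "Res Y (prime_spectrum R) W (Spec_global R f) \<in> carrier (Sec Y W)"
    by (rule global_res_closed[OF W(1) f])
  let ?N = "preim TV (pt \<psi>) W"
  have N: "T.opn ?N" "?N \<subseteq> V\<^sub>0" using psi_pre_open[OF W(1)] by auto
  have "cm \<psi> W r \<otimes>\<^bsub>Sec T ?N\<^esub> Res T V\<^sub>0 ?N (glob f) = \<one>\<^bsub>Sec T ?N\<^esub>"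
    using ring_hom_mult[OF psi_hom[OF W(1)] r(1) rc] r(2) ring_hom_one[OF psi_hom[OF W(1)]] glob_res[OF W(1) f] by simp
  moreover have "cm \<psi> W r \<in> carrier (Sec T ?N)" by (rule ring_hom_closed[OF psi_hom[OF W(1)] r(1)])
  moreover have "Res T V\<^sub>0 ?N (glob f) \<in> carrier (Sec T ?N)" by (rule T.res_closed[OF V0 N glob_closed[OF f]])
  ultimately have "Res T V\<^sub>0 ?N (glob f) \<in> Units (Sec T ?N)"
    using cring.unitI[OF T.sec_cring[OF N(1)]] by blast
  then have "unit_at T y V\<^sub>0 (glob f)" unfolding unit_at_def using N yW by blast
  then show "germ T y V\<^sub>0 (glob f) \<in> Units (stalk T y)" using T.unit_at_iff[OF V0 y glob_closed[OF f]] by simp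
qed

lemma germ_fraction:
  assumes y: "y \<in> V\<^sub>0" and \<xi>: "\<xi> \<in> carrier (stalk T y)"
  obtains a f where "a \<in> carrier R" "f \<in> carrier R" "germ T y V\<^sub>0 (glob f) \<in> Units (stalk T y)"
    "\<xi> \<otimes>\<^bsub>stalk T y\<^esub> germ T y V\<^sub>0 (glob f) = germ T y V\<^sub>0 (glob a)"
proof -
  obtain V s where V: "T.opn V" "y \<in> V" "V \<subseteq> V\<^sub>0" "s \<in> carrier (Sec T V)" "\<xi> = germ T y V s"
    by (rule T.stalk_elem_inside[OF \<xi> V0 y])
  let ?V' = "preim Y (pt inv_mor) V"
  have gc: "continuous_map (tsp Y) (tsp TV) (pt inv_mor)" using inv_mor(1) unfolding morphism_def by blast
  have V': "openin (tsp Y) ?V'" by (rule openin_preim[OF gc]) (use V TV_open in auto)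
  have yV': "pt \<psi> y \<in> ?V'" using inv_pt[OF y] V(2) psi_prime[OF y] by (simp add: preim_def R.Spec_topspace)
  have gs: "cm inv_mor V s \<in> carrier (Sec Y ?V')"
    using inv_mor(1)[unfolded morphism_def, THEN conjunct2, THEN conjunct1] V TV_open[of V]
    by (auto simp: TV_simps intro: ring_hom_closed)
  have pV': "preim TV (pt \<psi>) ?V' = V"
    using V(3) by (auto simp: pre_mem preY_mem inv_pt psi_prime)
  obtain W a f where W: "openin (tsp Y) W" "pt \<psi> y \<in> W" "W \<subseteq> ?V'" "a \<in> carrier R" "f \<in> carrier R" "\<forall>Q\<in>W. f \<notin> Q"
    "Res Y ?V' W (cm inv_mor V s) \<otimes>\<^bsub>Sec Y W\<^esub> Res Y (prime_spectrum R) W (Spec_global R f) =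
     Res Y (prime_spectrum R) W (Spec_global R a)"
    by (rule R.Spec_fraction[OF V' yV' gs])
  let ?N = "preim TV (pt \<psi>) W"
  have N: "T.opn ?N" "?N \<subseteq> V\<^sub>0" using psi_pre_open[OF W(1)] by auto
  have NV: "?N \<subseteq> V" using preim_mono[OF W(3), of TV "pt \<psi>"] pV' by simp
  have yN: "y \<in> ?N" using y W(2) by (simp add: pre_mem)
  have c1: "Res Y ?V' W (cm inv_mor V s) \<in> carrier (Sec Y W)"
  proof -
    have "\<exists>N a f. openin (tsp Y) N \<and> P \<in> N \<and> N \<subseteq> W \<and> a \<in> carrier R \<and> f \<in> carrier R \<and>
        (\<forall>Q\<in>N. f \<notin> Q \<and> restrict (cm inv_mor V s) W Q = loc_frac R Q a f)" if P: "P \<in> W" for P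
    proof -
      have "P \<in> ?V'" using P W(3) by blast
      then obtain N a f where N: "openin (tsp Y) N" "P \<in> N" "N \<subseteq> ?V'" "a \<in> carrier R" "f \<in> carrier R"
        "\<forall>Q\<in>N. f \<notin> Q \<and> cm inv_mor V s Q = loc_frac R Q a f" by (rule R.Spec_sectionE[OF gs])
      have "openin (tsp Y) (N \<inter> W)" using N(1) W(1) by (rule openin_Int)
      then show ?thesis using N P by - (rule exI[of _ "N \<inter> W"], rule exI[of _ a], rule exI[of _ f], auto)
    qed
    then show ?thesis unfolding R.Spec_res by (auto simp: Spec_def frac_space_def)
  qed
  have c2: "Res Y (prime_spectrum R) W (Spec_global R f) \<in> carrier (Sec Y W)"
    by (rule global_res_closed[OF W(1,5)])
  have "cm \<psi> W (Res Y ?V' W (cm inv_mor V s)) = Res T V ?N s"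
    using psi_res[OF V' W(1,3) gs] psi_inv[OF V(1,3,4)] pV' by simp
  then have eq: "Res T V ?N s \<otimes>\<^bsub>Sec T ?N\<^esub> Res T V\<^sub>0 ?N (glob f) = Res T V\<^sub>0 ?N (glob a)"
    using ring_hom_mult[OF psi_hom[OF W(1)] c1 c2] W(7) glob_res[OF W(1,4)] glob_res[OF W(1,5)] by simp
  have "germ T y ?N (Res T V ?N s) \<otimes>\<^bsub>stalk T y\<^esub> germ T y ?N (Res T V\<^sub>0 ?N (glob f)) =
      germ T y ?N (Res T V\<^sub>0 ?N (glob a))"
    unfolding eq[symmetric]
    by (rule T.germ_mult[OF N(1) yN T.res_closed[OF V(1) N(1) NV V(4)] T.res_closed[OF V0 N glob_closed[OF W(5)]]])
  then have "\<xi> \<otimes>\<^bsub>stalk T y\<^esub> germ T y V\<^sub>0 (glob f) = germ T y V\<^sub>0 (glob a)"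
    unfolding V(5) T.germ_res[OF V(1) N(1) yN NV V(4)]
      T.germ_res[OF V0 N(1) yN N(2) glob_closed[OF W(4)]] T.germ_res[OF V0 N(1) yN N(2) glob_closed[OF W(5)]] .
  moreover have "germ T y V\<^sub>0 (glob f) \<in> Units (stalk T y)"
    using germ_glob_unit[OF y W(5)] W(2,6) by blast
  ultimately show ?thesis using that[OF W(4,5)] by blast
qed

lemma germ_glob_zero:
  assumes y: "y \<in> V\<^sub>0" and a: "a \<in> carrier R" and z: "germ T y V\<^sub>0 (glob a) = \<zero>\<^bsub>stalk T y\<^esub>"
  obtains u where "u \<in> carrier R" "germ T y V\<^sub>0 (glob u) \<in> Units (stalk T y)" "u \<otimes> a = \<zero>"
proof -
  have "germ T y V\<^sub>0 (glob a) = germ T y V\<^sub>0 \<zero>\<^bsub>Sec T V\<^sub>0\<^esub>" using z T.germ_zero[OF V0 y] by simp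
  then obtain V where V: "T.opn V" "y \<in> V" "V \<subseteq> V\<^sub>0" "Res T V\<^sub>0 V (glob a) = Res T V\<^sub>0 V \<zero>\<^bsub>Sec T V\<^sub>0\<^esub>"
    by (rule T.germ_eqD[OF _ V0 y T.sec_closed(2)[OF V0]])
  have gc: "continuous_map (tsp Y) (tsp TV) (pt inv_mor)" using inv_mor(1) unfolding morphism_def by blast
  let ?pre = "preim Y (pt inv_mor)"
  have V': "openin (tsp Y) (?pre V)" by (rule openin_preim[OF gc]) (use V TV_open in auto)
  have yV': "pt \<psi> y \<in> ?pre V" using inv_pt[OF y] V(2) psi_prime[OF y] by (simp add: preim_def R.Spec_topspace)
  have pre0: "?pre V\<^sub>0 = prime_spectrum R"
    using gc by (auto simp: preim_def continuous_map_def TV_top R.Spec_topspace)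
  have g_res: "cm inv_mor V (Res T V\<^sub>0 V s) = Res Y (prime_spectrum R) (?pre V) (cm inv_mor V\<^sub>0 s)" if "s \<in> carrier (Sec T V\<^sub>0)" for s
  proof -
    have "\<forall>V W. openin (tsp TV) V \<and> openin (tsp TV) W \<and> W \<subseteq> V \<longrightarrow> (\<forall>s\<in>carrier (Sec T V).
        cm inv_mor W (Res T V W s) = Res Y (?pre V) (?pre W) (cm inv_mor V s))"
      using inv_mor(1)[unfolded morphism_def TV_simps, THEN conjunct2, THEN conjunct2, THEN conjunct1] .
    then show ?thesis using that V(1,3) V0 TV_open by (simp add: pre0)
  qed
  have g0: "cm inv_mor V\<^sub>0 (glob a) = Spec_global R a"
    using inv_psi[OF R.Spec_top_open global_closed[OF a]] by (simp add: psi_pre_top glob_def)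
  have z0: "Res T V\<^sub>0 V \<zero>\<^bsub>Sec T V\<^sub>0\<^esub> = \<zero>\<^bsub>Sec T V\<^esub>"
    by (rule ring_hom_zero[OF T.res_hom[OF V0 V(1,3)] T.sec_ring[OF V0] T.sec_ring[OF V(1)]])
  have gh: "cm inv_mor V \<in> ring_hom (Sec T V) (Sec Y (?pre V))"
    using inv_mor(1)[unfolded morphism_def TV_simps, THEN conjunct2, THEN conjunct1] V TV_open by simp
  have addz: "cm inv_mor V \<zero>\<^bsub>Sec T V\<^esub> = \<zero>\<^bsub>Sec Y (?pre V)\<^esub>"
  proof -
    have "cm inv_mor V \<zero>\<^bsub>Sec T V\<^esub> = Res Y (prime_spectrum R) (?pre V) (cm inv_mor V\<^sub>0 (glob \<zero>))"
      using g_res[OF glob_closed[OF R.zero_closed]] z0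
        ring_hom_zero[OF glob_hom R.ring_axioms T.sec_ring[OF V0]] by simp
    also have "\<dots> = Res Y (prime_spectrum R) (?pre V) (Spec_global R \<zero>)"
      using inv_psi[OF R.Spec_top_open global_closed[OF R.zero_closed]] by (simp add: psi_pre_top glob_def)
    also have "\<dots> = \<zero>\<^bsub>Sec Y (?pre V)\<^esub>"
      unfolding R.Spec_res Spec_global_def R.Spec_zero using R.Spec_open_sub[OF V']
      by (intro ext) (auto simp: restrict_def)
    finally show ?thesis .
  qed
  have "Res Y (prime_spectrum R) (?pre V) (Spec_global R a) = \<zero>\<^bsub>Sec Y (?pre V)\<^esub>"
    using g_res[OF glob_closed[OF a]] g0 V(4) z0 addz by simp
  then obtain u where "u \<in> carrier R" "u \<notin> pt \<psi> y" "u \<otimes> a = \<zero>"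
    by (rule R.Spec_global_zero[OF V' yV' a])
  then show ?thesis using that germ_glob_unit[OF y] by blast
qed

lemma pt_inj: "y \<in> V\<^sub>0 \<Longrightarrow> y' \<in> V\<^sub>0 \<Longrightarrow> pt \<psi> y = pt \<psi> y' \<Longrightarrow> y = y'"
  by (metis inv_pt)

end

section \<open>The total space near the zero section\<close>

text \<open>
  Over \<open>U\<close> in \<open>\<U>\<close> the total space is the spectrum of the polynomials over \<open>Sec C U\<close>, and \<open>t U\<close> is the
  fibre coordinate that belongs to the basis \<open>e U\<close> of \<open>L\<close>.
\<close>

locale total_space = scalar_automorphism C X \<iota> n \<sigma> lam
  for C :: "('p, 'a) rspace" and X :: "('p, 'b) rspace" and \<iota> :: "('p, 'a, 'p, 'b) mor" and n :: nat
    and \<sigma> :: "('p, 'b, 'p, 'b) mor" and lam :: complex +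
  fixes T :: "('q, 'c) rspace" and p :: "('q, 'c, 'p, 'a) mor" and z :: "('p, 'a, 'q, 'c) mor"
    and \<U> :: "'p set set" and e t \<psi>
  assumes T_ringed: "ringed_space T"
    and p_mor: "morphism T C p" and z_mor: "morphism C T z"
    and pz: "mor_eq C C (mor_comp T p z) mor_id"
    and cover: "\<Union>\<U> = topspace (tsp C)" and U_open: "U \<in> \<U> \<Longrightarrow> openin (tsp C) U"
    and basis: "U \<in> \<U> \<Longrightarrow> conormal_basis C X \<iota> U (e U)"
    and chart: "U \<in> \<U> \<Longrightarrow> is_iso (open_sub T (preim T (pt p) U))
             (Spec (UP (Sec C U)) (\<lambda>c. monom (UP (Sec C U)) (Cst C U c) 0)) (\<psi> U)"
    and chart_p: "U \<in> \<U> \<Longrightarrow> a \<in> carrier (Sec C U) \<Longrightarrow> cm (\<psi> U) (prime_spectrum (UP (Sec C U)))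
                (Spec_global (UP (Sec C U)) (monom (UP (Sec C U)) a 0)) = cm p U a"
    and t_def: "U \<in> \<U> \<Longrightarrow> t U = cm (\<psi> U) (prime_spectrum (UP (Sec C U)))
                (Spec_global (UP (Sec C U)) (monom (UP (Sec C U)) \<one>\<^bsub>Sec C U\<^esub> 1))"
    and z_t: "U \<in> \<U> \<Longrightarrow> cm z (preim T (pt p) U) (t U) = \<zero>\<^bsub>Sec C U\<^esub>"
    and t_change: "U \<in> \<U> \<Longrightarrow> V \<in> \<U> \<Longrightarrow> openin (tsp C) W \<Longrightarrow> W \<subseteq> U \<inter> V \<Longrightarrow> a \<in> carrier (Sec C W) \<Longrightarrow>
           restrict (e V) W = conormal_smult C X \<iota> W a (restrict (e U) W) \<Longrightarrow>
           Res T (preim T (pt p) V) (preim T (pt p) W) (t V) =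
             cm p W a \<otimes>\<^bsub>Sec T (preim T (pt p) W)\<^esub>
               Res T (preim T (pt p) U) (preim T (pt p) W) (t U)"
    and nontrivial: "x \<in> topspace (tsp C) \<Longrightarrow> \<one>\<^bsub>stalk C x\<^esub> \<noteq> \<zero>\<^bsub>stalk C x\<^esub>"
begin

sublocale T: ringed T by standard (rule T_ringed)
sublocale pm: ringed_mor T C p
  by (intro ringed_mor.intro ringed_mor_axioms.intro T.ringed_axioms C.ringed_axioms p_mor)
sublocale zm: ringed_mor C T z
  by (intro ringed_mor.intro ringed_mor_axioms.intro T.ringed_axioms C.ringed_axioms z_mor)

abbreviation over :: "'p set \<Rightarrow> 'q set" where "over U \<equiv> preim T (pt p) U"
abbreviation ps where "ps \<equiv> stalk_map T p"
abbreviation zs where "zs \<equiv> stalk_map C z"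
abbreviation gl where "gl U \<equiv> affine_chart.glob (UP (Sec C U)) (\<psi> U)"

definition tg where "tg U y = germ T y (over U) (t U)"

lemma p_z: "x \<in> topspace (tsp C) \<Longrightarrow> pt p (pt z x) = x"
  using pz by (simp add: mor_eq_def mor_comp_def mor_id_def)

lemma z_top: "x \<in> topspace (tsp C) \<Longrightarrow> pt z x \<in> topspace (tsp T)"
  by (rule zm.pt_in)

lemma over_open: "opn U \<Longrightarrow> T.opn (over U)" by (rule pm.pre_open)

lemma z_over: "opn U \<Longrightarrow> x \<in> U \<Longrightarrow> pt z x \<in> over U"
  using in_top[of U x] z_top[of x] p_z[of x] by (simp add: preim_def)

lemma pre_z_over: "opn V \<Longrightarrow> preim C (pt z) (over V) = V"
  using openin_subset[of "tsp C" V] by (auto simp: preim_def p_z z_top)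

lemma z_p: "opn V \<Longrightarrow> a \<in> carrier (Sec C V) \<Longrightarrow> cm z (over V) (cm p V a) = a"
  using pz by (simp add: mor_eq_def mor_comp_def mor_id_def)

lemma ps_germ: "opn V \<Longrightarrow> y \<in> over V \<Longrightarrow> a \<in> carrier (Sec C V) \<Longrightarrow>
    ps y (germ C (pt p y) V a) = germ T y (over V) (cm p V a)"
  by (rule pm.stalk_map_germ) (auto simp: preim_def)

lemma zs_germ: "x \<in> topspace (tsp C) \<Longrightarrow> T.opn V \<Longrightarrow> pt z x \<in> V \<Longrightarrow> s \<in> carrier (Sec T V) \<Longrightarrow>
    zs x (germ T (pt z x) V s) = germ C x (preim C (pt z) V) (cm z V s)"
  by (rule zm.stalk_map_germ)

lemma ps_hom_cring: "x \<in> topspace (tsp C) \<Longrightarrow> ring_hom_cring (stalk C x) (stalk T (pt z x)) (ps (pt z x))"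
  using pm.stalk_map_hom_cring[OF z_top] p_z by simp

lemma zs_hom_cring: "x \<in> topspace (tsp C) \<Longrightarrow> ring_hom_cring (stalk T (pt z x)) (stalk C x) (zs x)"
  by (rule zm.stalk_map_hom_cring)

lemma zs_ps: assumes x: "x \<in> topspace (tsp C)" and a: "\<alpha> \<in> carrier (stalk C x)" shows "zs x (ps (pt z x) \<alpha>) = \<alpha>"
proof -
  obtain V a where V: "opn V" "x \<in> V" "a \<in> carrier (Sec C V)" "\<alpha> = germ C x V a" by (rule C.stalk_elem[OF a])
  have "ps (pt z x) \<alpha> = germ T (pt z x) (over V) (cm p V a)"
    using ps_germ[OF V(1) z_over[OF V(1,2)] V(3)] p_z[OF x] V(4) by simp
  then show ?thesis
    using zs_germ[OF x over_open[OF V(1)] z_over[OF V(1,2)] pm.cm_closed[OF V(1,3)]] pre_z_over[OF V(1)] z_p[OF V(1,3)] V(4)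
    by simp
qed

lemma UP_cring_at: "U \<in> \<U> \<Longrightarrow> UP_cring (Sec C U)" by (intro UP_cring.intro C.sec_cring U_open)

lemma chart_affine: assumes U: "U \<in> \<U>"
  shows "affine_chart T (UP (Sec C U)) (\<lambda>c. monom (UP (Sec C U)) (Cst C U c) 0) (over U) (\<psi> U)"
proof -
  interpret UP_cring "Sec C U" "UP (Sec C U)" by (rule UP_cring_at[OF U]) simp
  show ?thesis
    by (intro affine_chart.intro affine_chart_axioms.intro T.ringed_axioms over_open U_open U chart) (rule P.is_cring)
qed

lemma gl_const: "U \<in> \<U> \<Longrightarrow> a \<in> carrier (Sec C U) \<Longrightarrow> gl U (monom (UP (Sec C U)) a 0) = cm p U a"
  using chart_p affine_chart.glob_def[OF chart_affine] by simp

lemma gl_X: "U \<in> \<U> \<Longrightarrow> gl U (monom (UP (Sec C U)) \<one>\<^bsub>Sec C U\<^esub> 1) = t U"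
  using t_def affine_chart.glob_def[OF chart_affine] by simp

lemma t_closed: assumes U: "U \<in> \<U>" shows "t U \<in> carrier (Sec T (over U))"
proof -
  interpret UP_cring "Sec C U" "UP (Sec C U)" by (rule UP_cring_at[OF U]) simp
  show ?thesis using affine_chart.glob_closed[OF chart_affine[OF U], of "monom (UP (Sec C U)) \<one>\<^bsub>Sec C U\<^esub> 1"] gl_X[OF U] by simp
qed

lemma tg_closed: "U \<in> \<U> \<Longrightarrow> y \<in> over U \<Longrightarrow> tg U y \<in> carrier (stalk T y)"
  unfolding tg_def by (intro T.germ_closed over_open U_open t_closed)

lemma zs_tg: "U \<in> \<U> \<Longrightarrow> x \<in> U \<Longrightarrow> zs x (tg U (pt z x)) = \<zero>\<^bsub>stalk C x\<^esub>"
  unfolding tg_def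
  using zs_germ[OF in_top[OF U_open] over_open[OF U_open] z_over[OF U_open] t_closed]
    pre_z_over[OF U_open] z_t C.germ_zero[OF U_open] by simp

text \<open>
  A polynomial is the sum of its constant coefficient, which is pulled back from \<open>C\<close>, and a multiple of
  the variable.
\<close>

lemma germ_gl_split:
  assumes U: "U \<in> \<U>" and y: "y \<in> over U" and a: "a \<in> carrier (UP (Sec C U))"
  obtains a' where "a' \<in> carrier (UP (Sec C U))" "a 0 \<in> carrier (Sec C U)"
    "a = monom (UP (Sec C U)) (a 0) 0 \<oplus>\<^bsub>UP (Sec C U)\<^esub> monom (UP (Sec C U)) \<one>\<^bsub>Sec C U\<^esub> 1 \<otimes>\<^bsub>UP (Sec C U)\<^esub> a'"
    "germ T y (over U) (gl U a) = ps y (germ C (pt p y) U (a 0)) \<oplus>\<^bsub>stalk T y\<^esub>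
       tg U y \<otimes>\<^bsub>stalk T y\<^esub> germ T y (over U) (gl U a')"
proof -
  interpret PR: UP_cring "Sec C U" "UP (Sec C U)" by (rule UP_cring_at[OF U]) simp
  interpret h: ring_hom_cring "UP (Sec C U)" "stalk T y" "\<lambda>a. germ T y (over U) (gl U a)"
    by (rule affine_chart.germ_glob_hom_cring[OF chart_affine[OF U] y])
  obtain a' where a': "a' \<in> carrier (UP (Sec C U))" "a 0 \<in> carrier (Sec C U)"
    "a = monom (UP (Sec C U)) (a 0) 0 \<oplus>\<^bsub>UP (Sec C U)\<^esub> monom (UP (Sec C U)) \<one>\<^bsub>Sec C U\<^esub> 1 \<otimes>\<^bsub>UP (Sec C U)\<^esub> a'"
    by (rule PR.poly_split[OF a])
  let ?m = "monom (UP (Sec C U)) (a 0) 0" and ?X = "monom (UP (Sec C U)) \<one>\<^bsub>Sec C U\<^esub> 1"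
  have c: "?m \<in> carrier (UP (Sec C U))" "?X \<in> carrier (UP (Sec C U))" using a'(2) by auto
  have "germ T y (over U) (gl U a) = germ T y (over U) (gl U (?m \<oplus>\<^bsub>UP (Sec C U)\<^esub> ?X \<otimes>\<^bsub>UP (Sec C U)\<^esub> a'))"
    using a'(3) by simp
  also have "\<dots> = germ T y (over U) (gl U ?m) \<oplus>\<^bsub>stalk T y\<^esub>
      germ T y (over U) (gl U ?X) \<otimes>\<^bsub>stalk T y\<^esub> germ T y (over U) (gl U a')"
    by (simp only: h.hom_add[OF c(1) PR.P.m_closed[OF c(2) a'(1)]] h.hom_mult[OF c(2) a'(1)])
  also have "\<dots> = ps y (germ C (pt p y) U (a 0)) \<oplus>\<^bsub>stalk T y\<^esub>
       tg U y \<otimes>\<^bsub>stalk T y\<^esub> germ T y (over U) (gl U a')"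
    unfolding gl_const[OF U a'(2)] gl_X[OF U] tg_def ps_germ[OF U_open[OF U] y a'(2)] ..
  finally show ?thesis using that[OF a'] by blast
qed

text \<open>
  Write \<open>\<sigma>' = a/f\<close> with polynomials \<open>a\<close> and \<open>f\<close>.  If \<open>t \<sigma>' = 0\<close>, then \<open>u X a = 0\<close> for the variable \<open>X\<close> and some
  \<open>u\<close> that is a unit in the stalk, hence \<open>u a = 0\<close>.
\<close>

lemma t_regular:
  assumes U: "U \<in> \<U>" and y: "y \<in> over U" and s: "\<sigma>' \<in> carrier (stalk T y)"
    and z: "tg U y \<otimes>\<^bsub>stalk T y\<^esub> \<sigma>' = \<zero>\<^bsub>stalk T y\<^esub>"
  shows "\<sigma>' = \<zero>\<^bsub>stalk T y\<^esub>"
proof -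
  interpret PR: UP_cring "Sec C U" "UP (Sec C U)" by (rule UP_cring_at[OF U]) simp
  interpret h: ring_hom_cring "UP (Sec C U)" "stalk T y" "\<lambda>a. germ T y (over U) (gl U a)"
    by (rule affine_chart.germ_glob_hom_cring[OF chart_affine[OF U] y])
  let ?X = "monom (UP (Sec C U)) \<one>\<^bsub>Sec C U\<^esub> 1"
  let ?g = "\<lambda>a. germ T y (over U) (gl U a)"
  have X: "?X \<in> carrier (UP (Sec C U))" by simp
  obtain a f where a: "a \<in> carrier (UP (Sec C U))" "f \<in> carrier (UP (Sec C U))" "?g f \<in> Units (stalk T y)"
    "\<sigma>' \<otimes>\<^bsub>stalk T y\<^esub> ?g f = ?g a" by (rule affine_chart.germ_fraction[OF chart_affine[OF U] y s])
  have fc: "?g f \<in> carrier (stalk T y)" using a(2) by simp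
  note tc = tg_closed[OF U y]
  have "?g (?X \<otimes>\<^bsub>UP (Sec C U)\<^esub> a) = tg U y \<otimes>\<^bsub>stalk T y\<^esub> ?g a"
    using h.hom_mult[OF X a(1)] gl_X[OF U] by (simp only: tg_def)
  also have "\<dots> = (tg U y \<otimes>\<^bsub>stalk T y\<^esub> \<sigma>') \<otimes>\<^bsub>stalk T y\<^esub> ?g f"
    unfolding a(4)[symmetric] using tc s fc by (simp add: h.S.m_assoc)
  also have "\<dots> = \<zero>\<^bsub>stalk T y\<^esub>" using z fc by simp
  finally obtain u where u: "u \<in> carrier (UP (Sec C U))" "?g u \<in> Units (stalk T y)"
    "u \<otimes>\<^bsub>UP (Sec C U)\<^esub> (?X \<otimes>\<^bsub>UP (Sec C U)\<^esub> a) = \<zero>\<^bsub>UP (Sec C U)\<^esub>"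
    by (rule affine_chart.germ_glob_zero[OF chart_affine[OF U] y PR.P.m_closed[OF X a(1)]])
  have "?X \<otimes>\<^bsub>UP (Sec C U)\<^esub> (u \<otimes>\<^bsub>UP (Sec C U)\<^esub> a) = \<zero>\<^bsub>UP (Sec C U)\<^esub>"
    using u(1,3) a(1) X by (simp only: PR.P.m_lcomm)
  then have "u \<otimes>\<^bsub>UP (Sec C U)\<^esub> a = \<zero>\<^bsub>UP (Sec C U)\<^esub>" by (rule PR.X_regular[OF PR.P.m_closed[OF u(1) a(1)]])
  then have "?g u \<otimes>\<^bsub>stalk T y\<^esub> ?g a = \<zero>\<^bsub>stalk T y\<^esub>" using h.hom_mult[OF u(1) a(1)] h.hom_zero by simp
  then have "?g a \<otimes>\<^bsub>stalk T y\<^esub> ?g u = \<zero>\<^bsub>stalk T y\<^esub>" using u(1) a(1) by (simp add: h.S.m_comm)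
  then obtain v where "v \<in> carrier (stalk T y)" "?g a = \<zero>\<^bsub>stalk T y\<^esub> \<otimes>\<^bsub>stalk T y\<^esub> v"
    by (rule h.S.cancel_unit[OF u(2) h.hom_closed[OF a(1)] h.S.zero_closed])
  then have "\<sigma>' \<otimes>\<^bsub>stalk T y\<^esub> ?g f = \<zero>\<^bsub>stalk T y\<^esub>" using a(4) by simp
  then obtain w where "w \<in> carrier (stalk T y)" "\<sigma>' = \<zero>\<^bsub>stalk T y\<^esub> \<otimes>\<^bsub>stalk T y\<^esub> w"
    by (rule h.S.cancel_unit[OF a(3) s h.S.zero_closed])
  then show ?thesis by simp
qed

text \<open>
  Write \<open>\<sigma>' = a/f\<close>.  If \<open>\<sigma>'\<close> vanishes on the zero section, then the constant coefficient of \<open>a\<close>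
  vanishes near \<open>x\<close> as a function on \<open>C\<close>; so does its pullback to \<open>T\<close>, and what is left of \<open>a\<close> is a
  multiple of \<open>t\<close>.
\<close>

lemma z_kernel:
  assumes U: "U \<in> \<U>" "x \<in> U" and s: "\<sigma>' \<in> carrier (stalk T (pt z x))" "zs x \<sigma>' = \<zero>\<^bsub>stalk C x\<^esub>"
  shows "\<exists>s\<in>carrier (stalk T (pt z x)). \<sigma>' = tg U (pt z x) \<otimes>\<^bsub>stalk T (pt z x)\<^esub> s"
proof -
  let ?y = "pt z x"
  have x: "x \<in> topspace (tsp C)" by (rule in_top[OF U_open[OF U(1)] U(2)])
  have y: "?y \<in> over U" by (rule z_over[OF U_open[OF U(1)] U(2)])
  interpret h: ring_hom_cring "UP (Sec C U)" "stalk T ?y" "\<lambda>a. germ T ?y (over U) (gl U a)"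
    by (rule affine_chart.germ_glob_hom_cring[OF chart_affine[OF U(1)] y])
  interpret zh: ring_hom_cring "stalk T ?y" "stalk C x" "zs x" by (rule zs_hom_cring[OF x])
  let ?g = "\<lambda>a. germ T ?y (over U) (gl U a)"
  obtain a f where a: "a \<in> carrier (UP (Sec C U))" "f \<in> carrier (UP (Sec C U))" "?g f \<in> Units (stalk T ?y)"
    "\<sigma>' \<otimes>\<^bsub>stalk T ?y\<^esub> ?g f = ?g a" by (rule affine_chart.germ_fraction[OF chart_affine[OF U(1)] y s(1)])
  obtain a' where a': "a' \<in> carrier (UP (Sec C U))" "a 0 \<in> carrier (Sec C U)"
    "?g a = ps ?y (germ C (pt p ?y) U (a 0)) \<oplus>\<^bsub>stalk T ?y\<^esub> tg U ?y \<otimes>\<^bsub>stalk T ?y\<^esub> ?g a'"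
    by (rule germ_gl_split[OF U(1) y a(1)])
  have gc: "?g f \<in> carrier (stalk T ?y)" "?g a' \<in> carrier (stalk T ?y)" "?g a \<in> carrier (stalk T ?y)"
    by (rule h.hom_closed[OF a(2)], rule h.hom_closed[OF a'(1)], rule h.hom_closed[OF a(1)])
  have g0: "germ C x U (a 0) \<in> carrier (stalk C x)" by (rule C.germ_closed[OF U_open[OF U(1)] U(2) a'(2)])
  interpret ph: ring_hom_cring "stalk C x" "stalk T ?y" "ps ?y" by (rule ps_hom_cring[OF x])
  note tc = tg_closed[OF U(1) y]
  have pc: "ps ?y (germ C x U (a 0)) \<in> carrier (stalk T ?y)" using g0 by simp
  have "zs x (?g a) = germ C x U (a 0)"
    unfolding a'(3) p_z[OF x] using tc gc pc g0 by (simp add: zs_ps[OF x g0] zs_tg[OF U])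
  moreover have "zs x (?g a) = \<zero>\<^bsub>stalk C x\<^esub>" using zh.hom_mult[OF s(1) gc(1)] s(2) a(4) gc(1) by simp
  ultimately have g0z: "germ C x U (a 0) = \<zero>\<^bsub>stalk C x\<^esub>" by simp
  have "?g a = tg U ?y \<otimes>\<^bsub>stalk T ?y\<^esub> ?g a'" unfolding a'(3) p_z[OF x] g0z using tc gc by simp
  then have "\<sigma>' \<otimes>\<^bsub>stalk T ?y\<^esub> ?g f = tg U ?y \<otimes>\<^bsub>stalk T ?y\<^esub> ?g a'" using a(4) by simp
  then obtain v where v: "v \<in> carrier (stalk T ?y)" "\<sigma>' = (tg U ?y \<otimes>\<^bsub>stalk T ?y\<^esub> ?g a') \<otimes>\<^bsub>stalk T ?y\<^esub> v"
    by (rule h.S.cancel_unit[OF a(3) s(1) h.S.m_closed[OF tc gc(2)]])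
  then show ?thesis using tc gc(2) by (intro bexI[of _ "?g a' \<otimes>\<^bsub>stalk T ?y\<^esub> v"]) (auto simp: h.S.m_assoc)
qed

section \<open>The comorphism on stalks\<close>

abbreviation q where "q x r \<equiv> ps (pt z x) (i x r)"

lemma q_hom_cring: assumes x: "x \<in> topspace (tsp C)"
  shows "ring_hom_cring (stalk X x) (stalk T (pt z x)) (q x)"
proof -
  interpret a: ring_hom_cring "stalk X x" "stalk C x" "i x" by (rule i_hom_cring[OF x])
  interpret b: ring_hom_cring "stalk C x" "stalk T (pt z x)" "ps (pt z x)" by (rule ps_hom_cring[OF x])
  show ?thesis
    using ring_hom_trans[OF a.homh b.homh]
    by (intro ring_hom_cring.intro ring_hom_cring_axioms.intro a.R.is_cring b.S.is_cring) (simp add: comp_def)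
qed

text \<open>
  The coefficients of the expansions in \<open>stalk T (pt z x)\<close> are read off by restriction to the zero section,
  those in \<open>stalk X x\<close> by restriction to \<open>C\<close>.  Both determine an element of \<open>Fixed x\<close>.
\<close>

lemma expansion_at:
  assumes U: "U \<in> \<U>" "x \<in> U"
  shows "expansion (stalk X x) (stalk T (pt z x)) (q x) (Fixed x) (tg U (pt z x)) (eps x (e U x)) n"
proof -
  let ?y = "pt z x" and ?e = "eps x (e U x)"
  have x: "x \<in> topspace (tsp C)" by (rule in_top[OF U_open[OF U(1)] U(2)])
  have y: "?y \<in> over U" by (rule z_over[OF U_open[OF U(1)] U(2)])
  interpret ev: eigen_thickening "stalk X x" "stalk C x" "i x" "gen x" n "\<phi> x" "\<kappa> x" lam by (rule eigen_at[OF x])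
  interpret qh: ring_hom_cring "stalk X x" "stalk T ?y" "q x" by (rule q_hom_cring[OF x])
  interpret zh: ring_hom_cring "stalk T ?y" "stalk C x" "zs x" by (rule zs_hom_cring[OF x])
  have zq: "zs x (q x r) = i x r" if "r \<in> carrier (stalk X x)" for r using zs_ps[OF x] that by simp
  obtain b where b: "b \<in> carrier (stalk X x)" "gen x = b \<otimes>\<^bsub>stalk X x\<^esub> ?e" and el: "?e \<in> Lin x"
    using eps_generates[OF basis[OF U(1)] U_open[OF U(1)] U(2)] by blast
  have e: "?e \<in> carrier (stalk X x)" "i x ?e = \<zero>\<^bsub>stalk C x\<^esub>" using el Lin_iff[OF x] by auto
  note tc = tg_closed[OF U(1) y]
  have Fc: "c \<in> carrier (stalk X x)" if "c \<in> Fixed x" for c using that Fixed_iff[OF x] by simp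
  show ?thesis
  proof (intro expansion.intro expansion_pair.intro expansion_pair_axioms.intro expansion_axioms.intro
      qh.ring_hom_cring_axioms ev.fixed_subring tc e(1) n)
    fix r assume r: "r \<in> carrier (stalk X x)"
    have ir: "i x r \<in> carrier (stalk C x)" using r by simp
    obtain c where c: "c \<in> Fixed x" "i x c = i x r" by (rule ev.fixed_lift[OF ir])
    note cc = Fc[OF c(1)]
    have "i x (r \<ominus>\<^bsub>stalk X x\<^esub> c) = \<zero>\<^bsub>stalk C x\<^esub>" using ev.i_minus[OF r cc] c(2) ir by simp
    then obtain w where w: "w \<in> carrier (stalk X x)" "r \<ominus>\<^bsub>stalk X x\<^esub> c = gen x \<otimes>\<^bsub>stalk X x\<^esub> w"
      using ev.i_ker[of "r \<ominus>\<^bsub>stalk X x\<^esub> c"] r cc by auto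
    have "r = c \<oplus>\<^bsub>stalk X x\<^esub> (r \<ominus>\<^bsub>stalk X x\<^esub> c)" by (rule ev.i.R.add_diff[OF cc r])
    also have "\<dots> = c \<oplus>\<^bsub>stalk X x\<^esub> ?e \<otimes>\<^bsub>stalk X x\<^esub> (b \<otimes>\<^bsub>stalk X x\<^esub> w)"
      unfolding w(2) b(2) using b(1) e(1) w(1) by (simp add: ev.i.R.m_ac)
    finally show "\<exists>b\<in>Fixed x. \<exists>r'\<in>carrier (stalk X x). r = b \<oplus>\<^bsub>stalk X x\<^esub> ?e \<otimes>\<^bsub>stalk X x\<^esub> r'"
      using c(1) b(1) w(1) by blast
  next
    show "?e [^]\<^bsub>stalk X x\<^esub> n = \<zero>\<^bsub>stalk X x\<^esub>" by (rule ev.lin_nilpotent[OF e])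
  next
    fix c r assume c: "c \<in> Fixed x" and r: "r \<in> carrier (stalk X x)" and eq: "c = ?e \<otimes>\<^bsub>stalk X x\<^esub> r"
    have "i x c = \<zero>\<^bsub>stalk C x\<^esub>" unfolding eq using e r by simp
    then show "c = \<zero>\<^bsub>stalk X x\<^esub>" by (rule ev.fixed_inj[OF c])
  next
    fix r assume "r \<in> carrier (stalk X x)" "?e \<otimes>\<^bsub>stalk X x\<^esub> r = \<zero>\<^bsub>stalk X x\<^esub>"
    then show "\<exists>y\<in>carrier (stalk X x). r = ?e [^]\<^bsub>stalk X x\<^esub> (n - 1) \<otimes>\<^bsub>stalk X x\<^esub> y"
      by (rule ev.annihilator[OF e(1) b])
  next
    fix s assume s: "s \<in> carrier (stalk T ?y)"
    have zc: "zs x s \<in> carrier (stalk C x)" using s by simp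
    obtain c where c: "c \<in> Fixed x" "i x c = zs x s" by (rule ev.fixed_lift[OF zc])
    note cc = Fc[OF c(1)]
    have qc: "q x c \<in> carrier (stalk T ?y)" using cc by simp
    have "zs x (s \<ominus>\<^bsub>stalk T ?y\<^esub> q x c) = \<zero>\<^bsub>stalk C x\<^esub>"
      using zh.hom_minus[OF s qc] zq[OF cc] c(2) zc by simp
    then obtain w where w: "w \<in> carrier (stalk T ?y)" "s \<ominus>\<^bsub>stalk T ?y\<^esub> q x c = tg U ?y \<otimes>\<^bsub>stalk T ?y\<^esub> w"
      using z_kernel[OF U, of "s \<ominus>\<^bsub>stalk T ?y\<^esub> q x c"] s qc by auto
    have "s = q x c \<oplus>\<^bsub>stalk T ?y\<^esub> (s \<ominus>\<^bsub>stalk T ?y\<^esub> q x c)" by (rule qh.S.add_diff[OF qc s])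
    then show "\<exists>b\<in>Fixed x. \<exists>s'\<in>carrier (stalk T ?y). s = q x b \<oplus>\<^bsub>stalk T ?y\<^esub> tg U ?y \<otimes>\<^bsub>stalk T ?y\<^esub> s'"
      unfolding w(2) using c(1) w(1) by blast
  next
    fix c s assume c: "c \<in> Fixed x" and s: "s \<in> carrier (stalk T ?y)" and eq: "q x c = tg U ?y \<otimes>\<^bsub>stalk T ?y\<^esub> s"
    have "i x c = zs x (tg U ?y \<otimes>\<^bsub>stalk T ?y\<^esub> s)" using zq[OF Fc[OF c]] eq by simp
    also have "\<dots> = \<zero>\<^bsub>stalk C x\<^esub>" using tc s zs_tg[OF U] by simp
    finally show "c = \<zero>\<^bsub>stalk X x\<^esub>" by (rule ev.fixed_inj[OF c])
  next
    fix s assume "s \<in> carrier (stalk T ?y)" "tg U ?y \<otimes>\<^bsub>stalk T ?y\<^esub> s = \<zero>\<^bsub>stalk T ?y\<^esub>"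
    then show "s = \<zero>\<^bsub>stalk T ?y\<^esub>" by (rule t_regular[OF U(1) y])
  qed
qed

abbreviation J where
  "J U x \<equiv> expn (stalk X x) (stalk T (pt z x)) (q x) (Fixed x) (tg U (pt z x)) (eps x (e U x))"

text \<open>
  The stalk map of the closed immersion.  It is defined by means of some chart at \<open>x\<close>; by \<open>J_change\<close> any other
  chart gives the same map.
\<close>

definition F where
  "F x = expansion.reduce (stalk X x) (stalk T (pt z x)) (q x) (Fixed x)
     (tg (SOME U. U \<in> \<U> \<and> x \<in> U) (pt z x)) (eps x (e (SOME U. U \<in> \<U> \<and> x \<in> U) x)) n"

lemma J_change:
  assumes U: "U \<in> \<U>" "x \<in> U" and U': "U' \<in> \<U>" "x \<in> U'" and J: "J U' x m s r"
  shows "J U x m s r"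
proof -
  let ?y = "pt z x"
  have x: "x \<in> topspace (tsp C)" by (rule in_top[OF U_open[OF U(1)] U(2)])
  interpret ex: expansion "stalk X x" "stalk T ?y" "q x" "Fixed x" "tg U ?y" "eps x (e U x)" n
    by (rule expansion_at[OF U])
  define N where "N = U \<inter> U'"
  obtain a u where a: "a \<in> carrier (Sec C N)"
    "restrict (e U') N = conormal_smult C X \<iota> N a (restrict (e U) N)"
    "u \<in> Fixed x" "i x u = germ C x N a" "eps x (e U' x) = u \<otimes>\<^bsub>stalk X x\<^esub> eps x (e U x)"
    unfolding N_def
    by (rule eps_change[OF basis[OF U(1)] basis[OF U'(1)] U_open[OF U(1)] U_open[OF U'(1)] U(2) U'(2)])
  have N: "opn N" "x \<in> N" "N \<subseteq> U \<inter> U'" "N \<subseteq> U" "N \<subseteq> U'" using U U' U_open unfolding N_def by auto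
  note yN = z_over[OF N(1,2)] and oN = over_open[OF N(1)]
  have sub: "over N \<subseteq> over U" "over N \<subseteq> over U'" by (rule preim_mono[OF N(4)], rule preim_mono[OF N(5)])
  note oU = over_open[OF U_open[OF U(1)]] and oU' = over_open[OF U_open[OF U'(1)]]
  note tU = T.res_closed[OF oU oN sub(1) t_closed[OF U(1)]]
  have "tg U' ?y = germ T ?y (over N) (Res T (over U') (over N) (t U'))"
    unfolding tg_def by (rule T.germ_res[OF oU' oN yN sub(2) t_closed[OF U'(1)], symmetric])
  also have "\<dots> = germ T ?y (over N) (cm p N a) \<otimes>\<^bsub>stalk T ?y\<^esub> germ T ?y (over N) (Res T (over U) (over N) (t U))"
    unfolding t_change[OF U(1) U'(1) N(1,3) a(1,2)]
    by (rule T.germ_mult[OF oN yN pm.cm_closed[OF N(1) a(1)] tU, symmetric])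
  also have "\<dots> = q x u \<otimes>\<^bsub>stalk T ?y\<^esub> tg U ?y"
    unfolding T.germ_res[OF oU oN yN sub(1) t_closed[OF U(1)]] tg_def a(4)
    using ps_germ[OF N(1) yN a(1)] p_z[OF x] by simp
  finally have "tg U' ?y = q x u \<otimes>\<^bsub>stalk T ?y\<^esub> tg U ?y" .
  then show ?thesis using ex.J_change[OF a(3)] J a(5) by simp
qed

lemma some_chart: assumes "x \<in> topspace (tsp C)"
  shows "(SOME U. U \<in> \<U> \<and> x \<in> U) \<in> \<U>" "x \<in> (SOME U. U \<in> \<U> \<and> x \<in> U)"
proof -
  have "\<exists>U. U \<in> \<U> \<and> x \<in> U" using assms cover by blast
  from someI_ex[OF this] show "(SOME U. U \<in> \<U> \<and> x \<in> U) \<in> \<U>" "x \<in> (SOME U. U \<in> \<U> \<and> x \<in> U)" by auto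
qed

lemma F_eq:
  assumes U: "U \<in> \<U>" "x \<in> U" and J: "J U x n s r" shows "F x s = r"
proof -
  have x: "x \<in> topspace (tsp C)" by (rule in_top[OF U_open[OF U(1)] U(2)])
  note V = some_chart[OF x]
  show ?thesis
    unfolding F_def by (rule expansion.reduce_eq[OF expansion_at[OF V] J_change[OF V U J]])
qed

lemma F_J:
  assumes U: "U \<in> \<U>" "x \<in> U" and s: "s \<in> carrier (stalk T (pt z x))" shows "J U x n s (F x s)"
proof -
  interpret ex: expansion "stalk X x" "stalk T (pt z x)" "q x" "Fixed x" "tg U (pt z x)" "eps x (e U x)" n
    by (rule expansion_at[OF U])
  show ?thesis using ex.reduce_J[OF s] F_eq[OF U ex.reduce_J[OF s]] by simp
qed

lemma F_reduce:
  assumes U: "U \<in> \<U>" "x \<in> U" and s: "s \<in> carrier (stalk T (pt z x))"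
  shows "F x s = expansion.reduce (stalk X x) (stalk T (pt z x)) (q x) (Fixed x) (tg U (pt z x)) (eps x (e U x)) n s"
  using expansion.reduce_eq[OF expansion_at[OF U] F_J[OF U s]] by simp

lemma F_hom: assumes x: "x \<in> topspace (tsp C)" shows "F x \<in> ring_hom (stalk T (pt z x)) (stalk X x)"
  unfolding F_def by (rule expansion.reduce_hom[OF expansion_at[OF some_chart[OF x]]])

lemma F_fixed: assumes x: "x \<in> topspace (tsp C)" and b: "b \<in> Fixed x" shows "F x (q x b) = b"
  unfolding F_def by (rule expansion.reduce_E[OF expansion_at[OF some_chart[OF x]] b])

lemma F_surj: assumes x: "x \<in> topspace (tsp C)" and r: "r \<in> carrier (stalk X x)"
  obtains s where "s \<in> carrier (stalk T (pt z x))" "F x s = r"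
  using expansion.reduce_surj[OF expansion_at[OF some_chart[OF x]] r] unfolding F_def by blast

lemma F_kernel:
  assumes U: "U \<in> \<U>" "x \<in> U" and s: "s \<in> carrier (stalk T (pt z x))"
  shows "F x s = \<zero>\<^bsub>stalk X x\<^esub> \<longleftrightarrow> (\<exists>s'\<in>carrier (stalk T (pt z x)).
    s = tg U (pt z x) [^]\<^bsub>stalk T (pt z x)\<^esub> n \<otimes>\<^bsub>stalk T (pt z x)\<^esub> s')"
  unfolding F_reduce[OF U s] by (rule expansion.reduce_kernel[OF expansion_at[OF U] s])

lemma i_F: assumes x: "x \<in> topspace (tsp C)" and s: "s \<in> carrier (stalk T (pt z x))" shows "i x (F x s) = zs x s"
proof -
  obtain U where U: "U \<in> \<U>" "x \<in> U" using some_chart[OF x] by blast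
  let ?y = "pt z x"
  interpret ex: expansion "stalk X x" "stalk T ?y" "q x" "Fixed x" "tg U ?y" "eps x (e U x)" n
    by (rule expansion_at[OF U])
  interpret zh: ring_hom_cring "stalk T ?y" "stalk C x" "zs x" by (rule zs_hom_cring[OF x])
  interpret ih: ring_hom_cring "stalk X x" "stalk C x" "i x" by (rule i_hom_cring[OF x])
  obtain m where m: "n = Suc m" using n by (cases n) auto
  have J: "J U x (Suc m) s (F x s)" using F_J[OF U s] m by simp
  obtain b s' r' where b: "b \<in> Fixed x" "s = q x b \<oplus>\<^bsub>stalk T ?y\<^esub> tg U ?y \<otimes>\<^bsub>stalk T ?y\<^esub> s'"
    "F x s = b \<oplus>\<^bsub>stalk X x\<^esub> eps x (e U x) \<otimes>\<^bsub>stalk X x\<^esub> r'"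
    "b \<in> carrier (stalk X x)" "q x b \<in> carrier (stalk T ?y)" "s' \<in> carrier (stalk T ?y)" "r' \<in> carrier (stalk X x)"
    by (rule ex.J_SucE[OF J])
  have el: "i x (eps x (e U x)) = \<zero>\<^bsub>stalk C x\<^esub>"
    using eps_generates(1)[OF basis[OF U(1)] U_open[OF U(1)] U(2)] Lin_iff[OF x] by simp
  have "zs x s = i x b" unfolding b(2) using b(4-6) ex.t zs_tg[OF U] zs_ps[OF x] by simp
  moreover have "i x (F x s) = i x b" unfolding b(3) using b(4,7) ex.eps el by simp
  ultimately show ?thesis by simp
qed

lemma F_local:
  assumes x: "x \<in> topspace (tsp C)" and s: "s \<in> carrier (stalk T (pt z x))" and u: "F x s \<in> Units (stalk X x)"
  shows "s \<in> Units (stalk T (pt z x))"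
proof (rule zm.stalk_map_local[OF x s])
  interpret ih: ring_hom_cring "stalk X x" "stalk C x" "i x" by (rule i_hom_cring[OF x])
  obtain r where r: "r \<in> carrier (stalk X x)" "r \<otimes>\<^bsub>stalk X x\<^esub> F x s = \<one>\<^bsub>stalk X x\<^esub>" "F x s \<in> carrier (stalk X x)"
    using u unfolding Units_def by blast
  have "i x r \<otimes>\<^bsub>stalk C x\<^esub> i x (F x s) = \<one>\<^bsub>stalk C x\<^esub>" using ih.hom_mult[OF r(1,3)] r(2) by simp
  then have "i x (F x s) \<in> Units (stalk C x)" using ih.S.unitI[of "i x r" "i x (F x s)"] r by simp
  then show "zs x s \<in> Units (stalk C x)" using i_F[OF x s] by simp
qed

text \<open>
  The finitely many germs that occur in the two expansions are represented by sections, and the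
  equations between them persist nearby.
\<close>

lemma J_open:
  assumes U: "U \<in> \<U>"
  shows "J U x m (germ T (pt z x) V s) (germ X x N r) \<Longrightarrow> x \<in> U \<Longrightarrow>
    T.opn V \<Longrightarrow> pt z x \<in> V \<Longrightarrow> s \<in> carrier (Sec T V) \<Longrightarrow> opn N \<Longrightarrow> x \<in> N \<Longrightarrow> r \<in> carrier (Sec X N) \<Longrightarrow>
    \<exists>W. opn W \<and> x \<in> W \<and> W \<subseteq> N \<inter> preim C (pt z) V \<inter> U \<and> (\<forall>y\<in>W. J U y m (germ T (pt z y) V s) (germ X y N r))"
proof (induction m arbitrary: V s N r)
  case 0
  have o: "opn (N \<inter> preim C (pt z) V \<inter> U)" using 0 zm.pre_open U_open[OF U] by auto
  have "x \<in> N \<inter> preim C (pt z) V \<inter> U" using 0 in_top[OF U_open[OF U]] by (auto simp: preim_def)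
  moreover have "\<forall>y\<in>N \<inter> preim C (pt z) V \<inter> U. J U y 0 (germ T (pt z y) V s) (germ X y N r)"
    using 0 T.germ_closed X.germ_closed by (auto simp: preim_def)
  ultimately show ?case using o by blast
next
  case (Suc m)
  note V = Suc.prems(3-5) and N = Suc.prems(6-8) and xU = Suc.prems(2)
  note oU = U_open[OF U]
  have x: "x \<in> topspace (tsp C)" by (rule in_top[OF oU xU])
  let ?y = "pt z x"
  interpret ex: expansion "stalk X x" "stalk T ?y" "q x" "Fixed x" "tg U ?y" "eps x (e U x)" n
    by (rule expansion_at[OF U xU])
  obtain b \<sigma>' r' where b: "b \<in> Fixed x" "J U x m \<sigma>' r'"
    "germ T ?y V s = q x b \<oplus>\<^bsub>stalk T ?y\<^esub> tg U ?y \<otimes>\<^bsub>stalk T ?y\<^esub> \<sigma>'"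
    "germ X x N r = b \<oplus>\<^bsub>stalk X x\<^esub> eps x (e U x) \<otimes>\<^bsub>stalk X x\<^esub> r'"
    "b \<in> carrier (stalk X x)" "q x b \<in> carrier (stalk T ?y)" "\<sigma>' \<in> carrier (stalk T ?y)" "r' \<in> carrier (stalk X x)"
    by (rule ex.J_SucE[OF Suc.prems(1)])
  obtain B b0 where B: "X.opn B" "x \<in> B" "b0 \<in> carrier (Sec X B)" "b = germ X x B b0" by (rule X.stalk_elem[OF b(5)])
  have B': "opn B" using B(1) by simp
  obtain V' s' where V': "T.opn V'" "?y \<in> V'" "s' \<in> carrier (Sec T V')" "\<sigma>' = germ T ?y V' s'" by (rule T.stalk_elem[OF b(7)])
  obtain N' r0 where N': "X.opn N'" "x \<in> N'" "r0 \<in> carrier (Sec X N')" "r' = germ X x N' r0" by (rule X.stalk_elem[OF b(8)])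
  have oN': "opn N'" using N'(1) by simp
  obtain W1 where W1: "opn W1" "x \<in> W1" "W1 \<subseteq> B" "\<And>y. y \<in> W1 \<Longrightarrow> germ X y B b0 \<in> Fixed y"
    using Fixed_open[OF B' B(2,3)] b(1) B(4) by auto
  obtain W2 where W2: "opn W2" "x \<in> W2" "W2 \<subseteq> N' \<inter> preim C (pt z) V' \<inter> U"
    "\<And>y. y \<in> W2 \<Longrightarrow> J U y m (germ T (pt z y) V' s') (germ X y N' r0)"
    using Suc.IH[of V' s' N' r0] b(2) V' N' oN' xU by auto
  have "e U \<in> conormal C X \<iota> U" using basis[OF U] unfolding conormal_basis_def by blast
  then obtain A w where A: "opn A" "x \<in> A" "A \<subseteq> U" "w \<in> K A" "\<forall>y\<in>A. e U y = conormal_germ C X \<iota> y A w"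
    by (rule conormal_rep[OF _ xU])
  obtain M s\<^sub>e where M: "opn M" "x \<in> M" "M \<subseteq> A" "s\<^sub>e \<in> carrier (Sec X M)" "\<forall>y\<in>M. germ X y M s\<^sub>e = eps y (e U y)"
    by (rule eps_open[OF A(1,2,4,5)])
  have "germ X x N r = germ X x B b0 \<oplus>\<^bsub>stalk X x\<^esub> germ X x M s\<^sub>e \<otimes>\<^bsub>stalk X x\<^esub> germ X x N' r0"
    using b(4) B(4) N'(4) M(5)[rule_format, OF M(2)] by simp
  then obtain W3 where W3: "X.opn W3" "x \<in> W3" "W3 \<subseteq> N \<inter> B \<inter> M \<inter> N'"
    "\<forall>y\<in>W3. germ X y N r = germ X y B b0 \<oplus>\<^bsub>stalk X y\<^esub> germ X y M s\<^sub>e \<otimes>\<^bsub>stalk X y\<^esub> germ X y N' r0"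
    by (rule X.nearby_affine[OF oX[OF N(1)] N(2,3) B(1-3) oX[OF M(1)] M(2,4) N'(1-3)])
  let ?ib = "cm \<iota> B b0"
  have ib: "?ib \<in> carrier (Sec C B)" by (rule ring_hom_closed[OF io_hom[OF B'] B(3)])
  have qB: "q y (germ X y B b0) = germ T (pt z y) (over B) (cm p B ?ib)" if y: "y \<in> B" for y
    using i_germ[OF B' y B(3)] ps_germ[OF B' z_over[OF B' y] ib] p_z[OF in_top[OF B' y]] by simp
  have "germ T ?y V s = germ T ?y (over B) (cm p B ?ib) \<oplus>\<^bsub>stalk T ?y\<^esub>
      germ T ?y (over U) (t U) \<otimes>\<^bsub>stalk T ?y\<^esub> germ T ?y V' s'"
    using b(3) qB[OF B(2)] B(4) V'(4) by (simp add: tg_def)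
  then obtain O4 where O4: "T.opn O4" "?y \<in> O4" "O4 \<subseteq> V \<inter> over B \<inter> over U \<inter> V'"
    "\<forall>y\<in>O4. germ T y V s = germ T y (over B) (cm p B ?ib) \<oplus>\<^bsub>stalk T y\<^esub>
      germ T y (over U) (t U) \<otimes>\<^bsub>stalk T y\<^esub> germ T y V' s'"
    by (rule T.nearby_affine[OF V over_open[OF B'] z_over[OF B' B(2)] pm.cm_closed[OF B' ib]
          over_open[OF oU] z_over[OF oU xU] t_closed[OF U] V'(1-3)])
  define W where "W = W1 \<inter> W2 \<inter> W3 \<inter> preim C (pt z) O4"
  have oW: "opn W" unfolding W_def using W1(1) W2(1) W3(1) zm.pre_open[OF O4(1)] by auto
  have xW: "x \<in> W" unfolding W_def using W1(2) W2(2) W3(2) O4(2) x by (simp add: preim_def)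
  have sub: "W \<subseteq> N \<inter> preim C (pt z) V \<inter> U"
    unfolding W_def using W2(3) W3(3) preim_mono[of O4 V C "pt z"] O4(3) by blast
  have "J U y (Suc m) (germ T (pt z y) V s) (germ X y N r)" if y: "y \<in> W" for y
  proof -
    have yy: "y \<in> W1" "y \<in> W2" "y \<in> W3" "pt z y \<in> O4" using y unfolding W_def preim_def by auto
    have yU: "y \<in> U" "y \<in> B" "y \<in> M" using yy W2(3) W1(3) W3(3) by auto
    interpret ey: expansion_pair "stalk X y" "stalk T (pt z y)" "q y" "Fixed y" "tg U (pt z y)" "eps y (e U y)"
      using expansion_at[OF U yU(1)] by (rule expansion.axioms(1))
    show ?thesis
    proof (rule ey.J_SucI[OF W1(4)[OF yy(1)] W2(4)[OF yy(2)]])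
      show "germ T (pt z y) V s = q y (germ X y B b0) \<oplus>\<^bsub>stalk T (pt z y)\<^esub>
          tg U (pt z y) \<otimes>\<^bsub>stalk T (pt z y)\<^esub> germ T (pt z y) V' s'"
        unfolding tg_def qB[OF yU(2)] by (rule O4(4)[rule_format, OF yy(4)])
      show "germ X y N r = germ X y B b0 \<oplus>\<^bsub>stalk X y\<^esub> eps y (e U y) \<otimes>\<^bsub>stalk X y\<^esub> germ X y N' r0"
        unfolding M(5)[rule_format, OF yU(3), symmetric] by (rule W3(4)[rule_format, OF yy(3)])
    qed
  qed
  then show ?case using oW xW sub by blast
qed

lemma F_nearby:
  assumes x: "x \<in> topspace (tsp C)" and V: "T.opn V" "pt z x \<in> V" "s \<in> carrier (Sec T V)"
  shows "\<exists>W r. opn W \<and> x \<in> W \<and> W \<subseteq> preim C (pt z) V \<and> r \<in> carrier (Sec X W) \<and>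
    (\<forall>y\<in>W. germ X y W r = F y (germ T (pt z y) V s))"
proof -
  obtain U where U: "U \<in> \<U>" "x \<in> U" using some_chart[OF x] by blast
  have sc: "germ T (pt z x) V s \<in> carrier (stalk T (pt z x))" by (rule T.germ_closed[OF V])
  have "F x (germ T (pt z x) V s) \<in> carrier (stalk X x)" by (rule ring_hom_closed[OF F_hom[OF x] sc])
  then obtain N r where N: "X.opn N" "x \<in> N" "r \<in> carrier (Sec X N)" "F x (germ T (pt z x) V s) = germ X x N r"
    by (rule X.stalk_elem)
  have N': "opn N" using N(1) by simp
  have "J U x n (germ T (pt z x) V s) (germ X x N r)" using F_J[OF U sc] N(4) by simp
  from J_open[OF U(1) this U(2) V N' N(2,3)]
  obtain W where W: "opn W" "x \<in> W" "W \<subseteq> N \<inter> preim C (pt z) V \<inter> U"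
    "\<And>y. y \<in> W \<Longrightarrow> J U y n (germ T (pt z y) V s) (germ X y N r)" by blast
  have WN: "W \<subseteq> N" using W(3) by blast
  have "germ X y W (Res X N W r) = F y (germ T (pt z y) V s)" if y: "y \<in> W" for y
    using X.germ_res[OF N(1) oX[OF W(1)] y WN N(3)] F_eq[OF U(1) _ W(4)[OF y]] W(3) y by auto
  moreover have "Res X N W r \<in> carrier (Sec X W)" by (rule X.res_closed[OF N(1) oX[OF W(1)] WN N(3)])
  ultimately show ?thesis using W by blast
qed

end

section \<open>The zero section is closed\<close>

context total_space
begin

lemma preim_X [simp]: "preim X h V = preim C h V" by (simp add: preim_def)

lemma z_pre_iff: "x \<in> preim C (pt z) V \<longleftrightarrow> x \<in> topspace (tsp C) \<and> pt z x \<in> V"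
  by (simp add: preim_def)

lemma tg_nonunit_zero_section:
  assumes U: "U \<in> \<U>" "x \<in> U" shows "tg U (pt z x) \<notin> Units (stalk T (pt z x))"
proof
  let ?y = "pt z x"
  have x: "x \<in> topspace (tsp C)" by (rule in_top[OF U_open[OF U(1)] U(2)])
  interpret zh: ring_hom_cring "stalk T ?y" "stalk C x" "zs x" by (rule zs_hom_cring[OF x])
  assume "tg U ?y \<in> Units (stalk T ?y)"
  then obtain r where r: "r \<in> carrier (stalk T ?y)" "r \<otimes>\<^bsub>stalk T ?y\<^esub> tg U ?y = \<one>\<^bsub>stalk T ?y\<^esub>" "tg U ?y \<in> carrier (stalk T ?y)"
    unfolding Units_def by blast
  have "zs x r \<otimes>\<^bsub>stalk C x\<^esub> zs x (tg U ?y) = \<one>\<^bsub>stalk C x\<^esub>" using zh.hom_mult[OF r(1,3)] r(2) by simp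
  then have "\<one>\<^bsub>stalk C x\<^esub> = \<zero>\<^bsub>stalk C x\<^esub>" using zs_tg[OF U] r(1) by simp
  then show False using nontrivial[OF x] by simp
qed

text \<open>
  If \<open>t\<close> is not invertible at \<open>y\<close>, then the variable is in the prime ideal of \<open>y\<close>, and whether a polynomial is
  in this ideal depends only on its constant coefficient.
\<close>

lemma chart_prime_mem:
  assumes U: "U \<in> \<U>" and y: "y \<in> over U" and t: "tg U y \<notin> Units (stalk T y)" and a: "a \<in> carrier (UP (Sec C U))"
  shows "a \<in> pt (\<psi> U) y \<longleftrightarrow> germ C (pt p y) U (a 0) \<notin> Units (stalk C (pt p y))"
proof -
  interpret PR: UP_cring "Sec C U" "UP (Sec C U)" by (rule UP_cring_at[OF U]) simp
  let ?X = "monom (UP (Sec C U)) \<one>\<^bsub>Sec C U\<^esub> 1" and ?m = "monom (UP (Sec C U)) (a 0) 0"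
  have X: "?X \<in> carrier (UP (Sec C U))" by simp
  have pU: "pt p y \<in> U" and yt: "y \<in> topspace (tsp T)" using y by (auto simp: preim_def)
  obtain a' where a': "a' \<in> carrier (UP (Sec C U))" "a 0 \<in> carrier (Sec C U)"
    "a = ?m \<oplus>\<^bsub>UP (Sec C U)\<^esub> ?X \<otimes>\<^bsub>UP (Sec C U)\<^esub> a'" by (rule germ_gl_split[OF U y a])
  have m: "?m \<in> carrier (UP (Sec C U))" using a'(2) by simp
  interpret I: primeideal "pt (\<psi> U) y" "UP (Sec C U)"
    using affine_chart.psi_prime[OF chart_affine[OF U] y] by (simp add: prime_spectrum_def)
  have XI: "?X \<in> pt (\<psi> U) y"
    using affine_chart.germ_glob_unit[OF chart_affine[OF U] y X] t gl_X[OF U] by (simp add: tg_def)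
  have XaI: "?X \<otimes>\<^bsub>UP (Sec C U)\<^esub> a' \<in> pt (\<psi> U) y" by (rule I.I_r_closed[OF XI a'(1)])
  have "a \<in> pt (\<psi> U) y \<longleftrightarrow> ?m \<in> pt (\<psi> U) y"
  proof
    assume "?m \<in> pt (\<psi> U) y"
    then have "?m \<oplus>\<^bsub>UP (Sec C U)\<^esub> ?X \<otimes>\<^bsub>UP (Sec C U)\<^esub> a' \<in> pt (\<psi> U) y" by (rule I.a_closed[OF _ XaI])
    then show "a \<in> pt (\<psi> U) y" using a'(3) by simp
  next
    assume aI: "a \<in> pt (\<psi> U) y"
    have inv: "\<ominus>\<^bsub>UP (Sec C U)\<^esub> (?X \<otimes>\<^bsub>UP (Sec C U)\<^esub> a') \<in> pt (\<psi> U) y" by (rule I.a_inv_closed[OF XaI])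
    have "(?m \<oplus>\<^bsub>UP (Sec C U)\<^esub> ?X \<otimes>\<^bsub>UP (Sec C U)\<^esub> a') \<oplus>\<^bsub>UP (Sec C U)\<^esub>
        \<ominus>\<^bsub>UP (Sec C U)\<^esub> (?X \<otimes>\<^bsub>UP (Sec C U)\<^esub> a') \<in> pt (\<psi> U) y"
      unfolding a'(3)[symmetric] by (rule I.a_closed[OF aI inv])
    moreover have "(?m \<oplus>\<^bsub>UP (Sec C U)\<^esub> ?X \<otimes>\<^bsub>UP (Sec C U)\<^esub> a') \<oplus>\<^bsub>UP (Sec C U)\<^esub>
        \<ominus>\<^bsub>UP (Sec C U)\<^esub> (?X \<otimes>\<^bsub>UP (Sec C U)\<^esub> a') = ?m"
      using m PR.P.m_closed[OF X a'(1)] by (simp only: PR.P.a_assoc PR.P.a_inv_closed PR.P.r_neg PR.P.r_zero)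
    ultimately show "?m \<in> pt (\<psi> U) y" by simp
  qed
  also have "\<dots> \<longleftrightarrow> germ T y (over U) (cm p U (a 0)) \<notin> Units (stalk T y)"
    using affine_chart.germ_glob_unit[OF chart_affine[OF U] y m] gl_const[OF U a'(2)] by simp
  also have "\<dots> \<longleftrightarrow> germ C (pt p y) U (a 0) \<notin> Units (stalk C (pt p y))"
  proof -
    have g: "germ C (pt p y) U (a 0) \<in> carrier (stalk C (pt p y))" by (rule C.germ_closed[OF U_open[OF U] pU a'(2)])
    interpret ph: ring_hom_cring "stalk C (pt p y)" "stalk T y" "ps y" by (rule pm.stalk_map_hom_cring[OF yt])
    have "ps y (germ C (pt p y) U (a 0)) \<in> Units (stalk T y)" if "germ C (pt p y) U (a 0) \<in> Units (stalk C (pt p y))"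
    proof -
      obtain r where r: "r \<in> carrier (stalk C (pt p y))"
        "r \<otimes>\<^bsub>stalk C (pt p y)\<^esub> germ C (pt p y) U (a 0) = \<one>\<^bsub>stalk C (pt p y)\<^esub>"
        using \<open>germ C (pt p y) U (a 0) \<in> Units _\<close> unfolding Units_def by blast
      have "ps y r \<otimes>\<^bsub>stalk T y\<^esub> ps y (germ C (pt p y) U (a 0)) = \<one>\<^bsub>stalk T y\<^esub>"
        using ph.hom_mult[OF r(1) g] r(2) by simp
      then show ?thesis by (rule ph.S.unitI[OF ph.hom_closed[OF r(1)] ph.hom_closed[OF g]])
    qed
    then show ?thesis
      using pm.stalk_map_local[OF yt g] ps_germ[OF U_open[OF U] y a'(2)] by metis
  qed
  finally show ?thesis .
qed

text \<open>
  The points \<open>y\<close> and \<open>z (p y)\<close> have the same prime ideal by \<open>chart_prime_mem\<close>.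
\<close>

lemma zero_section_locus:
  assumes U: "U \<in> \<U>" and y: "y \<in> over U" and t: "tg U y \<notin> Units (stalk T y)"
  shows "y = pt z (pt p y)"
proof -
  have pU: "pt p y \<in> U" and yt: "y \<in> topspace (tsp T)" using y by (auto simp: preim_def)
  have x: "pt p y \<in> topspace (tsp C)" by (rule in_top[OF U_open[OF U] pU])
  let ?y' = "pt z (pt p y)"
  have y': "?y' \<in> over U" by (rule z_over[OF U_open[OF U] pU])
  have t': "tg U ?y' \<notin> Units (stalk T ?y')" by (rule tg_nonunit_zero_section[OF U pU])
  have sub: "pt (\<psi> U) w \<subseteq> carrier (UP (Sec C U))" if "w \<in> over U" for w
  proof -
    have "primeideal (pt (\<psi> U) w) (UP (Sec C U))"
      using affine_chart.psi_prime[OF chart_affine[OF U] that] by (simp add: prime_spectrum_def)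
    then interpret I: primeideal "pt (\<psi> U) w" "UP (Sec C U)" .
    show ?thesis by (rule I.a_subset)
  qed
  have "a \<in> pt (\<psi> U) y \<longleftrightarrow> a \<in> pt (\<psi> U) ?y'" if a: "a \<in> carrier (UP (Sec C U))" for a
    using chart_prime_mem[OF U y t a] chart_prime_mem[OF U y' t' a] p_z[OF x] by simp
  then have "pt (\<psi> U) y = pt (\<psi> U) ?y'" using sub[OF y] sub[OF y'] by blast
  then show ?thesis by (rule affine_chart.pt_inj[OF chart_affine[OF U] y y'])
qed

text \<open>
  By \<open>zero_section_locus\<close> a point off the zero section has a neighbourhood on which some \<open>t U\<close> is
  invertible.  The zero section does not meet it, since \<open>t U\<close> vanishes there.
\<close>

lemma zero_section_closed: "closedin (tsp T) (pt z ` topspace (tsp C))"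
proof -
  let ?S = "topspace (tsp T) - pt z ` topspace (tsp C)"
  have "\<exists>W. T.opn W \<and> y \<in> W \<and> W \<subseteq> ?S" if y: "y \<in> ?S" for y
  proof -
    have py: "pt p y \<in> topspace (tsp C)" using pm.pt_in y by blast
    obtain U where U: "U \<in> \<U>" "pt p y \<in> U" using some_chart[OF py] by blast
    have yU: "y \<in> over U" using y U by (simp add: preim_def)
    have "tg U y \<in> Units (stalk T y)" using zero_section_locus[OF U(1) yU] y py by blast
    then have "unit_at T y (over U) (t U)"
      using T.unit_at_iff[OF over_open[OF U_open[OF U(1)]] yU t_closed[OF U(1)]] by (simp add: tg_def)
    then obtain W where W: "T.opn W" "y \<in> W" "W \<subseteq> over U" "Res T (over U) W (t U) \<in> Units (Sec T W)"
      unfolding unit_at_def by blast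
    have "pt z x \<notin> W" if x: "x \<in> topspace (tsp C)" for x
    proof
      assume zW: "pt z x \<in> W"
      then have zU: "pt z x \<in> over U" using W by blast
      then have xU: "x \<in> U" using p_z[OF x] by (simp add: preim_def)
      have "unit_at T (pt z x) (over U) (t U)" unfolding unit_at_def using W zW by blast
      then have "tg U (pt z x) \<in> Units (stalk T (pt z x))"
        using T.unit_at_iff[OF over_open[OF U_open[OF U(1)]] zU t_closed[OF U(1)]] by (simp add: tg_def)
      then show False using tg_nonunit_zero_section[OF U(1) xU] by simp
    qed
    then have "W \<subseteq> ?S" using openin_subset[OF W(1)] by blast
    then show ?thesis using W by blast
  qed
  then have "T.opn ?S" by (subst openin_subopen) blast
  then show ?thesis using z_top by (auto simp: closedin_def)
qed

section \<open>The closed immersion\<close>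

lemma F_const:
  assumes x: "x \<in> topspace (tsp C)" and V: "T.opn V" "pt z x \<in> V"
  shows "F x (germ T (pt z x) V (Cst T V c)) = germ X x (preim C (pt z) V) (Cst X (preim C (pt z) V) c)"
proof -
  let ?C = "topspace (tsp C)"
  interpret ev: eigen_thickening "stalk X x" "stalk C x" "i x" "gen x" n "\<phi> x" "\<kappa> x" lam by (rule eigen_at[OF x])
  have oC: "opn ?C" by simp
  have k: "\<kappa> x c \<in> Fixed x" using Fixed_iff[OF x] ev.phi_kap by simp
  note oo = over_open[OF oC] and zo = z_over[OF oC x]
  have oVo: "T.opn (V \<inter> over ?C)" using V oo by blast
  have "q x (\<kappa> x c) = ps (pt z x) (germ C x ?C (cm \<iota> ?C (Cst X ?C c)))"
    using i_germ[OF oC x X.cst_closed[OF oX[OF oC]]] by simp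
  also have "\<dots> = germ T (pt z x) (over ?C) (cm p ?C (Cst C ?C c))"
    using io.cm_cst[of ?C c] preim_iota[OF oC] ps_germ[OF oC zo C.cst_closed[OF oC]] p_z[OF x] by simp
  also have "\<dots> = germ T (pt z x) (over ?C) (Cst T (over ?C) c)" using pm.cm_cst[OF oC] by simp
  also have "\<dots> = germ T (pt z x) V (Cst T V c)"
    by (rule T.germ_eqI[OF oo T.cst_closed[OF oo] V(1) T.cst_closed[OF V(1)] oVo])
      (use V zo T.res_cst[OF oo oVo] T.res_cst[OF V(1) oVo] in auto)
  finally have "F x (germ T (pt z x) V (Cst T V c)) = \<kappa> x c" using F_fixed[OF x k] by simp
  also have "\<dots> = germ X x (preim C (pt z) V) (Cst X (preim C (pt z) V) c)"
  proof -
    have o: "opn (preim C (pt z) V)" by (rule zm.pre_open[OF V(1)])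
    show ?thesis
      using X.germ_res[OF oX[OF oC] oX[OF o] _ openin_subset[OF o] X.cst_closed[OF oX[OF oC]], of x]
        X.res_cst[OF oX[OF oC] oX[OF o] openin_subset[OF o]] x V(2) by (simp add: z_pre_iff)
  qed
  finally show ?thesis .
qed

text \<open>
  Away from the zero section both the comorphism and the ideal are trivial, because sections over the
  empty set are.  At a point of the zero section everything is a statement about \<open>F x\<close>.
\<close>

theorem trivial_curve: "trivial_multiple_curve n C X \<iota> T z"
proof -
  obtain f where f: "morphism X T f" "pt f = pt z"
    and fg: "\<And>x V s. x \<in> topspace (tsp X) \<Longrightarrow> T.opn V \<Longrightarrow> pt z x \<in> V \<Longrightarrow> s \<in> carrier (Sec T V) \<Longrightarrow>
      germ X x (preim X (pt z) V) (cm f V s) = F x (germ T (pt z x) V s)"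
  proof (rule morphism_from_stalk_maps[OF X.ringed_space T_ringed, of "pt z" F])
    show "continuous_map (tsp X) (tsp T) (pt z)" using zm.cont by simp
    show "\<And>x. x \<in> topspace (tsp X) \<Longrightarrow> F x \<in> ring_hom (stalk T (pt z x)) (stalk X x)" using F_hom by simp
    show "\<And>x c V. x \<in> topspace (tsp X) \<Longrightarrow> T.opn V \<Longrightarrow> pt z x \<in> V \<Longrightarrow>
      F x (germ T (pt z x) V (Cst T V c)) = germ X x (preim X (pt z) V) (Cst X (preim X (pt z) V) c)"
      using F_const by simp
    show "\<And>x \<xi>. x \<in> topspace (tsp X) \<Longrightarrow> \<xi> \<in> carrier (stalk T (pt z x)) \<Longrightarrow> F x \<xi> \<in> Units (stalk X x) \<Longrightarrow>
      \<xi> \<in> Units (stalk T (pt z x))" using F_local by simp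
    show "\<And>x V s. x \<in> topspace (tsp X) \<Longrightarrow> T.opn V \<Longrightarrow> pt z x \<in> V \<Longrightarrow> s \<in> carrier (Sec T V) \<Longrightarrow>
      \<exists>W r. openin (tsp X) W \<and> x \<in> W \<and> W \<subseteq> preim X (pt z) V \<and> r \<in> carrier (Sec X W) \<and>
        (\<forall>y\<in>W. germ X y W r = F y (germ T (pt z y) V s))" using F_nearby by simp
  qed (rule that)
  let ?z = "\<lambda>V. preim C (pt z) V"
  have oz: "opn (?z V)" if "T.opn V" for V by (rule zm.pre_open[OF that])
  have fc: "cm f V s \<in> carrier (Sec X (?z V))" if "T.opn V" "s \<in> carrier (Sec T V)" for V s
    using f that ring_hom_closed[of "cm f V" "Sec T V" "Sec X (preim X (pt z) V)" s] unfolding morphism_def by simp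
  have fgerm: "germ X x (?z V) (cm f V s) = F x (germ T (pt z x) V s)"
    if "T.opn V" "s \<in> carrier (Sec T V)" "x \<in> ?z V" for x V s
    using fg[of x V s] that by (simp add: z_pre_iff)
  have empty_pre: "?z (topspace (tsp T) - pt z ` topspace (tsp C)) = {}" by (auto simp: preim_def)
  have out_open: "T.opn (topspace (tsp T) - pt z ` topspace (tsp C))"
    using zero_section_closed by (rule openin_diff[OF openin_topspace])
  have emb: "embedding_map (tsp X) (tsp T) (pt f)"
    unfolding f(2) by (rule section_imp_embedding_map)
      (auto simp: section_map_def retraction_maps_def zm.cont pm.cont p_z intro!: exI[of _ "pt p"])
  have surj: "\<exists>W r. T.opn W \<and> y \<in> W \<and> W \<subseteq> V \<and> r \<in> carrier (Sec T W) \<and> cm f W r = Res X (?z V) (?z W) s"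
    if V: "T.opn V" "y \<in> V" and s: "s \<in> carrier (Sec X (?z V))" for V s y
  proof (cases "y \<in> pt z ` topspace (tsp C)")
    case True
    then obtain x where x: "x \<in> topspace (tsp C)" "y = pt z x" by blast
    have xV: "x \<in> ?z V" using x V by (simp add: z_pre_iff)
    note ozV = oX[OF oz[OF V(1)]]
    have "germ X x (?z V) s \<in> carrier (stalk X x)" by (rule X.germ_closed[OF ozV xV s])
    then obtain \<xi> where xi: "\<xi> \<in> carrier (stalk T y)" "F x \<xi> = germ X x (?z V) s"
      unfolding x(2) by (rule F_surj[OF x(1)])
    obtain V' r where V': "T.opn V'" "y \<in> V'" "V' \<subseteq> V" "r \<in> carrier (Sec T V')" "\<xi> = germ T y V' r"
      by (rule T.stalk_elem_inside[OF xi(1) V])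
    have xV': "x \<in> ?z V'" using x V' by (simp add: z_pre_iff)
    have "germ X x (?z V') (cm f V' r) = germ X x (?z V) s"
      using fgerm[OF V'(1,4) xV'] xi(2) V'(5) x(2) by simp
    then obtain N where N: "X.opn N" "x \<in> N" "N \<subseteq> ?z V'" "N \<subseteq> ?z V"
      "\<And>w. w \<in> N \<Longrightarrow> germ X w (?z V') (cm f V' r) = germ X w (?z V) s"
      using X.germ_eq_nearby[OF _ oX[OF oz[OF V'(1)]] ozV xV fc[OF V'(1,4)] s] by metis
    have N': "opn N" using N(1) by simp
    \<comment> \<open>The section \<open>r\<close> is restricted so that its pullback lives on \<open>N\<close>, where it agrees with \<open>s\<close>.\<close>
    define W where "W = V' \<inter> over N"
    have W: "T.opn W" "y \<in> W" "W \<subseteq> V'" "W \<subseteq> V"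
      unfolding W_def using V' over_open[OF N'] z_over[OF N' N(2)] x(2) by auto
    have zW: "?z W \<subseteq> N" unfolding W_def by (auto simp: preim_def p_z)
    have zWV: "?z W \<subseteq> ?z V" by (rule preim_mono[OF W(4)])
    have rW: "Res T V' W r \<in> carrier (Sec T W)" by (rule T.res_closed[OF V'(1) W(1,3) V'(4)])
    have "cm f W (Res T V' W r) = Res X (?z V) (?z W) s"
    proof (rule X.germs_determine[OF oX[OF oz[OF W(1)]] fc[OF W(1) rW]
          X.res_closed[OF ozV oX[OF oz[OF W(1)]] zWV s]])
      fix w assume w: "w \<in> ?z W"
      have wW: "pt z w \<in> W" and wV': "w \<in> ?z V'" using w W(3) by (auto simp: z_pre_iff)
      have wN: "w \<in> N" using w zW by blast
      have "germ X w (?z W) (cm f W (Res T V' W r)) = F w (germ T (pt z w) V' r)"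
        using fgerm[OF W(1) rW w] T.germ_res[OF V'(1) W(1) wW W(3) V'(4)] by simp
      also have "\<dots> = germ X w (?z V) s" using fgerm[OF V'(1,4) wV'] N(5)[OF wN] by simp
      also have "\<dots> = germ X w (?z W) (Res X (?z V) (?z W) s)"
        by (rule X.germ_res[OF ozV oX[OF oz[OF W(1)]] w zWV s, symmetric])
      finally show "germ X w (?z W) (cm f W (Res T V' W r)) = germ X w (?z W) (Res X (?z V) (?z W) s)" .
    qed
    then show ?thesis using W(1,2,4) rW by blast
  next
    case False
    define W where "W = V \<inter> (topspace (tsp T) - pt z ` topspace (tsp C))"
    have W: "T.opn W" "y \<in> W" "W \<subseteq> V" unfolding W_def using V False out_open openin_subset[OF V(1)] by auto
    have zW: "?z W = {}" unfolding W_def by (auto simp: preim_def)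
    have one: "\<one>\<^bsub>Sec T W\<^esub> \<in> carrier (Sec T W)" by (rule T.sec_closed(1)[OF W(1)])
    have "Res X (?z V) {} s \<in> carrier (Sec X {})"
      by (rule X.res_closed[OF oX[OF oz[OF V(1)]] _ _ s]) auto
    then have "cm f W \<one>\<^bsub>Sec T W\<^esub> = Res X (?z V) (?z W) s"
      using X.sec_empty fc[OF W(1) one] unfolding zW by blast
    then show ?thesis using W one by blast
  qed
  have closed_imm: "closed_immersion X T f"
    unfolding closed_immersion_def using f(1) emb zero_section_closed surj f(2) by simp
  have "mor_eq C T (mor_comp X f \<iota>) z"
    unfolding mor_eq_def
  proof (intro conjI ballI allI impI)
    fix x assume "x \<in> topspace (tsp C)"
    then show "pt (mor_comp X f \<iota>) x = pt z x" using pt_io f(2) by (simp add: mor_comp_def)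
  next
    fix V s assume V: "T.opn V" "s \<in> carrier (Sec T V)"
    note o = oz[OF V(1)]
    have "cm \<iota> (?z V) (cm f V s) = cm z V s"
    proof (rule C.germs_determine[OF o])
      show "cm \<iota> (?z V) (cm f V s) \<in> carrier (Sec C (?z V))" by (rule ring_hom_closed[OF io_hom[OF o] fc[OF V]])
      show "cm z V s \<in> carrier (Sec C (?z V))" by (rule zm.cm_closed[OF V])
      fix x assume x: "x \<in> ?z V"
      have xt: "x \<in> topspace (tsp C)" "pt z x \<in> V" using x by (auto simp: z_pre_iff)
      show "germ C x (?z V) (cm \<iota> (?z V) (cm f V s)) = germ C x (?z V) (cm z V s)"
        using i_germ[OF o x fc[OF V]] fgerm[OF V x] i_F[OF xt(1) T.germ_closed[OF V(1) xt(2) V(2)]]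
          zs_germ[OF xt(1) V(1) xt(2) V(2)] by simp
    qed
    then show "cm (mor_comp X f \<iota>) V s = cm z V s" using f(2) by (simp add: mor_comp_def)
  qed
  moreover have "ker_sheaf X T f V = ideal_sheaf_pow T (ker_sheaf C T z) n V" if V: "T.opn V" for V
  proof (rule Set.set_eqI)
    fix s
    note o = oX[OF oz[OF V]]
    have zero_iff: "cm f V s = \<zero>\<^bsub>Sec X (?z V)\<^esub> \<longleftrightarrow>
        (\<forall>x\<in>?z V. F x (germ T (pt z x) V s) = \<zero>\<^bsub>stalk X x\<^esub>)" if s: "s \<in> carrier (Sec T V)"
    proof
      assume "cm f V s = \<zero>\<^bsub>Sec X (?z V)\<^esub>"
      then show "\<forall>x\<in>?z V. F x (germ T (pt z x) V s) = \<zero>\<^bsub>stalk X x\<^esub>"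
        using fgerm[OF V s] X.germ_zero[OF o] by simp
    next
      assume z0: "\<forall>x\<in>?z V. F x (germ T (pt z x) V s) = \<zero>\<^bsub>stalk X x\<^esub>"
      show "cm f V s = \<zero>\<^bsub>Sec X (?z V)\<^esub>"
        by (rule X.germs_determine[OF o fc[OF V s] X.sec_closed(2)[OF o]])
          (use z0 fgerm[OF V s] X.germ_zero[OF o] in simp)
    qed
    show "s \<in> ker_sheaf X T f V \<longleftrightarrow> s \<in> ideal_sheaf_pow T (ker_sheaf C T z) n V"
    proof
      assume "s \<in> ker_sheaf X T f V"
      then have s: "s \<in> carrier (Sec T V)" "\<forall>x\<in>?z V. F x (germ T (pt z x) V s) = \<zero>\<^bsub>stalk X x\<^esub>"
        using zero_iff f(2) unfolding ker_sheaf_def by auto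
      have "\<exists>W. T.opn W \<and> y \<in> W \<and> W \<subseteq> V \<and> Res T V W s \<in> ideal_pow (Sec T W) (ker_sheaf C T z W) n"
        if y: "y \<in> V" for y
      proof (cases "y \<in> pt z ` topspace (tsp C)")
        case True
        then obtain x where x: "x \<in> topspace (tsp C)" "y = pt z x" by blast
        obtain U where U: "U \<in> \<U>" "x \<in> U" using some_chart[OF x(1)] by blast
        have xV: "x \<in> ?z V" using x y by (simp add: z_pre_iff)
        have gc: "germ T y V s \<in> carrier (stalk T y)" by (rule T.germ_closed[OF V y s(1)])
        obtain \<eta> where e: "\<eta> \<in> carrier (stalk T y)"
          "germ T y V s = germ T y (over U) (t U) [^]\<^bsub>stalk T y\<^esub> n \<otimes>\<^bsub>stalk T y\<^esub> \<eta>"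
          using F_kernel[OF U gc[unfolded x(2)]] s(2) xV unfolding x(2) tg_def by blast
        have yU: "y \<in> over U" unfolding x(2) by (rule z_over[OF U_open[OF U(1)] U(2)])
        note oU = over_open[OF U_open[OF U(1)]]
        show ?thesis
        proof (rule T.germ_power_ideal_pow[OF V y s(1) oU yU t_closed[OF U(1)] _ e])
          fix W assume W: "T.opn W" "W \<subseteq> over U"
          have zW: "?z W \<subseteq> U" using preim_mono[OF W(2), of C "pt z"] pre_z_over[OF U_open[OF U(1)]] by simp
          have "cm z W (Res T (over U) W (t U)) = Res C U (?z W) \<zero>\<^bsub>Sec C U\<^esub>"
            using zm.cm_res[OF oU W t_closed[OF U(1)]] pre_z_over[OF U_open[OF U(1)]] z_t[OF U(1)] by simp
          also have "\<dots> = \<zero>\<^bsub>Sec C (?z W)\<^esub>"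
            by (rule ring_hom_zero[OF C.res_hom[OF U_open[OF U(1)] oz[OF W(1)] zW]
                  C.sec_ring[OF U_open[OF U(1)]] C.sec_ring[OF oz[OF W(1)]]])
          finally show "Res T (over U) W (t U) \<in> ker_sheaf C T z W"
            using T.res_closed[OF oU W t_closed[OF U(1)]] by (simp add: ker_sheaf_def)
        qed
      next
        case False
        define W where "W = V \<inter> (topspace (tsp T) - pt z ` topspace (tsp C))"
        have W: "T.opn W" "y \<in> W" "W \<subseteq> V" unfolding W_def using V y False out_open openin_subset[OF V] by auto
        have zW: "?z W = {}" unfolding W_def by (auto simp: preim_def)
        note one = T.sec_closed(1)[OF W(1)]
        note sW = T.res_closed[OF V W(1,3) s(1)]
        interpret TW: cring "Sec T W" by (rule T.sec_cring[OF W(1)])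
        have "cm z W \<one>\<^bsub>Sec T W\<^esub> = \<zero>\<^bsub>Sec C (?z W)\<^esub>"
          using C.sec_empty[of "cm z W \<one>\<^bsub>Sec T W\<^esub>" "\<zero>\<^bsub>Sec C {}\<^esub>"] zm.cm_closed[OF W(1) one] C.sec_closed(2)[of "{}"]
          unfolding zW by simp
        then have "\<one>\<^bsub>Sec T W\<^esub> \<in> ker_sheaf C T z W" using one by (simp add: ker_sheaf_def)
        from T.power_in_ideal_pow[OF W(1) this sW one, of n]
        have "Res T V W s \<in> ideal_pow (Sec T W) (ker_sheaf C T z W) n" using sW by simp
        then show ?thesis using W by blast
      qed
      then show "s \<in> ideal_sheaf_pow T (ker_sheaf C T z) n V" unfolding ideal_sheaf_pow_def using s(1) by blast
    next
      assume sI: "s \<in> ideal_sheaf_pow T (ker_sheaf C T z) n V"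
      then have s: "s \<in> carrier (Sec T V)" unfolding ideal_sheaf_pow_def by simp
      have "F x (germ T (pt z x) V s) = \<zero>\<^bsub>stalk X x\<^esub>" if x: "x \<in> ?z V" for x
      proof -
        have xt: "x \<in> topspace (tsp C)" "pt z x \<in> V" using x by (auto simp: z_pre_iff)
        obtain U where U: "U \<in> \<U>" "x \<in> U" using some_chart[OF xt(1)] by blast
        note yU = z_over[OF U_open[OF U(1)] U(2)]
        have "\<exists>\<eta>\<in>carrier (stalk T (pt z x)). germ T (pt z x) V s =
            tg U (pt z x) [^]\<^bsub>stalk T (pt z x)\<^esub> n \<otimes>\<^bsub>stalk T (pt z x)\<^esub> \<eta>"
        proof (rule T.ideal_sheaf_pow_germ[OF V xt(2) sI tg_closed[OF U(1) yU]])
          fix W k assume W: "T.opn W" "pt z x \<in> W" "k \<in> ker_sheaf C T z W"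
          have k: "k \<in> carrier (Sec T W)" "cm z W k = \<zero>\<^bsub>Sec C (?z W)\<^esub>" using W(3) unfolding ker_sheaf_def by auto
          have xW: "x \<in> ?z W" using xt W by (simp add: z_pre_iff)
          have "zs x (germ T (pt z x) W k) = \<zero>\<^bsub>stalk C x\<^esub>"
            using zs_germ[OF xt(1) W(1,2) k(1)] k(2) C.germ_zero[OF oz[OF W(1)] xW] by simp
          then show "k \<in> carrier (Sec T W) \<and> (\<exists>\<eta>\<in>carrier (stalk T (pt z x)).
              germ T (pt z x) W k = tg U (pt z x) \<otimes>\<^bsub>stalk T (pt z x)\<^esub> \<eta>)"
            using z_kernel[OF U T.germ_closed[OF W(1,2) k(1)]] k(1) by blast
        qed
        then show ?thesis using F_kernel[OF U T.germ_closed[OF V xt(2) s]] by blast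
      qed
      then show "s \<in> ker_sheaf X T f V" using zero_iff[OF s] s f(2) unfolding ker_sheaf_def by simp
    qed
  qed
  ultimately show ?thesis unfolding trivial_multiple_curve_def using closed_imm by blast
qed

end

section \<open>The theorem\<close>

lemma regular_local_nontrivial:
  assumes "regular_local_ring R" shows "\<one>\<^bsub>R\<^esub> \<noteq> \<zero>\<^bsub>R\<^esub>"
proof
  assume e: "\<one>\<^bsub>R\<^esub> = \<zero>\<^bsub>R\<^esub>"
  obtain M where M: "maximalideal M R" and R: "cring R" using assms unfolding regular_local_ring_def by blast
  interpret maximalideal M R by (rule M)
  have "\<one>\<^bsub>R\<^esub> \<in> M" unfolding e by (rule additive_subgroup.zero_closed) unfold_locales
  then have "M = carrier R" by (rule one_imp_carrier)
  then show False using I_notcarr by simp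
qed

theorem mainTheorem11:
  fixes n :: nat
    and C :: "('p, 'a) rspace"
    and X :: "('p, 'b) rspace"
    and \<iota> :: "('p, 'a, 'p, 'b) mor"
    and T :: "('q, 'c) rspace"
    and p :: "('q, 'c, 'p, 'a) mor"
    and z :: "('p, 'a, 'q, 'c) mor"
    and lam :: complex
  assumes "n \<ge> 2"
    and "smooth_projective_curve C"
    and "primitive_multiple_curve n C X \<iota>"
    and "total_space_dual_conormal C X \<iota> T p z"
    and "lam \<in> alpha_image C X \<iota>"
    and "\<forall>i\<in>{1..n - 1}. lam ^ i \<noteq> 1"
  shows "trivial_multiple_curve n C X \<iota> T z"
proof -
  have C: "scheme C" and reg: "\<And>x. x \<in> topspace (tsp C) \<Longrightarrow> regular_local_ring (stalk C x)"
    using assms(2) unfolding smooth_projective_curve_def by auto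
  interpret M: multiple_curve C X \<iota> n by (rule multiple_curveI[OF C _ assms(3)]) (use assms(1) in simp)
  obtain \<sigma> where \<sigma>: "lam \<noteq> 0" "\<sigma> \<in> Aut_over C X \<iota>" "\<forall>V. openin (tsp C) V \<longrightarrow>
     (\<forall>l\<in>conormal C X \<iota> V. conormal_aut C X \<iota> \<sigma> V l = conormal_smult C X \<iota> V (Cst C V lam) l)"
    using assms(5) unfolding alpha_image_def by auto
  interpret S: scalar_automorphism C X \<iota> n \<sigma> lam
    by (unfold_locales) (use \<sigma> assms(6) in blast)+
  note T = assms(4)[unfolded total_space_dual_conormal_def]
  obtain \<U> e t \<psi> where U: "\<Union>\<U> = topspace (tsp C)"
    and charts: "\<forall>U\<in>\<U>. affine_open C U \<and> conormal_basis C X \<iota> U (e U) \<and>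
           is_iso (open_sub T (preim T (pt p) U))
             (Spec (UP (Sec C U)) (\<lambda>c. monom (UP (Sec C U)) (Cst C U c) 0)) (\<psi> U) \<and>
           (\<forall>a\<in>carrier (Sec C U).
              cm (\<psi> U) (prime_spectrum (UP (Sec C U)))
                (Spec_global (UP (Sec C U)) (monom (UP (Sec C U)) a 0)) = cm p U a) \<and>
           t U = cm (\<psi> U) (prime_spectrum (UP (Sec C U)))
                (Spec_global (UP (Sec C U)) (monom (UP (Sec C U)) \<one>\<^bsub>Sec C U\<^esub> 1)) \<and>
           cm z (preim T (pt p) U) (t U) = \<zero>\<^bsub>Sec C U\<^esub>"
    and change: "\<forall>U\<in>\<U>. \<forall>V\<in>\<U>. \<forall>W a. openin (tsp C) W \<and> W \<subseteq> U \<inter> V \<and> a \<in> carrier (Sec C W) \<and>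
           restrict (e V) W = conormal_smult C X \<iota> W a (restrict (e U) W) \<longrightarrow>
           Res T (preim T (pt p) V) (preim T (pt p) W) (t V) =
             cm p W a \<otimes>\<^bsub>Sec T (preim T (pt p) W)\<^esub>
               Res T (preim T (pt p) U) (preim T (pt p) W) (t U)"
    using T by (elim conjE exE)
  have ax: "total_space_axioms C X \<iota> T p z \<U> e t \<psi>"
  proof (rule total_space_axioms.intro)
    show "ringed_space T" "morphism T C p" "morphism C T z" "mor_eq C C (mor_comp T p z) mor_id"
      using T unfolding scheme_def by auto
    show "\<one>\<^bsub>stalk C x\<^esub> \<noteq> \<zero>\<^bsub>stalk C x\<^esub>" if "x \<in> topspace (tsp C)" for x
      by (rule regular_local_nontrivial[OF reg[OF that]])
    show "openin (tsp C) U" if "U \<in> \<U>" for U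
      using charts that unfolding affine_open_def by blast
    show "cm z (preim T (pt p) U) (t U) = \<zero>\<^bsub>Sec C U\<^esub>" if "U \<in> \<U>" for U
      using charts that by blast
  qed (use U charts change in \<open>simp_all add: Ball_def\<close>)
  interpret TS: total_space C X \<iota> n \<sigma> lam T p z \<U> e t \<psi>
    by (intro total_space.intro S.scalar_automorphism_axioms ax)
  show ?thesis by (rule TS.trivial_curve)
qed

end
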